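(* Let $c_{\mathrm{ww}}(\kappa)=\sqrt{\tanh\kappa/\kappa}$ (with $c_{\mathrm{ww}}(0)=1$), and for $\kappa>0$ let $c_{\mathrm{ww}}^2(\kappa|\partial_z|)$ denote the Fourier multiplier acting on $2\pi$-periodic functions by $c_{\mathrm{ww}}^2(\kappa|\partial_z|)e^{inz}=c_{\mathrm{ww}}^2(n\kappa)e^{inz}$, $n\in\mathbb{Z}$. Consider the system $$-c\eta+u+u\eta=(1-c^2)b_1,\qquad -cu+c_{\mathrm{ww}}^2(\kappa|\partial_z|)\eta+\tfrac12u^2=(1-c^2)b_2$$ for $2\pi$-periodic functions $\eta,u$ of $z$, a speed $c$, and parameters $\kappa>0$, $b_1,b_2\in\mathbb{R}$. Then for any $\kappa>0$ and any $b_1,b_2\in\mathbb{R}$ with $|b_1|,|b_2|$ sufficiently small, there exists a one-parameter family of solutions $\eta(a;\kappa,b_1,b_2)(z)$, $u(a;\kappa,b_1,b_2)(z)$, $c(a;\kappa,b_1,b_2)$, for $a\in\mathbb{R}$ with $|a|$ sufficiently small, such that $\eta$ and $u$ are $2\pi$-periodic, even and smooth in $z$, $c$ is even in $a$, and $\eta,u,c$ depend analytically on $a,\kappa,b_1,b_2$. Moreover, as $a,b_1,b_2\to0$, $$\eta(a;\kappa,b_1,b_2)(z)=\eta_0(\kappa,b_1,b_2)+a\cos z+a(b_1c_{\mathrm{ww}}(\kappa)+b_2)\cos z+a^2(h_0+h_2\cos2z)+O(a(a+b_1+b_2)^2),$$ $$u(a;\kappa,b_1,b_2)(z)=u_0(\kappa,b_1,b_2)+ac_{\mathrm{ww}}(\kappa)\cos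 z+\tfrac12ac_{\mathrm{ww}}(\kappa)(b_1c_{\mathrm{ww}}(\kappa)+b_2)\cos z+a^2c_{\mathrm{ww}}(\kappa)\Big(h_0-\tfrac12+\big(h_2-\tfrac12\big)\cos2z\Big)+O(a(a+b_1+b_2)^2),$$ $$c(a;\kappa,b_1,b_2)=c_0(\kappa,b_1,b_2)+\tfrac34a^2c_{\mathrm{ww}}(\kappa)(2h_0+h_2-1)+O(a(a+b_1+b_2)^2),$$ where, as $b_1,b_2\to0$, $$\eta_0=b_1c_{\mathrm{ww}}(\kappa)+b_2+O((b_1+b_2)^2),\quad u_0=b_1+b_2c_{\mathrm{ww}}(\kappa)+O((b_1+b_2)^2),$$ $$c_0=c_{\mathrm{ww}}(\kappa)+b_1\big(\tfrac12c_{\mathrm{ww}}^2(\kappa)+1\big)+\tfrac32b_2c_{\mathrm{ww}}(\kappa)+O((b_1+b_2)^2),$$ and $$h_0=\frac34\frac{c_{\mathrm{ww}}^2(\kappa)}{c_{\mathrm{ww}}^2(\kappa)-1},\qquad h_2=\frac34\frac{c_{\mathrm{ww}}^2(\kappa)}{c_{\mathrm{ww}}^2(\kappa)-c_{\mathrm{ww}}^2(2\kappa)}.$$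
   Context: The system describes $2\pi/\kappa$-periodic traveling waves $\eta(\kappa(x-ct)),u(\kappa(x-ct))$ of the normalized full-dispersion shallow water equations $\partial_t\eta+\partial_xu+\partial_x(u\eta)=0$, $\partial_tu+c_{\mathrm{ww}}^2(|\partial_x|)\partial_x\eta+u\partial_xu=0$, where $c_{\mathrm{ww}}^2(|\partial_x|)$ is the Fourier multiplier with symbol $c_{\mathrm{ww}}^2(k)$. *)

theory Defs
  imports "HOL-Analysis.Analysis"
begin

definition cww :: "real \<Rightarrow> real" where
  "cww k = (if k = 0 then 1 else sqrt (tanh k / k))"

definition fcoeff :: "(real \<Rightarrow> real) \<Rightarrow> int \<Rightarrow> complex" where
  "fcoeff f n = integral {0..2*pi}
      (\<lambda>z. complex_of_real (f z) * exp (- \<i> * of_int n * complex_of_real z)) / complex_of_real (2*pi)"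

definition fourier_mult :: "(real \<Rightarrow> real) \<Rightarrow> (real \<Rightarrow> real) \<Rightarrow> real \<Rightarrow> real" where
  "fourier_mult m f z = Re (\<Sum>\<^sub>\<infinity>n::int. complex_of_real (m (of_int n)) * fcoeff f n
        * exp (\<i> * of_int n * complex_of_real z))"

definition cww2_mult :: "real \<Rightarrow> (real \<Rightarrow> real) \<Rightarrow> real \<Rightarrow> real" where
  "cww2_mult \<kappa> f = fourier_mult (\<lambda>n. (cww (n * \<kappa>))^2) f"

definition smooth_real :: "(real \<Rightarrow> real) \<Rightarrow> bool" where
  "smooth_real f \<longleftrightarrow> (\<forall>n x. ((deriv ^^ n) f) differentiable (at x))"

text \<open>Real-analytic dependence on the parameters (a, kappa, b1, b2) of a family of
  functions of z, with values in the bounded functions (sup norm): around each point of U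
  the family is given by a 4-variable power series whose coefficient functions have
  sup-norm bounds M with sum M(alpha) r^|alpha| finite.\<close>
definition analytic_family_on ::
  "(real \<times> real \<times> real \<times> real) set \<Rightarrow> (real \<times> real \<times> real \<times> real \<Rightarrow> real \<Rightarrow> real) \<Rightarrow> bool" where
  "analytic_family_on U F \<longleftrightarrow>
    (\<forall>(a, k, b, d) \<in> U. \<exists>r>0. \<exists>(C :: nat \<times> nat \<times> nat \<times> nat \<Rightarrow> real \<Rightarrow> real) M.
       (\<forall>\<alpha> z. \<bar>C \<alpha> z\<bar> \<le> M \<alpha>) \<and>
       ((\<lambda>(i, j, l, m). M (i, j, l, m) * r ^ (i + j + l + m)) summable_on UNIV) \<and>
       (\<forall>x y v w z. \<bar>x\<bar> < r \<longrightarrow> \<bar>y\<bar> < r \<longrightarrow> \<bar>v\<bar> < r \<longrightarrow> \<bar>w\<bar> < r \<longrightarrow>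
          (a + x, k + y, b + v, d + w) \<in> U \<longrightarrow>
          ((\<lambda>(i, j, l, m). C (i, j, l, m) z * x ^ i * y ^ j * v ^ l * w ^ m)
             has_sum F (a + x, k + y, b + v, d + w) z) UNIV))"

end

(* In the frame of the wave the system says that (1 + eta) (u - c) and m eta + (u - c)^2 / 2 are constant, where m is
   the multiplier; this is invariant under 1 + eta -> s^2 (1 + eta), u - c -> s (u - c).  Hence a solution is obtained from
   one with b1 = b2 = 0 and speed q through 1 + eta = s^2 (1 + e), u - c = s q (w - 1), where e = w + w e and
   2 m e = q^2 (2 w - w^2); the numbers c and s are determined by q, b1, b2 through two scalar equations, which a
   contraction solves near c = q, s = 1.
   For b1 = b2 = 0 the unknowns e, w and q^2 are power series in the amplitude a.  At order a^d all modes n with n <> 1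
   can be solved for because cww (n kappa) differs from cww kappa, and the mode n = 1 determines the next coefficient
   of q^2.  A majorant argument gives convergence for complex a, kappa and z.  The solution is then bounded and
   holomorphic in each of a, kappa, b1, b2 separately, which makes it a convergent power series in all four. *)

theory Submission
  imports Defs "HOL-Complex_Analysis.Complex_Analysis"
begin

section \<open>Bounded separately holomorphic families\<close>

text \<open>The scaling keeps b1 and b2 out of the infinite-dimensional problem: they enter only
  through the numbers c and s. Since c - q and s - 1 vanish for b1 = b2 = 0, moving q away from its
  value at a = 0 changes c - q and s only by a multiple of a^2 (|b1| + |b2|); this is what produces
  an error a (a + b1 + b2)^2 with its factor a. The scalar problem for c is nondegenerate because
  its derivative at the base point is a multiple of 1 - q^2 and cww kappa < 1. The parameter a is
  normalised by asking that cos z have coefficient exactly a in e. The term of order a^d contains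
  only frequencies between -d and d of the parity of d, so it can be stored as a polynomial of
  degree at most d, and the majorant argument becomes an induction on finite sums of absolute values
  of coefficients. Every component of the wave is one formula in complex arguments (sum of a series,
  principal square root, limit of iterates) that does not mention the wave number near which it is
  estimated. Waves constructed near different wave numbers therefore agree automatically, and local
  estimates suffice for all kappa > 0.\<close>

definition taylor_coeff :: "nat \<Rightarrow> (complex \<Rightarrow> complex) \<Rightarrow> complex" where
  "taylor_coeff n f = (deriv ^^ n) f 0 / fact n"

text \<open>Cauchy's inequality on the circle of radius \<rho>/2, because \<open>f\<close> is
  controlled only on the open disc; this costs the factor 2 in 2/\<rho>.\<close>

lemma taylor_coeff_bound:
  assumes hol: "f holomorphic_on ball 0 \<rho>" and "\<rho> > 0"
    and B: "\<And>x. x \<in> ball 0 \<rho> \<Longrightarrow> norm (f x) \<le> B"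
  shows "norm (taylor_coeff n f) \<le> B * (2/\<rho>)^n"
proof -
  have sub: "cball 0 (\<rho>/2) \<subseteq> ball (0::complex) \<rho>" using \<open>\<rho> > 0\<close> by auto
  have "norm ((deriv ^^ n) f 0) \<le> fact n * B / (\<rho>/2)^n"
  proof (rule Cauchy_inequality)
    show "f holomorphic_on ball 0 (\<rho>/2)"
      using hol sub ball_subset_cball by (meson holomorphic_on_subset subset_trans)
    show "continuous_on (cball 0 (\<rho>/2)) f"
      using hol sub holomorphic_on_imp_continuous_on holomorphic_on_subset by blast
    show "norm (f x) \<le> B" if "norm (0 - x) = \<rho>/2" for x
      using that \<open>\<rho> > 0\<close> by (intro B) auto
  qed (use \<open>\<rho> > 0\<close> in auto)
  then show ?thesis
    unfolding taylor_coeff_def by (simp add: norm_divide field_simps power_divide)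
qed

lemma taylor_coeff_sums:
  assumes "f holomorphic_on ball 0 \<rho>" "x \<in> ball 0 \<rho>"
  shows "(\<lambda>n. taylor_coeff n f * x^n) sums f x"
  using holomorphic_power_series[OF assms] by (simp add: taylor_coeff_def)

text \<open>Weierstrass' theorem for a rate that is uniform on all of \<open>S\<close>. Both
  applications come in this form: the remainder quotients that define Taylor coefficients, and the
  iterates of Newton's method.\<close>

lemma holomorphic_uniform_rate:
  fixes f :: "nat \<Rightarrow> complex \<Rightarrow> complex"
  assumes "open S" and hol: "\<And>n. f n holomorphic_on S" and \<epsilon>: "\<epsilon> \<longlonglongrightarrow> 0"
    and bd: "\<And>n x. x \<in> S \<Longrightarrow> norm (f n x - g x) \<le> \<epsilon> n"
  shows "g holomorphic_on S"
proof (rule holomorphic_uniform_sequence[OF \<open>open S\<close> hol])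
  fix x assume "x \<in> S"
  then obtain d where d: "d > 0" "cball x d \<subseteq> S" using \<open>open S\<close> open_contains_cball by blast
  have "uniform_limit (cball x d) f g sequentially"
  proof (rule uniform_limitI)
    fix e :: real assume "e > 0"
    with \<epsilon> have "\<forall>\<^sub>F n in sequentially. \<epsilon> n < e" by (rule order_tendstoD(2))
    then show "\<forall>\<^sub>F n in sequentially. \<forall>y\<in>cball x d. dist (f n y) (g y) < e"
    proof eventually_elim
      case (elim n)
      show ?case unfolding dist_norm using le_less_trans[OF bd elim] d(2) by blast
    qed
  qed
  then show "\<exists>d. 0 < d \<and> cball x d \<subseteq> S \<and> uniform_limit (cball x d) f g sequentially" using d by blast
qed

lemma geometric_null: "(\<lambda>n. C * (1/2) ^ n) \<longlonglongrightarrow> (0::real)"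
  using tendsto_mult[OF tendsto_const LIMSEQ_realpow_zero[of "1/2::real"], of C] by simp

text \<open>The \<open>n\<close>-th coefficient is the uniform limit, as \<open>x \<rightarrow> 0\<close>, of the \<open>n\<close>-th remainder divided
  by \<open>x ^ n\<close>, hence holomorphic in the remaining variable.\<close>

lemma holomorphic_taylor_coeff:
  assumes "\<rho> > 0"
    and hx: "\<And>y. y \<in> ball 0 \<sigma> \<Longrightarrow> (\<lambda>x. F x y) holomorphic_on ball 0 \<rho>"
    and hy: "\<And>x. x \<in> ball 0 \<rho> \<Longrightarrow> (\<lambda>y. F x y) holomorphic_on ball 0 \<sigma>"
    and B: "\<And>x y. x \<in> ball 0 \<rho> \<Longrightarrow> y \<in> ball 0 \<sigma> \<Longrightarrow> norm (F x y) \<le> B"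
  shows "(\<lambda>y. taylor_coeff n (\<lambda>x. F x y)) holomorphic_on ball 0 \<sigma>"
proof (induction n rule: less_induct)
  case (less n)
  define c where "c i y = taylor_coeff i (\<lambda>x. F x y)" for i y
  \<comment> \<open>Points of norm at most \<rho>/4 tending to 0. The factor \<rho>/2 in
    \<open>X k\<close> cancels the 2/\<rho> of the coefficient bound, so that the tail of the series
    at \<open>X k\<close> is geometric with ratio \<open>\<theta> k\<close>, at most 1/2.\<close>
  define \<theta> :: "nat \<Rightarrow> real" where "\<theta> k = inverse (real (Suc (Suc k)))" for k
  define X :: "nat \<Rightarrow> complex" where "X k = of_real (\<theta> k * (\<rho>/2))" for k
  define g where "g k y = (F (X k) y - (\<Sum>i<n. c i y * X k ^ i)) / X k ^ n" for k y
  have \<theta>: "0 < \<theta> k" "\<theta> k \<le> 1/2" for k by (auto simp: \<theta>_def field_simps)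
  have nX: "norm (X k) = \<theta> k * (\<rho>/2)" for k
    using \<theta>[of k] \<open>\<rho> > 0\<close> by (simp add: X_def norm_mult)
  have X0: "X k \<noteq> 0" for k using nX[of k] \<theta>[of k] \<open>\<rho> > 0\<close> by auto
  have "\<theta> k * (\<rho>/2) < \<rho>" for k
    using mult_right_mono[OF \<theta>(2)[of k], of "\<rho>/2"] \<open>\<rho> > 0\<close> by linarith
  then have Xb: "X k \<in> ball 0 \<rho>" for k by (simp add: nX)
  have bd: "norm (g k y - c n y) \<le> 2 * B * (2/\<rho>)^n * \<theta> k" if y: "y \<in> ball 0 \<sigma>" for k y
  proof -
    have B0: "B \<ge> 0" using B[OF Xb y, of 0] norm_ge_zero order_trans by blast
    have cb: "norm (c i y) \<le> B * (2/\<rho>)^i" for i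
      unfolding c_def using y by (intro taylor_coeff_bound[OF hx]) (use \<open>\<rho> > 0\<close> B in auto)
    have s: "(\<lambda>i. c i y * X k ^ i) sums F (X k) y"
      unfolding c_def using y Xb by (intro taylor_coeff_sums[OF hx])
    have s2: "(\<lambda>j. c (j + Suc n) y * X k ^ (j + Suc n)) sums (F (X k) y - (\<Sum>i<Suc n. c i y * X k ^ i))"
      using s by (rule sums_split_initial_segment)
    have s3: "(\<lambda>j. c (j + Suc n) y * X k ^ (j + Suc n) / X k ^ n) sums (g k y - c n y)"
      using sums_divide[OF s2, of "X k ^ n"] X0[of k] by (simp add: g_def field_simps)
    have nb: "norm (c (j + Suc n) y * X k ^ (j + Suc n) / X k ^ n) \<le> B * (2/\<rho>)^n * \<theta> k * \<theta> k ^ j" for j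
    proof -
      have "norm (c (j + Suc n) y * X k ^ (j + Suc n) / X k ^ n) = norm (c (j + Suc n) y) * (\<theta> k * (\<rho>/2)) ^ Suc j"
        using X0[of k] by (simp add: norm_mult norm_divide norm_power nX power_add)
      also have "\<dots> \<le> B * (2/\<rho>)^(j + Suc n) * (\<theta> k * (\<rho>/2)) ^ Suc j"
        using \<theta>(1)[of k] \<open>\<rho> > 0\<close> by (intro mult_right_mono cb) auto
      also have "\<dots> = B * (2/\<rho>)^n * \<theta> k * \<theta> k ^ j"
        using \<open>\<rho> > 0\<close> by (simp add: power_add power_mult_distrib power_divide field_simps)
      finally show ?thesis .
    qed
    have "(\<lambda>j. B * (2/\<rho>)^n * \<theta> k * \<theta> k ^ j) sums (B * (2/\<rho>)^n * \<theta> k * (1 / (1 - \<theta> k)))"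
      using \<theta>[of k] by (intro sums_mult geometric_sums) auto
    then have "norm (g k y - c n y) \<le> B * (2/\<rho>)^n * \<theta> k * (1 / (1 - \<theta> k))"
      using norm_suminf_le[of _ "\<lambda>j. B * (2/\<rho>)^n * \<theta> k * \<theta> k ^ j", OF nb] s3
      by (simp add: sums_iff)
    also have "\<dots> \<le> B * (2/\<rho>)^n * \<theta> k * 2"
      using \<theta>[of k] B0 \<open>\<rho> > 0\<close> by (intro mult_left_mono) (auto simp: field_simps)
    finally show ?thesis by (simp add: mult_ac)
  qed
  have "c n holomorphic_on ball 0 \<sigma>"
  proof (rule holomorphic_uniform_rate[OF open_ball _ _ bd])
    show "g k holomorphic_on ball 0 \<sigma>" for k
      unfolding g_def using less hy[OF Xb[of k]] X0[of k]
      by (intro holomorphic_intros) (auto simp: c_def)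
    have "(\<lambda>k. 2 * B * (2/\<rho>)^n * \<theta> k) \<longlonglongrightarrow> 2 * B * (2/\<rho>)^n * 0"
      unfolding \<theta>_def
      by (intro tendsto_intros LIMSEQ_Suc[OF LIMSEQ_inverse_real_of_nat])
    then show "(\<lambda>k. 2 * B * (2/\<rho>)^n * \<theta> k) \<longlonglongrightarrow> 0" by simp
  qed
  then show ?case by (simp add: c_def[abs_def])
qed

section \<open>Power series in four variables from boundedness and separate holomorphy\<close>

definition separately_holomorphic4 :: "real \<Rightarrow> (complex \<Rightarrow> complex \<Rightarrow> complex \<Rightarrow> complex \<Rightarrow> complex) \<Rightarrow> bool" where
  "separately_holomorphic4 \<rho> F \<longleftrightarrow>
    (\<forall>y\<in>ball 0 \<rho>. \<forall>v\<in>ball 0 \<rho>. \<forall>w\<in>ball 0 \<rho>. (\<lambda>x. F x y v w) holomorphic_on ball 0 \<rho>) \<and>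
    (\<forall>x\<in>ball 0 \<rho>. \<forall>v\<in>ball 0 \<rho>. \<forall>w\<in>ball 0 \<rho>. (\<lambda>y. F x y v w) holomorphic_on ball 0 \<rho>) \<and>
    (\<forall>x\<in>ball 0 \<rho>. \<forall>y\<in>ball 0 \<rho>. \<forall>w\<in>ball 0 \<rho>. (\<lambda>v. F x y v w) holomorphic_on ball 0 \<rho>) \<and>
    (\<forall>x\<in>ball 0 \<rho>. \<forall>y\<in>ball 0 \<rho>. \<forall>v\<in>ball 0 \<rho>. (\<lambda>w. F x y v w) holomorphic_on ball 0 \<rho>)"

text \<open>A product of four geometric series, built up one factor at a time; the nested pairs
  follow the index type of \<open>analytic_family_on\<close>.\<close>

lemma abs_summable_geometric4:
  fixes q :: real
  assumes "0 \<le> q" "q < 1"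
  shows "(\<lambda>(i::nat, j::nat, l::nat, m::nat). q ^ (i + j + l + m)) summable_on UNIV"
proof -
  have g: "((\<lambda>n. q ^ n) has_sum (1/(1-q))) (UNIV::nat set)"
    using geometric_sums[of q] assms by (intro norm_summable_imp_has_sum) auto
  have step: "(\<lambda>(i::nat, y). q ^ i * h y) summable_on UNIV"
    if "h summable_on UNIV" "\<And>y. h y \<ge> 0" for h :: "'z \<Rightarrow> real"
  proof -
    have "(\<lambda>(i::nat, y). q ^ i * h y) summable_on Sigma UNIV (\<lambda>_. UNIV)"
    proof (rule summable_on_SigmaI[where g = "\<lambda>i. q ^ i * infsum h UNIV"])
      show "((\<lambda>y. case (i, y) of (i, y) \<Rightarrow> q ^ i * h y) has_sum q ^ i * infsum h UNIV) UNIV" for i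
        using that by (auto intro!: has_sum_cmult_right)
      show "(\<lambda>i. q ^ i * infsum h UNIV) summable_on UNIV"
        using g by (intro summable_on_cmult_left) (auto simp: summable_on_def)
    qed (use that assms in auto)
    then show ?thesis by simp
  qed
  have 1: "(\<lambda>n. q ^ n) summable_on (UNIV::nat set)" using g by (auto simp: summable_on_def)
  have 2: "(\<lambda>(l::nat, m::nat). q ^ l * q ^ m) summable_on UNIV"
    by (rule step[OF 1]) (use assms in auto)
  have 3: "(\<lambda>(j::nat, y). q ^ j * (case y of (l::nat, m::nat) \<Rightarrow> q ^ l * q ^ m)) summable_on UNIV"
    by (rule step[OF 2]) (use assms in \<open>auto split: prod.split\<close>)
  have 4: "(\<lambda>(i::nat, y). q ^ i * (case y of (j::nat, y) \<Rightarrow> q ^ j * (case y of (l::nat, m::nat) \<Rightarrow> q ^ l * q ^ m))) summable_on UNIV"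
    by (rule step[OF 3]) (use assms in \<open>auto split: prod.split\<close>)
  show ?thesis
    by (rule summable_on_cong[THEN iffD1, OF _ 4]) (auto simp: power_add)
qed

text \<open>Expand in one variable after another: by \<open>holomorphic_taylor_coeff\<close> each
  coefficient is again bounded and holomorphic in every remaining variable, so joint continuity
  never has to be established. The coefficient bounds multiply to a power of 2/\<rho>; on the box of
  radius \<rho>/4 each variable then contributes the ratio 1/2, which makes the fourfold family
  absolutely summable.\<close>

lemma power_series4:
  assumes "\<rho> > 0" and sh: "separately_holomorphic4 \<rho> F"
    and B: "\<And>x y v w. x \<in> ball 0 \<rho> \<Longrightarrow> y \<in> ball 0 \<rho> \<Longrightarrow> v \<in> ball 0 \<rho> \<Longrightarrow> w \<in> ball 0 \<rho>
               \<Longrightarrow> norm (F x y v w) \<le> B"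
  obtains C where "\<And>i j l m. norm (C (i, j, l, m)) \<le> B * (2/\<rho>)^(i+j+l+m)"
    and "\<And>x y v w. norm x < \<rho>/4 \<Longrightarrow> norm y < \<rho>/4 \<Longrightarrow> norm v < \<rho>/4 \<Longrightarrow> norm w < \<rho>/4 \<Longrightarrow>
      ((\<lambda>(i, j, l, m). C (i, j, l, m) * x^i * y^j * v^l * w^m) has_sum F x y v w) UNIV"
proof -
  define C1 where "C1 i y v w = taylor_coeff i (\<lambda>x. F x y v w)" for i y v w
  define C2 where "C2 i j v w = taylor_coeff j (\<lambda>y. C1 i y v w)" for i j v w
  define C3 where "C3 i j l w = taylor_coeff l (\<lambda>v. C2 i j v w)" for i j l w
  define C4 where "C4 i j l m = taylor_coeff m (\<lambda>w. C3 i j l w)" for i j l m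
  note sh' = sh[unfolded separately_holomorphic4_def]
  have b1: "norm (C1 i y v w) \<le> B * (2/\<rho>)^i" if "y \<in> ball 0 \<rho>" "v \<in> ball 0 \<rho>" "w \<in> ball 0 \<rho>" for i y v w
    unfolding C1_def using sh' that \<open>\<rho> > 0\<close> B by (intro taylor_coeff_bound) auto
  have h1y: "(\<lambda>y. C1 i y v w) holomorphic_on ball 0 \<rho>" if "v \<in> ball 0 \<rho>" "w \<in> ball 0 \<rho>" for i v w
    unfolding C1_def using sh' that B by (intro holomorphic_taylor_coeff[OF \<open>\<rho> > 0\<close>, where B=B]) auto
  have h1v: "(\<lambda>v. C1 i y v w) holomorphic_on ball 0 \<rho>" if "y \<in> ball 0 \<rho>" "w \<in> ball 0 \<rho>" for i y w
    unfolding C1_def using sh' that B by (intro holomorphic_taylor_coeff[OF \<open>\<rho> > 0\<close>, where B=B]) auto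
  have h1w: "(\<lambda>w. C1 i y v w) holomorphic_on ball 0 \<rho>" if "y \<in> ball 0 \<rho>" "v \<in> ball 0 \<rho>" for i y v
    unfolding C1_def using sh' that B by (intro holomorphic_taylor_coeff[OF \<open>\<rho> > 0\<close>, where B=B]) auto
  have b2: "norm (C2 i j v w) \<le> B * (2/\<rho>)^i * (2/\<rho>)^j" if "v \<in> ball 0 \<rho>" "w \<in> ball 0 \<rho>" for i j v w
    unfolding C2_def using that \<open>\<rho> > 0\<close> b1 by (intro taylor_coeff_bound h1y) auto
  have h2v: "(\<lambda>v. C2 i j v w) holomorphic_on ball 0 \<rho>" if "w \<in> ball 0 \<rho>" for i j w
    unfolding C2_def using that b1 h1y h1v
    by (intro holomorphic_taylor_coeff[OF \<open>\<rho> > 0\<close>, where B="B * (2/\<rho>)^i"]) auto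
  have h2w: "(\<lambda>w. C2 i j v w) holomorphic_on ball 0 \<rho>" if "v \<in> ball 0 \<rho>" for i j v
    unfolding C2_def using that b1 h1y h1w
    by (intro holomorphic_taylor_coeff[OF \<open>\<rho> > 0\<close>, where B="B * (2/\<rho>)^i"]) auto
  have b3: "norm (C3 i j l w) \<le> B * (2/\<rho>)^i * (2/\<rho>)^j * (2/\<rho>)^l" if "w \<in> ball 0 \<rho>" for i j l w
    unfolding C3_def using that \<open>\<rho> > 0\<close> b2 by (intro taylor_coeff_bound h2v) auto
  have h3w: "(\<lambda>w. C3 i j l w) holomorphic_on ball 0 \<rho>" for i j l
    unfolding C3_def using b2 h2v h2w
    by (intro holomorphic_taylor_coeff[OF \<open>\<rho> > 0\<close>, where B="B * (2/\<rho>)^i * (2/\<rho>)^j"]) auto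
  have b4: "norm (C4 i j l m) \<le> B * (2/\<rho>)^i * (2/\<rho>)^j * (2/\<rho>)^l * (2/\<rho>)^m" for i j l m
    unfolding C4_def using \<open>\<rho> > 0\<close> b3 by (intro taylor_coeff_bound h3w) auto
  have bnd: "norm (C4 i j l m) \<le> B * (2/\<rho>)^(i+j+l+m)" for i j l m
    using b4[of i j l m] by (simp add: power_add mult_ac)
  have B0: "B \<ge> 0" using B[of 0 0 0 0] \<open>\<rho> > 0\<close> norm_ge_zero order_trans by (metis centre_in_ball)
  have hs: "((\<lambda>(i, j, l, m). C4 i j l m * x^i * y^j * v^l * w^m) has_sum F x y v w) UNIV"
    if n: "norm x < \<rho>/4" "norm y < \<rho>/4" "norm v < \<rho>/4" "norm w < \<rho>/4" for x y v w
  proof -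
    have in': "x \<in> ball 0 \<rho>" "y \<in> ball 0 \<rho>" "v \<in> ball 0 \<rho>" "w \<in> ball 0 \<rho>"
      using n \<open>\<rho> > 0\<close> by auto
    have p: "norm (t ^ i) \<le> (\<rho>/4)^i" if "norm t < \<rho>/4" for t :: complex and i
      using that by (simp add: norm_power power_mono)
    have nrm: "norm (C4 i j l m * x^i * y^j * v^l * w^m) \<le> B * (1/2)^(i+j+l+m)" for i j l m
    proof -
      have "norm (C4 i j l m * x^i * y^j * v^l * w^m) \<le>
          B * (2/\<rho>)^(i+j+l+m) * (\<rho>/4)^i * (\<rho>/4)^j * (\<rho>/4)^l * (\<rho>/4)^m"
        unfolding norm_mult using B0 \<open>\<rho> > 0\<close> n
        by (intro mult_mono bnd p mult_nonneg_nonneg) auto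
      also have "\<dots> = B * ((2/\<rho>) * (\<rho>/4))^(i+j+l+m)"
        unfolding power_mult_distrib power_add by (simp only: mult_ac)
      also have "(2/\<rho>) * (\<rho>/4) = 1/2" using \<open>\<rho> > 0\<close> by simp
      finally show ?thesis .
    qed
    have "(\<lambda>(i::nat, j::nat, l::nat, m::nat). B * (1/2)^(i+j+l+m)) summable_on UNIV"
      using summable_on_cmult_right[OF abs_summable_geometric4[of "1/2"], of B]
      by (simp add: case_prod_unfold)
    then have "(\<lambda>t. norm (case t of (i, j, l, m) \<Rightarrow> C4 i j l m * x^i * y^j * v^l * w^m)) summable_on UNIV"
      by (rule Infinite_Sum.abs_summable_on_comparison_test') (auto simp del: power_one_over intro: nrm)
    then have sm: "(\<lambda>(i, j, l, m). C4 i j l m * x^i * y^j * v^l * w^m) summable_on UNIV"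
      by (rule abs_summable_summable)
    have to_has: "(f has_sum S) UNIV" if "f sums S" "f summable_on UNIV" for f :: "nat \<Rightarrow> complex" and S
      using that has_sum_imp_sums has_sum_infsum sums_unique2 by blast
    have s3: "(\<lambda>(j, l, m). C4 i j l m * x^i * y^j * v^l * w^m) summable_on UNIV" for i
      using summable_on_SigmaD1[of "\<lambda>i (j,l,m). C4 i j l m * x^i * y^j * v^l * w^m" UNIV "\<lambda>_. UNIV" i]
        sm by (simp add: case_prod_unfold)
    have s2: "(\<lambda>(l, m). C4 i j l m * x^i * y^j * v^l * w^m) summable_on UNIV" for i j
      using summable_on_SigmaD1[of "\<lambda>j (l,m). C4 i j l m * x^i * y^j * v^l * w^m" UNIV "\<lambda>_. UNIV" j]
        s3[of i] by (simp add: case_prod_unfold)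
    have s1: "(\<lambda>m. C4 i j l m * x^i * y^j * v^l * w^m) summable_on UNIV" for i j l
      using summable_on_SigmaD1[of "\<lambda>l m. C4 i j l m * x^i * y^j * v^l * w^m" UNIV "\<lambda>_. UNIV" l]
        s2[of i j] by (simp add: case_prod_unfold)
    \<comment> \<open>Summability of the fourfold family is known, its value is not. Summing out the
      last index, then the one before it, and so on turns the sum into iterated Taylor series, whose
      values are known.\<close>
    have q1: "((\<lambda>m. C4 i j l m * x^i * y^j * v^l * w^m) has_sum (C3 i j l w * x^i * y^j * v^l)) UNIV" for i j l
    proof (rule to_has[OF _ s1])
      have "(\<lambda>m. C4 i j l m * w^m) sums C3 i j l w"
        unfolding C4_def by (rule taylor_coeff_sums[OF h3w]) (rule in')
      from sums_mult2[OF this, of "x^i * y^j * v^l"]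
      show "(\<lambda>m. C4 i j l m * x^i * y^j * v^l * w^m) sums (C3 i j l w * x^i * y^j * v^l)"
        by (simp add: mult_ac)
    qed
    have inner2: "((\<lambda>l. C3 i j l w * x^i * y^j * v^l) has_sum S) UNIV"
      if "((\<lambda>(l, m). C4 i j l m * x^i * y^j * v^l * w^m) has_sum S) UNIV" for i j S
      using has_sum_SigmaD[of "\<lambda>(l, m). C4 i j l m * x^i * y^j * v^l * w^m" UNIV "\<lambda>_. UNIV" _
         "\<lambda>l. C3 i j l w * x^i * y^j * v^l"] that q1 by simp
    have q2: "((\<lambda>(l, m). C4 i j l m * x^i * y^j * v^l * w^m) has_sum (C2 i j v w * x^i * y^j)) UNIV" for i j
    proof -
      obtain S where S: "((\<lambda>(l, m). C4 i j l m * x^i * y^j * v^l * w^m) has_sum S) UNIV"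
        using s2[of i j] by (auto simp: summable_on_def)
      have "(\<lambda>l. C3 i j l w * v^l) sums C2 i j v w"
        unfolding C3_def by (rule taylor_coeff_sums[OF h2v]) (rule in')+
      from sums_mult2[OF this, of "x^i * y^j"]
      have "(\<lambda>l. C3 i j l w * x^i * y^j * v^l) sums (C2 i j v w * x^i * y^j)"
        by (simp add: mult_ac)
      then show ?thesis using S has_sum_imp_sums[OF inner2[OF S]] sums_unique2 by blast
    qed
    have inner3: "((\<lambda>j. C2 i j v w * x^i * y^j) has_sum S) UNIV"
      if "((\<lambda>(j, l, m). C4 i j l m * x^i * y^j * v^l * w^m) has_sum S) UNIV" for i S
      using has_sum_SigmaD[of "\<lambda>(j, l, m). C4 i j l m * x^i * y^j * v^l * w^m" UNIV "\<lambda>_. UNIV" _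
         "\<lambda>j. C2 i j v w * x^i * y^j"] that q2 by simp
    have q3: "((\<lambda>(j, l, m). C4 i j l m * x^i * y^j * v^l * w^m) has_sum (C1 i y v w * x^i)) UNIV" for i
    proof -
      obtain S where S: "((\<lambda>(j, l, m). C4 i j l m * x^i * y^j * v^l * w^m) has_sum S) UNIV"
        using s3[of i] by (auto simp: summable_on_def)
      have "(\<lambda>j. C2 i j v w * y^j) sums C1 i y v w"
        unfolding C2_def by (rule taylor_coeff_sums[OF h1y]) (rule in')+
      from sums_mult2[OF this, of "x^i"]
      have "(\<lambda>j. C2 i j v w * x^i * y^j) sums (C1 i y v w * x^i)"
        by (simp add: mult_ac)
      then show ?thesis using S has_sum_imp_sums[OF inner3[OF S]] sums_unique2 by blast
    qed
    obtain S where S: "((\<lambda>(i, j, l, m). C4 i j l m * x^i * y^j * v^l * w^m) has_sum S) UNIV"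
      using sm by (auto simp: summable_on_def)
    have "((\<lambda>i. C1 i y v w * x^i) has_sum S) UNIV"
      using has_sum_SigmaD[of "\<lambda>(i, j, l, m). C4 i j l m * x^i * y^j * v^l * w^m" UNIV "\<lambda>_. UNIV" _
         "\<lambda>i. C1 i y v w * x^i"] S q3 by simp
    moreover have "(\<lambda>i. C1 i y v w * x^i) sums F x y v w"
      unfolding C1_def using sh' in' by (intro taylor_coeff_sums) auto
    ultimately show ?thesis using S has_sum_imp_sums sums_unique2 by blast
  qed
  show ?thesis
    by (rule that[of "\<lambda>(i,j,l,m). C4 i j l m"]) (use bnd hs in auto)
qed

text \<open>The bound \<open>B\<close> and the radius \<rho> are the same for all \<open>z\<close>,
  hence so is the majorant of the coefficients; this is the sup-norm part of
  \<open>analytic_family_on\<close>. The complex family \<open>F\<close> may depend on the chosen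
  point and is compared with \<open>G\<close> at real points of \<open>U\<close> only. As the
  increments are real, the real parts of the complex coefficients are coefficients for
  \<open>G\<close>.\<close>

lemma analytic_family_onI:
  assumes loc: "\<And>a k b d. (a, k, b, d) \<in> U \<Longrightarrow>
     \<exists>\<rho>>0. \<exists>B F. (\<forall>z. separately_holomorphic4 \<rho> (F z)) \<and>
       (\<forall>z. \<forall>x\<in>ball 0 \<rho>. \<forall>y\<in>ball 0 \<rho>. \<forall>v\<in>ball 0 \<rho>. \<forall>w\<in>ball 0 \<rho>. norm (F z x y v w) \<le> B) \<and>
       (\<forall>z x y v w. \<bar>x\<bar> < \<rho> \<longrightarrow> \<bar>y\<bar> < \<rho> \<longrightarrow> \<bar>v\<bar> < \<rho> \<longrightarrow> \<bar>w\<bar> < \<rho> \<longrightarrow>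
          (a + x, k + y, b + v, d + w) \<in> U \<longrightarrow>
          G (a + x, k + y, b + v, d + w) z = Re (F z (of_real x) (of_real y) (of_real v) (of_real w)))"
  shows "analytic_family_on U G"
  unfolding analytic_family_on_def
proof (clarify)
  fix a k b d assume "(a, k, b, d) \<in> U"
  from loc[OF this] obtain \<rho> B F where "\<rho> > 0" and F1: "\<forall>z::real. separately_holomorphic4 \<rho> (F z)"
    and F2: "\<forall>z. \<forall>x\<in>ball 0 \<rho>. \<forall>y\<in>ball 0 \<rho>. \<forall>v\<in>ball 0 \<rho>. \<forall>w\<in>ball 0 \<rho>. norm (F z x y v w) \<le> B"
    and F3: "\<forall>z x y v w. \<bar>x\<bar> < \<rho> \<longrightarrow> \<bar>y\<bar> < \<rho> \<longrightarrow> \<bar>v\<bar> < \<rho> \<longrightarrow> \<bar>w\<bar> < \<rho> \<longrightarrow>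
          (a + x, k + y, b + v, d + w) \<in> U \<longrightarrow>
          G (a + x, k + y, b + v, d + w) z = Re (F z (of_real x) (of_real y) (of_real v) (of_real w))"
    by (elim exE conjE) (rule that)
  have sh: "separately_holomorphic4 \<rho> (F z)" for z using F1 by blast
  have B: "norm (F z x y v w) \<le> B" if "x \<in> ball 0 \<rho>" "y \<in> ball 0 \<rho>" "v \<in> ball 0 \<rho>" "w \<in> ball 0 \<rho>" for z x y v w
    using F2 that by blast
  have eq: "G (a + x, k + y, b + v, d + w) z = Re (F z (of_real x) (of_real y) (of_real v) (of_real w))"
    if "\<bar>x\<bar> < \<rho>" "\<bar>y\<bar> < \<rho>" "\<bar>v\<bar> < \<rho>" "\<bar>w\<bar> < \<rho>" "(a + x, k + y, b + v, d + w) \<in> U" for z x y v w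
    using F3 that by blast
  \<comment> \<open>Coefficients are obtained for each \<open>z\<close> separately; the predicate
    allows one array to be chosen for every \<open>z\<close>.\<close>
  define P where "P z C \<longleftrightarrow> (\<forall>i j l m. norm (C (i, j, l, m)) \<le> B * (2/\<rho>)^(i+j+l+m)) \<and>
     (\<forall>x y v w. norm x < \<rho>/4 \<longrightarrow> norm y < \<rho>/4 \<longrightarrow> norm v < \<rho>/4 \<longrightarrow> norm w < \<rho>/4 \<longrightarrow>
      ((\<lambda>(i, j, l, m). C (i, j, l, m) * x^i * y^j * v^l * w^m) has_sum F z x y v w) UNIV)" for z C
  have "\<exists>C. P z C" for z
  proof (rule power_series4[OF \<open>\<rho> > 0\<close> sh[of z]])
    show "norm (F z x y v w) \<le> B" if "x \<in> ball 0 \<rho>" "y \<in> ball 0 \<rho>" "v \<in> ball 0 \<rho>" "w \<in> ball 0 \<rho>" for x y v w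
      by (rule B[OF that])
    show "\<exists>C. P z C"
      if "\<And>i j l m. norm (C (i, j, l, m)) \<le> B * (2/\<rho>)^(i+j+l+m)"
        "\<And>x y v w. norm x < \<rho>/4 \<Longrightarrow> norm y < \<rho>/4 \<Longrightarrow> norm v < \<rho>/4 \<Longrightarrow> norm w < \<rho>/4 \<Longrightarrow>
        ((\<lambda>(i, j, l, m). C (i, j, l, m) * x^i * y^j * v^l * w^m) has_sum F z x y v w) UNIV" for C
      unfolding P_def by (intro exI[of _ C] conjI allI impI that)
  qed
  then obtain C where CP: "\<And>z. P z (C z)" by metis
  have C: "norm (C z (i, j, l, m)) \<le> B * (2/\<rho>)^(i+j+l+m)" for z i j l m
    using CP unfolding P_def by blast
  have hs: "((\<lambda>(i, j, l, m). C z (i, j, l, m) * x^i * y^j * v^l * w^m) has_sum F z x y v w) UNIV"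
    if "norm x < \<rho>/4" "norm y < \<rho>/4" "norm v < \<rho>/4" "norm w < \<rho>/4" for z x y v w
    using CP that unfolding P_def by blast
  define M where "M = (\<lambda>(i::nat,j::nat,l::nat,m::nat). B * (2/\<rho>)^(i+j+l+m))"
  show "\<exists>r>0. \<exists>(C :: nat \<times> nat \<times> nat \<times> nat \<Rightarrow> real \<Rightarrow> real) M.
       (\<forall>\<alpha> z. \<bar>C \<alpha> z\<bar> \<le> M \<alpha>) \<and>
       ((\<lambda>(i, j, l, m). M (i, j, l, m) * r ^ (i + j + l + m)) summable_on UNIV) \<and>
       (\<forall>x y v w z. \<bar>x\<bar> < r \<longrightarrow> \<bar>y\<bar> < r \<longrightarrow> \<bar>v\<bar> < r \<longrightarrow> \<bar>w\<bar> < r \<longrightarrow>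
          (a + x, k + y, b + v, d + w) \<in> U \<longrightarrow>
          ((\<lambda>(i, j, l, m). C (i, j, l, m) z * x ^ i * y ^ j * v ^ l * w ^ m)
             has_sum G (a + x, k + y, b + v, d + w) z) UNIV)"
  proof (rule exI[of _ "\<rho>/4"], rule conjI, goal_cases)
    case 1
    show "\<rho>/4 > 0" using \<open>\<rho> > 0\<close> by simp
  next
    case 2
    show ?case
    proof (rule exI[of _ "\<lambda>\<alpha> z. Re (C z \<alpha>)"], rule exI[of _ M], intro conjI allI impI)
      show "\<bar>Re (C z \<alpha>)\<bar> \<le> M \<alpha>" for \<alpha> z
        using C[of z] abs_Re_le_cmod[of "C z \<alpha>"] by (cases \<alpha>) (auto simp: M_def intro: order_trans)
      have "(\<lambda>(i, j, l, m). M (i, j, l, m) * (\<rho>/4) ^ (i + j + l + m)) =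
         (\<lambda>x. B * (case x of (i::nat,j::nat,l::nat,m::nat) \<Rightarrow> (1/2) ^ (i+j+l+m)))"
      proof -
        have "(2/\<rho>)^n * (\<rho>/4)^n = (1/2)^n" for n
          using \<open>\<rho> > 0\<close> by (simp flip: power_mult_distrib)
        then show ?thesis by (auto simp: M_def fun_eq_iff mult.assoc simp del: power_one_over)
      qed
      then show "(\<lambda>(i, j, l, m). M (i, j, l, m) * (\<rho>/4) ^ (i + j + l + m)) summable_on UNIV"
        using summable_on_cmult_right[OF abs_summable_geometric4[of "1/2"], of B] by simp
    next
      fix x y v w z
      assume s: "\<bar>x\<bar> < \<rho>/4" "\<bar>y\<bar> < \<rho>/4" "\<bar>v\<bar> < \<rho>/4" "\<bar>w\<bar> < \<rho>/4" and U: "(a + x, k + y, b + v, d + w) \<in> U"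
      have "((\<lambda>(i, j, l, m). C z (i, j, l, m) * of_real x^i * of_real y^j * of_real v^l * of_real w^m)
         has_sum F z (of_real x) (of_real y) (of_real v) (of_real w)) UNIV"
        by (rule hs) (use s in auto)
      then have "((\<lambda>t. Re (case t of (i, j, l, m) \<Rightarrow> C z (i, j, l, m) * of_real x^i * of_real y^j * of_real v^l * of_real w^m))
         has_sum Re (F z (of_real x) (of_real y) (of_real v) (of_real w))) UNIV"
        by (rule has_sum_Re)
      moreover have "Re (F z (of_real x) (of_real y) (of_real v) (of_real w)) = G (a + x, k + y, b + v, d + w) z"
        using s U by (intro eq[symmetric]) auto
      moreover have "(\<lambda>t. Re (case t of (i, j, l, m) \<Rightarrow> C z (i, j, l, m) * of_real x^i * of_real y^j * of_real v^l * of_real w^m))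
        = (\<lambda>(i, j, l, m). Re (C z (i, j, l, m)) * x ^ i * y ^ j * v ^ l * w ^ m)"
        by (auto simp: fun_eq_iff simp flip: of_real_power)
      ultimately show "((\<lambda>(i, j, l, m). Re (C z (i, j, l, m)) * x ^ i * y ^ j * v ^ l * w ^ m)
               has_sum G (a + x, k + y, b + v, d + w) z) UNIV" by simp
    qed
  qed
qed

section \<open>Fourier multipliers and the symbol\<close>

text \<open>Absolute summability makes the series converge uniformly, so it may be integrated term
  by term against exp (-i n z), and only the term k = n survives. The limit is taken along finite
  sets of integers, in agreement with \<open>has_sum\<close>.\<close>

lemma fcoeff_absolutely_convergent:
  fixes c :: "int \<Rightarrow> complex"
  assumes sm: "(\<lambda>n. norm (c n)) summable_on UNIV"
    and f: "\<And>z. ((\<lambda>n. c n * exp (\<i> * of_int n * of_real z)) has_sum complex_of_real (f z)) UNIV"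
  shows "fcoeff f n = c n"
proof -
  define h where "h k z = c k * exp (\<i> * of_int (k - n) * complex_of_real z)" for k and z :: real
  define g where "g z = complex_of_real (f z) * exp (- \<i> * of_int n * complex_of_real z)" for z
  have hg: "((\<lambda>k. h k z) has_sum g z) UNIV" for z
  proof -
    have "((\<lambda>k. c k * exp (\<i> * of_int k * of_real z) * exp (- \<i> * of_int n * complex_of_real z)) has_sum g z) UNIV"
      unfolding g_def by (rule has_sum_cmult_left[OF f])
    moreover have "c k * exp (\<i> * of_int k * of_real z) * exp (- \<i> * of_int n * complex_of_real z) = h k z" for k
      by (simp add: h_def mult.assoc exp_add[symmetric] algebra_simps)
    ultimately show ?thesis by simp
  qed
  have ul: "uniform_limit {0..2*pi} (\<lambda>X z. \<Sum>k\<in>X. h k z) g (finite_subsets_at_top UNIV)"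
    by (rule Weierstrass_m_test_general'[OF _ hg sm]) (simp add: h_def norm_mult)
  obtain I J where I: "\<And>X. ((\<lambda>z. \<Sum>k\<in>X. h k z) has_integral I X) {0..2*pi}"
    and J: "(g has_integral J) {0..2*pi}" and lim: "(I \<longlongrightarrow> J) (finite_subsets_at_top UNIV)"
    by (rule uniform_limit_integral[OF ul]) (auto simp: h_def intro!: continuous_intros)
  have hI: "(h k has_integral (if k = n then 2 * pi * c n else 0)) {0..2*pi}" for k
  proof (cases "k = n")
    case True
    have "((\<lambda>z. c n) has_integral (2 * pi - 0) *\<^sub>R c n) {0..2*pi}"
      using has_integral_const_real[of "c n" 0 "2*pi"] by simp
    then show ?thesis using True by (simp add: h_def[abs_def] scaleR_conv_of_real)
  next
    case False
    define H where "H z = c k * exp (\<i> * of_int (k - n) * complex_of_real z) / (\<i> * of_int (k - n))" for z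
    have "(h k has_integral (H (2*pi) - H 0)) {0..2*pi}"
    proof (rule fundamental_theorem_of_calculus)
      fix x :: real
      have "((\<lambda>z. c k * exp (\<i> * of_int (k - n) * z) / (\<i> * of_int (k - n))) has_field_derivative h k x) (at (of_real x))"
        unfolding h_def using False by (auto intro!: derivative_eq_intros)
      then show "(H has_vector_derivative h k x) (at x within {0..2*pi})"
        unfolding H_def by (rule has_vector_derivative_real_field)
    qed simp
    moreover have "H (2*pi) = H 0"
    proof -
      have "exp (\<i> * of_int (k - n) * complex_of_real (2*pi)) = 1"
        using exp_2pi_1_int[of "k - n"] by (simp add: mult_ac)
      then show ?thesis by (simp add: H_def)
    qed
    ultimately show ?thesis using False by simp
  qed
  have Ifin: "I X = (if n \<in> X then 2 * pi * c n else 0)" if "finite X" for X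
  proof -
    have "((\<lambda>z. \<Sum>k\<in>X. h k z) has_integral (\<Sum>k\<in>X. if k = n then 2 * pi * c n else 0)) {0..2*pi}"
      using that hI by (intro has_integral_sum) auto
    then have "I X = (\<Sum>k\<in>X. if k = n then 2 * pi * c n else 0)"
      using I has_integral_unique by blast
    then show ?thesis using that by simp
  qed
  have "\<forall>\<^sub>F X in finite_subsets_at_top UNIV. I X = 2 * pi * c n"
    unfolding eventually_finite_subsets_at_top by (rule exI[of _ "{n}"]) (simp add: Ifin)
  then have "(I \<longlongrightarrow> 2 * pi * c n) (finite_subsets_at_top UNIV)"
    by (rule tendsto_eventually)
  with lim have "J = 2 * pi * c n"
    using tendsto_unique finite_subsets_at_top_neq_bot by blast
  then show ?thesis
    using J by (simp add: fcoeff_def g_def[abs_def] integral_unique)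
qed

text \<open>\<open>X d n\<close> is the contribution of order \<open>d\<close> to the frequency
  \<open>n\<close>. Summing over \<open>d\<close> first yields the Fourier coefficients; after
  multiplication by the bounded symbol, absolute summability permits a return to the double
  sum.\<close>

lemma fourier_mult_double_series:
  fixes X :: "nat \<Rightarrow> int \<Rightarrow> complex"
  assumes sm: "(\<lambda>(d, n). norm (X d n)) summable_on UNIV"
    and f: "\<And>z. ((\<lambda>(d, n). X d n * exp (\<i> * of_int n * of_real z)) has_sum complex_of_real (f z)) UNIV"
    and B: "\<And>n. \<bar>m (of_int n)\<bar> \<le> B"
  shows "fourier_mult m f z = Re (\<Sum>\<^sub>\<infinity>(d, n). of_real (m (of_int n)) * X d n * exp (\<i> * of_int n * of_real z))"
proof -
  define c where "c n = (\<Sum>\<^sub>\<infinity>d. X d n)" for n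
  have sw: "(\<lambda>(n, d). norm (X d n)) summable_on UNIV \<times> UNIV"
    using sm summable_on_swap[of "\<lambda>(d, n). norm (X d n)" UNIV UNIV] by simp
  have Xs: "(\<lambda>d. norm (X d n)) summable_on UNIV" for n
    using summable_on_SigmaD1[of "\<lambda>n d. norm (X d n)" UNIV "\<lambda>_. UNIV" n] sw by simp
  have hc: "((\<lambda>d. X d n) has_sum c n) UNIV" for n
    unfolding c_def by (rule has_sum_infsum[OF abs_summable_summable[OF Xs]])
  \<comment> \<open>Used with \<open>g\<close> the exponential, to recover \<open>f\<close>, and
    with \<open>g\<close> the symbol times the exponential, to evaluate the multiplier.\<close>
  have key: "((\<lambda>n. c n * g n) has_sum (\<Sum>\<^sub>\<infinity>(d, n). X d n * g n)) UNIV"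
    if g: "\<And>n. norm (g n) \<le> C" for g C
  proof -
    have "(\<lambda>p. C * (case p of (n, d) \<Rightarrow> norm (X d n))) summable_on UNIV \<times> UNIV"
      by (rule summable_on_cmult_right[OF sw])
    then have "(\<lambda>p. norm (case p of (n, d) \<Rightarrow> X d n * g n)) summable_on UNIV \<times> UNIV"
      by (rule Infinite_Sum.abs_summable_on_comparison_test')
         (auto simp: norm_mult mult.commute intro!: mult_right_mono g)
    then have "(\<lambda>(n, d). X d n * g n) summable_on UNIV \<times> UNIV"
      by (rule abs_summable_summable)
    then obtain S where S: "((\<lambda>(n, d). X d n * g n) has_sum S) (UNIV \<times> UNIV)"
      by (auto simp: summable_on_def)
    have "((\<lambda>n. c n * g n) has_sum S) UNIV"
      by (rule has_sum_SigmaD[OF S]) (simp add: has_sum_cmult_left[OF hc])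
    moreover have "(\<Sum>\<^sub>\<infinity>(d, n). X d n * g n) = S"
      using S has_sum_swap[of "\<lambda>(n, d). X d n * g n" UNIV UNIV S] by (simp add: infsumI)
    ultimately show ?thesis by simp
  qed
  have "(\<lambda>n. \<Sum>\<^sub>\<infinity>d. norm (X d n)) summable_on UNIV"
    using summable_on_Sigma_banach[of "\<lambda>n d. norm (X d n)" UNIV "\<lambda>_. UNIV"] sw by simp
  then have csm: "(\<lambda>n. norm (c n)) summable_on UNIV"
    by (rule Infinite_Sum.abs_summable_on_comparison_test')
       (simp add: c_def norm_infsum_bound Xs)
  have "fcoeff f n = c n" for n
  proof (rule fcoeff_absolutely_convergent[OF csm])
    fix z
    have "((\<lambda>n. c n * exp (\<i> * of_int n * of_real z)) has_sum (\<Sum>\<^sub>\<infinity>(d, n). X d n * exp (\<i> * of_int n * of_real z))) UNIV"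
      by (rule key[where C = 1]) simp
    then show "((\<lambda>n. c n * exp (\<i> * of_int n * of_real z)) has_sum complex_of_real (f z)) UNIV"
      using f[of z] by (simp add: infsumI)
  qed
  moreover have "((\<lambda>n. c n * (of_real (m (of_int n)) * exp (\<i> * of_int n * of_real z))) has_sum
      (\<Sum>\<^sub>\<infinity>(d, n). X d n * (of_real (m (of_int n)) * exp (\<i> * of_int n * of_real z)))) UNIV"
    by (rule key[where C = B]) (simp add: norm_mult B)
  ultimately show ?thesis
    by (simp add: fourier_mult_def infsumI mult_ac)
qed

text \<open>Along the real line, taking real parts commutes with differentiation, so every real
  derivative is the real part of a complex one.\<close>

lemma smooth_real_of_holomorphic:
  assumes S: "open S" and hol: "F holomorphic_on S" and R: "\<And>x::real. of_real x \<in> S"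
  shows "smooth_real (\<lambda>x. Re (F (of_real x)))"
proof -
  have hd: "((\<lambda>x. Re (G (of_real x))) has_real_derivative Re (deriv G (of_real x))) (at x)"
    if "G holomorphic_on S" for G x
  proof -
    have "(G has_field_derivative deriv G (of_real x)) (at (of_real x))"
      using that S R by (simp add: holomorphic_derivI)
    then have "((\<lambda>x. G (of_real x)) has_vector_derivative deriv G (of_real x)) (at x)"
      by (rule has_vector_derivative_real_field)
    from bounded_linear.has_vector_derivative[OF bounded_linear_Re this] show ?thesis
      by (simp add: has_real_derivative_iff_has_vector_derivative)
  qed
  have *: "(deriv ^^ n) (\<lambda>x. Re (F (of_real x))) = (\<lambda>x. Re ((deriv ^^ n) F (of_real x)))" for n
  proof (induction n)
    case (Suc n)
    have "(deriv ^^ n) F holomorphic_on S"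
      by (rule holomorphic_higher_deriv[OF hol S])
    from hd[OF this] show ?case
      by (auto simp: Suc intro!: ext DERIV_imp_deriv)
  qed simp
  show ?thesis
    unfolding smooth_real_def
  proof (intro allI)
    fix n x
    have "(deriv ^^ n) F holomorphic_on S"
      by (rule holomorphic_higher_deriv[OF hol S])
    from hd[OF this] show "(deriv ^^ n) (\<lambda>x. Re (F (of_real x))) differentiable at x"
      unfolding * by (meson real_differentiable_def)
  qed
qed

section \<open>The dispersion symbol: non-resonance and complex extension\<close>

text \<open>The symbol \<open>tanh (n \<kappa>) / (n \<kappa>)\<close>, written so that it extends to complex \<open>\<kappa>\<close>.\<close>

definition cww2_complex :: "complex \<Rightarrow> nat \<Rightarrow> complex" where
  "cww2_complex \<kappa> n = (if n = 0 then 1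
     else (1 - exp (- 2 * of_nat n * \<kappa>)) / ((1 + exp (- 2 * of_nat n * \<kappa>)) * (of_nat n * \<kappa>)))"

text \<open>The mean value theorem for x - tanh x, whose derivative is tanh^2. It separates the
  symbol at frequency 0 from its value at frequency 1.\<close>

lemma tanh_less_self: "tanh x < x" if "x > 0" for x :: real
proof -
  have "\<exists>z. 0 < z \<and> z < x \<and> (x - tanh x) - (0 - tanh 0) = (x - 0) * (tanh z)\<^sup>2"
    by (rule MVT2[OF that]) (auto intro!: derivative_eq_intros)
  then obtain z where "0 < z" "x - tanh x = x * (tanh z)\<^sup>2" by auto
  moreover have "x * (tanh z)\<^sup>2 > 0" using \<open>0 < z\<close> that by simp
  ultimately show ?thesis by linarith
qed

text \<open>By the addition theorem tanh is strictly subadditive on positive numbers. This separates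
  the symbol at frequencies n >= 2 from its value at frequency 1.\<close>

lemma tanh_mult_less: "tanh (real n * x) < real n * tanh x" if "x > 0" "n \<ge> 2" for x :: real
  using \<open>n \<ge> 2\<close>
proof (induction n rule: nat_induct_at_least)
  have add: "tanh (x + y) < tanh x + tanh y" if "x > 0" "y > 0" for x y :: real
  proof -
    have p: "tanh x > 0" "tanh y > 0" using that by auto
    then have q: "1 + tanh x * tanh y > 1" by simp
    have "tanh (x + y) = (tanh x + tanh y) / (1 + tanh x * tanh y)"
      by (rule tanh_add) auto
    also have "\<dots> < (tanh x + tanh y) / 1"
      using p q by (intro divide_strict_left_mono add_pos_pos mult_pos_pos) auto
    finally show ?thesis by simp
  qed
  {
    case base
    show ?case using add[OF that(1) that(1)] by simp
  next
    case (Suc n)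
    have "tanh (real (Suc n) * x) < tanh x + tanh (real n * x)"
      using add[of x "real n * x"] that(1) Suc.hyps by (simp add: algebra_simps)
    then show ?case using Suc.IH by (simp add: algebra_simps)
  }
qed

lemma cww_pos: "cww k > 0" if "k > 0"
  using that by (simp add: cww_def)

lemma cww_power2: "(cww k)\<^sup>2 = tanh k / k" if "k > 0"
  using that by (simp add: cww_def)

lemma cww_less_one: "cww k < 1" if "k > 0"
proof -
  have "(cww k)\<^sup>2 < 1\<^sup>2" using that tanh_less_self[OF that] by (simp add: cww_power2)
  then show ?thesis by (rule power_less_imp_less_base) simp
qed

lemma cww2_complex_of_real:
  assumes "k > 0"
  shows "cww2_complex (of_real k) n = of_real ((cww (real n * k))\<^sup>2)"
proof (cases "n = 0")
  case False
  then have "real n * k > 0" using assms by simp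
  then have "(cww (real n * k))\<^sup>2 = (1 - exp (- 2 * (real n * k))) / (1 + exp (- 2 * (real n * k))) / (real n * k)"
    by (simp only: cww_power2 tanh_real_altdef)
  then show ?thesis using False by (simp add: cww2_complex_def exp_of_real[symmetric] mult_ac)
qed (simp add: cww2_complex_def cww_def)

text \<open>Non-resonance: at the speed \<open>cww k\<close> the linearised problem is singular at
  the frequencies 1 and -1 only, so the divisors of the recursion do not vanish.\<close>

lemma cww_power2_neq:
  assumes "k > 0" "n \<noteq> 1"
  shows "(cww (real n * k))\<^sup>2 \<noteq> (cww k)\<^sup>2"
proof (cases "n = 0")
  case True
  have "(cww k)\<^sup>2 < 1" using tanh_less_self[OF assms(1)] assms by (simp add: cww_power2)
  then show ?thesis using True by (simp add: cww_def)
next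
  case False
  then have "tanh (real n * k) < real n * tanh k" "real n > 0"
    using assms tanh_mult_less[of k n] by auto
  then show ?thesis using assms by (simp add: cww_power2 field_simps)
qed

text \<open>In the disc Re \<kappa> > k0/2, so exp (-2 n \<kappa>) has norm at most exp (-k0) < 1
  for n >= 1 and the denominator stays away from 0. The decay 1/n is what later makes the separation
  of the symbol values uniform in \<open>n\<close>.\<close>

lemma norm_cww2_complex_le:
  assumes "k0 > 0" "dist (complex_of_real k0) \<kappa> < k0 / 2" "n > 0"
  shows "norm (cww2_complex \<kappa> n) \<le> 4 / ((1 - exp (- k0)) * k0) / real n"
    and "1 + exp (- 2 * of_nat n * \<kappa>) \<noteq> 0" and "\<kappa> \<noteq> 0"
proof -
  have "\<bar>Re (complex_of_real k0 - \<kappa>)\<bar> < k0 / 2"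
    using assms(2) abs_Re_le_cmod[of "complex_of_real k0 - \<kappa>"] by (simp add: dist_norm)
  then have Re: "Re \<kappa> > k0 / 2" by (auto simp: abs_if split: if_splits)
  then have nk: "norm \<kappa> \<ge> k0 / 2" using complex_Re_le_cmod[of \<kappa>] by linarith
  then show "\<kappa> \<noteq> 0" using assms by auto
  define e where "e = exp (- 2 * of_nat n * \<kappa>)"
  have "norm e = exp (- 2 * real n * Re \<kappa>)" by (simp add: e_def norm_exp_eq_Re)
  also have "\<dots> \<le> exp (- k0)"
  proof -
    have "1 * (k0 / 2) \<le> real n * Re \<kappa>" using Re assms by (intro mult_mono) auto
    then show ?thesis by simp
  qed
  finally have ne: "norm e \<le> exp (- k0)" .
  have q: "exp (- k0) < 1" using assms by simp
  have "norm (1 + e) \<ge> 1 - norm e" using norm_diff_ineq[of 1 e] by simp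
  then have de: "norm (1 + e) \<ge> 1 - exp (- k0)" using ne by linarith
  then show "1 + exp (- 2 * of_nat n * \<kappa>) \<noteq> 0" using q e_def by force
  have nu: "norm (1 - e) \<le> 2" using norm_triangle_ineq4[of 1 e] ne q by (simp del: exp_less_one_iff)
  have "norm (cww2_complex \<kappa> n) = norm (1 - e) / (norm (1 + e) * (real n * norm \<kappa>))"
    using assms by (simp add: cww2_complex_def e_def norm_divide norm_mult)
  also have "\<dots> \<le> 2 / ((1 - exp (- k0)) * (real n * (k0 / 2)))"
    using nu de nk q assms by (intro frac_le mult_mono mult_pos_pos) auto
  also have "\<dots> = 4 / ((1 - exp (- k0)) * k0) / real n"
    by (simp add: field_simps)
  finally show "norm (cww2_complex \<kappa> n) \<le> 4 / ((1 - exp (- k0)) * k0) / real n" .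
qed

lemma cww2_complex_holomorphic:
  assumes "k0 > 0" "r \<le> k0 / 2"
  shows "(\<lambda>\<kappa>. cww2_complex \<kappa> n) holomorphic_on ball (of_real k0) r"
proof (cases "n = 0")
  case False
  then show ?thesis
    unfolding cww2_complex_def using norm_cww2_complex_le(2,3)[OF assms(1), of _ n] assms(2)
    by (auto intro!: holomorphic_intros)
qed (simp add: cww2_complex_def)

text \<open>The separation has to be uniform in \<open>n\<close> on a full complex disc. For large
  \<open>n\<close> the decay pushes the symbol below a quarter of its value \<open>s\<close> at
  frequency 1; the finitely many other \<open>n\<close> follow by continuity from the real point
  \<open>k0\<close>, where \<open>cww_power2_neq\<close> applies.\<close>

lemma cww2_complex_local:
  assumes k0: "k0 > 0"
  obtains r M \<delta> where "r > 0" "r \<le> k0 / 2" "\<delta> > 0" "M \<ge> 1"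
    "\<And>\<kappa> n. \<kappa> \<in> ball (of_real k0) r \<Longrightarrow> norm (cww2_complex \<kappa> n) \<le> M"
    "\<And>\<kappa> n. \<kappa> \<in> ball (of_real k0) r \<Longrightarrow> n \<noteq> 1 \<Longrightarrow> norm (cww2_complex \<kappa> n - cww2_complex \<kappa> 1) \<ge> \<delta>"
proof -
  define K where "K = 4 / ((1 - exp (- k0)) * k0)"
  have K: "K > 0" using k0 by (simp add: K_def)
  define m0 where "m0 n = cww2_complex (of_real k0) n" for n
  define s where "s = (cww k0)\<^sup>2"
  have s: "s > 0" using cww_pos[OF k0] by (simp add: s_def)
  have m01: "m0 1 = of_real s" using cww2_complex_of_real[OF k0, of 1] by (simp add: m0_def s_def)
  \<comment> \<open>From this index on K/n is at most s/4. The summand 2 also puts 0 below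
    \<open>N\<close>, so that the finite set \<open>A\<close> is not empty and has a
    minimum.\<close>
  define N where "N = nat \<lceil>4 * K / s\<rceil> + 2"
  have N: "K / real n \<le> s / 4" if "n \<ge> N" for n
  proof -
    have "4 * K / s \<le> real n" using that unfolding N_def by linarith
    moreover have "real n > 0" using that N_def by simp
    ultimately show ?thesis using s K by (simp add: field_simps)
  qed
  define d where "d n = norm (m0 n - m0 1)" for n
  have d: "d n > 0" if "n \<noteq> 1" for n
  proof -
    have "m0 n \<noteq> m0 1"
      using cww_power2_neq[OF k0 that] cww2_complex_of_real[OF k0, of n] m01
      unfolding m0_def s_def by (metis of_real_eq_iff)
    then show ?thesis by (simp add: d_def)
  qed
  define A where "A = {..<N} - {1::nat}"
  have finA: "finite A" by (simp add: A_def)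
  have "0 \<in> A" by (simp add: A_def N_def)
  \<comment> \<open>For the tail the gap is at least 3s/4 - s/4; on the finite set half of the gap
    at \<open>k0\<close> survives in a neighbourhood.\<close>
  define \<delta> where "\<delta> = min (s / 4) (Min (d ` A) / 2)"
  have "Min (d ` A) \<in> d ` A" using finA \<open>0 \<in> A\<close> by (intro Min_in) auto
  then obtain n where "n \<in> A" "Min (d ` A) = d n" by blast
  then have \<delta>: "\<delta> > 0" using s d[of n] by (simp add: \<delta>_def A_def)
  have cont: "isCont (\<lambda>\<kappa>. cww2_complex \<kappa> n) (of_real k0)" for n
    using cww2_complex_holomorphic[OF k0 order_refl, of n] k0
    by (intro continuous_on_interior[OF holomorphic_on_imp_continuous_on]) auto
  then have tends: "((\<lambda>\<kappa>. cww2_complex \<kappa> n) \<longlongrightarrow> m0 n) (nhds (of_real k0))" for n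
    using tendsto_at_iff_tendsto_nhds[of "\<lambda>\<kappa>. cww2_complex \<kappa> n" "of_real k0"]
    unfolding m0_def continuous_at by simp
  have ev1: "\<forall>\<^sub>F \<kappa> in nhds (of_real k0). dist (cww2_complex \<kappa> 1) (m0 1) < s / 4"
    using tends[of 1] s by (intro tendstoD) auto
  have "\<forall>\<^sub>F \<kappa> in nhds (of_real k0). d n / 2 < norm (cww2_complex \<kappa> n - cww2_complex \<kappa> 1)" if "n \<in> A" for n
  proof -
    have "((\<lambda>\<kappa>. norm (cww2_complex \<kappa> n - cww2_complex \<kappa> 1)) \<longlongrightarrow> d n) (nhds (of_real k0))"
      unfolding d_def by (intro tendsto_intros tends)
    then show ?thesis using d[of n] that by (intro order_tendstoD(1)) (auto simp: A_def)
  qed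
  then have ev2: "\<forall>\<^sub>F \<kappa> in nhds (of_real k0). \<forall>n\<in>A. d n / 2 < norm (cww2_complex \<kappa> n - cww2_complex \<kappa> 1)"
    using finA by (simp add: eventually_ball_finite)
  obtain r0 where r0: "r0 > 0" and R: "\<And>\<kappa>. dist \<kappa> (of_real k0) < r0 \<Longrightarrow>
     dist (cww2_complex \<kappa> 1) (m0 1) < s / 4 \<and> (\<forall>n\<in>A. d n / 2 < norm (cww2_complex \<kappa> n - cww2_complex \<kappa> 1))"
    using eventually_conj[OF ev1 ev2] unfolding eventually_nhds_metric by blast
  show ?thesis
  proof (rule that[of "min r0 (k0/2)" \<delta> "max 1 K"])
    show "0 < min r0 (k0/2)" using r0 k0 by simp
    fix \<kappa> :: complex and n :: nat assume \<kappa>: "\<kappa> \<in> ball (of_real k0) (min r0 (k0/2))"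
    have bnd: "norm (cww2_complex \<kappa> n) \<le> K / real n" if "n > 0" for n
      unfolding K_def using norm_cww2_complex_le(1)[OF k0 _ that] \<kappa> by auto
    show "norm (cww2_complex \<kappa> n) \<le> max 1 K"
    proof (cases "n = 0")
      case False
      then have "K / real n \<le> K / 1" using K by (intro divide_left_mono) auto
      then show ?thesis using bnd[of n] False by auto
    qed (simp add: cww2_complex_def)
    have R': "dist (cww2_complex \<kappa> 1) (m0 1) < s / 4" "\<forall>n\<in>A. d n / 2 < norm (cww2_complex \<kappa> n - cww2_complex \<kappa> 1)"
      using R[of \<kappa>] \<kappa> by (auto simp: dist_commute)
    assume n: "n \<noteq> 1"
    show "\<delta> \<le> norm (cww2_complex \<kappa> n - cww2_complex \<kappa> 1)"
    proof (cases "n < N")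
      case True
      then have nA: "n \<in> A" using n by (simp add: A_def)
      then have "Min (d ` A) \<le> d n" using finA by simp
      moreover have "d n / 2 < norm (cww2_complex \<kappa> n - cww2_complex \<kappa> 1)" using R' nA by blast
      ultimately show ?thesis unfolding \<delta>_def by linarith
    next
      case False
      then have "n > 0" by (simp add: N_def)
      have "norm (cww2_complex \<kappa> n) \<le> s / 4" using order_trans[OF bnd[OF \<open>n > 0\<close>] N] False by simp
      moreover have "norm (m0 1) - norm (m0 1 - cww2_complex \<kappa> 1) \<le> norm (cww2_complex \<kappa> 1)"
        using norm_triangle_ineq2[of "m0 1" "m0 1 - cww2_complex \<kappa> 1"] by simp
      moreover have "norm (m0 1) = s" using s m01 by simp
      moreover have "norm (m0 1 - cww2_complex \<kappa> 1) < s / 4"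
        using R'(1) by (simp add: dist_norm norm_minus_commute)
      moreover have "norm (cww2_complex \<kappa> 1) - norm (cww2_complex \<kappa> n) \<le> norm (cww2_complex \<kappa> n - cww2_complex \<kappa> 1)"
        by (metis norm_minus_commute norm_triangle_ineq2)
      moreover have "\<delta> \<le> s / 4" by (simp add: \<delta>_def)
      ultimately show ?thesis using s by linarith
    qed
  qed (use \<delta> in auto)
qed

section \<open>The formal expansion\<close>

text \<open>For the trigonometric polynomials that will be encoded by \<open>p\<close>, this is the
  norm of the Wiener algebra; it is submultiplicative and blind to a common shift of the
  frequencies.\<close>

definition poly_norm :: "complex poly \<Rightarrow> real" where
  "poly_norm p = (\<Sum>i\<le>degree p. norm (coeff p i))"

lemma poly_norm_altdef: "degree p \<le> n \<Longrightarrow> poly_norm p = (\<Sum>i\<le>n. norm (coeff p i))"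
  unfolding poly_norm_def by (rule sum.mono_neutral_left) (auto simp: coeff_eq_0)

lemma poly_norm_nonneg [simp]: "poly_norm p \<ge> 0"
  by (simp add: poly_norm_def sum_nonneg)

lemma poly_norm_0 [simp]: "poly_norm 0 = 0"
  by (simp add: poly_norm_def)

lemma poly_norm_pCons [simp]: "poly_norm (pCons a p) = norm a + poly_norm p"
proof -
  have "poly_norm (pCons a p) = (\<Sum>i\<le>Suc (degree p). norm (coeff (pCons a p) i))"
    by (rule poly_norm_altdef) (rule degree_pCons_le)
  also have "\<dots> = norm a + (\<Sum>i\<le>degree p. norm (coeff p i))"
    by (subst sum.atMost_Suc_shift) simp
  finally show ?thesis by (simp add: poly_norm_def)
qed

lemma poly_norm_add: "poly_norm (p + q) \<le> poly_norm p + poly_norm q"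
proof -
  define n where "n = max (degree p) (degree q)"
  have "degree p \<le> n" "degree q \<le> n" "degree (p + q) \<le> n"
    by (auto simp: n_def degree_add_le)
  then show ?thesis
    by (simp add: poly_norm_altdef sum.distrib[symmetric] sum_mono norm_triangle_ineq)
qed

lemma poly_norm_minus [simp]: "poly_norm (- p) = poly_norm p"
  by (simp add: poly_norm_def)

lemma poly_norm_diff: "poly_norm (p - q) \<le> poly_norm p + poly_norm q"
  using poly_norm_add[of p "- q"] by simp

lemma poly_norm_smult: "poly_norm (smult c p) = norm c * poly_norm p"
  by (simp add: poly_norm_def sum_distrib_left norm_mult)

lemma poly_norm_monom: "poly_norm (monom c n) = norm c"
proof -
  have "poly_norm (monom c n) = (\<Sum>i\<le>n. norm (coeff (monom c n) i))"
    by (rule poly_norm_altdef) (rule degree_monom_le)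
  also have "\<dots> = (\<Sum>i\<le>n. if i = n then norm c else 0)"
    by (intro sum.cong) auto
  finally show ?thesis by simp
qed

lemma poly_norm_sum: "poly_norm (\<Sum>x\<in>A. f x) \<le> (\<Sum>x\<in>A. poly_norm (f x))"
proof (induction A rule: infinite_finite_induct)
  case (insert x F)
  then show ?case using poly_norm_add[of "f x" "\<Sum>x\<in>F. f x"] by simp
qed auto

lemma poly_norm_mult: "poly_norm (p * q) \<le> poly_norm p * poly_norm q"
proof (induction p)
  case (pCons a p)
  have "poly_norm (pCons a p * q) \<le> poly_norm (smult a q) + poly_norm (pCons 0 (p * q))"
    unfolding mult_pCons_left by (rule poly_norm_add)
  also have "\<dots> \<le> norm a * poly_norm q + poly_norm p * poly_norm q"
    using pCons.IH by (simp add: poly_norm_smult)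
  finally show ?case by (simp add: algebra_simps)
qed simp

lemma norm_coeff_le_poly_norm: "norm (coeff p i) \<le> poly_norm p"
proof (cases "i \<le> degree p")
  case True
  then show ?thesis unfolding poly_norm_def by (intro member_le_sum) auto
qed (simp add: coeff_eq_0)

section \<open>Even trigonometric polynomials as palindromic polynomials\<close>

text \<open>A polynomial \<open>p\<close> of degree at most \<open>d\<close> encodes the trigonometric polynomial with coefficient \<open>coeff p i\<close>
  at frequency \<open>2 * i - d\<close>; products of polynomials are products of trigonometric polynomials, and
  \<open>palindromic d p\<close> says that the latter is even.\<close>

definition palindromic :: "nat \<Rightarrow> complex poly \<Rightarrow> bool" where
  "palindromic d p \<longleftrightarrow> degree p \<le> d \<and> (\<forall>x. x \<noteq> 0 \<longrightarrow> x ^ d * poly p (1 / x) = poly p x)"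

lemma palindromic_degree: "palindromic d p \<Longrightarrow> degree p \<le> d"
  by (simp add: palindromic_def)

lemma palindromic_0 [simp]: "palindromic d 0"
  by (simp add: palindromic_def)

lemma palindromic_add: "palindromic d p \<Longrightarrow> palindromic d q \<Longrightarrow> palindromic d (p + q)"
  by (simp add: palindromic_def degree_add_le distrib_left)

lemma palindromic_diff: "palindromic d p \<Longrightarrow> palindromic d q \<Longrightarrow> palindromic d (p - q)"
  by (simp add: palindromic_def degree_diff_le right_diff_distrib)

lemma palindromic_sum: "(\<And>x. x \<in> A \<Longrightarrow> palindromic d (f x)) \<Longrightarrow> palindromic d (sum f A)"
  by (induction A rule: infinite_finite_induct) (auto intro: palindromic_add)

lemma palindromic_smult: "palindromic d p \<Longrightarrow> palindromic d (smult c p)"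
  by (auto simp: palindromic_def intro: order_trans[OF degree_smult_le])

lemma palindromic_mult: "palindromic d p \<Longrightarrow> palindromic e q \<Longrightarrow> palindromic (d + e) (p * q)"
proof -
  assume p: "palindromic d p" and q: "palindromic e q"
  have "x ^ (d + e) * poly (p * q) (1 / x) = poly (p * q) x" if "x \<noteq> 0" for x
  proof -
    have "x ^ (d + e) * poly (p * q) (1 / x) = (x ^ d * poly p (1 / x)) * (x ^ e * poly q (1 / x))"
      unfolding poly_mult power_add by (simp only: mult_ac)
    also have "\<dots> = poly p x * poly q x" using p q that by (simp add: palindromic_def)
    finally show ?thesis by simp
  qed
  moreover have "degree (p * q) \<le> d + e"
    using p q degree_mult_le[of p q] by (auto simp: palindromic_def)
  ultimately show ?thesis by (simp add: palindromic_def)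
qed

lemma poly_eq_sum_atMost: "degree p \<le> n \<Longrightarrow> poly p (x::complex) = (\<Sum>i\<le>n. coeff p i * x ^ i)"
  unfolding poly_altdef by (rule sum.mono_neutral_left) (auto simp: coeff_eq_0)

text \<open>The functional form is stable under products, while the coefficient form is what the
  recursion yields mode by mode. Both say that \<open>p\<close> equals the polynomial
  \<open>r\<close> with reversed coefficients.\<close>

lemma palindromic_iff_coeff:
  "palindromic d p \<longleftrightarrow> degree p \<le> d \<and> (\<forall>i\<le>d. coeff p (d - i) = coeff p i)"
proof (cases "degree p \<le> d")
  case deg: True
  define r where "r = (\<Sum>i\<le>d. monom (coeff p (d - i)) i)"
  have cr: "coeff r i = (if i \<le> d then coeff p (d - i) else 0)" for i
    by (simp add: r_def coeff_sum)
  have pr: "poly r x = x ^ d * poly p (1 / x)" if "x \<noteq> 0" for x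
  proof -
    have "x ^ d * poly p (1 / x) = (\<Sum>i\<le>d. coeff p i * x ^ (d - i))"
    proof -
      have "x ^ d * (coeff p i * (1 / x) ^ i) = coeff p i * x ^ (d - i)" if "i \<le> d" for i
        using \<open>x \<noteq> 0\<close> that by (simp add: power_diff power_one_over divide_simps)
      then show ?thesis
        unfolding poly_eq_sum_atMost[OF deg] sum_distrib_left by (intro sum.cong) auto
    qed
    also have "\<dots> = (\<Sum>i\<le>d. coeff p (d - i) * x ^ i)"
      by (rule sum.reindex_bij_witness[of _ "\<lambda>i. d - i" "\<lambda>i. d - i"]) auto
    also have "\<dots> = poly r x" by (simp add: r_def poly_sum poly_monom)
    finally show ?thesis by simp
  qed
  have "palindromic d p \<longleftrightarrow> (\<forall>x. x \<noteq> 0 \<longrightarrow> poly r x = poly p x)"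
    using deg pr by (auto simp: palindromic_def)
  also have "\<dots> \<longleftrightarrow> r = p"
  proof
    assume eq: "\<forall>x. x \<noteq> 0 \<longrightarrow> poly r x = poly p x"
    \<comment> \<open>The identity is known only for arguments other than 0; multiplication by x
      makes the two sides agree at 0 as well.\<close>
    have "poly (pCons 0 r) = poly (pCons 0 p)"
    proof
      fix x show "poly (pCons 0 r) x = poly (pCons 0 p) x" using eq by (cases "x = 0") auto
    qed
    then show "r = p" by (simp add: poly_eq_poly_eq_iff)
  qed auto
  also have "\<dots> \<longleftrightarrow> (\<forall>i\<le>d. coeff p (d - i) = coeff p i)"
    using deg by (auto simp: poly_eq_iff cr coeff_eq_0)
  finally show ?thesis using deg by simp
qed (simp add: palindromic_def)

section \<open>The recursion for the coefficients\<close>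

text \<open>Without its end terms the convolution at \<open>d\<close> refers only to orders strictly
  between 0 and \<open>d\<close>, as a recursion requires; for sequences that start with 0 it is the
  full Cauchy product.\<close>

definition conv :: "(nat \<Rightarrow> 'a::comm_ring_1) \<Rightarrow> (nat \<Rightarrow> 'a) \<Rightarrow> nat \<Rightarrow> 'a" where
  "conv f g d = (\<Sum>e=1..<d. f e * g (d - e))"

lemma conv_cong: "(\<And>e. e < d \<Longrightarrow> f e = f' e) \<Longrightarrow> (\<And>e. e < d \<Longrightarrow> g e = g' e) \<Longrightarrow> conv f g d = conv f' g' d"
  unfolding conv_def by (intro sum.cong) auto

lemma conv_full: "f 0 = 0 \<Longrightarrow> g 0 = 0 \<Longrightarrow> (\<Sum>e\<le>d. f e * g (d - e)) = conv f g d"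
  unfolding conv_def
proof (rule sum.mono_neutral_right)
  assume "f 0 = 0" "g 0 = 0"
  then show "\<forall>i\<in>{..d} - {1..<d}. f i * g (d - i) = 0"
    by (auto simp: not_less Suc_le_eq)
qed auto

text \<open>The absolute value of the frequency stored at index \<open>i\<close>. The symbol is
  even, so its value depends on this number only.\<close>

definition mode :: "nat \<Rightarrow> nat \<Rightarrow> nat" where
  "mode d i = nat \<bar>2 * int i - int d\<bar>"

text \<open>The coefficient of \<open>a ^ e\<close> in \<open>q\<^sup>2\<close>, as a constant trigonometric polynomial of formal degree \<open>e\<close>. It is
  indexed by \<open>Suc e\<close>, the order of the equation that determines it.\<close>

definition speed_poly :: "(nat \<Rightarrow> complex) \<Rightarrow> nat \<Rightarrow> complex poly" where
  "speed_poly N e = monom (N (Suc e)) (e div 2)"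

text \<open>Everything in the equation of order \<open>d\<close> except the terms in \<open>E d\<close> and the term \<open>e = d - 1\<close>; the latter
  contains the unknown \<open>N d\<close> and contributes only to the frequencies 1 and -1.\<close>

definition residual :: "complex \<Rightarrow> (nat \<Rightarrow> complex poly) \<Rightarrow> (nat \<Rightarrow> complex poly) \<Rightarrow> (nat \<Rightarrow> complex) \<Rightarrow> nat \<Rightarrow> complex poly" where
  "residual c E W N d =
     (\<Sum>e=1..<d-1. speed_poly N e * (2 * W (d - e) - conv W W (d - e)))
     - smult c (2 * conv W E d + conv W W d)"

text \<open>Inversion of the linear part, a division by twice the difference of symbol values. The
  value 0 at the frequencies 1 and -1 is a normalisation: it leaves exactly \<open>a\<close> as
  coefficient of cos z in e and so gives \<open>a\<close> its meaning as amplitude.\<close>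

definition solve_modes :: "(nat \<Rightarrow> complex) \<Rightarrow> nat \<Rightarrow> complex poly \<Rightarrow> complex poly" where
  "solve_modes m d R = (\<Sum>i\<le>d. monom (if mode d i = 1 then 0 else coeff R i / (2 * (m (mode d i) - m 1))) i)"

text \<open>At order \<open>d\<close> the components are the coefficients of a^d in e and in w, and
  the coefficient of a^(d-1) in q^2. The data of order 1 are cos z, cos z and the symbol at
  frequency 1, that is, the bifurcation point. The guards \<open>e < d\<close> make the decrease of
  the argument visible. Frequency -1 has index (d - 1)/2 and occurs for odd \<open>d\<close> only,
  whence the default 0 for even \<open>d\<close>.\<close>

function stokes :: "(nat \<Rightarrow> complex) \<Rightarrow> nat \<Rightarrow> complex poly \<times> complex poly \<times> complex" where
  "stokes m d =
    (if d = 0 then (0, 0, 0)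
     else if d = 1 then ([:1/2, 1/2:], [:1/2, 1/2:], m 1)
     else let E = (\<lambda>e. if e < d then fst (stokes m e) else 0);
              W = (\<lambda>e. if e < d then fst (snd (stokes m e)) else 0);
              N = (\<lambda>e. if e < d then snd (snd (stokes m e)) else 0);
              R = residual (m 1) E W N d;
              p = solve_modes m d R
          in (p, p - conv W E d, if odd d then - coeff R ((d - 1) div 2) else 0))"
  by auto
termination by (relation "Wellfounded.measure snd") auto

declare stokes.simps [simp del]

context fixes m :: "nat \<Rightarrow> complex" begin

definition eta_coeff :: "nat \<Rightarrow> complex poly" where "eta_coeff d = fst (stokes m d)"
definition w_coeff :: "nat \<Rightarrow> complex poly" where "w_coeff d = fst (snd (stokes m d))"
definition nu_coeff :: "nat \<Rightarrow> complex" where "nu_coeff d = snd (snd (stokes m d))"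
definition sigma_coeff :: "nat \<Rightarrow> complex poly" where
  "sigma_coeff d = 2 * w_coeff d - conv w_coeff w_coeff d"
definition mu_coeff :: "nat \<Rightarrow> complex poly" where "mu_coeff = speed_poly nu_coeff"
definition residual_coeff :: "nat \<Rightarrow> complex poly" where
  "residual_coeff d = residual (m 1) eta_coeff w_coeff nu_coeff d"

lemma coeff_0 [simp]: "eta_coeff 0 = 0" "w_coeff 0 = 0" "nu_coeff 0 = 0" "sigma_coeff 0 = 0"
  by (simp_all add: eta_coeff_def w_coeff_def nu_coeff_def sigma_coeff_def conv_def stokes.simps)

lemma coeff_1: "eta_coeff 1 = [:1/2, 1/2:]" "w_coeff 1 = [:1/2, 1/2:]" "nu_coeff 1 = m 1" "sigma_coeff 1 = [:1, 1:]"
  by (simp_all add: eta_coeff_def w_coeff_def nu_coeff_def sigma_coeff_def conv_def stokes.simps numeral_poly)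

lemma coeff_ge_2:
  assumes "d \<ge> 2"
  shows "eta_coeff d = solve_modes m d (residual_coeff d)"
    and "w_coeff d = eta_coeff d - conv w_coeff eta_coeff d"
    and "nu_coeff d = (if odd d then - coeff (residual_coeff d) ((d - 1) div 2) else 0)"
proof -
  define E where "E = (\<lambda>e. if e < d then fst (stokes m e) else 0)"
  define W where "W = (\<lambda>e. if e < d then fst (snd (stokes m e)) else 0)"
  define N where "N = (\<lambda>e. if e < d then snd (snd (stokes m e)) else 0)"
  have EE: "E e = eta_coeff e" "W e = w_coeff e" "N e = nu_coeff e" if "e < d" for e
    using that by (simp_all add: E_def W_def N_def eta_coeff_def w_coeff_def nu_coeff_def)
  \<comment> \<open>All arguments inside \<open>residual\<close> are below \<open>d\<close>,
    including \<open>Suc e\<close> for the coefficients of q^2, so the guards may be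
    dropped.\<close>
  have R: "residual (m 1) E W N d = residual_coeff d"
    unfolding residual_def residual_coeff_def speed_poly_def
    by (intro arg_cong2[where f = minus] arg_cong2[where f = plus] arg_cong2[where f = times]
        arg_cong2[where f = smult] arg_cong2[where f = monom] refl sum.cong conv_cong EE) auto
  have C: "conv W E d = conv w_coeff eta_coeff d" by (intro conv_cong EE)
  have B: "stokes m d = (let p = solve_modes m d (residual_coeff d) in
     (p, p - conv w_coeff eta_coeff d, if odd d then - coeff (residual_coeff d) ((d - 1) div 2) else 0))"
    using assms R C unfolding E_def W_def N_def by (subst stokes.simps) (simp add: Let_def)
  show "eta_coeff d = solve_modes m d (residual_coeff d)" by (simp add: eta_coeff_def B Let_def)
  then show "w_coeff d = eta_coeff d - conv w_coeff eta_coeff d"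
    by (simp add: w_coeff_def[of d] B Let_def)
  show "nu_coeff d = (if odd d then - coeff (residual_coeff d) ((d - 1) div 2) else 0)"
    by (simp add: nu_coeff_def B Let_def)
qed

lemma residual_coeff_altdef:
  "residual_coeff d = (\<Sum>e=1..<d-1. mu_coeff e * sigma_coeff (d - e))
     - smult (m 1) (2 * conv w_coeff eta_coeff d + conv w_coeff w_coeff d)"
  by (simp add: residual_coeff_def residual_def mu_coeff_def sigma_coeff_def)

text \<open>Because of the shift of the index by one, this says that q^2 contains only even powers
  of \<open>a\<close>; it is the reason why c is even in \<open>a\<close>.\<close>

lemma nu_coeff_even: "even d \<Longrightarrow> nu_coeff d = 0"
  using coeff_ge_2(3)[of d] coeff_0(3) by (cases "d \<ge> 2") (auto simp: not_le less_2_cases_iff)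

lemma coeff_solve_modes:
  "coeff (solve_modes m d R) i =
     (if i \<le> d \<and> mode d i \<noteq> 1 then coeff R i / (2 * (m (mode d i) - m 1)) else 0)"
  by (simp add: solve_modes_def coeff_sum)

lemma palindromic_mu_coeff: "palindromic d (mu_coeff d)"
proof (cases "even d")
  case True
  then obtain k where k: "d = 2 * k" by auto
  have "degree (mu_coeff d) \<le> k"
    using degree_monom_le[of "nu_coeff (Suc d)" k] by (simp add: mu_coeff_def speed_poly_def k)
  then show ?thesis
    by (auto simp: palindromic_iff_coeff mu_coeff_def speed_poly_def k)
next
  case False
  then show ?thesis by (simp add: mu_coeff_def speed_poly_def nu_coeff_even)
qed

lemma palindromic_conv:
  "(\<And>e. e < d \<Longrightarrow> palindromic e (f e)) \<Longrightarrow> (\<And>e. e < d \<Longrightarrow> palindromic e (g e)) \<Longrightarrow> palindromic d (conv f g d)"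
  unfolding conv_def
proof (rule palindromic_sum)
  fix e assume *: "\<And>e. e < d \<Longrightarrow> palindromic e (f e)" "\<And>e. e < d \<Longrightarrow> palindromic e (g e)" "e \<in> {1..<d}"
  then show "palindromic d (f e * g (d - e))"
    using palindromic_mult[of e "f e" "d - e" "g (d - e)"] by simp
qed

lemma palindromic_two: "palindromic d p \<Longrightarrow> palindromic d (2 * p)"
  using palindromic_add[of d p p] by simp

text \<open>A joint induction, since the residual of order \<open>d\<close> mixes all sequences at
  lower orders. Besides evenness in z it provides the symmetry that lets a single unknown of q^2
  remove the residual at both frequencies 1 and -1.\<close>

lemma palindromic_all: "palindromic d (eta_coeff d) \<and> palindromic d (w_coeff d) \<and> palindromic d (sigma_coeff d) \<and> (d \<ge> 2 \<longrightarrow> palindromic d (residual_coeff d))"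
proof (induction d rule: less_induct)
  case (less d)
  have one: "palindromic (Suc 0) [:1/2, 1/2:]" "palindromic (Suc 0) [:1, 1:]"
    by (auto simp: palindromic_def field_simps)
  show ?case
  proof (cases "d \<ge> 2")
    case False
    then have "d = 0 \<or> d = 1" by auto
    then show ?thesis using one by (auto simp: coeff_1[simplified])
  next
    case True
    have S: "palindromic d (residual_coeff d)"
      unfolding residual_coeff_altdef
    proof (intro palindromic_diff palindromic_sum palindromic_smult palindromic_add palindromic_two palindromic_conv)
      fix e assume "e \<in> {1..<d - 1}"
      then show "palindromic d (mu_coeff e * sigma_coeff (d - e))"
        using palindromic_mult[OF palindromic_mu_coeff[of e], of "d - e" "sigma_coeff (d - e)"] less[of "d - e"] by auto
    qed (use less in auto)
    have E: "palindromic d (eta_coeff d)"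
      unfolding palindromic_iff_coeff
    proof (intro conjI allI impI)
      show "degree (eta_coeff d) \<le> d"
        by (rule degree_le) (simp add: coeff_ge_2[OF True] coeff_solve_modes)
      fix i assume i: "i \<le> d"
      have "mode d (d - i) = mode d i" using i by (auto simp: mode_def)
      moreover have "coeff (residual_coeff d) (d - i) = coeff (residual_coeff d) i"
        using S i by (simp add: palindromic_iff_coeff)
      ultimately show "coeff (eta_coeff d) (d - i) = coeff (eta_coeff d) i"
        using i by (simp add: coeff_ge_2[OF True] coeff_solve_modes)
    qed
    have W: "palindromic d (w_coeff d)"
      unfolding coeff_ge_2(2)[OF True] using E less by (intro palindromic_diff palindromic_conv) auto
    have "palindromic d (sigma_coeff d)"
      unfolding sigma_coeff_def using W less by (intro palindromic_diff palindromic_conv palindromic_two) auto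
    with S E W show ?thesis by simp
  qed
qed

lemmas palindromic_eta = palindromic_all[THEN conjunct1]
lemmas palindromic_w = palindromic_all[THEN conjunct2, THEN conjunct1]
lemmas palindromic_sigma = palindromic_all[THEN conjunct2, THEN conjunct2, THEN conjunct1]

section \<open>The recursion solves the equations order by order\<close>

definition multiplier_poly :: "nat \<Rightarrow> complex poly \<Rightarrow> complex poly" where
  "multiplier_poly d p = (\<Sum>i\<le>d. monom (m (mode d i) * coeff p i) i)"

lemma coeff_multiplier_poly: "coeff (multiplier_poly d p) i = (if i \<le> d then m (mode d i) * coeff p i else 0)"
  by (simp add: multiplier_poly_def coeff_sum)

lemma eta_equation: "eta_coeff d - w_coeff d = (\<Sum>e\<le>d. w_coeff e * eta_coeff (d - e))"
proof -
  have "eta_coeff d - w_coeff d = conv w_coeff eta_coeff d"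
  proof (cases "d \<ge> 2")
    case False
    then have "d = 0 \<or> d = 1" by auto
    then show ?thesis by (auto simp: coeff_1[simplified] conv_def)
  qed (use coeff_ge_2(2)[of d] in simp)
  then show ?thesis by (simp add: conv_full)
qed

lemma sigma_equation: "sigma_coeff d = 2 * w_coeff d - (\<Sum>e\<le>d. w_coeff e * w_coeff (d - e))"
  by (simp add: conv_full sigma_coeff_def)

text \<open>Off the frequencies 1 and -1 the equation of order \<open>d\<close> is the definition of
  the coefficients of \<open>eta_coeff m d\<close>. At these two the left side is 0 by the
  normalisation, and \<open>nu_coeff m d\<close> is chosen to cancel the residual.\<close>

lemma wave_equation:
  assumes ne: "\<And>n. n \<noteq> 1 \<Longrightarrow> m n \<noteq> m 1"
  shows "2 * multiplier_poly d (eta_coeff d) = (\<Sum>e\<le>d. mu_coeff e * sigma_coeff (d - e))"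
proof (cases "d \<ge> 2")
  case False
  then have "d = 0 \<or> d = 1" by auto
  moreover have "mode (Suc 0) 0 = 1" "mode (Suc 0) (Suc 0) = 1" by (auto simp: mode_def)
  ultimately show ?thesis
    by (auto simp: multiplier_poly_def mu_coeff_def speed_poly_def coeff_1[simplified] monom_Suc monom_0 numeral_poly)
next
  case True
  define k where "k = (d - 1) div 2"
  have muS: "mu_coeff (d - 1) * sigma_coeff 1 = smult (nu_coeff d) (monom 1 k + monom 1 (Suc k))"
  proof -
    have 1: "mu_coeff (d - 1) = smult (nu_coeff d) (monom 1 k)"
      using True by (simp add: mu_coeff_def speed_poly_def k_def smult_monom)
    have 2: "monom 1 k * [:1, 1:] = (monom 1 k + monom 1 (Suc k) :: complex poly)"
      by (simp add: monom_Suc algebra_simps)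
    show ?thesis unfolding 1 coeff_1 mult_smult_left 2 ..
  qed
  \<comment> \<open>The term e = d drops out since sigma starts at order 1; e = 0 carries the
    unknown coefficients of order \<open>d\<close> in e, and e = d - 1 the unknown coefficient of
    q^2.\<close>
  have "{..d} = insert 0 (insert (d - 1) (insert d {1..<d-1}))" using True by auto
  then have "(\<Sum>e\<le>d. mu_coeff e * sigma_coeff (d - e)) =
     mu_coeff 0 * sigma_coeff d + (mu_coeff (d - 1) * sigma_coeff 1 + (\<Sum>e=1..<d-1. mu_coeff e * sigma_coeff (d - e)))"
    using True by (simp add: algebra_simps)
  also have "mu_coeff 0 = [:m 1:]"
    using coeff_1(3) by (simp add: mu_coeff_def speed_poly_def monom_0)
  also have "(\<Sum>e=1..<d-1. mu_coeff e * sigma_coeff (d - e)) =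
     residual_coeff d + smult (m 1) (2 * conv w_coeff eta_coeff d + conv w_coeff w_coeff d)"
    by (simp add: residual_coeff_altdef)
  also have "sigma_coeff d = 2 * eta_coeff d - 2 * conv w_coeff eta_coeff d - conv w_coeff w_coeff d"
    by (simp add: sigma_coeff_def coeff_ge_2(2)[OF True] algebra_simps)
  finally have eq: "(\<Sum>e\<le>d. mu_coeff e * sigma_coeff (d - e)) =
     smult (2 * m 1) (eta_coeff d) + smult (nu_coeff d) (monom 1 k + monom 1 (Suc k)) + residual_coeff d"
    unfolding muS by (simp add: algebra_simps smult_add_right smult_diff_right numeral_poly)
  show ?thesis
  proof (rule poly_eqI)
    fix i
    have L: "coeff (2 * multiplier_poly d (eta_coeff d)) i = (if i \<le> d then 2 * m (mode d i) * coeff (eta_coeff d) i else 0)"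
      by (simp add: numeral_poly coeff_multiplier_poly)
    have Rr: "coeff (\<Sum>e\<le>d. mu_coeff e * sigma_coeff (d - e)) i =
       2 * m 1 * coeff (eta_coeff d) i + nu_coeff d * ((if i = k then 1 else 0) + (if i = Suc k then 1 else 0)) + coeff (residual_coeff d) i"
      unfolding eq by (simp add: eq_commute)
    have hr: "palindromic d (residual_coeff d)" using palindromic_all True by blast
    show "coeff (2 * multiplier_poly d (eta_coeff d)) i = coeff (\<Sum>e\<le>d. mu_coeff e * sigma_coeff (d - e)) i"
    proof (cases "i \<le> d")
      case False
      then have "coeff (residual_coeff d) i = 0" "coeff (eta_coeff d) i = 0"
        using palindromic_degree[OF hr] palindromic_degree[OF palindromic_eta[of d]] by (auto simp: coeff_eq_0)
      moreover have "i \<noteq> k" "i \<noteq> Suc k" using False True by (auto simp: k_def)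
      ultimately show ?thesis unfolding L Rr using False by simp
    next
      case i: True
      show ?thesis
      proof (cases "mode d i = 1")
        case False
        have "nu_coeff d * ((if i = k then 1 else 0) + (if i = Suc k then 1 else 0)) = 0"
        proof (cases "odd d")
          case True
          then obtain j where "d = 2 * j + 1" by (auto elim: oddE)
          then have "i \<noteq> k" "i \<noteq> Suc k" using False by (auto simp: k_def mode_def)
          then show ?thesis by simp
        qed (simp add: nu_coeff_even)
        moreover have "coeff (eta_coeff d) i = coeff (residual_coeff d) i / (2 * (m (mode d i) - m 1))"
          using i False by (simp add: coeff_ge_2(1)[OF True] coeff_solve_modes)
        ultimately show ?thesis
          unfolding L Rr using i ne[OF False] by (simp add: field_simps)
      next
        case m1: True
        then have e0: "coeff (eta_coeff d) i = 0"
          by (simp add: coeff_ge_2(1)[OF True] coeff_solve_modes)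
        have "2 * int i - int d = 1 \<or> 2 * int i - int d = -1" using m1 unfolding mode_def by linarith
        then have "odd (int d)" by presburger
        then have "odd d" by simp
        then obtain j where j: "d = 2 * j + 1" by (auto elim: oddE)
        have k: "k = j" using j by (simp add: k_def)
        have nu: "nu_coeff d = - coeff (residual_coeff d) k"
          using \<open>odd d\<close> by (simp add: coeff_ge_2(3)[OF True] k_def)
        \<comment> \<open>The residual has equal coefficients at the frequencies -1 and 1, so one
          number cancels both.\<close>
        have sy: "coeff (residual_coeff d) (Suc k) = coeff (residual_coeff d) k"
          using hr[unfolded palindromic_iff_coeff] j k by (auto dest: spec[of _ k])
        have "i = k \<or> i = Suc k" using m1 j k by (auto simp: mode_def)
        then show ?thesis unfolding L Rr using i e0 nu sy by auto
      qed
    qed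
  qed
qed

end

section \<open>Convergence of the expansion\<close>

text \<open>Every pair (e, d - e) occurs for one \<open>d\<close> only and has both entries between
  1 and D - 1; the other pairs of that square only add nonnegative terms.\<close>

lemma sum_conv_le:
  fixes a b :: "nat \<Rightarrow> real"
  assumes "\<And>e. a e \<ge> 0" "\<And>e. b e \<ge> 0"
  shows "(\<Sum>d=2..D. \<Sum>e=1..<d. a e * b (d - e)) \<le> (\<Sum>e=1..D-1. a e) * (\<Sum>e=1..D-1. b e)"
proof -
  have "(\<Sum>d=2..D. \<Sum>e=1..<d. a e * b (d - e)) = (\<Sum>(d, e)\<in>(SIGMA d:{2..D}. {1..<d}). a e * b (d - e))"
    by (simp add: sum.Sigma)
  also have "\<dots> = (\<Sum>(e, f)\<in>(\<lambda>(d, e). (e, d - e)) ` (SIGMA d:{2..D}. {1..<d}). a e * b f)"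
    by (subst sum.reindex) (auto simp: inj_on_def case_prod_unfold)
  also have "\<dots> \<le> (\<Sum>(e, f)\<in>{1..D-1} \<times> {1..D-1}. a e * b f)"
    by (rule sum_mono2) (auto simp: assms)
  also have "\<dots> = (\<Sum>e=1..D-1. a e) * (\<Sum>e=1..D-1. b e)"
    by (simp add: sum_product sum.cartesian_product)
  finally show ?thesis .
qed

lemma poly_norm_conv:
  "poly_norm (conv f g d) \<le> (\<Sum>e=1..<d. poly_norm (f e) * poly_norm (g (d - e)))"
  unfolding conv_def by (rule order_trans[OF poly_norm_sum]) (intro sum_mono poly_norm_mult)

lemma sum_poly_norm_conv:
  assumes "t \<ge> 0"
  shows "(\<Sum>d=2..D. poly_norm (conv f g d) * t ^ d) \<le>
     (\<Sum>e=1..D-1. poly_norm (f e) * t ^ e) * (\<Sum>e=1..D-1. poly_norm (g e) * t ^ e)"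
proof -
  have "(\<Sum>d=2..D. poly_norm (conv f g d) * t ^ d) \<le>
     (\<Sum>d=2..D. \<Sum>e=1..<d. (poly_norm (f e) * t ^ e) * (poly_norm (g (d - e)) * t ^ (d - e)))"
  proof (intro sum_mono)
    fix d
    have "poly_norm (conv f g d) * t ^ d \<le> (\<Sum>e=1..<d. poly_norm (f e) * poly_norm (g (d - e))) * t ^ d"
      using assms by (intro mult_right_mono poly_norm_conv) auto
    also have "\<dots> = (\<Sum>e=1..<d. (poly_norm (f e) * t ^ e) * (poly_norm (g (d - e)) * t ^ (d - e)))"
      unfolding sum_distrib_right
      by (intro sum.cong) (auto simp: mult_ac simp flip: power_add)
    finally show "poly_norm (conv f g d) * t ^ d \<le> \<dots>" .
  qed
  also have "\<dots> \<le> (\<Sum>e=1..D-1. poly_norm (f e) * t ^ e) * (\<Sum>e=1..D-1. poly_norm (g e) * t ^ e)"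
    using assms by (intro sum_conv_le) auto
  finally show ?thesis .
qed

lemma poly_norm_solve_modes:
  assumes "\<delta> > 0" and d: "\<And>n. n \<noteq> 1 \<Longrightarrow> norm (m n - m 1) \<ge> \<delta>" and "degree R \<le> d"
  shows "poly_norm (solve_modes m d R) \<le> poly_norm R / (2 * \<delta>)"
proof -
  have deg: "degree (solve_modes m d R) \<le> d"
    by (rule degree_le) (simp add: coeff_solve_modes)
  have "norm (coeff (solve_modes m d R) i) \<le> norm (coeff R i) / (2 * \<delta>)" for i
  proof (cases "i \<le> d \<and> mode d i \<noteq> 1")
    case True
    then have "norm (coeff R i) / norm (2 * (m (mode d i) - m 1)) \<le> norm (coeff R i) / (2 * \<delta>)"
      unfolding norm_mult using d[of "mode d i"] \<open>\<delta> > 0\<close> by (intro divide_left_mono mult_pos_pos) auto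
    then show ?thesis using True by (simp add: coeff_solve_modes norm_divide)
  qed (use \<open>\<delta> > 0\<close> in \<open>auto simp: coeff_solve_modes\<close>)
  then show ?thesis
    by (simp add: poly_norm_altdef[OF deg] poly_norm_altdef[OF \<open>degree R \<le> d\<close>] sum_divide_distrib sum_mono)
qed

lemma poly_norm_mu_coeff: "poly_norm (mu_coeff m e) = norm (nu_coeff m (Suc e))"
  by (simp add: mu_coeff_def speed_poly_def poly_norm_monom)

lemma poly_norm_two: "poly_norm (2 * p) \<le> 2 * poly_norm p"
  using poly_norm_add[of p p] by simp

text \<open>Induction on the truncation order: convolutions up to order D + 1 involve orders up to D
  only. A convolution of two series bounded by 2 t is at most 4 t^2, so the part of the residual
  with factor \<open>M\<close> is at most 12 M t^2, and the remaining K1 K2 t^3 is absorbed into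
  t^2: this is \<open>K2\<close>. Then sigma = 2 w - w^2 gives \<open>K1\<close>. The sum for sigma
  starts at order 2 because the residual omits sigma of order 1; this supplies the extra power of t
  that closes the estimate. The sum for mu ends at D - 1 because its term of order e is found at
  order e + 1.\<close>

lemma stokes_majorant:
  fixes M \<delta> t K1 K2 :: real
  assumes M: "norm (m 1) \<le> M" and "\<delta> > 0" and sep: "\<And>n. n \<noteq> 1 \<Longrightarrow> norm (m n - m 1) \<ge> \<delta>"
    and K2: "K2 = 12 * M + 1" and K1: "K1 = K2 / \<delta> + 12"
    and t: "t > 0" "K1 * K2 * t \<le> 1" "(K2 / (2 * \<delta>) + 4) * t \<le> 1"
  shows "(\<Sum>d=1..D. poly_norm (eta_coeff m d) * t ^ d) \<le> 2 * t \<and>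
    (\<Sum>d=1..D. poly_norm (w_coeff m d) * t ^ d) \<le> 2 * t \<and>
    (\<Sum>d=2..D. poly_norm (sigma_coeff m d) * t ^ d) \<le> K1 * t\<^sup>2 \<and>
    (\<Sum>d=1..D-1. poly_norm (mu_coeff m d) * t ^ d) \<le> K2 * t"
proof (induction D)
  case 0
  have "M \<ge> 0" using M norm_ge_zero order_trans by blast
  then show ?case using t \<open>\<delta> > 0\<close> by (simp add: K1 K2)
next
  case (Suc D)
  have M0: "M \<ge> 0" using M norm_ge_zero order_trans by blast
  have K20: "K2 > 0" using M0 by (simp add: K2)
  have K10: "K1 > 0" using K20 \<open>\<delta> > 0\<close> by (simp add: K1 add_pos_pos)
  show ?case
  proof (cases "D = 0")
    case True
    then show ?thesis
      using t K10 K20 by (simp add: coeff_1[simplified])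
  next
    case False
    define h where "h d = poly_norm (eta_coeff m d) * t ^ d" for d
    define w where "w d = poly_norm (w_coeff m d) * t ^ d" for d
    define s where "s d = poly_norm (sigma_coeff m d) * t ^ d" for d
    define v where "v d = poly_norm (mu_coeff m d) * t ^ d" for d
    define r where "r d = poly_norm (residual_coeff m d) * t ^ d" for d
    define A where "A d = poly_norm (conv (w_coeff m) (eta_coeff m) d) * t ^ d" for d
    define W where "W d = poly_norm (conv (w_coeff m) (w_coeff m) d) * t ^ d" for d
    have nn: "h d \<ge> 0" "w d \<ge> 0" "s d \<ge> 0" "v d \<ge> 0" "r d \<ge> 0" "A d \<ge> 0" "W d \<ge> 0" for d
      using t by (auto simp: h_def w_def s_def v_def r_def A_def W_def)
    have IH: "(\<Sum>d=1..D. h d) \<le> 2 * t" "(\<Sum>d=1..D. w d) \<le> 2 * t"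
      "(\<Sum>d=2..D. s d) \<le> K1 * t\<^sup>2" "(\<Sum>d=1..D-1. v d) \<le> K2 * t"
      using Suc.IH by (simp_all add: h_def w_def s_def v_def)
    have tp: "t ^ d \<ge> 0" for d using t by simp
    have A: "(\<Sum>d=2..Suc D. A d) \<le> 4 * t\<^sup>2"
    proof -
      have "(\<Sum>d=2..Suc D. A d) \<le> (\<Sum>d=1..D. w d) * (\<Sum>d=1..D. h d)"
        using sum_poly_norm_conv[of t "w_coeff m" "eta_coeff m" "Suc D"] t by (simp add: A_def w_def h_def)
      also have "\<dots> \<le> (2 * t) * (2 * t)"
        using IH nn t by (intro mult_mono sum_nonneg) auto
      finally show ?thesis by (simp add: power2_eq_square)
    qed
    have W: "(\<Sum>d=2..Suc D. W d) \<le> 4 * t\<^sup>2"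
    proof -
      have "(\<Sum>d=2..Suc D. W d) \<le> (\<Sum>d=1..D. w d) * (\<Sum>d=1..D. w d)"
        using sum_poly_norm_conv[of t "w_coeff m" "w_coeff m" "Suc D"] t by (simp add: W_def w_def)
      also have "\<dots> \<le> (2 * t) * (2 * t)"
        using IH nn t by (intro mult_mono sum_nonneg) auto
      finally show ?thesis by (simp add: power2_eq_square)
    qed
    have rd: "r d \<le> (\<Sum>e=1..<d. (if e < d - 1 then v e else 0) * s (d - e)) + M * (2 * A d + W d)" for d
    proof -
      have "poly_norm (residual_coeff m d) \<le> (\<Sum>e=1..<d-1. poly_norm (mu_coeff m e) * poly_norm (sigma_coeff m (d - e)))
         + M * (2 * poly_norm (conv (w_coeff m) (eta_coeff m) d) + poly_norm (conv (w_coeff m) (w_coeff m) d))"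
        unfolding residual_coeff_altdef
      proof (rule order_trans[OF poly_norm_diff], rule add_mono)
        show "poly_norm (\<Sum>e=1..<d-1. mu_coeff m e * sigma_coeff m (d - e)) \<le>
            (\<Sum>e=1..<d-1. poly_norm (mu_coeff m e) * poly_norm (sigma_coeff m (d - e)))"
          by (rule order_trans[OF poly_norm_sum]) (intro sum_mono poly_norm_mult)
        show "poly_norm (smult (m 1) (2 * conv (w_coeff m) (eta_coeff m) d + conv (w_coeff m) (w_coeff m) d))
          \<le> M * (2 * poly_norm (conv (w_coeff m) (eta_coeff m) d) + poly_norm (conv (w_coeff m) (w_coeff m) d))"
          unfolding poly_norm_smult using M M0
          by (intro mult_mono order_trans[OF poly_norm_add] add_mono poly_norm_two) auto
      qed
      then have "r d \<le> ((\<Sum>e=1..<d-1. poly_norm (mu_coeff m e) * poly_norm (sigma_coeff m (d - e)))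
         + M * (2 * poly_norm (conv (w_coeff m) (eta_coeff m) d) + poly_norm (conv (w_coeff m) (w_coeff m) d))) * t ^ d"
        unfolding r_def using tp by (rule mult_right_mono)
      also have "\<dots> = (\<Sum>e=1..<d-1. v e * s (d - e)) + M * (2 * A d + W d)"
      proof -
        have "(\<Sum>e=1..<d-1. poly_norm (mu_coeff m e) * poly_norm (sigma_coeff m (d - e))) * t ^ d = (\<Sum>e=1..<d-1. v e * s (d - e))"
          unfolding sum_distrib_right v_def s_def
          by (intro sum.cong) (auto simp: mult_ac simp flip: power_add)
        then show ?thesis by (simp add: A_def W_def algebra_simps)
      qed
      also have "(\<Sum>e=1..<d-1. v e * s (d - e)) = (\<Sum>e=1..<d. (if e < d - 1 then v e else 0) * s (d - e))"
        by (intro sum.mono_neutral_cong_left) auto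
      finally show ?thesis .
    qed
    have R: "(\<Sum>d=2..Suc D. r d) \<le> K2 * t\<^sup>2"
    proof -
      \<comment> \<open>Cut-offs adapted to the induction hypothesis: residuals up to order D + 1
        contain mu only below order D and sigma only from order 2 on.\<close>
      define v' where "v' e = (if e < D then v e else 0)" for e
      define s' where "s' f = (if f \<ge> 2 then s f else 0)" for f
      have "(\<Sum>d=2..Suc D. r d) \<le> (\<Sum>d=2..Suc D. (\<Sum>e=1..<d. v' e * s' (d - e)) + M * (2 * A d + W d))"
      proof (intro sum_mono order_trans[OF rd] add_mono order_refl)
        fix d e assume "d \<in> {2..Suc D}" "e \<in> {1..<d}"
        then show "(if e < d - 1 then v e else 0) * s (d - e) \<le> v' e * s' (d - e)"
          using nn by (auto simp: v'_def s'_def)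
      qed
      also have "\<dots> = (\<Sum>d=2..Suc D. \<Sum>e=1..<d. v' e * s' (d - e)) + M * (2 * (\<Sum>d=2..Suc D. A d) + (\<Sum>d=2..Suc D. W d))"
        by (simp add: sum.distrib sum_distrib_left distrib_left)
      also have "\<dots> \<le> (\<Sum>e=1..D. v' e) * (\<Sum>e=1..D. s' e) + M * (2 * (4 * t\<^sup>2) + 4 * t\<^sup>2)"
        using sum_conv_le[of v' s' "Suc D"] nn A W M0
        by (intro add_mono mult_left_mono) (auto simp: v'_def s'_def)
      also have "(\<Sum>e=1..D. v' e) = (\<Sum>e=1..D-1. v e)"
        unfolding v'_def by (intro sum.mono_neutral_cong_right) auto
      also have "(\<Sum>e=1..D. s' e) = (\<Sum>e=2..D. s e)"
        unfolding s'_def by (intro sum.mono_neutral_cong_right) auto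
      also have "(\<Sum>e=1..D-1. v e) * (\<Sum>e=2..D. s e) \<le> (K2 * t) * (K1 * t\<^sup>2)"
        using IH nn t K20 by (intro mult_mono sum_nonneg) auto
      also have "(K2 * t) * (K1 * t\<^sup>2) = (K1 * K2 * t) * t\<^sup>2" by simp
      also have "\<dots> \<le> 1 * t\<^sup>2" using t by (intro mult_right_mono) auto
      finally show ?thesis by (simp add: K2 algebra_simps)
    qed
    have E: "(\<Sum>d=2..Suc D. h d) \<le> K2 * t\<^sup>2 / (2 * \<delta>)"
    proof -
      have "h d \<le> r d / (2 * \<delta>)" if "d \<in> {2..Suc D}" for d
      proof -
        have "palindromic d (residual_coeff m d)" using that palindromic_all[of d m] by auto
        then have "poly_norm (eta_coeff m d) \<le> poly_norm (residual_coeff m d) / (2 * \<delta>)"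
          using that poly_norm_solve_modes[where m = m and R = "residual_coeff m d" and d = d, OF \<open>\<delta> > 0\<close> sep] coeff_ge_2(1)[of d m] palindromic_degree by auto
        then show ?thesis
          unfolding h_def r_def using mult_right_mono[OF _ tp[of d]] by fastforce
      qed
      then have "(\<Sum>d=2..Suc D. h d) \<le> (\<Sum>d=2..Suc D. r d) / (2 * \<delta>)"
        unfolding sum_divide_distrib by (rule sum_mono)
      also have "\<dots> \<le> K2 * t\<^sup>2 / (2 * \<delta>)" using R \<open>\<delta> > 0\<close> by (intro divide_right_mono) auto
      finally show ?thesis .
    qed
    have W': "(\<Sum>d=2..Suc D. w d) \<le> K2 * t\<^sup>2 / (2 * \<delta>) + 4 * t\<^sup>2"
    proof -
      have "w d \<le> h d + A d" if "d \<in> {2..Suc D}" for d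
        using that mult_right_mono[OF poly_norm_diff[of "eta_coeff m d" "conv (w_coeff m) (eta_coeff m) d"] tp[of d]]
        by (simp add: w_def h_def A_def coeff_ge_2(2)[of d m] algebra_simps)
      then have "(\<Sum>d=2..Suc D. w d) \<le> (\<Sum>d=2..Suc D. h d + A d)" by (rule sum_mono)
      then show ?thesis using E A by (simp add: sum.distrib)
    qed
    have S: "(\<Sum>d=2..Suc D. s d) \<le> K1 * t\<^sup>2"
    proof -
      have "s d \<le> 2 * w d + W d" for d
      proof -
        have "poly_norm (sigma_coeff m d) \<le> 2 * poly_norm (w_coeff m d) + poly_norm (conv (w_coeff m) (w_coeff m) d)"
          unfolding sigma_coeff_def by (rule order_trans[OF poly_norm_diff]) (intro add_mono poly_norm_two order_refl)
        from mult_right_mono[OF this tp[of d]] show ?thesis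
          by (simp add: s_def w_def W_def algebra_simps)
      qed
      then have "(\<Sum>d=2..Suc D. s d) \<le> (\<Sum>d=2..Suc D. 2 * w d + W d)" by (intro sum_mono)
      also have "\<dots> = 2 * (\<Sum>d=2..Suc D. w d) + (\<Sum>d=2..Suc D. W d)" by (simp add: sum.distrib sum_distrib_left)
      also have "\<dots> \<le> 2 * (K2 * t\<^sup>2 / (2 * \<delta>) + 4 * t\<^sup>2) + 4 * t\<^sup>2" using W' W by (intro add_mono mult_left_mono) auto
      also have "\<dots> = K1 * t\<^sup>2" by (simp add: K1 algebra_simps)
      finally show ?thesis .
    qed
    have V: "(\<Sum>d=1..D. v d) \<le> K2 * t"
    proof -
      \<comment> \<open>mu of order d is \<open>nu_coeff\<close> of order d + 1, so one power of t
        converts its sum into a sum bounded by the residuals.\<close>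
      have "t * (\<Sum>d=1..D. v d) = (\<Sum>d=2..Suc D. norm (nu_coeff m d) * t ^ d)"
        unfolding v_def poly_norm_mu_coeff sum_distrib_left
        by (rule sum.reindex_bij_witness[of _ "\<lambda>d. d - 1" Suc]) (auto simp: mult_ac)
      also have "\<dots> \<le> (\<Sum>d=2..Suc D. r d)"
      proof (rule sum_mono)
        fix d assume "d \<in> {2..Suc D}"
        then have "norm (nu_coeff m d) \<le> poly_norm (residual_coeff m d)"
          by (auto simp: coeff_ge_2(3) norm_coeff_le_poly_norm)
        then show "norm (nu_coeff m d) * t ^ d \<le> r d"
          unfolding r_def using tp by (rule mult_right_mono)
      qed
      also have "\<dots> \<le> t * (K2 * t)" using R by (simp add: power2_eq_square mult_ac)
      finally show ?thesis using t by simp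
    qed
    \<comment> \<open>The third condition on \<open>t\<close>: all orders from 2 on together
      contribute at most \<open>t\<close>, the same as order 1.\<close>
    have bnd: "K2 * t\<^sup>2 / (2 * \<delta>) + 4 * t\<^sup>2 \<le> t"
    proof -
      have "((K2 / (2 * \<delta>) + 4) * t) * t \<le> 1 * t" using t by (intro mult_right_mono) auto
      then show ?thesis by (simp add: power2_eq_square algebra_simps)
    qed
    have split: "(\<Sum>d=1..Suc D. f d) = f 1 + (\<Sum>d=2..Suc D. f d)" for f :: "nat \<Rightarrow> real"
      by (simp add: sum.atLeast_Suc_atMost numeral_2_eq_2)
    have "h 1 = t" "w 1 = t" by (simp_all add: h_def w_def coeff_1[simplified])
    moreover have "(\<Sum>d=2..Suc D. h d) \<le> t"
      by (rule order_trans[OF E order_trans[OF _ bnd]]) simp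
    ultimately have "(\<Sum>d=1..Suc D. h d) \<le> 2 * t" "(\<Sum>d=1..Suc D. w d) \<le> 2 * t"
      unfolding split using order_trans[OF W' bnd] by linarith+
    then show ?thesis using S V by (simp add: h_def w_def s_def v_def)
  qed
qed

text \<open>\<open>t\<close> and \<open>B\<close> depend on \<open>M\<close> and \<delta> only, so
  they serve for all complex \<kappa> of a disc at once; holomorphy in \<kappa> of the sums rests on
  this uniformity.\<close>

lemma stokes_bound:
  fixes M \<delta> :: real
  assumes "M \<ge> 0" "\<delta> > 0"
  obtains t B where "0 < t" "t \<le> 1" "B \<ge> 0"
    "\<And>m d. norm (m 1) \<le> M \<Longrightarrow> (\<And>n. n \<noteq> 1 \<Longrightarrow> norm (m n - m 1) \<ge> \<delta>) \<Longrightarrow>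
       poly_norm (eta_coeff m d) * t ^ d \<le> B \<and> poly_norm (w_coeff m d) * t ^ d \<le> B \<and>
       poly_norm (sigma_coeff m d) * t ^ d \<le> B \<and> poly_norm (mu_coeff m d) * t ^ d \<le> B"
proof -
  define K2 where "K2 = 12 * M + 1"
  define K1 where "K1 = K2 / \<delta> + 12"
  define c where "c = K2 / (2 * \<delta>) + 4"
  define t where "t = min 1 (min (1 / (K1 * K2)) (1 / c))"
  define B where "B = K1 + K2 + M + 2"
  have pos: "K2 > 0" "K1 > 0" "c > 0" using assms by (auto simp: K2_def K1_def c_def add_pos_pos add_nonneg_pos)
  have t: "t > 0" "t \<le> 1" using pos by (auto simp: t_def)
  have t1: "K1 * K2 * t \<le> 1"
    using mult_left_mono[of t "1 / (K1 * K2)" "K1 * K2"] pos by (simp add: t_def)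
  have t2: "c * t \<le> 1"
    using mult_left_mono[of t "1 / c" c] pos by (simp add: t_def)
  have t2': "t\<^sup>2 \<le> 1" using t by (simp add: power_le_one)
  have B: "K1 * t\<^sup>2 \<le> B" "2 * t \<le> B" "K2 * t \<le> B" "M \<le> B"
    using mult_left_mono[OF t2' less_imp_le[OF pos(2)]] mult_left_mono[OF t(2) less_imp_le[OF pos(1)]] pos t assms
    unfolding B_def by linarith+
  show ?thesis
  proof (rule that[of t B])
    show "B \<ge> 0" using B(4) assms by linarith
    fix m :: "nat \<Rightarrow> complex" and d :: nat
    assume m1: "norm (m 1) \<le> M" and sep: "\<And>n. n \<noteq> 1 \<Longrightarrow> norm (m n - m 1) \<ge> \<delta>"
    note maj = stokes_majorant[of m M \<delta> K2 K1 t, OF m1 assms(2) sep K2_def K1_def t(1) t1 t2[unfolded c_def]]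
    have single: "poly_norm (p d) * t ^ d \<le> C"
      if "(\<Sum>i=k..n. poly_norm (p i) * t ^ i) \<le> C" "k \<le> d" "d \<le> n" for p k n C
    proof -
      have "poly_norm (p d) * t ^ d \<le> (\<Sum>i=k..n. poly_norm (p i) * t ^ i)"
        using that t by (intro member_le_sum) auto
      then show ?thesis using that by linarith
    qed
    show "poly_norm (eta_coeff m d) * t ^ d \<le> B \<and> poly_norm (w_coeff m d) * t ^ d \<le> B \<and>
       poly_norm (sigma_coeff m d) * t ^ d \<le> B \<and> poly_norm (mu_coeff m d) * t ^ d \<le> B"
    proof (cases "d = 0")
      case True
      have "poly_norm (mu_coeff m 0) \<le> M" using m1 coeff_1(3)[of m] by (simp add: poly_norm_mu_coeff)
      then show ?thesis using True B assms by auto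
    next
      case False
      then have d: "1 \<le> d" by simp
      have "poly_norm (eta_coeff m d) * t ^ d \<le> 2 * t"
        using maj[of d] d by (intro single[of "eta_coeff m" 1 d]) auto
      moreover have "poly_norm (w_coeff m d) * t ^ d \<le> 2 * t"
        using maj[of d] d by (intro single[of "w_coeff m" 1 d]) auto
      moreover have "poly_norm (mu_coeff m d) * t ^ d \<le> K2 * t"
        using maj[of "Suc d"] d by (intro single[of "mu_coeff m" 1 d]) auto
      moreover have "poly_norm (sigma_coeff m d) * t ^ d \<le> B"
      proof (cases "d = 1")
        case True
        then show ?thesis using B by (simp add: coeff_1[simplified])
      next
        case False
        then have "poly_norm (sigma_coeff m d) * t ^ d \<le> K1 * t\<^sup>2"
          using maj[of d] d by (intro single[of "sigma_coeff m" 2 d]) auto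
        then show ?thesis using B by linarith
      qed
      ultimately show ?thesis using B by linarith
    qed
  qed (use t in auto)
qed

section \<open>Dependence of the coefficients on the wave number\<close>

text \<open>Used both for the functions of \<open>\<kappa>\<close> holomorphic on a disc and for those real on a set.\<close>

locale function_ring =
  fixes S :: "complex set" and \<A> :: "(complex \<Rightarrow> complex) set"
  assumes const: "(\<lambda>_. of_real r) \<in> \<A>"
    and add: "f \<in> \<A> \<Longrightarrow> g \<in> \<A> \<Longrightarrow> (\<lambda>x. f x + g x) \<in> \<A>"
    and mult: "f \<in> \<A> \<Longrightarrow> g \<in> \<A> \<Longrightarrow> (\<lambda>x. f x * g x) \<in> \<A>"
    and divide: "f \<in> \<A> \<Longrightarrow> g \<in> \<A> \<Longrightarrow> (\<And>x. x \<in> S \<Longrightarrow> g x \<noteq> 0) \<Longrightarrow> (\<lambda>x. f x / g x) \<in> \<A>"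
begin

lemma uminus: "f \<in> \<A> \<Longrightarrow> (\<lambda>x. - f x) \<in> \<A>"
  using mult[OF const[of "-1"]] by simp

lemma diff: "f \<in> \<A> \<Longrightarrow> g \<in> \<A> \<Longrightarrow> (\<lambda>x. f x - g x) \<in> \<A>"
  using add[OF _ uminus, of f g] by simp

lemma zero: "(\<lambda>_. 0) \<in> \<A>"
  using const[of 0] by simp

lemma sum: "(\<And>i. i \<in> I \<Longrightarrow> f i \<in> \<A>) \<Longrightarrow> (\<lambda>x. \<Sum>i\<in>I. f i x) \<in> \<A>"
  by (induction I rule: infinite_finite_induct) (auto intro: zero add)

definition coeffs_in :: "(complex \<Rightarrow> complex poly) \<Rightarrow> bool" where
  "coeffs_in P \<longleftrightarrow> (\<forall>i. (\<lambda>x. coeff (P x) i) \<in> \<A>)"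

lemma coeffs_in_add: "coeffs_in P \<Longrightarrow> coeffs_in Q \<Longrightarrow> coeffs_in (\<lambda>x. P x + Q x)"
  by (simp add: coeffs_in_def add)

lemma coeffs_in_diff: "coeffs_in P \<Longrightarrow> coeffs_in Q \<Longrightarrow> coeffs_in (\<lambda>x. P x - Q x)"
  by (simp add: coeffs_in_def diff)

lemma coeffs_in_smult: "f \<in> \<A> \<Longrightarrow> coeffs_in P \<Longrightarrow> coeffs_in (\<lambda>x. smult (f x) (P x))"
  by (simp add: coeffs_in_def mult)

lemma coeffs_in_mult: "coeffs_in P \<Longrightarrow> coeffs_in Q \<Longrightarrow> coeffs_in (\<lambda>x. P x * Q x)"
  by (simp add: coeffs_in_def coeff_mult sum mult)

lemma coeffs_in_sum: "(\<And>i. i \<in> I \<Longrightarrow> coeffs_in (P i)) \<Longrightarrow> coeffs_in (\<lambda>x. \<Sum>i\<in>I. P i x)"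
  by (simp add: coeffs_in_def coeff_sum sum)

lemma coeffs_in_two: "coeffs_in P \<Longrightarrow> coeffs_in (\<lambda>x. 2 * P x)"
  using coeffs_in_add[of P P] by simp

lemma coeffs_in_conv:
  "(\<And>e. e < d \<Longrightarrow> coeffs_in (\<lambda>x. P x e)) \<Longrightarrow> (\<And>e. e < d \<Longrightarrow> coeffs_in (\<lambda>x. Q x e)) \<Longrightarrow>
    coeffs_in (\<lambda>x. conv (P x) (Q x) d)"
  unfolding conv_def by (intro coeffs_in_sum coeffs_in_mult) auto

text \<open>The recursion uses only ring operations and divisions by 2 (m n - m 1), which has no
  zero on \<open>S\<close>.\<close>

lemma coeffs_in_stokes:
  assumes m: "\<And>n. (\<lambda>x. m x n) \<in> \<A>" and ne: "\<And>x n. x \<in> S \<Longrightarrow> n \<noteq> 1 \<Longrightarrow> m x n \<noteq> m x 1"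
  shows "coeffs_in (\<lambda>x. eta_coeff (m x) d) \<and> coeffs_in (\<lambda>x. w_coeff (m x) d) \<and>
    coeffs_in (\<lambda>x. sigma_coeff (m x) d) \<and> (\<lambda>x. nu_coeff (m x) d) \<in> \<A>"
proof (induction d rule: less_induct)
  case (less d)
  have c: "coeffs_in (\<lambda>_. [:of_real a, of_real b:])" for a b
    by (auto simp: coeffs_in_def coeff_pCons split: nat.split intro: zero const)
  have z: "coeffs_in (\<lambda>_. 0)" by (simp add: coeffs_in_def zero)
  show ?case
  proof (cases "d \<ge> 2")
    case False
    then have "d = 0 \<or> d = 1" by auto
    then show ?thesis
      using c[of "1/2" "1/2"] c[of 1 1] z zero m by (auto simp: coeff_1[simplified])
  next
    case True
    have mu: "coeffs_in (\<lambda>x. mu_coeff (m x) e)" if "Suc e < d" for e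
      unfolding coeffs_in_def
    proof
      fix i
      show "(\<lambda>x. coeff (mu_coeff (m x) e) i) \<in> \<A>"
        using less[of "Suc e"] that zero by (cases "i = e div 2") (auto simp: mu_coeff_def speed_poly_def)
    qed
    have R: "coeffs_in (\<lambda>x. residual_coeff (m x) d)"
      unfolding residual_coeff_altdef
    proof (intro coeffs_in_diff coeffs_in_sum coeffs_in_smult coeffs_in_add coeffs_in_two coeffs_in_conv m)
      fix e assume "e \<in> {1..<d - 1}"
      then show "coeffs_in (\<lambda>x. mu_coeff (m x) e * sigma_coeff (m x) (d - e))"
        using less[of "d - e"] by (intro coeffs_in_mult mu) auto
    qed (use less in auto)
    have E: "coeffs_in (\<lambda>x. eta_coeff (m x) d)"
      unfolding coeffs_in_def coeff_ge_2(1)[OF True] coeff_solve_modes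
    proof
      fix i
      show "(\<lambda>x. if i \<le> d \<and> mode d i \<noteq> 1 then coeff (residual_coeff (m x) d) i / (2 * (m x (mode d i) - m x 1)) else 0) \<in> \<A>"
      proof (cases "i \<le> d \<and> mode d i \<noteq> 1")
        case True
        have "(\<lambda>x. coeff (residual_coeff (m x) d) i / (of_real 2 * (m x (mode d i) - m x 1))) \<in> \<A>"
          using R ne True by (intro divide mult const diff m) (auto simp: coeffs_in_def)
        then show ?thesis using True by simp
      qed (use zero in auto)
    qed
    have W: "coeffs_in (\<lambda>x. w_coeff (m x) d)"
      unfolding coeff_ge_2(2)[OF True] using E less by (intro coeffs_in_diff coeffs_in_conv) auto
    have "coeffs_in (\<lambda>x. sigma_coeff (m x) d)"
      unfolding sigma_coeff_def using W less by (intro coeffs_in_diff coeffs_in_two coeffs_in_conv) auto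
    moreover have "(\<lambda>x. nu_coeff (m x) d) \<in> \<A>"
      unfolding coeff_ge_2(3)[OF True] using R zero by (cases "odd d") (auto simp: coeffs_in_def uminus)
    ultimately show ?thesis using E W by simp
  qed
qed

end

section \<open>Trigonometric polynomials with complex phase\<close>

definition trig :: "nat \<Rightarrow> complex poly \<Rightarrow> complex \<Rightarrow> complex" where
  "trig d p z = (\<Sum>i\<le>d. coeff p i * exp (\<i> * of_int (2 * int i - int d) * z))"

text \<open>Once exp (-i d z) is taken out, a polynomial in exp (2 i z) remains. Products thus
  become polynomial products, with formal degrees adding up.\<close>

lemma trig_altdef:
  assumes "degree p \<le> d"
  shows "trig d p z = exp (- (\<i> * of_nat d * z)) * poly p (exp (2 * \<i> * z))"
proof -
  have "exp (\<i> * of_int (2 * int i - int d) * z) = exp (- (\<i> * of_nat d * z)) * exp (2 * \<i> * z) ^ i" for i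
    by (simp add: exp_of_nat_mult[symmetric] exp_add[symmetric] algebra_simps)
  then show ?thesis
    by (simp add: trig_def poly_eq_sum_atMost[OF assms] sum_distrib_left mult_ac)
qed

lemma trig_mult:
  assumes "degree p \<le> d" "degree q \<le> e"
  shows "trig (d + e) (p * q) z = trig d p z * trig e q z"
proof -
  have "degree (p * q) \<le> d + e" using assms degree_mult_le[of p q] by simp
  then show ?thesis
    using assms by (simp add: trig_altdef exp_add[symmetric] algebra_simps)
qed

lemma trig_add: "trig d (p + q) z = trig d p z + trig d q z"
  by (simp add: trig_def sum.distrib algebra_simps)

lemma trig_diff: "trig d (p - q) z = trig d p z - trig d q z"
  by (simp add: trig_def sum_subtractf algebra_simps)

lemma trig_two: "trig d (2 * p) z = 2 * trig d p z"
  using trig_add[of d p p z] by simp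

lemma trig_0 [simp]: "trig d 0 z = 0"
  by (simp add: trig_def)

lemma trig_sum: "trig d (\<Sum>x\<in>A. f x) z = (\<Sum>x\<in>A. trig d (f x) z)"
  by (induction A rule: infinite_finite_induct) (auto simp: trig_add)

lemma norm_exp_mode_le:
  assumes "i \<le> d"
  shows "norm (exp (\<i> * of_int (2 * int i - int d) * z)) \<le> exp \<bar>Im z\<bar> ^ d"
proof -
  have "\<bar>of_int (2 * int i - int d)\<bar> \<le> real d" using assms by linarith
  then have "\<bar>of_int (2 * int i - int d) * Im z\<bar> \<le> real d * \<bar>Im z\<bar>"
    unfolding abs_mult by (intro mult_right_mono) auto
  then have "- (of_int (2 * int i - int d) * Im z) \<le> real d * \<bar>Im z\<bar>" by linarith
  moreover have "exp \<bar>Im z\<bar> ^ d = exp (real d * \<bar>Im z\<bar>)" by (simp add: exp_of_nat_mult)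
  ultimately show ?thesis by (simp add: norm_exp_eq_Re)
qed

text \<open>Off the real axis a frequency of size at most d grows at most like exp (d |Im z|). Hence
  \<open>a\<close> and z enter all convergence conditions through the single quantity |a| exp |Im
  z|.\<close>

lemma norm_trig_le:
  assumes "degree p \<le> d"
  shows "norm (trig d p z) \<le> poly_norm p * exp \<bar>Im z\<bar> ^ d"
  unfolding trig_def poly_norm_altdef[OF assms] sum_distrib_right
proof (intro sum_norm_le)
  fix i assume "i \<in> {..d}"
  then show "norm (coeff p i * exp (\<i> * of_int (2 * int i - int d) * z)) \<le> norm (coeff p i) * exp \<bar>Im z\<bar> ^ d"
    unfolding norm_mult by (intro mult_left_mono norm_exp_mode_le) auto
qed

text \<open>Passing from z to -z inverts exp (2 i z); the factor exp (2 i z)^d from palindromy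
  compensates for the change of the prefactor exp (-i d z).\<close>

lemma trig_minus:
  assumes "palindromic d p"
  shows "trig d p (- z) = trig d p z"
proof -
  have deg: "degree p \<le> d" using assms by (rule palindromic_degree)
  have sym: "exp (2 * \<i> * z) ^ d * poly p (1 / exp (2 * \<i> * z)) = poly p (exp (2 * \<i> * z))"
    using assms by (simp add: palindromic_def)
  have 1: "exp (2 * \<i> * z) ^ d = exp (\<i> * of_nat d * z) * exp (\<i> * of_nat d * z)"
    by (simp add: exp_of_nat_mult[symmetric] exp_add[symmetric] algebra_simps)
  have 2: "1 / exp (2 * \<i> * z) = exp (2 * \<i> * (- z))"
    by (simp add: exp_minus inverse_eq_divide)
  have 3: "exp (- (\<i> * of_nat d * z)) * exp (\<i> * of_nat d * z) = 1"
    by (simp add: exp_add[symmetric])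
  have "trig d p z = (exp (- (\<i> * of_nat d * z)) * exp (\<i> * of_nat d * z)) * (exp (\<i> * of_nat d * z) * poly p (exp (2 * \<i> * (- z))))"
    unfolding trig_altdef[OF deg] sym[symmetric] 1 2 by (simp only: mult_ac)
  also have "\<dots> = trig d p (- z)" unfolding 3 trig_altdef[OF deg] by simp
  finally show ?thesis by simp
qed

text \<open>For real coefficients and real phase, conjugation amounts to z -> -z, which palindromy
  undoes.\<close>

lemma trig_real:
  assumes "palindromic d p" "\<And>i. coeff p i \<in> \<real>"
  shows "trig d p (of_real x) \<in> \<real>"
proof -
  have "cnj (trig d p (of_real x)) = trig d p (- of_real x)"
    unfolding trig_def cnj_sum
    by (intro sum.cong) (use assms(2) in \<open>simp_all add: Reals_cnj_iff exp_cnj\<close>)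
  then show ?thesis using trig_minus[OF assms(1)] by (simp add: Reals_cnj_iff)
qed

lemma trig_periodic: "trig d p (z + 2 * of_real pi) = trig d p z"
proof -
  have "exp (\<i> * of_int k * (z + 2 * of_real pi)) = exp (\<i> * of_int k * z)" for k
  proof -
    have "exp (\<i> * of_int k * (z + 2 * of_real pi)) = exp (\<i> * of_int k * z) * exp (\<i> * (of_int k * (of_real pi * 2)))"
      by (simp add: exp_add[symmetric] algebra_simps)
    then show ?thesis by (simp only: exp_2pi_1_int mult_1_right)
  qed
  then show ?thesis unfolding trig_def by (simp only:)
qed

lemma trig_holomorphic: "trig d p holomorphic_on S"
  unfolding trig_def[abs_def] by (intro holomorphic_intros)

lemma trig_monom_half: "even d \<Longrightarrow> trig d (monom c (d div 2)) z = c"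
  by (auto simp: trig_def if_distrib[of "\<lambda>x. x * _"] cong: if_cong elim!: evenE)

lemma trig_1: "trig 1 [:1/2, 1/2:] z = cos z"
  by (simp add: trig_def cos_exp_eq field_simps)

lemma trig_2: "trig 2 [:x, y, x:] z = y + 2 * x * cos (2 * z)"
  by (simp add: trig_def cos_exp_eq numeral_2_eq_2 field_simps)

section \<open>Power series in the amplitude\<close>

definition trig_series :: "(nat \<Rightarrow> complex poly) \<Rightarrow> complex \<Rightarrow> complex \<Rightarrow> complex" where
  "trig_series f a z = (\<Sum>d. a ^ d * trig d (f d) z)"

definition geom_bounded :: "real \<Rightarrow> real \<Rightarrow> (nat \<Rightarrow> complex poly) \<Rightarrow> bool" where
  "geom_bounded t B f \<longleftrightarrow> (\<forall>d. degree (f d) \<le> d \<and> poly_norm (f d) * t ^ d \<le> B)"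

text \<open>Half of the radius at which the coefficient bound gives convergence, so that the terms
  decay at least like (1/2)^d and the sum is at most 2 B.\<close>

definition small_amplitude :: "real \<Rightarrow> complex \<Rightarrow> complex \<Rightarrow> bool" where
  "small_amplitude t a z \<longleftrightarrow> norm a * exp \<bar>Im z\<bar> \<le> t / 2"

lemma norm_trig_series_term_le:
  assumes "geom_bounded t B f" "t > 0"
  shows "norm (a ^ d * trig d (f d) z) \<le> B * (norm a * exp \<bar>Im z\<bar> / t) ^ d"
proof -
  have f: "degree (f d) \<le> d" "poly_norm (f d) * t ^ d \<le> B" using assms by (auto simp: geom_bounded_def)
  have "norm (a ^ d * trig d (f d) z) \<le> norm a ^ d * (poly_norm (f d) * exp \<bar>Im z\<bar> ^ d)"
    unfolding norm_mult norm_power by (intro mult_left_mono norm_trig_le f) auto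
  also have "\<dots> = (poly_norm (f d) * t ^ d) * (norm a * exp \<bar>Im z\<bar> / t) ^ d"
    using assms by (simp add: power_mult_distrib power_divide)
  also have "\<dots> \<le> B * (norm a * exp \<bar>Im z\<bar> / t) ^ d"
    using assms by (intro mult_right_mono f) auto
  finally show ?thesis .
qed

lemma geom_bounded_nonneg: "geom_bounded t B f \<Longrightarrow> B \<ge> 0"
  unfolding geom_bounded_def by (metis mult_1_right order_trans poly_norm_nonneg power_0)

lemma norm_trig_series_term_half:
  assumes "geom_bounded t B f" "t > 0" "small_amplitude t a z"
  shows "norm (a ^ d * trig d (f d) z) \<le> B * (1/2) ^ d"
proof -
  have "norm a * exp \<bar>Im z\<bar> / t \<le> 1/2"
    using assms by (simp add: small_amplitude_def field_simps)
  then have "(norm a * exp \<bar>Im z\<bar> / t) ^ d \<le> (1/2) ^ d"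
    using assms by (intro power_mono) auto
  then show ?thesis
    using norm_trig_series_term_le[OF assms(1,2), of a d z] mult_left_mono[OF _ geom_bounded_nonneg[OF assms(1)]]
    by (meson order_trans)
qed

lemma summable_trig_series:
  assumes "geom_bounded t B f" "t > 0" "small_amplitude t a z"
  shows "summable (\<lambda>d. norm (a ^ d * trig d (f d) z))"
proof (rule summable_comparison_test')
  show "summable (\<lambda>d. B * (1/2) ^ d)" by (intro summable_mult summable_geometric) simp
  show "norm (norm (a ^ d * trig d (f d) z)) \<le> B * (1/2) ^ d" if "d \<ge> 0" for d
    using norm_trig_series_term_half[OF assms, of d] by simp
qed

lemma norm_trig_series_le:
  assumes "geom_bounded t B f" "t > 0" "small_amplitude t a z"
  shows "norm (trig_series f a z) \<le> 2 * B"
proof -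
  have "(\<lambda>d. B * (1/2) ^ d) sums (B * (1 / (1 - 1/2)))"
    by (intro sums_mult geometric_sums) simp
  then have s: "summable (\<lambda>d. B * (1/2) ^ d)" "(\<Sum>d. B * (1/2) ^ d) = 2 * B"
    by (auto simp: sums_iff)
  show ?thesis
    unfolding trig_series_def s(2)[symmetric]
    by (rule norm_suminf_le[OF norm_trig_series_term_half[OF assms] s(1)])
qed

text \<open>The tail of a geometric series with ratio at most 1/2. On the real axis the bound does
  not depend on the phase.\<close>

lemma trig_series_remainder:
  assumes f: "geom_bounded t B f" "t > 0" and a: "norm a \<le> t / 2"
  shows "norm (trig_series f a (of_real x) - (\<Sum>d<n. a ^ d * trig d (f d) (of_real x))) \<le> 2 * B / t ^ n * norm a ^ n"
proof -
  have sm: "small_amplitude t a (of_real x)" using a by (simp add: small_amplitude_def)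
  define q where "q = norm a / t"
  have q: "0 \<le> q" "q \<le> 1/2" using a f by (auto simp: q_def field_simps)
  have sum: "summable (\<lambda>d. a ^ d * trig d (f d) (of_real x))"
    by (rule summable_norm_cancel[OF summable_trig_series[OF f sm]])
  have bd: "norm (a ^ (d + n) * trig (d + n) (f (d + n)) (of_real x)) \<le> B * q ^ n * q ^ d" for d
    using norm_trig_series_term_le[OF f, of a "d + n" "of_real x"] by (simp add: q_def power_add mult_ac)
  have g: "(\<lambda>d. B * q ^ n * q ^ d) sums (B * q ^ n * (1 / (1 - q)))"
    using q by (intro sums_mult geometric_sums) auto
  have "trig_series f a (of_real x) - (\<Sum>d<n. a ^ d * trig d (f d) (of_real x)) = (\<Sum>d. a ^ (d + n) * trig (d + n) (f (d + n)) (of_real x))"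
    unfolding trig_series_def by (simp add: suminf_minus_initial_segment[OF sum])
  then have "norm (trig_series f a (of_real x) - (\<Sum>d<n. a ^ d * trig d (f d) (of_real x))) \<le> B * q ^ n * (1 / (1 - q))"
    using norm_suminf_le[OF bd sums_summable[OF g]] unfolding sums_unique[OF g, symmetric] by simp
  also have "\<dots> \<le> B * q ^ n * 2"
    using q geom_bounded_nonneg[OF f(1)] by (intro mult_left_mono) (auto simp: field_simps)
  also have "\<dots> = 2 * B / t ^ n * norm a ^ n" by (simp add: q_def power_divide)
  finally show ?thesis .
qed

lemma trig_series_mult:
  assumes "geom_bounded t B f" "geom_bounded t B' g" "t > 0" "small_amplitude t a z"
  shows "trig_series (\<lambda>d. \<Sum>e\<le>d. f e * g (d - e)) a z = trig_series f a z * trig_series g a z"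
proof -
  have "trig_series f a z * trig_series g a z = (\<Sum>d. \<Sum>e\<le>d. (a ^ e * trig e (f e) z) * (a ^ (d - e) * trig (d - e) (g (d - e)) z))"
    unfolding trig_series_def by (rule Cauchy_product[OF summable_trig_series[OF assms(1,3,4)] summable_trig_series[OF assms(2,3,4)]])
  also have "\<dots> = trig_series (\<lambda>d. \<Sum>e\<le>d. f e * g (d - e)) a z"
    unfolding trig_series_def
  proof (intro suminf_cong)
    fix d
    have "trig d (f e * g (d - e)) z = trig e (f e) z * trig (d - e) (g (d - e)) z" if "e \<le> d" for e
      using trig_mult[of "f e" e "g (d - e)" "d - e" z] assms that by (simp add: geom_bounded_def)
    moreover have "a ^ d = a ^ e * a ^ (d - e)" if "e \<le> d" for e
      using that by (simp flip: power_add)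
    ultimately show "(\<Sum>e\<le>d. (a ^ e * trig e (f e) z) * (a ^ (d - e) * trig (d - e) (g (d - e)) z)) =
        a ^ d * trig d (\<Sum>e\<le>d. f e * g (d - e)) z"
      unfolding trig_sum sum_distrib_left by (intro sum.cong) (auto simp: mult_ac)
  qed
  finally show ?thesis by simp
qed

lemma trig_series_diff:
  assumes "geom_bounded t B f" "geom_bounded t B' g" "t > 0" "small_amplitude t a z"
  shows "trig_series (\<lambda>d. f d - g d) a z = trig_series f a z - trig_series g a z"
  unfolding trig_series_def trig_diff right_diff_distrib
  by (rule suminf_diff[symmetric]; rule summable_norm_cancel) (use assms summable_trig_series in blast)+

lemma trig_series_two:
  assumes "geom_bounded t B f" "t > 0" "small_amplitude t a z"
  shows "trig_series (\<lambda>d. 2 * f d) a z = 2 * trig_series f a z"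
  unfolding trig_series_def trig_two mult.left_commute[of _ 2]
  by (rule suminf_mult) (rule summable_norm_cancel[OF summable_trig_series[OF assms]])

lemma holomorphic_geometric_series:
  assumes "open S" and hol: "\<And>d. g d holomorphic_on S"
    and bd: "\<And>d x. x \<in> S \<Longrightarrow> norm (g d x) \<le> B * (1/2) ^ d"
  shows "(\<lambda>x. \<Sum>d. g d x) holomorphic_on S"
proof (rule holomorphic_uniform_sequence[OF \<open>open S\<close>, where f = "\<lambda>n x. \<Sum>d<n. g d x"])
  show "(\<lambda>x. \<Sum>d<n. g d x) holomorphic_on S" for n by (intro holomorphic_intros hol)
  fix x assume "x \<in> S"
  then obtain e where e: "e > 0" "cball x e \<subseteq> S" using \<open>open S\<close> open_contains_cball by blast
  have "uniform_limit (cball x e) (\<lambda>n x. \<Sum>d<n. g d x) (\<lambda>x. \<Sum>d. g d x) sequentially"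
  proof (rule Weierstrass_m_test)
    show "norm (g n y) \<le> B * (1/2) ^ n" if "y \<in> cball x e" for n y
      using bd that e by blast
    show "summable (\<lambda>n. B * (1/2) ^ n)" by (intro summable_mult summable_geometric) simp
  qed
  then show "\<exists>d. 0 < d \<and> cball x d \<subseteq> S \<and> uniform_limit (cball x d) (\<lambda>n x. \<Sum>d<n. g d x) (\<lambda>x. \<Sum>d. g d x) sequentially"
    using e by blast
qed

lemma trig_series_holomorphic_amplitude:
  assumes "geom_bounded t B f" "t > 0" "open S" "\<And>a. a \<in> S \<Longrightarrow> small_amplitude t a z"
  shows "(\<lambda>a. trig_series f a z) holomorphic_on S"
  unfolding trig_series_def using assms norm_trig_series_term_half
  by (intro holomorphic_geometric_series holomorphic_intros) blast+

lemma trig_series_holomorphic_phase: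
  assumes "geom_bounded t B f" "t > 0" "open S" "\<And>z. z \<in> S \<Longrightarrow> small_amplitude t a z"
  shows "(\<lambda>z. trig_series f a z) holomorphic_on S"
  unfolding trig_series_def using assms norm_trig_series_term_half
  by (intro holomorphic_geometric_series holomorphic_intros trig_holomorphic) blast+

lemma trig_series_holomorphic_parameter:
  assumes "\<And>x. x \<in> S \<Longrightarrow> geom_bounded t B (f x)" "t > 0" "open S" "small_amplitude t a z"
    and "\<And>d i. (\<lambda>x. coeff (f x d) i) holomorphic_on S"
  shows "(\<lambda>x. trig_series (f x) a z) holomorphic_on S"
  unfolding trig_series_def
proof (rule holomorphic_geometric_series[OF \<open>open S\<close>])
  show "(\<lambda>x. a ^ d * trig d (f x d) z) holomorphic_on S" for d
    unfolding trig_def by (intro holomorphic_intros assms)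
  show "norm (a ^ d * trig d (f x d) z) \<le> B * (1/2) ^ d" if "x \<in> S" for x d
    by (rule norm_trig_series_term_half[OF assms(1)[OF that] assms(2,4)])
qed

lemma trig_series_real:
  assumes "\<And>d. palindromic d (f d)" "\<And>d i. coeff (f d) i \<in> \<real>" "a \<in> \<real>"
    "geom_bounded t B f" "t > 0" "small_amplitude t a (of_real x)"
  shows "trig_series f a (of_real x) \<in> \<real>"
proof -
  have "summable (\<lambda>d. a ^ d * trig d (f d) (of_real x))"
    by (rule summable_norm_cancel[OF summable_trig_series[OF assms(4-6)]])
  moreover have "a ^ d * trig d (f d) (of_real x) \<in> \<real>" for d
    using assms by (intro Reals_mult Reals_power trig_real) auto
  ultimately show ?thesis
    unfolding trig_series_def complex_is_Real_iff by (simp add: Im_suminf)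
qed

lemma trig_series_minus: "(\<And>d. palindromic d (f d)) \<Longrightarrow> trig_series f a (- z) = trig_series f a z"
  by (simp add: trig_series_def trig_minus)

lemma trig_series_periodic: "trig_series f a (z + 2 * of_real pi) = trig_series f a z"
  by (simp add: trig_series_def trig_periodic)

section \<open>The coefficients of orders two and three\<close>

lemma conv_2: "conv f g 2 = f 1 * g 1"
proof -
  have "{1..<2} = {1::nat}" by auto
  then show ?thesis by (simp add: conv_def)
qed

lemma conv_3: "conv f g 3 = f 1 * g 2 + f 2 * g 1"
proof -
  have "{1..<3} = {1, 2::nat}" by auto
  then show ?thesis by (simp add: conv_def)
qed

text \<open>The residual of order 2 is -3 m 1 cos^2 z, and cos^2 z has the coefficients 1/4, 1/2,
  1/4. After the division by 2 (m n - m 1) the middle entry is the h0 of the theorem and each outer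
  entry is half of h2.\<close>

lemma eta_coeff_2:
  "eta_coeff m 2 = (let x = - (3/8) * m 1 / (m 2 - m 1) in [:x, - (3/4) * m 1 / (m 0 - m 1), x:])"
proof -
  have R: "residual_coeff m 2 = smult (- (3/4) * m 1) [:1, 2, 1:]"
    by (simp add: residual_coeff_altdef conv_2 coeff_1[simplified] numeral_poly)
  have "mode 2 0 = 2" "mode 2 1 = 0" "mode 2 2 = 2" by (simp_all add: mode_def)
  then have "coeff (eta_coeff m 2) i = coeff (let x = - (3/8) * m 1 / (m 2 - m 1) in [:x, - (3/4) * m 1 / (m 0 - m 1), x:]) i" for i
    unfolding coeff_ge_2(1)[OF order_refl] coeff_solve_modes R Let_def
    by (cases "i = 0"; cases "i = 1"; cases "i = 2")
       (auto simp: coeff_pCons field_simps numeral_2_eq_2 split: nat.split)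
  then show ?thesis by (rule poly_eqI)
qed

text \<open>w = e - w e, and the product w e starts with cos^2 z.\<close>

lemma w_coeff_2: "w_coeff m 2 = eta_coeff m 2 - [:1/4, 1/2, 1/4:]"
  by (simp add: coeff_ge_2(2)[OF order_refl] conv_2 coeff_1[simplified])

text \<open>The coefficient of a^2 in q^2, the first correction of the speed. In terms of the
  theorem it is 3/2 m 1 (2 h0 + h2 - 1); the square root will divide it by 2 q, which produces the
  factor 3/4.\<close>

lemma nu_coeff_3:
  "nu_coeff m 3 = (3/2) * m 1 * (2 * coeff (eta_coeff m 2) 1 + 2 * coeff (eta_coeff m 2) 0 - 1)"
proof -
  define x where "x = - (3/8) * m 1 / (m 2 - m 1)"
  define y where "y = - (3/4) * m 1 / (m 0 - m 1)"
  have e2: "eta_coeff m 2 = [:x, y, x:]" by (simp add: eta_coeff_2 x_def y_def Let_def)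
  have w2: "w_coeff m 2 = [:x - 1/4, y - 1/2, x - 1/4:]" by (simp add: w_coeff_2 e2)
  have "{1..<3 - 1} = {1::nat}" by auto
  then have "residual_coeff m 3 = mu_coeff m 1 * sigma_coeff m 2 - smult (m 1) (2 * conv (w_coeff m) (eta_coeff m) 3 + conv (w_coeff m) (w_coeff m) 3)"
    by (simp add: residual_coeff_altdef)
  also have "mu_coeff m 1 = 0"
    using nu_coeff_even[of 2 m] by (simp add: mu_coeff_def speed_poly_def numeral_2_eq_2)
  finally have "coeff (residual_coeff m 3) 1 = - m 1 * (3 * (x + y) - 3/2)"
    by (simp add: conv_3 coeff_1[simplified] e2 w2 numeral_poly field_simps)
  then have "nu_coeff m 3 = m 1 * (3 * (x + y) - 3/2)"
    by (simp add: coeff_ge_2(3))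
  then show ?thesis by (simp add: e2 algebra_simps)
qed

section \<open>The speed for small \<open>b1\<close>, \<open>b2\<close>\<close>

text \<open>The square of the scaling factor s as a function of c: when the z-dependent terms of the
  second equation cancel, s^2 (1 + q^2/2) = 1 + c^2/2 + (1 - c^2) b2 is left.\<close>

definition stretch :: "complex \<Rightarrow> complex \<Rightarrow> complex \<Rightarrow> complex" where
  "stretch q b2 c = (1 + c\<^sup>2 / 2 + (1 - c\<^sup>2) * b2) / (1 + q\<^sup>2 / 2)"

text \<open>Newton's method for \<open>c = (1 - c\<^sup>2) * b1 + q * s ^ 3\<close>, with the derivative frozen at \<open>b1 = b2 = 0\<close>, \<open>c = q\<close>.\<close>

definition speed_step :: "complex \<Rightarrow> complex \<Rightarrow> complex \<Rightarrow> complex \<Rightarrow> complex" where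
  "speed_step q b1 b2 c = c - (c - (1 - c\<^sup>2) * b1 - q * (stretch q b2 c * csqrt (stretch q b2 c)))
      * ((1 + q\<^sup>2 / 2) / (1 - q\<^sup>2))"

definition speed_step_deriv :: "complex \<Rightarrow> complex \<Rightarrow> complex \<Rightarrow> complex \<Rightarrow> complex" where
  "speed_step_deriv q b1 b2 c = 1 - (1 + 2 * c * b1 - q * (3 / 2 * csqrt (stretch q b2 c) * ((c - 2 * c * b2) / (1 + q\<^sup>2 / 2))))
      * ((1 + q\<^sup>2 / 2) / (1 - q\<^sup>2))"

definition wave_speed :: "complex \<Rightarrow> complex \<Rightarrow> complex \<Rightarrow> complex" where
  "wave_speed q b1 b2 = lim (\<lambda>n. (speed_step q b1 b2 ^^ n) q)"

lemma Re_pos_not_nonpos: "Re z > 0 \<Longrightarrow> z \<notin> \<real>\<^sub>\<le>\<^sub>0"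
  by (auto simp: complex_nonpos_Reals_iff)

lemma DERIV_speed_step:
  assumes q: "1 + q\<^sup>2 / 2 \<noteq> 0" and Q: "Re (stretch q b2 c) > 0"
  shows "(speed_step q b1 b2 has_field_derivative speed_step_deriv q b1 b2 c) (at c)"
proof -
  define D where "D = (c - 2 * c * b2) / (1 + q\<^sup>2 / 2)"
  have d1: "(stretch q b2 has_field_derivative D) (at c)"
    unfolding stretch_def[abs_def] D_def
    by (rule derivative_eq_intros refl | use q in simp)+
  have nz: "csqrt (stretch q b2 c) \<noteq> 0" using Q by auto
  have d2: "((\<lambda>c. csqrt (stretch q b2 c)) has_field_derivative D / (2 * csqrt (stretch q b2 c))) (at c)"
    by (rule has_field_derivative_csqrt'[OF d1 Re_pos_not_nonpos[OF Q]])
  have d23: "((\<lambda>c. stretch q b2 c * csqrt (stretch q b2 c)) has_field_derivative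
      stretch q b2 c * (D / (2 * csqrt (stretch q b2 c))) + D * csqrt (stretch q b2 c)) (at c)"
    by (rule DERIV_mult'[OF d1 d2])
  have eq: "stretch q b2 c * (D / (2 * csqrt (stretch q b2 c))) + D * csqrt (stretch q b2 c)
      = 3 / 2 * csqrt (stretch q b2 c) * D"
  proof -
    have "stretch q b2 c = csqrt (stretch q b2 c) * csqrt (stretch q b2 c)"
      using power2_csqrt[of "stretch q b2 c"] by (simp add: power2_eq_square)
    then have "stretch q b2 c / csqrt (stretch q b2 c) = csqrt (stretch q b2 c)"
      using nz by (metis nonzero_mult_div_cancel_left)
    moreover have "stretch q b2 c * (D / (2 * csqrt (stretch q b2 c))) = D / 2 * (stretch q b2 c / csqrt (stretch q b2 c))"
      by simp
    ultimately show ?thesis by simp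
  qed
  have d3: "((\<lambda>c. stretch q b2 c * csqrt (stretch q b2 c)) has_field_derivative 3 / 2 * csqrt (stretch q b2 c) * D) (at c)"
    using d23 unfolding eq .
  show ?thesis
    unfolding speed_step_def[abs_def] speed_step_deriv_def D_def[symmetric]
    by (rule derivative_eq_intros d3 refl)+ (simp add: algebra_simps)
qed

text \<open>At the base point the equation for c has derivative 1 - 3/2 q^2 / (1 + q^2/2) = (1 -
  q^2) / (1 + q^2/2), and the factor in \<open>speed_step\<close> is its inverse. That the
  derivative of the step vanishes here is the source of the contraction.\<close>

lemma speed_step_deriv_base:
  assumes "1 + q\<^sup>2 / 2 \<noteq> 0" "1 - q\<^sup>2 \<noteq> 0"
  shows "speed_step_deriv q 0 0 q = 0"
proof -
  have "stretch q 0 q = 1" using assms by (simp add: stretch_def)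
  then have "speed_step_deriv q 0 0 q = 1 - (1 - 3 / 2 * q\<^sup>2 / (1 + q\<^sup>2 / 2)) * ((1 + q\<^sup>2 / 2) / (1 - q\<^sup>2))"
    by (simp add: speed_step_deriv_def power2_eq_square)
  also have "1 - 3 / 2 * q\<^sup>2 / (1 + q\<^sup>2 / 2) = (1 - q\<^sup>2) / (1 + q\<^sup>2 / 2)"
    using assms by (simp add: field_simps)
  finally show ?thesis using assms by simp
qed

text \<open>With s^2 = \<open>stretch q b2 q\<close>, the identity s^3 - 1 = (s^2 - 1) (s + 1/(s +
  1)) brings out a factor 1 - q^2, which cancels the denominator of the step. The first correction
  is therefore at most linear in b1 and b2 with a constant free of 1 - q^2.\<close>

lemma norm_speed_step_initial:
  assumes q: "norm q \<le> 2" "norm (1 + q\<^sup>2 / 2) \<ge> 1 / 2" "1 - q\<^sup>2 \<noteq> 0" and b: "norm b2 \<le> 1"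
  shows "norm (speed_step q b1 b2 q - q) \<le> 10 * (norm b1 + norm b2)"
    and "norm (stretch q b2 q - 1) \<le> 10 * norm b2"
proof -
  define j where "j = 1 + q\<^sup>2 / 2"
  define Q where "Q = stretch q b2 q"
  define s where "s = csqrt Q"
  have j: "j \<noteq> 0" "norm j \<ge> 1/2" using q by (auto simp: j_def)
  have q2: "norm (q\<^sup>2) \<le> 4"
    using power_mono[OF q(1), of 2] by (simp add: norm_power)
  have nj: "norm j \<le> 3"
    using norm_triangle_ineq[of 1 "q\<^sup>2 / 2"] q2 by (simp add: j_def norm_divide)
  have n1: "norm (1 - q\<^sup>2) \<le> 5"
    using norm_triangle_ineq4[of 1 "q\<^sup>2"] q2 by simp
  have "Q = (j + (1 - q\<^sup>2) * b2) / j" by (simp add: Q_def stretch_def j_def)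
  then have Q1: "Q - 1 = (1 - q\<^sup>2) * b2 / j"
    using j by (simp add: add_divide_distrib)
  have "norm (Q - 1) \<le> (5 * norm b2) / (1/2)"
    unfolding Q1 norm_divide norm_mult using j n1 by (intro frac_le mult_right_mono) auto
  then show Qb: "norm (stretch q b2 q - 1) \<le> 10 * norm b2" by (simp add: Q_def)
  then have "norm Q \<le> 16"
    using norm_triangle_ineq2[of Q 1] b by (simp add: Q_def)
  then have "sqrt (norm Q) \<le> sqrt (4\<^sup>2)" by (intro real_sqrt_le_mono) simp
  then have s4: "norm s \<le> 4" by (simp add: s_def)
  have "Re (s + 1) \<ge> 1" using Re_csqrt[of Q] by (simp add: s_def)
  then have s1: "norm (s + 1) \<ge> 1" using complex_Re_le_cmod[of "s + 1"] by linarith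
  have ss: "s * s = Q" using power2_csqrt[of Q] by (simp add: s_def power2_eq_square)
  have "s + 1 \<noteq> 0" using s1 by auto
  have eq: "speed_step q b1 b2 q - q = j * b1 + q * b2 * (s + 1 / (s + 1))"
  proof -
    have s3: "Q * s - 1 = (Q - 1) * (s + 1 / (s + 1))"
    proof -
      have "(Q - 1) / (s + 1) = s - 1"
        using \<open>s + 1 \<noteq> 0\<close> by (simp add: field_simps ss)
      then show ?thesis by (simp add: distrib_left algebra_simps)
    qed
    have "speed_step q b1 b2 q - q = ((1 - q\<^sup>2) * b1 + q * (Q * s - 1)) * (j / (1 - q\<^sup>2))"
      by (simp add: speed_step_def j_def[symmetric] Q_def[symmetric] s_def[symmetric] algebra_simps)
    also have "(1 - q\<^sup>2) * b1 + q * (Q * s - 1) = (1 - q\<^sup>2) * (b1 + q * b2 / j * (s + 1 / (s + 1)))"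
    proof -
      have "(1 - q\<^sup>2) * b1 + q * ((1 - q\<^sup>2) * b2 / j * S) = (1 - q\<^sup>2) * (b1 + q * b2 / j * S)" for S
        by (simp add: distrib_left)
      then show ?thesis unfolding s3 Q1 .
    qed
    also have "(1 - q\<^sup>2) * (b1 + q * b2 / j * (s + 1 / (s + 1))) * (j / (1 - q\<^sup>2)) = (b1 + q * b2 / j * (s + 1 / (s + 1))) * j"
    proof -
      have "(x * y) * (z / x) = y * z" if "x \<noteq> 0" for x y z :: complex using that by simp
      from this[OF q(3)] show ?thesis .
    qed
    also have "\<dots> = j * b1 + q * b2 * (s + 1 / (s + 1))"
    proof -
      have "(b1 + q * b2 / j * S) * j = j * b1 + q * b2 * S" for S
        using j(1) by (simp add: field_simps)
      then show ?thesis .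
    qed
    finally show ?thesis .
  qed
  have "norm (1 / (s + 1)) \<le> 1" using s1 by (simp add: norm_divide divide_simps)
  then have s5: "norm (s + 1 / (s + 1)) \<le> 5" using norm_triangle_ineq[of s "1 / (s + 1)"] s4 by linarith
  have "norm (speed_step q b1 b2 q - q) \<le> norm j * norm b1 + norm q * norm b2 * norm (s + 1 / (s + 1))"
    unfolding eq by (rule order_trans[OF norm_triangle_ineq]) (simp add: norm_mult)
  also have "\<dots> \<le> 3 * norm b1 + (2 * norm b2) * 5"
    using nj q s5 by (intro add_mono mult_mono) auto
  finally show "norm (speed_step q b1 b2 q - q) \<le> 10 * (norm b1 + norm b2)"
    by (rule order_trans) simp
qed

text \<open>At q = c = q0 and b1 = b2 = 0 the derivative is 0, \<open>stretch\<close> is 1 and q0^2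
  < 1, so all conditions hold there with room to spare and persist nearby by continuity.\<close>

lemma speed_step_region:
  assumes q0: "0 < q0" "q0 < 1"
  obtains R where "0 < R" "R \<le> 1"
    "\<And>q b1 b2 c. norm (q - of_real q0) < R \<Longrightarrow> norm b1 < R \<Longrightarrow> norm b2 < R \<Longrightarrow> norm (c - of_real q0) < R \<Longrightarrow>
       norm (speed_step_deriv q b1 b2 c) \<le> 1 / 2 \<and> Re (stretch q b2 c) > 0 \<and>
       norm (1 + q\<^sup>2 / 2) \<ge> 1 / 2 \<and> 1 - q\<^sup>2 \<noteq> 0"
proof -
  define x where "x = complex_of_real q0"
  define p0 where "p0 = (x, 0 :: complex, 0 :: complex, x)"
  have x1: "1 + x\<^sup>2 / 2 = of_real (1 + q0\<^sup>2 / 2)" by (simp add: x_def)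
  have j: "norm (1 + x\<^sup>2 / 2) \<ge> 1" unfolding x1 norm_of_real by simp
  then have j0: "1 + x\<^sup>2 / 2 \<noteq> 0" by auto
  have "q0\<^sup>2 < 1" using q0 by (simp add: power_less_one_iff abs_square_less_1)
  have "x\<^sup>2 \<noteq> 1"
  proof
    assume "x\<^sup>2 = 1"
    then have "complex_of_real (q0\<^sup>2) = of_real 1" by (simp add: x_def)
    then have "q0\<^sup>2 = 1" by (simp only: of_real_eq_iff)
    then show False using \<open>q0\<^sup>2 < 1\<close> by simp
  qed
  then have d0: "1 - x\<^sup>2 \<noteq> 0" by simp
  define F where "F = nhds p0"
  have t1: "((\<lambda>p. fst p) \<longlongrightarrow> x) F" and t2: "((\<lambda>p. fst (snd p)) \<longlongrightarrow> 0) F"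
    and t3: "((\<lambda>p. fst (snd (snd p))) \<longlongrightarrow> 0) F" and t4: "((\<lambda>p. snd (snd (snd p))) \<longlongrightarrow> x) F"
  proof -
    have id: "((\<lambda>p. p) \<longlongrightarrow> p0) F" unfolding F_def by (rule filterlim_ident)
    show "((\<lambda>p. fst p) \<longlongrightarrow> x) F" using tendsto_fst[OF id] by (simp add: p0_def)
    show "((\<lambda>p. fst (snd p)) \<longlongrightarrow> 0) F" using tendsto_fst[OF tendsto_snd[OF id]] by (simp add: p0_def)
    show "((\<lambda>p. fst (snd (snd p))) \<longlongrightarrow> 0) F" using tendsto_fst[OF tendsto_snd[OF tendsto_snd[OF id]]] by (simp add: p0_def)
    show "((\<lambda>p. snd (snd (snd p))) \<longlongrightarrow> x) F" using tendsto_snd[OF tendsto_snd[OF tendsto_snd[OF id]]] by (simp add: p0_def)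
  qed
  have tQ: "((\<lambda>p. stretch (fst p) (fst (snd (snd p))) (snd (snd (snd p)))) \<longlongrightarrow> stretch x 0 x) F"
    unfolding stretch_def by (intro tendsto_intros t1 t2 t3 t4 j0) auto
  have Q0: "stretch x 0 x = 1" using j0 by (simp add: stretch_def)
  have ts: "((\<lambda>p. csqrt (stretch (fst p) (fst (snd (snd p))) (snd (snd (snd p))))) \<longlongrightarrow> csqrt (stretch x 0 x)) F"
    by (rule isCont_tendsto_compose[OF _ tQ]) (simp add: Q0 continuous_at_csqrt)
  have tD: "((\<lambda>p. speed_step_deriv (fst p) (fst (snd p)) (fst (snd (snd p))) (snd (snd (snd p)))) \<longlongrightarrow> speed_step_deriv x 0 0 x) F"
    unfolding speed_step_deriv_def by (intro tendsto_intros t1 t2 t3 t4 ts j0 d0) auto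
  have e1: "\<forall>\<^sub>F p in F. norm (speed_step_deriv (fst p) (fst (snd p)) (fst (snd (snd p))) (snd (snd (snd p)))) < 1/2"
    using tendsto_norm[OF tD] speed_step_deriv_base[OF j0 d0] by (intro order_tendstoD(2)) auto
  have e2: "\<forall>\<^sub>F p in F. Re (stretch (fst p) (fst (snd (snd p))) (snd (snd (snd p)))) > 0"
    using tendsto_Re[OF tQ] Q0 by (intro order_tendstoD(1)) auto
  have e3: "\<forall>\<^sub>F p in F. norm (1 + (fst p)\<^sup>2 / 2) > 1 / 2"
  proof -
    have "((\<lambda>p. norm (1 + (fst p)\<^sup>2 / 2)) \<longlongrightarrow> norm (1 + x\<^sup>2 / 2)) F" by (intro tendsto_intros t1) auto
    then show ?thesis using j by (intro order_tendstoD(1)) auto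
  qed
  have e4: "\<forall>\<^sub>F p in F. 1 - (fst p)\<^sup>2 \<noteq> 0"
  proof -
    have "((\<lambda>p. 1 - (fst p)\<^sup>2) \<longlongrightarrow> 1 - x\<^sup>2) F" by (intro tendsto_intros t1)
    then show ?thesis using d0 by (rule tendsto_imp_eventually_ne)
  qed
  obtain e where e: "e > 0" and E: "\<And>p. dist p p0 < e \<Longrightarrow>
      norm (speed_step_deriv (fst p) (fst (snd p)) (fst (snd (snd p))) (snd (snd (snd p)))) < 1/2 \<and>
      Re (stretch (fst p) (fst (snd (snd p))) (snd (snd (snd p)))) > 0 \<and>
      norm (1 + (fst p)\<^sup>2 / 2) > 1 / 2 \<and> 1 - (fst p)\<^sup>2 \<noteq> 0"
    using eventually_conj[OF e1 eventually_conj[OF e2 eventually_conj[OF e3 e4]]]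
    unfolding F_def eventually_nhds_metric by blast
  show ?thesis
  \<comment> \<open>The distance in the product is at most the sum of the four distances, each below
    e/4.\<close>
  proof (rule that[of "min 1 (e / 4)"])
    fix q b1 b2 c :: complex
    assume *: "norm (q - of_real q0) < min 1 (e/4)" "norm b1 < min 1 (e/4)" "norm b2 < min 1 (e/4)" "norm (c - of_real q0) < min 1 (e/4)"
    have dp: "dist (u, v) (u', v') \<le> dist u u' + dist v v'" for u u' :: complex and v v' :: "'b::metric_space"
      unfolding dist_Pair_Pair by (rule sqrt_sum_squares_le_sum) auto
    have "dist (q, b1, b2, c) p0 \<le> norm (q - x) + (norm b1 + (norm b2 + norm (c - x)))"
      unfolding p0_def by (intro order_trans[OF dp] add_mono) (auto simp: dist_norm)
    also have "\<dots> < e" using * by (auto simp: x_def)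
    finally show "norm (speed_step_deriv q b1 b2 c) \<le> 1 / 2 \<and> Re (stretch q b2 c) > 0 \<and>
       norm (1 + q\<^sup>2 / 2) \<ge> 1 / 2 \<and> 1 - q\<^sup>2 \<noteq> 0"
      using E[of "(q, b1, b2, c)"] by auto
  qed (use e in auto)
qed

section \<open>Fixed points that depend holomorphically on parameters\<close>

text \<open>A ball about the starting point is mapped into itself because the first step covers at
  most half of the radius. The explicit geometric rate is recorded since it makes the iterates
  converge uniformly in the parameters.\<close>

lemma Banach_fixpoint_rate:
  fixes f :: "'a::complete_space \<Rightarrow> 'a"
  assumes r: "r \<ge> 0" and lip: "\<And>x y. x \<in> cball q r \<Longrightarrow> y \<in> cball q r \<Longrightarrow> dist (f x) (f y) \<le> dist x y / 2"
    and start: "dist (f q) q \<le> r / 2"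
  obtains x where "x \<in> cball q r" "f x = x" "\<And>n. (f ^^ n) q \<in> cball q r" "\<And>n. dist ((f ^^ n) q) x \<le> r * (1/2) ^ n"
    "dist x q \<le> 2 * dist (f q) q"
proof -
  have maps: "f x \<in> cball q r" if "x \<in> cball q r" for x
  proof -
    have "dist (f x) (f q) \<le> r / 2" using lip[OF that, of q] that r by (simp add: dist_commute)
    then show ?thesis using start dist_triangle[of "f x" q "f q"] by (simp add: dist_commute)
  qed
  have "\<exists>!x\<in>cball q r. f x = x"
    by (rule Banach_fix[of _ "1/2"]) (use maps lip r in \<open>auto simp: complete_eq_closed\<close>)
  then obtain x where x: "x \<in> cball q r" "f x = x" by blast
  have it: "(f ^^ n) q \<in> cball q r" for n by (induction n) (use maps r in auto)
  have rate: "dist ((f ^^ n) q) x \<le> r * (1/2) ^ n" for n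
  proof (induction n)
    case (Suc n)
    have "dist ((f ^^ Suc n) q) x \<le> dist ((f ^^ n) q) x / 2"
      using lip[OF it[of n] x(1)] x(2) by simp
    then show ?case using Suc by simp
  qed (use x in simp)
  have "dist x q \<le> dist x q / 2 + dist (f q) q"
    using lip[OF x(1), of q] x(2) r dist_triangle[of x q "f q"] by simp
  then show ?thesis using that x it rate by auto
qed

text \<open>Every Newton iterate is holomorphic in each parameter and real for real parameters; the
  uniform rate passes both properties on to the limit.\<close>

lemma wave_speed_local:
  assumes q0: "0 < q0" "q0 < 1"
  obtains \<rho> where "0 < \<rho>" "\<rho> \<le> 1"
    and "\<And>q b1 b2. q \<in> ball (of_real q0) \<rho> \<Longrightarrow> b1 \<in> ball 0 \<rho> \<Longrightarrow> b2 \<in> ball 0 \<rho> \<Longrightarrow>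
      (let c = wave_speed q b1 b2; Q = stretch q b2 c in
        c = (1 - c\<^sup>2) * b1 + q * (Q * csqrt Q) \<and> Re Q > 0 \<and> norm (1 + q\<^sup>2 / 2) \<ge> 1 / 2 \<and> 1 - q\<^sup>2 \<noteq> 0 \<and>
        norm (c - q) \<le> 20 * (norm b1 + norm b2))"
    and "\<And>b1 b2. b1 \<in> ball 0 \<rho> \<Longrightarrow> b2 \<in> ball 0 \<rho> \<Longrightarrow> (\<lambda>q. wave_speed q b1 b2) holomorphic_on ball (of_real q0) \<rho>"
    and "\<And>q b2. q \<in> ball (of_real q0) \<rho> \<Longrightarrow> b2 \<in> ball 0 \<rho> \<Longrightarrow> (\<lambda>b1. wave_speed q b1 b2) holomorphic_on ball 0 \<rho>"
    and "\<And>q b1. q \<in> ball (of_real q0) \<rho> \<Longrightarrow> b1 \<in> ball 0 \<rho> \<Longrightarrow> (\<lambda>b2. wave_speed q b1 b2) holomorphic_on ball 0 \<rho>"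
    and "\<And>q b1 b2. q \<in> ball (of_real q0) \<rho> \<Longrightarrow> b1 \<in> ball 0 \<rho> \<Longrightarrow> b2 \<in> ball 0 \<rho> \<Longrightarrow>
      q \<in> \<real> \<Longrightarrow> b1 \<in> \<real> \<Longrightarrow> b2 \<in> \<real> \<Longrightarrow> wave_speed q b1 b2 \<in> \<real>"
proof -
  obtain R where R: "0 < R" "R \<le> 1"
    and reg: "\<And>q b1 b2 c. norm (q - of_real q0) < R \<Longrightarrow> norm b1 < R \<Longrightarrow> norm b2 < R \<Longrightarrow> norm (c - of_real q0) < R \<Longrightarrow>
       norm (speed_step_deriv q b1 b2 c) \<le> 1 / 2 \<and> Re (stretch q b2 c) > 0 \<and>
       norm (1 + q\<^sup>2 / 2) \<ge> 1 / 2 \<and> 1 - q\<^sup>2 \<noteq> 0"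
    using speed_step_region[OF q0] by metis
  \<comment> \<open>For |b1|, |b2| < R/80 the first step has length below 20 R/80 = r/2, as
    \<open>Banach_fixpoint_rate\<close> requires, and R/2 + R/80 < R keeps the ball inside the
    region.\<close>
  define r where "r = R / 2"
  define \<rho> where "\<rho> = R / 80"
  have \<rho>: "0 < \<rho>" "\<rho> \<le> 1" "\<rho> < R" using R by (auto simp: \<rho>_def)
  define it where "it q b1 b2 n = (speed_step q b1 b2 ^^ n) q" for q b1 b2 n
  have near: "norm (c - of_real q0) < R" if "q \<in> ball (of_real q0) \<rho>" "c \<in> cball q r" for q c
  proof -
    have "dist c (of_real q0) \<le> dist c q + dist q (of_real q0)" by (rule dist_triangle)
    then show ?thesis using that R by (auto simp: r_def \<rho>_def dist_norm norm_minus_commute)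
  qed
  have reg': "norm (speed_step_deriv q b1 b2 c) \<le> 1 / 2" "Re (stretch q b2 c) > 0"
       "norm (1 + q\<^sup>2 / 2) \<ge> 1 / 2" "1 - q\<^sup>2 \<noteq> 0"
    if "q \<in> ball (of_real q0) \<rho>" "b1 \<in> ball 0 \<rho>" "b2 \<in> ball 0 \<rho>" "c \<in> cball q r" for q b1 b2 c
    using reg[of q b1 b2 c] near[of q c] that \<rho> by (auto simp: dist_norm norm_minus_commute)
  have fixed: "\<exists>x. x \<in> cball q r \<and> speed_step q b1 b2 x = x \<and> (\<forall>n. it q b1 b2 n \<in> cball q r) \<and>
      (\<forall>n. dist (it q b1 b2 n) x \<le> r * (1/2) ^ n) \<and> dist x q \<le> 20 * (norm b1 + norm b2)"
    if q: "q \<in> ball (of_real q0) \<rho>" and b1: "b1 \<in> ball 0 \<rho>" and b2: "b2 \<in> ball 0 \<rho>" for q b1 b2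
  proof -
    have qq: "q \<in> cball q r" using R by (simp add: r_def)
    have j: "norm (1 + q\<^sup>2 / 2) \<ge> 1 / 2" "1 - q\<^sup>2 \<noteq> 0" using reg'[OF q b1 b2 qq] by auto
    then have j0: "1 + q\<^sup>2 / 2 \<noteq> 0" by auto
    have "norm q \<le> norm (of_real q0 :: complex) + norm (q - of_real q0)" by (metis norm_triangle_sub)
    also have "\<dots> \<le> 2" using q q0 \<rho> by (simp add: dist_norm norm_minus_commute)
    finally have q2: "norm q \<le> 2" .
    have init: "dist (speed_step q b1 b2 q) q \<le> 10 * (norm b1 + norm b2)"
      unfolding dist_norm using b2 \<rho> by (intro norm_speed_step_initial q2 j) auto
    have lip: "dist (speed_step q b1 b2 x) (speed_step q b1 b2 y) \<le> dist x y / 2"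
      if "x \<in> cball q r" "y \<in> cball q r" for x y
    proof -
      have "norm (speed_step q b1 b2 x - speed_step q b1 b2 y) \<le> 1/2 * norm (x - y)"
        by (rule field_differentiable_bound[OF convex_cball[of q r] has_field_derivative_at_within[OF DERIV_speed_step[OF j0]]])
           (use reg'[OF q b1 b2] that in auto)
      then show ?thesis by (simp add: dist_norm)
    qed
    have st: "dist (speed_step q b1 b2 q) q \<le> r / 2" using init b1 b2 by (simp add: r_def \<rho>_def)
    have r0: "r \<ge> 0" using R by (simp add: r_def)
    show ?thesis
      by (rule Banach_fixpoint_rate[OF r0 lip st]) (use init in \<open>auto simp: it_def\<close>)
  qed
  have ws: "wave_speed q b1 b2 \<in> cball q r \<and> speed_step q b1 b2 (wave_speed q b1 b2) = wave_speed q b1 b2 \<and>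
      (\<forall>n. it q b1 b2 n \<in> cball q r) \<and> it q b1 b2 \<longlonglongrightarrow> wave_speed q b1 b2 \<and>
      (\<forall>n. norm (it q b1 b2 n - wave_speed q b1 b2) \<le> r * (1/2) ^ n) \<and> norm (wave_speed q b1 b2 - q) \<le> 20 * (norm b1 + norm b2)"
    if "q \<in> ball (of_real q0) \<rho>" "b1 \<in> ball 0 \<rho>" "b2 \<in> ball 0 \<rho>" for q b1 b2
  proof -
    obtain x where x: "x \<in> cball q r" "speed_step q b1 b2 x = x" "\<forall>n. it q b1 b2 n \<in> cball q r"
      "\<And>n. dist (it q b1 b2 n) x \<le> r * (1/2) ^ n" "dist x q \<le> 20 * (norm b1 + norm b2)"
      using fixed[OF \<open>q \<in> _\<close> \<open>b1 \<in> _\<close> \<open>b2 \<in> _\<close>] by blast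
    from geometric_null[of r] have "(\<lambda>n. dist (it q b1 b2 n) x) \<longlonglongrightarrow> 0"
      by (rule Lim_null_comparison[OF always_eventually, rotated]) (simp add: x(4))
    then have "it q b1 b2 \<longlonglongrightarrow> x" by (rule tendsto_dist_iff[THEN iffD2])
    moreover from this have "wave_speed q b1 b2 = x"
      unfolding wave_speed_def it_def[symmetric] by (rule limI)
    ultimately show ?thesis using x by (simp add: dist_norm)
  qed
  have step_hol: "(\<lambda>x. speed_step (f x) (g x) (h x) (k x)) holomorphic_on S"
    if "f holomorphic_on S" "g holomorphic_on S" "h holomorphic_on S" "k holomorphic_on S"
      "\<And>x. x \<in> S \<Longrightarrow> f x \<in> ball (of_real q0) \<rho> \<and> g x \<in> ball 0 \<rho> \<and> h x \<in> ball 0 \<rho> \<and> k x \<in> cball (f x) r" for f g h k S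
  proof -
    have j: "1 + (f x)\<^sup>2 / 2 \<noteq> 0" "1 - (f x)\<^sup>2 \<noteq> 0" "stretch (f x) (h x) (k x) \<notin> \<real>\<^sub>\<le>\<^sub>0" if "x \<in> S" for x
      using reg'(2-4)[of "f x" "g x" "h x" "k x"] \<open>\<And>x. x \<in> S \<Longrightarrow> _\<close>[OF that] Re_pos_not_nonpos by auto
    have Q: "(\<lambda>x. stretch (f x) (h x) (k x)) holomorphic_on S"
      unfolding stretch_def by (intro holomorphic_intros that(1-4)) (auto simp: j(1))
    have C: "(\<lambda>x. csqrt (stretch (f x) (h x) (k x))) holomorphic_on S"
      by (rule holomorphic_on_csqrt'[OF Q j(3)])
    show ?thesis unfolding speed_step_def
      by (intro holomorphic_on_diff holomorphic_on_mult holomorphic_on_divide holomorphic_on_add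
          holomorphic_on_power holomorphic_on_const that(1-4) Q C) (auto dest: j(2))
  qed
  have it_hol: "(\<lambda>x. it (f x) (g x) (h x) n) holomorphic_on S"
    if fgh: "f holomorphic_on S" "g holomorphic_on S" "h holomorphic_on S"
      "\<And>x. x \<in> S \<Longrightarrow> f x \<in> ball (of_real q0) \<rho> \<and> g x \<in> ball 0 \<rho> \<and> h x \<in> ball 0 \<rho>" for f g h n S
  proof (induction n)
    case (Suc n)
    have "(\<lambda>x. speed_step (f x) (g x) (h x) (it (f x) (g x) (h x) n)) holomorphic_on S"
      using fgh(4) ws by (intro step_hol fgh(1-3) Suc) blast
    then show ?case by (simp add: it_def)
  qed (use fgh in \<open>simp add: it_def\<close>)
  have ws_hol: "(\<lambda>x. wave_speed (f x) (g x) (h x)) holomorphic_on S"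
    if "open S" and fgh: "f holomorphic_on S" "g holomorphic_on S" "h holomorphic_on S"
      "\<And>x. x \<in> S \<Longrightarrow> f x \<in> ball (of_real q0) \<rho> \<and> g x \<in> ball 0 \<rho> \<and> h x \<in> ball 0 \<rho>" for f g h S
  proof (rule holomorphic_uniform_rate[where f = "\<lambda>n x. it (f x) (g x) (h x) n", OF \<open>open S\<close> it_hol[OF fgh] geometric_null[of r]])
    show "norm (it (f x) (g x) (h x) n - wave_speed (f x) (g x) (h x)) \<le> r * (1/2) ^ n" if "x \<in> S" for x n
      using ws[of "f x" "g x" "h x"] fgh(4)[OF that] by simp
  qed
  show ?thesis
  proof (rule that[OF \<rho>(1,2)])
    fix q b1 b2 :: complex
    assume q: "q \<in> ball (of_real q0) \<rho>" and b1: "b1 \<in> ball 0 \<rho>" and b2: "b2 \<in> ball 0 \<rho>"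
    define c where "c = wave_speed q b1 b2"
    define Q where "Q = stretch q b2 c"
    note W = ws[OF q b1 b2, folded c_def]
    have j: "Re Q > 0" "norm (1 + q\<^sup>2 / 2) \<ge> 1 / 2" "1 - q\<^sup>2 \<noteq> 0"
      using reg'[OF q b1 b2, of c] W by (auto simp: Q_def)
    then have j0: "1 + q\<^sup>2 / 2 \<noteq> 0" by auto
    have "(c - (1 - c\<^sup>2) * b1 - q * (Q * csqrt Q)) * ((1 + q\<^sup>2 / 2) / (1 - q\<^sup>2)) = 0"
      using W by (simp add: speed_step_def Q_def)
    then have "c - (1 - c\<^sup>2) * b1 - q * (Q * csqrt Q) = 0"
      using j(3) j0 by (metis divide_eq_0_iff mult_eq_0_iff)
    then have eq: "c = (1 - c\<^sup>2) * b1 + q * (Q * csqrt Q)"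
      by (simp add: diff_diff_eq)
    have cq: "norm (c - q) \<le> 20 * (norm b1 + norm b2)" using W by blast
    show "let c = wave_speed q b1 b2; Q = stretch q b2 c in
        c = (1 - c\<^sup>2) * b1 + q * (Q * csqrt Q) \<and> Re Q > 0 \<and> norm (1 + q\<^sup>2 / 2) \<ge> 1 / 2 \<and> 1 - q\<^sup>2 \<noteq> 0 \<and>
        norm (c - q) \<le> 20 * (norm b1 + norm b2)"
      unfolding Let_def c_def[symmetric] Q_def[symmetric] by (intro conjI eq j cq)
    assume re: "q \<in> \<real>" "b1 \<in> \<real>" "b2 \<in> \<real>"
    have sr: "speed_step q b1 b2 x \<in> \<real>" if "x \<in> \<real>" "x \<in> cball q r" for x
    proof -
      have "stretch q b2 x \<in> \<real>" unfolding stretch_def using re that by (intro Reals_divide Reals_add Reals_mult Reals_diff Reals_power) auto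
      moreover have "Re (stretch q b2 x) > 0" using reg'(2)[OF q b1 b2 that(2)] .
      ultimately have "csqrt (stretch q b2 x) \<in> \<real>"
        by (metis Reals_of_real csqrt_of_real less_imp_le of_real_Re)
      with \<open>stretch q b2 x \<in> \<real>\<close> show ?thesis
        unfolding speed_step_def using re that by (intro Reals_divide Reals_add Reals_mult Reals_diff Reals_power) auto
    qed
    have itR: "it q b1 b2 n \<in> \<real>" for n
    proof (induction n)
      case (Suc n)
      then show ?case using sr[of "it q b1 b2 n"] ws[OF q b1 b2] by (simp add: it_def)
    qed (use re in \<open>simp add: it_def\<close>)
    have lim: "it q b1 b2 \<longlonglongrightarrow> wave_speed q b1 b2" using ws[OF q b1 b2] by blast
    show "wave_speed q b1 b2 \<in> \<real>"
      by (rule Lim_in_closed_set[OF closed_complex_Reals _ _ lim]) (simp_all add: itR)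
  next
    fix b1 b2 :: complex assume "b1 \<in> ball 0 \<rho>" "b2 \<in> ball 0 \<rho>"
    then show "(\<lambda>q. wave_speed q b1 b2) holomorphic_on ball (of_real q0) \<rho>"
      by (intro ws_hol[of _ "\<lambda>q. q" "\<lambda>_. b1" "\<lambda>_. b2"] holomorphic_intros; simp)
  next
    fix q b :: complex assume qb: "q \<in> ball (of_real q0) \<rho>" "b \<in> ball 0 \<rho>"
    show "(\<lambda>b1. wave_speed q b1 b) holomorphic_on ball 0 \<rho>" "(\<lambda>b2. wave_speed q b b2) holomorphic_on ball 0 \<rho>"
      by (intro ws_hol[of _ "\<lambda>_. q" "\<lambda>b1. b1" "\<lambda>_. b"] holomorphic_intros; use qb in simp)
         (intro ws_hol[of _ "\<lambda>_. q" "\<lambda>_. b" "\<lambda>b2. b2"] holomorphic_intros; use qb in simp)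
  qed
qed

section \<open>Expansion of the speed and of the scaling factor\<close>

text \<open>Cauchy's inequality for the derivative, on discs of radius \<rho>/4 about the points of
  the disc of half the size.\<close>

lemma holomorphic_lipschitz:
  assumes hol: "f holomorphic_on ball z0 \<rho>" and "\<rho> > 0" and M: "\<And>z. z \<in> ball z0 \<rho> \<Longrightarrow> norm (f z) \<le> M"
    and z: "z \<in> ball z0 (\<rho>/2)"
  shows "norm (f z - f z0) \<le> 4 * M / \<rho> * norm (z - z0)"
proof (rule field_differentiable_bound[OF convex_ball[of z0 "\<rho>/2"], of f "deriv f"])
  fix w assume w: "w \<in> ball z0 (\<rho>/2)"
  have "ball z0 (\<rho>/2) \<subseteq> ball z0 \<rho>" using \<open>\<rho> > 0\<close> by auto
  then have "(f has_field_derivative deriv f w) (at w)"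
    using hol w by (intro holomorphic_derivI[OF hol open_ball]) auto
  then show "(f has_field_derivative deriv f w) (at w within ball z0 (\<rho>/2))"
    by (rule has_field_derivative_at_within)
  have sub: "cball w (\<rho>/4) \<subseteq> ball z0 \<rho>"
  proof
    fix y assume "y \<in> cball w (\<rho>/4)"
    then have "dist z0 y \<le> dist z0 w + \<rho>/4" using dist_triangle[of z0 y w] by simp
    then show "y \<in> ball z0 \<rho>" using w \<open>\<rho> > 0\<close> by simp
  qed
  have "norm ((deriv ^^ 1) f w) \<le> fact 1 * M / (\<rho>/4)^1"
  proof (rule Cauchy_inequality)
    show "f holomorphic_on ball w (\<rho>/4)"
      using hol sub ball_subset_cball by (meson holomorphic_on_subset subset_trans)
    show "continuous_on (cball w (\<rho>/4)) f"
      using hol sub holomorphic_on_imp_continuous_on holomorphic_on_subset by blast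
    show "norm (f x) \<le> M" if "norm (w - x) = \<rho>/4" for x
      using that sub by (intro M) (auto simp: dist_norm)
  qed (use \<open>\<rho> > 0\<close> in auto)
  then show "norm (deriv f w) \<le> 4 * M / \<rho>" by (simp add: field_simps)
qed (use z \<open>\<rho> > 0\<close> in auto)

text \<open>Here \<open>q + x\<close> is the speed \<open>c\<close> and \<open>1 + \<sigma>\<close> the scaling factor \<open>s\<close>.\<close>

lemma speed_expansion:
  fixes q x \<sigma> b1 b2 :: complex and \<beta> :: real
  assumes E1: "q + x = (1 - (q + x)\<^sup>2) * b1 + q * (1 + \<sigma>) ^ 3"
    and E2: "(1 + \<sigma>)\<^sup>2 * (1 + q\<^sup>2 / 2) = 1 + (q + x)\<^sup>2 / 2 + (1 - (q + x)\<^sup>2) * b2"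
    and b: "norm b1 \<le> \<beta>" "norm b2 \<le> \<beta>" "\<beta> \<le> 1/20"
    and x: "norm x \<le> 20 * \<beta>" and \<sigma>: "norm \<sigma> \<le> 120 * \<beta>"
    and q: "norm q \<le> 1" and d: "0 < d" "d \<le> 1" "norm (1 - q\<^sup>2) = d"
  shows "norm (\<sigma> - (q * b1 + b2) / 2) \<le> 10 ^ 6 / d * \<beta>\<^sup>2"
    and "norm (x - (b1 * (q\<^sup>2 / 2 + 1) + 3 / 2 * b2 * q)) \<le> 10 ^ 6 / d * \<beta>\<^sup>2"
proof -
  have \<beta>: "\<beta> \<ge> 0" using b norm_ge_zero order_trans by blast
  \<comment> \<open>The terms of second and higher order in the two equations. Without them
    \<open>x\<close> and \<sigma> satisfy a linear system; eliminating \<open>x\<close> leaves the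
    factor 2 (1 - q^2) in front of \<sigma>, and this is the origin of 1/d.\<close>
  define e1 where "e1 = q * (\<sigma>\<^sup>2 * (3 + \<sigma>)) - x * (2 * q + x) * b1"
  define e2 where "e2 = x\<^sup>2 / 2 - x * (2 * q + x) * b2 - \<sigma>\<^sup>2 * (1 + q\<^sup>2 / 2)"
  define \<tau> where "\<tau> = (e2 + q * e1) / (2 * (1 - q\<^sup>2))"
  have d0: "1 - q\<^sup>2 \<noteq> 0" using d by auto
  have x1: "x = 3 * q * \<sigma> + (1 - q\<^sup>2) * b1 + e1"
    using E1 unfolding e1_def by (simp add: algebra_simps power2_eq_square power3_eq_cube)
  have x2: "\<sigma> * (2 + q\<^sup>2) = q * x + (1 - q\<^sup>2) * b2 + e2"
  proof -
    have "\<sigma> * (2 + q\<^sup>2) - (q * x + (1 - q\<^sup>2) * b2 + e2) =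
       (1 + \<sigma>)\<^sup>2 * (1 + q\<^sup>2 / 2) - (1 + (q + x)\<^sup>2 / 2 + (1 - (q + x)\<^sup>2) * b2)"
      unfolding e2_def by (simp add: field_simps power2_eq_square)
    then show ?thesis using E2 by simp
  qed
  have "2 * (1 - q\<^sup>2) * (\<sigma> - (q * b1 + b2) / 2) = e2 + q * e1"
  proof -
    have "\<sigma> * (2 + q\<^sup>2) = q * (3 * q * \<sigma> + (1 - q\<^sup>2) * b1 + e1) + (1 - q\<^sup>2) * b2 + e2"
      using x2 x1 by simp
    then have "(1 - q\<^sup>2) * (2 * \<sigma> - (q * b1 + b2)) = e2 + q * e1"
      by (simp add: algebra_simps power2_eq_square)
    moreover have "2 * (1 - q\<^sup>2) * (\<sigma> - X / 2) = (1 - q\<^sup>2) * (2 * \<sigma> - X)" for X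
      by (simp add: algebra_simps)
    ultimately show ?thesis by metis
  qed
  then have \<sigma>1: "\<sigma> - (q * b1 + b2) / 2 = \<tau>"
    unfolding \<tau>_def using d0 by (metis mult_eq_0_iff nonzero_mult_div_cancel_left zero_neq_numeral)
  have x3: "x - (b1 * (q\<^sup>2 / 2 + 1) + 3 / 2 * b2 * q) = 3 * q * \<tau> + e1"
    by (subst x1) (simp add: \<sigma>1[symmetric] field_simps power2_eq_square)
  have n2: "norm (\<sigma>\<^sup>2) \<le> 14400 * \<beta>\<^sup>2"
    using power_mono[OF \<sigma>, of 2] by (simp add: norm_power power_mult_distrib)
  have nx2: "norm (x\<^sup>2) \<le> 400 * \<beta>\<^sup>2"
    using power_mono[OF x, of 2] by (simp add: norm_power power_mult_distrib)
  have nx1: "norm x \<le> 1" using x b by linarith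
  have n3: "norm (3 + \<sigma>) \<le> 9" using norm_triangle_ineq[of 3 \<sigma>] \<sigma> b by simp
  have n4: "norm (2 * q + x) \<le> 3" using norm_triangle_ineq[of "2 * q" x] q nx1 by (simp add: norm_mult)
  have n5: "norm (x * (2 * q + x) * b) \<le> 60 * \<beta>\<^sup>2" if "norm b \<le> \<beta>" for b
  proof -
    have "norm (x * (2 * q + x) * b) \<le> (20 * \<beta>) * 3 * \<beta>"
      unfolding norm_mult using x n4 that \<beta> by (intro mult_mono) auto
    then show ?thesis by (simp add: power2_eq_square)
  qed
  have n6: "norm (1 + q\<^sup>2 / 2) \<le> 2"
    using norm_triangle_ineq[of 1 "q\<^sup>2 / 2"] power_mono[OF q, of 2] by (simp add: norm_divide norm_power)
  have ne1: "norm e1 \<le> 200000 * \<beta>\<^sup>2"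
  proof -
    have "norm (q * (\<sigma>\<^sup>2 * (3 + \<sigma>))) \<le> 1 * ((14400 * \<beta>\<^sup>2) * 9)"
      unfolding norm_mult using q n2 n3 by (intro mult_mono) auto
    then show ?thesis
      unfolding e1_def using n5[OF b(1)] norm_triangle_ineq4[of "q * (\<sigma>\<^sup>2 * (3 + \<sigma>))" "x * (2 * q + x) * b1"]
        zero_le_power2[of \<beta>] by linarith
  qed
  have ne2: "norm e2 \<le> 40000 * \<beta>\<^sup>2"
  proof -
    have "norm (\<sigma>\<^sup>2 * (1 + q\<^sup>2 / 2)) \<le> (14400 * \<beta>\<^sup>2) * 2"
      unfolding norm_mult using n2 n6 by (intro mult_mono) auto
    moreover have "norm (x\<^sup>2 / 2) \<le> 200 * \<beta>\<^sup>2" using nx2 by (simp add: norm_divide)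
    moreover have "norm e2 \<le> norm (x\<^sup>2 / 2) + norm (x * (2 * q + x) * b2) + norm (\<sigma>\<^sup>2 * (1 + q\<^sup>2 / 2))"
      unfolding e2_def by (meson norm_triangle_ineq4 order_trans add_mono order_refl)
    ultimately show ?thesis using n5[OF b(2)] zero_le_power2[of \<beta>] by linarith
  qed
  have nqe: "norm (q * e1) \<le> 1 * (200000 * \<beta>\<^sup>2)"
    unfolding norm_mult using q ne1 by (intro mult_mono) auto
  have n\<tau>: "norm \<tau> \<le> 120000 / d * \<beta>\<^sup>2"
  proof -
    have "norm \<tau> = norm (e2 + q * e1) / (2 * d)" unfolding \<tau>_def norm_divide norm_mult d(3) by simp
    also have "\<dots> \<le> (240000 * \<beta>\<^sup>2) / (2 * d)"
      using norm_triangle_ineq[of e2 "q * e1"] ne2 nqe d by (intro divide_right_mono) auto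
    finally show ?thesis by simp
  qed
  have mono: "A * \<beta>\<^sup>2 \<le> A / d * \<beta>\<^sup>2" if "A \<ge> 0" for A
    using that d by (intro mult_right_mono) (auto simp: field_simps mult_left_le)
  have dpos: "0 \<le> \<beta>\<^sup>2 / d" using d by simp
  have m: "A / d * \<beta>\<^sup>2 = A * (\<beta>\<^sup>2 / d)" for A by simp
  have six: "(10::real) ^ 6 = 1000000" by simp
  show "norm (\<sigma> - (q * b1 + b2) / 2) \<le> 10 ^ 6 / d * \<beta>\<^sup>2"
    unfolding \<sigma>1 using n\<tau> dpos unfolding m six by linarith
  \<comment> \<open>Here 360000/d + 200000 stays below 10^6/d because \<open>d\<close> is at most
    1.\<close>
  have "norm (3 * q * \<tau>) \<le> 3 * 1 * (120000 / d * \<beta>\<^sup>2)"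
    unfolding norm_mult using q n\<tau> by (intro mult_mono) auto
  then show "norm (x - (b1 * (q\<^sup>2 / 2 + 1) + 3 / 2 * b2 * q)) \<le> 10 ^ 6 / d * \<beta>\<^sup>2"
    unfolding x3 using norm_triangle_ineq[of "3 * q * \<tau>" e1] ne1 mono[of 200000] dpos unfolding m six by linarith
qed

text \<open>The scaling factor s; the principal root is the one near 1.\<close>

definition root_stretch :: "complex \<Rightarrow> complex \<Rightarrow> complex \<Rightarrow> complex" where
  "root_stretch q b1 b2 = csqrt (stretch q b2 (wave_speed q b1 b2))"

text \<open>The estimate \<open>mixed\<close> is the delicate one. On the whole disc c - q and s - 1
  are of size |b1| + |b2|, so by Cauchy's inequality their variation with \<open>q\<close> keeps
  this factor, as the mixed terms of the final error demand.\<close>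

locale speed_local =
  fixes q0 \<rho>0 K0 :: real
  assumes \<rho>0: "0 < \<rho>0" and K0: "K0 \<ge> 0"
    and main: "\<And>q b1 b2. q \<in> ball (of_real q0) \<rho>0 \<Longrightarrow> b1 \<in> ball 0 \<rho>0 \<Longrightarrow> b2 \<in> ball 0 \<rho>0 \<Longrightarrow>
      (let c = wave_speed q b1 b2; s = root_stretch q b1 b2 in
        c = (1 - c\<^sup>2) * b1 + q * s ^ 3 \<and> s\<^sup>2 * (1 + q\<^sup>2 / 2) = 1 + c\<^sup>2 / 2 + (1 - c\<^sup>2) * b2 \<and>
        Re (s\<^sup>2) > 0 \<and>
        norm (c - q) \<le> K0 * (norm b1 + norm b2) \<and> norm (s - 1) \<le> K0 * (norm b1 + norm b2) \<and>
        norm c \<le> K0 \<and> norm s \<le> K0 \<and> norm q \<le> K0)"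
    and hol: "\<And>F b1 b2. F = wave_speed \<or> F = root_stretch \<Longrightarrow> b1 \<in> ball 0 \<rho>0 \<Longrightarrow> b2 \<in> ball 0 \<rho>0 \<Longrightarrow>
        (\<lambda>q. F q b1 b2) holomorphic_on ball (of_real q0) \<rho>0"
      "\<And>F q b2. F = wave_speed \<or> F = root_stretch \<Longrightarrow> q \<in> ball (of_real q0) \<rho>0 \<Longrightarrow> b2 \<in> ball 0 \<rho>0 \<Longrightarrow>
        (\<lambda>b1. F q b1 b2) holomorphic_on ball 0 \<rho>0"
      "\<And>F q b1. F = wave_speed \<or> F = root_stretch \<Longrightarrow> q \<in> ball (of_real q0) \<rho>0 \<Longrightarrow> b1 \<in> ball 0 \<rho>0 \<Longrightarrow>
        (\<lambda>b2. F q b1 b2) holomorphic_on ball 0 \<rho>0"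
    and real: "\<And>q b1 b2. q \<in> ball (of_real q0) \<rho>0 \<Longrightarrow> b1 \<in> ball 0 \<rho>0 \<Longrightarrow> b2 \<in> ball 0 \<rho>0 \<Longrightarrow>
      q \<in> \<real> \<Longrightarrow> b1 \<in> \<real> \<Longrightarrow> b2 \<in> \<real> \<Longrightarrow> wave_speed q b1 b2 \<in> \<real> \<and> root_stretch q b1 b2 \<in> \<real>"
    and first_order: "\<And>b1 b2. b1 \<in> ball 0 \<rho>0 \<Longrightarrow> b2 \<in> ball 0 \<rho>0 \<Longrightarrow>
      norm (root_stretch (of_real q0) b1 b2 - 1 - (of_real q0 * b1 + b2) / 2) \<le> K0 * (norm b1 + norm b2)\<^sup>2 \<and>
      norm (wave_speed (of_real q0) b1 b2 - (of_real q0 + b1 * ((of_real q0)\<^sup>2 / 2 + 1) + 3 / 2 * b2 * of_real q0))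
        \<le> K0 * (norm b1 + norm b2)\<^sup>2"
    and mixed: "\<And>q b1 b2. q \<in> ball (of_real q0) (\<rho>0/2) \<Longrightarrow> b1 \<in> ball 0 \<rho>0 \<Longrightarrow> b2 \<in> ball 0 \<rho>0 \<Longrightarrow>
      norm ((wave_speed q b1 b2 - q) - (wave_speed (of_real q0) b1 b2 - of_real q0))
        \<le> K0 * (norm b1 + norm b2) * norm (q - of_real q0) \<and>
      norm (root_stretch q b1 b2 - root_stretch (of_real q0) b1 b2) \<le> K0 * (norm b1 + norm b2) * norm (q - of_real q0)"

lemma speed_local_exists:
  assumes q0: "0 < q0" "q0 < 1"
  obtains \<rho> K where "speed_local q0 \<rho> K"
proof -
  obtain r where r: "0 < r" "r \<le> 1"
    and main: "\<And>q b1 b2. q \<in> ball (of_real q0) r \<Longrightarrow> b1 \<in> ball 0 r \<Longrightarrow> b2 \<in> ball 0 r \<Longrightarrow>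
      (let c = wave_speed q b1 b2; Q = stretch q b2 c in
        c = (1 - c\<^sup>2) * b1 + q * (Q * csqrt Q) \<and> Re Q > 0 \<and> norm (1 + q\<^sup>2 / 2) \<ge> 1 / 2 \<and> 1 - q\<^sup>2 \<noteq> 0 \<and>
        norm (c - q) \<le> 20 * (norm b1 + norm b2))"
    and hol: "\<And>b1 b2. b1 \<in> ball 0 r \<Longrightarrow> b2 \<in> ball 0 r \<Longrightarrow> (\<lambda>q. wave_speed q b1 b2) holomorphic_on ball (of_real q0) r"
      "\<And>q b2. q \<in> ball (of_real q0) r \<Longrightarrow> b2 \<in> ball 0 r \<Longrightarrow> (\<lambda>b1. wave_speed q b1 b2) holomorphic_on ball 0 r"
      "\<And>q b1. q \<in> ball (of_real q0) r \<Longrightarrow> b1 \<in> ball 0 r \<Longrightarrow> (\<lambda>b2. wave_speed q b1 b2) holomorphic_on ball 0 r"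
    and real: "\<And>q b1 b2. q \<in> ball (of_real q0) r \<Longrightarrow> b1 \<in> ball 0 r \<Longrightarrow> b2 \<in> ball 0 r \<Longrightarrow>
      q \<in> \<real> \<Longrightarrow> b1 \<in> \<real> \<Longrightarrow> b2 \<in> \<real> \<Longrightarrow> wave_speed q b1 b2 \<in> \<real>"
    by (rule wave_speed_local[OF q0]) (rule that; blast)
  define \<rho> where "\<rho> = min r (1/40)"
  have \<rho>: "0 < \<rho>" "\<rho> \<le> 1/40" "\<rho> \<le> r" using r by (auto simp: \<rho>_def)
  have sub: "ball z \<rho> \<subseteq> ball z r" for z :: complex using \<rho> by auto
  define d where "d = 1 - q0\<^sup>2"
  have d: "0 < d" "d \<le> 1" using q0 by (auto simp: d_def power_less_one_iff abs_square_less_1)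
  have nd: "norm (1 - (complex_of_real q0)\<^sup>2) = d"
  proof -
    have "1 - (complex_of_real q0)\<^sup>2 = of_real d" by (simp add: d_def)
    then show ?thesis using d by simp
  qed
  \<comment> \<open>10^6/d comes from \<open>speed_expansion\<close>, and 480/\<rho> = 4 *
    120/\<rho> from \<open>holomorphic_lipschitz\<close> applied to s - 1; being at least 10^6, the
    sum also covers the numerical bounds in \<open>M\<close>.\<close>
  define K where "K = 10 ^ 6 / d + 480 / \<rho>"
  have z: "1000000 \<le> 10 ^ 6 / d" "0 \<le> 480 / \<rho>" using d \<rho> by (simp_all add: field_simps)
  have K: "K \<ge> 10 ^ 6 / d" using z unfolding K_def by simp
  have K2: "K \<ge> 480 / \<rho>" using order_trans[OF _ z(1), of 0] unfolding K_def by simp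
  have K3: "K \<ge> 1000000" using z(1) K by (rule order_trans)
  note K = K K2 K3
  have M: "let c = wave_speed q b1 b2; s = root_stretch q b1 b2 in
        c = (1 - c\<^sup>2) * b1 + q * s ^ 3 \<and> s\<^sup>2 * (1 + q\<^sup>2 / 2) = 1 + c\<^sup>2 / 2 + (1 - c\<^sup>2) * b2 \<and>
        Re (s\<^sup>2) > 0 \<and> 1 + q\<^sup>2 / 2 \<noteq> 0 \<and>
        norm (c - q) \<le> 20 * (norm b1 + norm b2) \<and> norm (s - 1) \<le> 120 * (norm b1 + norm b2) \<and>
        norm c \<le> 3 \<and> norm s \<le> 7 \<and> norm q \<le> 2"
    if q: "q \<in> ball (of_real q0) \<rho>" and b1: "b1 \<in> ball 0 \<rho>" and b2: "b2 \<in> ball 0 \<rho>" for q b1 b2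
  proof -
    define c where "c = wave_speed q b1 b2"
    define Q where "Q = stretch q b2 c"
    define s where "s = root_stretch q b1 b2"
    define \<beta> where "\<beta> = norm b1 + norm b2"
    have m: "c = (1 - c\<^sup>2) * b1 + q * (Q * csqrt Q)" "Re Q > 0" "norm (1 + q\<^sup>2 / 2) \<ge> 1 / 2" "1 - q\<^sup>2 \<noteq> 0"
        "norm (c - q) \<le> 20 * \<beta>"
      using main[OF subsetD[OF sub q] subsetD[OF sub b1] subsetD[OF sub b2]]
      unfolding Let_def c_def[symmetric] Q_def[symmetric] \<beta>_def by auto
    have s: "s = csqrt Q" by (simp add: s_def root_stretch_def Q_def c_def)
    then have sQ: "s\<^sup>2 = Q" by simp
    have "Q * csqrt Q = s\<^sup>2 * s" by (simp only: s power2_csqrt)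
    then have s3: "Q * csqrt Q = s ^ 3" by (simp add: power2_eq_square power3_eq_cube)
    have j0: "1 + q\<^sup>2 / 2 \<noteq> 0" using m(3) by auto
    have \<beta>: "\<beta> \<le> 1/20" "norm b2 \<le> \<beta>" using b1 b2 \<rho> by (auto simp: \<beta>_def)
    have nq: "norm q \<le> 2"
      using q q0 \<rho> norm_triangle_sub[of q "of_real q0"] by (simp add: dist_norm norm_minus_commute)
    have nc: "norm c \<le> 3" using norm_triangle_sub[of c q] m(5) nq \<beta> by linarith
    have Qj: "Q * (1 + q\<^sup>2 / 2) = 1 + c\<^sup>2 / 2 + (1 - c\<^sup>2) * b2"
      using j0 by (simp add: Q_def stretch_def)
    \<comment> \<open>Division by 1 + q^2/2, of norm at least 1/2, turns the bound 60 \<beta> into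
      120 \<beta>. The same bound passes to s - 1 = (Q - 1)/(s + 1), since Re s >= 0 gives |s + 1|
      >= 1.\<close>
    have "(Q - 1) * (1 + q\<^sup>2 / 2) = (c - q) * (c + q) / 2 + (1 - c\<^sup>2) * b2"
      using Qj by (simp add: algebra_simps power2_eq_square add_divide_distrib diff_divide_distrib)
    then have "norm (Q - 1) * norm (1 + q\<^sup>2 / 2) \<le> norm ((c - q) * (c + q) / 2) + norm ((1 - c\<^sup>2) * b2)"
      by (metis norm_mult norm_triangle_ineq)
    also have "\<dots> \<le> 20 * \<beta> * 5 / 2 + 10 * \<beta>"
    proof (intro add_mono)
      have "norm (c + q) \<le> 5" using norm_triangle_ineq[of c q] nc nq by linarith
      then have "norm (c - q) * norm (c + q) \<le> (20 * \<beta>) * 5"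
        using m(5) by (intro mult_mono) (auto simp: \<beta>_def)
      then show "norm ((c - q) * (c + q) / 2) \<le> 20 * \<beta> * 5 / 2" by (simp add: norm_mult norm_divide)
      have "norm (1 - c\<^sup>2) \<le> 10"
        using norm_triangle_ineq4[of 1 "c\<^sup>2"] power_mono[OF nc, of 2] by (simp add: norm_power)
      then show "norm ((1 - c\<^sup>2) * b2) \<le> 10 * \<beta>"
        unfolding norm_mult using \<beta> by (intro mult_mono) auto
    qed
    finally have "norm (Q - 1) * norm (1 + q\<^sup>2 / 2) \<le> 60 * \<beta>" by simp
    moreover have "norm (Q - 1) * (1/2) \<le> norm (Q - 1) * norm (1 + q\<^sup>2 / 2)"
      using m(3) by (intro mult_left_mono) auto
    ultimately have nQ: "norm (Q - 1) \<le> 120 * \<beta>" by linarith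
    have "Re (s + 1) \<ge> 1" using Re_csqrt[of Q] s by simp
    then have s1: "norm (s + 1) \<ge> 1" using complex_Re_le_cmod[of "s + 1"] by linarith
    have "(s - 1) * (s + 1) = Q - 1" using sQ by (simp add: algebra_simps power2_eq_square)
    then have "norm (s - 1) * norm (s + 1) = norm (Q - 1)" by (metis norm_mult)
    moreover have "norm (s - 1) * 1 \<le> norm (s - 1) * norm (s + 1)" using s1 by (intro mult_left_mono) auto
    ultimately have ns: "norm (s - 1) \<le> 120 * \<beta>" using nQ by linarith
    have n7: "norm s \<le> 7" using norm_triangle_sub[of s 1] ns \<beta> by simp
    show ?thesis
      unfolding Let_def c_def[symmetric] s_def[symmetric] \<beta>_def[symmetric]
      using m Qj s3 sQ j0 ns nc n7 nq by simp
  qed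
  have q0b: "complex_of_real q0 \<in> ball (of_real q0) \<rho>" using \<rho> by simp
  have rs_hol: "(\<lambda>x. root_stretch (f x) (g x) (h x)) holomorphic_on S"
    if "f holomorphic_on S" "h holomorphic_on S" "(\<lambda>x. wave_speed (f x) (g x) (h x)) holomorphic_on S"
      "\<And>x. x \<in> S \<Longrightarrow> f x \<in> ball (of_real q0) \<rho>" "\<And>x. x \<in> S \<Longrightarrow> g x \<in> ball 0 \<rho>" "\<And>x. x \<in> S \<Longrightarrow> h x \<in> ball 0 \<rho>" for f g h S
    unfolding root_stretch_def
  proof (rule holomorphic_on_csqrt')
    have j: "1 + (f x)\<^sup>2 / 2 \<noteq> 0" "Re (stretch (f x) (h x) (wave_speed (f x) (g x) (h x))) > 0" if x: "x \<in> S" for x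
      using M[of "f x" "g x" "h x"] \<open>\<And>x. x \<in> S \<Longrightarrow> f x \<in> _\<close>[OF x] \<open>\<And>x. x \<in> S \<Longrightarrow> g x \<in> _\<close>[OF x] \<open>\<And>x. x \<in> S \<Longrightarrow> h x \<in> _\<close>[OF x]
      unfolding Let_def root_stretch_def by auto
    show "(\<lambda>x. stretch (f x) (h x) (wave_speed (f x) (g x) (h x))) holomorphic_on S"
      unfolding stretch_def
      by (intro holomorphic_on_diff holomorphic_on_mult holomorphic_on_divide holomorphic_on_add
          holomorphic_on_power holomorphic_on_const that(1-3)) (auto dest: j(1))
    show "stretch (f x) (h x) (wave_speed (f x) (g x) (h x)) \<notin> \<real>\<^sub>\<le>\<^sub>0" if "x \<in> S" for x
      using Re_pos_not_nonpos[OF j(2)[OF that]] .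
  qed
  have h1: "(\<lambda>q. wave_speed q b1 b2) holomorphic_on ball (of_real q0) \<rho>" "(\<lambda>q. root_stretch q b1 b2) holomorphic_on ball (of_real q0) \<rho>"
    if "b1 \<in> ball 0 \<rho>" "b2 \<in> ball 0 \<rho>" for b1 b2
  proof -
    show w: "(\<lambda>q. wave_speed q b1 b2) holomorphic_on ball (of_real q0) \<rho>"
      by (rule holomorphic_on_subset[OF hol(1) sub]) (use that sub in blast)+
    show "(\<lambda>q. root_stretch q b1 b2) holomorphic_on ball (of_real q0) \<rho>"
      by (rule rs_hol[of "\<lambda>q. q" _ "\<lambda>_. b2" "\<lambda>_. b1"]) (use that w in \<open>auto intro: holomorphic_intros\<close>)
  qed
  have h2: "(\<lambda>b1. wave_speed q b1 b2) holomorphic_on ball 0 \<rho>" "(\<lambda>b1. root_stretch q b1 b2) holomorphic_on ball 0 \<rho>"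
    if "q \<in> ball (of_real q0) \<rho>" "b2 \<in> ball 0 \<rho>" for q b2
  proof -
    show w: "(\<lambda>b1. wave_speed q b1 b2) holomorphic_on ball 0 \<rho>"
      by (rule holomorphic_on_subset[OF hol(2) sub]) (use that sub in blast)+
    show "(\<lambda>b1. root_stretch q b1 b2) holomorphic_on ball 0 \<rho>"
      by (rule rs_hol[of "\<lambda>_. q" _ "\<lambda>_. b2" "\<lambda>b. b"]) (use that w in \<open>auto intro: holomorphic_intros\<close>)
  qed
  have h3: "(\<lambda>b2. wave_speed q b1 b2) holomorphic_on ball 0 \<rho>" "(\<lambda>b2. root_stretch q b1 b2) holomorphic_on ball 0 \<rho>"
    if "q \<in> ball (of_real q0) \<rho>" "b1 \<in> ball 0 \<rho>" for q b1
  proof -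
    show w: "(\<lambda>b2. wave_speed q b1 b2) holomorphic_on ball 0 \<rho>"
      by (rule holomorphic_on_subset[OF hol(3) sub]) (use that sub in blast)+
    show "(\<lambda>b2. root_stretch q b1 b2) holomorphic_on ball 0 \<rho>"
      by (rule rs_hol[of "\<lambda>_. q" _ "\<lambda>b. b" "\<lambda>_. b1"]) (use that w in \<open>auto intro: holomorphic_intros\<close>)
  qed
  show ?thesis
  proof (rule that[of \<rho> K], unfold_locales)
    show "K \<ge> 0" using K by linarith
    fix q b1 b2 :: complex
    assume q: "q \<in> ball (of_real q0) \<rho>" and b1: "b1 \<in> ball 0 \<rho>" and b2: "b2 \<in> ball 0 \<rho>"
    have "20 * (norm b1 + norm b2) \<le> K * (norm b1 + norm b2)" "120 * (norm b1 + norm b2) \<le> K * (norm b1 + norm b2)"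
      using K by (intro mult_right_mono; simp)+
    then show "let c = wave_speed q b1 b2; s = root_stretch q b1 b2 in
        c = (1 - c\<^sup>2) * b1 + q * s ^ 3 \<and> s\<^sup>2 * (1 + q\<^sup>2 / 2) = 1 + c\<^sup>2 / 2 + (1 - c\<^sup>2) * b2 \<and>
        Re (s\<^sup>2) > 0 \<and>
        norm (c - q) \<le> K * (norm b1 + norm b2) \<and> norm (s - 1) \<le> K * (norm b1 + norm b2) \<and>
        norm c \<le> K \<and> norm s \<le> K \<and> norm q \<le> K"
      using M[OF q b1 b2] K unfolding Let_def by auto
    assume re: "q \<in> \<real>" "b1 \<in> \<real>" "b2 \<in> \<real>"
    have c: "wave_speed q b1 b2 \<in> \<real>" by (rule real) (use sub q b1 b2 re in blast)+
    have "stretch q b2 (wave_speed q b1 b2) \<in> \<real>"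
      unfolding stretch_def using re c by (intro Reals_divide Reals_add Reals_mult Reals_diff Reals_power) auto
    moreover have "Re (stretch q b2 (wave_speed q b1 b2)) > 0"
      using M[OF q b1 b2] unfolding Let_def root_stretch_def by simp
    ultimately have "root_stretch q b1 b2 \<in> \<real>"
      unfolding root_stretch_def by (metis Reals_of_real csqrt_of_real less_imp_le of_real_Re)
    then show "wave_speed q b1 b2 \<in> \<real> \<and> root_stretch q b1 b2 \<in> \<real>" using c by simp
  next
    fix b1 b2 :: complex
    assume b1: "b1 \<in> ball 0 \<rho>" and b2: "b2 \<in> ball 0 \<rho>"
    define c where "c = wave_speed (of_real q0) b1 b2"
    define s where "s = root_stretch (of_real q0) b1 b2"
    define \<beta> where "\<beta> = norm b1 + norm b2"
    note m = M[OF q0b b1 b2, unfolded Let_def c_def[symmetric] s_def[symmetric] \<beta>_def[symmetric]]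
    have \<beta>: "\<beta> \<le> 1/20" "norm b1 \<le> \<beta>" "norm b2 \<le> \<beta>" using b1 b2 \<rho> by (auto simp: \<beta>_def)
    have E: "of_real q0 + (c - of_real q0) = (1 - (of_real q0 + (c - of_real q0))\<^sup>2) * b1 + of_real q0 * (1 + (s - 1)) ^ 3"
      "(1 + (s - 1))\<^sup>2 * (1 + (complex_of_real q0)\<^sup>2 / 2) = 1 + (of_real q0 + (c - of_real q0))\<^sup>2 / 2 + (1 - (of_real q0 + (c - of_real q0))\<^sup>2) * b2"
      using m by simp_all
    note sp = speed_expansion[OF E \<beta>(2,3,1) _ _ _ d nd]
    have le: "10 ^ 6 / d * \<beta>\<^sup>2 \<le> K * \<beta>\<^sup>2" using K by (intro mult_right_mono) auto
    have "norm (s - 1 - (of_real q0 * b1 + b2) / 2) \<le> 10 ^ 6 / d * \<beta>\<^sup>2"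
      by (rule sp(1)) (use m q0 in auto)
    moreover have "norm (c - of_real q0 - (b1 * ((of_real q0)\<^sup>2 / 2 + 1) + 3 / 2 * b2 * of_real q0)) \<le> 10 ^ 6 / d * \<beta>\<^sup>2"
      using sp(2) m q0 by simp
    ultimately have "norm (s - 1 - (of_real q0 * b1 + b2) / 2) \<le> K * \<beta>\<^sup>2 \<and>
      norm (c - (q0 + b1 * (q0\<^sup>2 / 2 + 1) + 3 / 2 * b2 * q0)) \<le> K * \<beta>\<^sup>2"
      using le by (simp add: algebra_simps)
    then show "norm (root_stretch (of_real q0) b1 b2 - 1 - (of_real q0 * b1 + b2) / 2) \<le> K * (norm b1 + norm b2)\<^sup>2 \<and>
      norm (wave_speed (of_real q0) b1 b2 - (of_real q0 + b1 * ((of_real q0)\<^sup>2 / 2 + 1) + 3 / 2 * b2 * of_real q0)) \<le> K * (norm b1 + norm b2)\<^sup>2"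
      by (simp add: c_def s_def \<beta>_def)
  next
    fix q b1 b2 :: complex
    assume q: "q \<in> ball (of_real q0) (\<rho>/2)" and b1: "b1 \<in> ball 0 \<rho>" and b2: "b2 \<in> ball 0 \<rho>"
    define \<beta> where "\<beta> = norm b1 + norm b2"
    have "norm ((wave_speed q b1 b2 - q) - (wave_speed (of_real q0) b1 b2 - of_real q0)) \<le> 4 * (20 * \<beta>) / \<rho> * norm (q - of_real q0)"
      using M[OF _ b1 b2] q \<rho> unfolding Let_def \<beta>_def
      by (intro holomorphic_lipschitz holomorphic_on_diff holomorphic_on_ident h1 b1 b2) auto
    moreover have "norm ((root_stretch q b1 b2 - 1) - (root_stretch (of_real q0) b1 b2 - 1)) \<le> 4 * (120 * \<beta>) / \<rho> * norm (q - of_real q0)"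
      using M[OF _ b1 b2] q \<rho> unfolding Let_def \<beta>_def
      by (intro holomorphic_lipschitz holomorphic_on_diff holomorphic_on_const h1 b1 b2) auto
    moreover have "4 * (20 * \<beta>) / \<rho> * norm (q - of_real q0) \<le> K * \<beta> * norm (q - of_real q0)"
      "4 * (120 * \<beta>) / \<rho> * norm (q - of_real q0) \<le> K * \<beta> * norm (q - of_real q0)"
    proof -
      have "(80 / \<rho>) * \<beta> \<le> K * \<beta>" "(480 / \<rho>) * \<beta> \<le> K * \<beta>"
        using K(2) \<rho> divide_right_mono[of 80 480 \<rho>] by (intro mult_right_mono; simp add: \<beta>_def)+
      then show "4 * (20 * \<beta>) / \<rho> * norm (q - of_real q0) \<le> K * \<beta> * norm (q - of_real q0)"
        "4 * (120 * \<beta>) / \<rho> * norm (q - of_real q0) \<le> K * \<beta> * norm (q - of_real q0)"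
        by (intro mult_right_mono; simp)+
    qed
    ultimately show "norm ((wave_speed q b1 b2 - q) - (wave_speed (of_real q0) b1 b2 - of_real q0)) \<le> K * (norm b1 + norm b2) * norm (q - of_real q0) \<and>
      norm (root_stretch q b1 b2 - root_stretch (of_real q0) b1 b2) \<le> K * (norm b1 + norm b2) * norm (q - of_real q0)"
      unfolding \<beta>_def by simp
  qed (use \<rho> h1 h2 h3 in auto)
qed

section \<open>The multiplier acting on the expansion\<close>

text \<open>The power of the amplitude is already part of \<open>p d\<close>. Arranged by order and
  frequency, the coefficients form an absolutely summable double family, so the multiplier may act
  term by term. Evenness of the symbol is required because \<open>multiplier_poly\<close> sees only
  the absolute frequency.\<close>

lemma fourier_mult_trig_series:
  fixes p :: "nat \<Rightarrow> complex poly"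
  assumes deg: "\<And>d. degree (p d) \<le> d" and C: "\<And>d. poly_norm (p d) \<le> C * (1/2) ^ d"
    and f: "\<And>z. (\<lambda>d. trig d (p d) (of_real z)) sums complex_of_real (f z)"
    and B: "\<And>n. \<bar>g (of_int n)\<bar> \<le> B" and ev: "\<And>n. g (of_int n) = g (of_nat (nat \<bar>n\<bar>))"
  shows "fourier_mult g f z = Re (\<Sum>d. trig d (multiplier_poly (\<lambda>n. of_real (g (of_nat n))) d (p d)) (of_real z))"
proof -
  define N where "N d = (\<lambda>i. 2 * int i - int d) ` {..d}" for d :: nat
  \<comment> \<open>At order d the frequency n sits at index (n + d)/2; frequencies of the wrong
    parity or beyond d receive the value 0.\<close>
  define X where "X d n = (if n \<in> N d then coeff (p d) (nat ((n + int d) div 2)) else 0)" for d n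
  have X: "X d (2 * int i - int d) = coeff (p d) i" if "i \<le> d" for d i
    using that by (simp add: X_def N_def)
  have inj: "inj_on (\<lambda>i. 2 * int i - int d) {..d}" for d by (auto simp: inj_on_def)
  have fin: "((\<lambda>n. h (X d n) n) has_sum (\<Sum>i\<le>d. h (coeff (p d) i) (2 * int i - int d))) UNIV"
    if "\<And>n. h 0 n = 0" for h :: "complex \<Rightarrow> int \<Rightarrow> 'z::{topological_comm_monoid_add, t2_space}" and d
  proof -
    have "((\<lambda>n. h (X d n) n) has_sum (\<Sum>n\<in>N d. h (X d n) n)) (N d)"
      by (rule has_sum_finite) (simp add: N_def)
    also have "(\<Sum>n\<in>N d. h (X d n) n) = (\<Sum>i\<le>d. h (coeff (p d) i) (2 * int i - int d))"
      unfolding N_def by (subst sum.reindex[OF inj]) (auto intro!: sum.cong simp: X)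
    finally show ?thesis
      by (subst has_sum_cong_neutral[where S = UNIV and T = "N d" and g = "\<lambda>n. h (X d n) n"]) (auto simp: X_def that)
  qed
  have sC: "summable (\<lambda>d. C * (1/2) ^ d)" by (intro summable_mult summable_geometric) simp
  have pn: "(\<lambda>d. poly_norm (p d)) summable_on UNIV"
  proof -
    have "summable (\<lambda>d. norm (poly_norm (p d)))"
      by (rule summable_comparison_test'[OF sC, of 0]) (simp add: C)
    then show ?thesis by (rule norm_summable_imp_summable_on)
  qed
  have sm: "(\<lambda>(d, n). norm (X d n)) summable_on UNIV"
  proof -
    have "(\<lambda>(d, n). norm (X d n)) summable_on (Sigma UNIV (\<lambda>_. UNIV))"
    proof (rule summable_on_SigmaI[OF _ pn])
      show "((\<lambda>n. case (d, n) of (d, n) \<Rightarrow> norm (X d n)) has_sum poly_norm (p d)) UNIV" for d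
        using fin[of "\<lambda>x n. norm x" d] by (simp add: poly_norm_altdef[OF deg])
    qed auto
    then show ?thesis by simp
  qed
  have main: "((\<lambda>(d, n). X d n * h n) has_sum (\<Sum>d. \<Sum>i\<le>d. coeff (p d) i * h (2 * int i - int d))) UNIV"
    if h: "\<And>n. norm (h n) \<le> D" for h :: "int \<Rightarrow> complex" and D
  proof -
    have D: "D \<ge> 0" using h[of 0] norm_ge_zero order_trans by blast
    have inner: "((\<lambda>n. X d n * h n) has_sum (\<Sum>i\<le>d. coeff (p d) i * h (2 * int i - int d))) UNIV" for d
      using fin[of "\<lambda>x n. x * h n" d] by simp
    have "norm (\<Sum>i\<le>d. coeff (p d) i * h (2 * int i - int d)) \<le> D * C * (1/2) ^ d" for d
    proof -
      have "norm (\<Sum>i\<le>d. coeff (p d) i * h (2 * int i - int d)) \<le> (\<Sum>i\<le>d. norm (coeff (p d) i) * D)"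
        by (rule sum_norm_le) (auto simp: norm_mult intro!: mult_left_mono h)
      also have "\<dots> = D * poly_norm (p d)"
        by (simp add: poly_norm_altdef[OF deg] sum_distrib_left mult.commute)
      also have "\<dots> \<le> D * (C * (1/2) ^ d)" using C D by (intro mult_left_mono)
      finally show ?thesis by simp
    qed
    note * = this
    have smn: "summable (\<lambda>d. norm (\<Sum>i\<le>d. coeff (p d) i * h (2 * int i - int d)))"
    proof (rule summable_comparison_test'[where N = 0 and g = "\<lambda>d. D * C * (1/2) ^ d", rotated])
      show "norm (norm (\<Sum>i\<le>d. coeff (p d) i * h (2 * int i - int d))) \<le> D * C * (1/2) ^ d" for d
        using *[of d] by simp
    qed (intro summable_mult summable_geometric, simp)
    have outer: "((\<lambda>d. \<Sum>i\<le>d. coeff (p d) i * h (2 * int i - int d)) has_sum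
        (\<Sum>d. \<Sum>i\<le>d. coeff (p d) i * h (2 * int i - int d))) UNIV"
      by (rule norm_summable_imp_has_sum[OF smn]) (rule summable_sums[OF summable_norm_cancel[OF smn]])
    have "(\<lambda>x. norm (case x of (d, n) \<Rightarrow> X d n * h n)) summable_on UNIV"
    proof (rule Infinite_Sum.abs_summable_on_comparison_test')
      show "(\<lambda>x. D * (case x of (d, n) \<Rightarrow> norm (X d n))) summable_on UNIV"
        by (rule summable_on_cmult_right[OF sm])
    qed (auto simp: norm_mult mult.commute[of _ "norm (h _)"] intro!: mult_right_mono h)
    then have "(\<lambda>(d, n). X d n * h n) summable_on (Sigma UNIV (\<lambda>_. UNIV))"
      using abs_summable_summable by (simp add: case_prod_unfold)
    then have "((\<lambda>(d, n). X d n * h n) has_sum (\<Sum>d. \<Sum>i\<le>d. coeff (p d) i * h (2 * int i - int d))) (Sigma UNIV (\<lambda>_. UNIV))"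
      by (rule has_sum_SigmaI[rotated 2]) (use inner outer in auto)
    then show ?thesis by simp
  qed
  have "fourier_mult g f z = Re (\<Sum>\<^sub>\<infinity>(d, n). of_real (g (of_int n)) * X d n * exp (\<i> * of_int n * of_real z))"
  proof (rule fourier_mult_double_series[where X = X and m = g and B = B and f = f])
    show "(\<lambda>(d, n). norm (X d n)) summable_on UNIV" by (rule sm)
    show "\<bar>g (of_int n)\<bar> \<le> B" for n by (rule B)
    fix z
    have "((\<lambda>(d, n). X d n * exp (\<i> * of_int n * of_real z)) has_sum (\<Sum>d. trig d (p d) (of_real z))) UNIV"
      unfolding trig_def by (rule main[of "\<lambda>n. exp (\<i> * of_int n * of_real z)" 1]) simp
    then show "((\<lambda>(d, n). X d n * exp (\<i> * of_int n * of_real z)) has_sum complex_of_real (f z)) UNIV"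
      using f[of z] by (simp add: sums_iff)
  qed
  also have "(\<Sum>\<^sub>\<infinity>(d, n). of_real (g (of_int n)) * X d n * exp (\<i> * of_int n * of_real z)) =
     (\<Sum>d. \<Sum>i\<le>d. coeff (p d) i * (of_real (g (of_int (2 * int i - int d))) * exp (\<i> * of_int (2 * int i - int d) * of_real z)))"
    using main[of "\<lambda>n. of_real (g (of_int n)) * exp (\<i> * of_int n * of_real z)" B] B
    by (simp add: infsumI norm_mult mult_ac)
  also have "\<dots> = (\<Sum>d. trig d (multiplier_poly (\<lambda>n. of_real (g (of_nat n))) d (p d)) (of_real z))"
    unfolding trig_def
  proof (intro suminf_cong sum.cong refl)
    fix d i :: nat assume "i \<in> {..d}"
    moreover have "g (of_int (2 * int i - int d)) = g (of_nat (mode d i))"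
      unfolding mode_def by (rule ev)
    ultimately show "coeff (p d) i * (of_real (g (of_int (2 * int i - int d))) * exp (\<i> * of_int (2 * int i - int d) * of_real z)) =
       coeff (multiplier_poly (\<lambda>n. of_real (g (of_nat n))) d (p d)) i * exp (\<i> * of_int (2 * int i - int d) * of_real z)"
      by (simp only: coeff_multiplier_poly) simp
  qed
  finally show ?thesis .
qed

section \<open>The sums of the series near a real wave number\<close>

definition eta_series :: "complex \<Rightarrow> complex \<Rightarrow> complex \<Rightarrow> complex" where
  "eta_series a \<kappa> z = trig_series (eta_coeff (cww2_complex \<kappa>)) a z"
definition w_series :: "complex \<Rightarrow> complex \<Rightarrow> complex \<Rightarrow> complex" where
  "w_series a \<kappa> z = trig_series (w_coeff (cww2_complex \<kappa>)) a z"
definition mult_eta_series :: "complex \<Rightarrow> complex \<Rightarrow> complex \<Rightarrow> complex" where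
  "mult_eta_series a \<kappa> z = trig_series (\<lambda>d. multiplier_poly (cww2_complex \<kappa>) d (eta_coeff (cww2_complex \<kappa>) d)) a z"
text \<open>All terms are constant in the phase, so the evaluation at 0 is merely one
  choice.\<close>

definition mu_series :: "complex \<Rightarrow> complex \<Rightarrow> complex" where
  "mu_series a \<kappa> = trig_series (mu_coeff (cww2_complex \<kappa>)) a 0"

lemma trig_mu: "trig d (mu_coeff m d) z = nu_coeff m (Suc d)"
proof (cases "even d")
  case False
  then show ?thesis by (simp add: mu_coeff_def speed_poly_def nu_coeff_even)
qed (simp add: mu_coeff_def speed_poly_def trig_monom_half)

lemma series_mu: "trig_series (mu_coeff (cww2_complex \<kappa>)) a z = mu_series a \<kappa>"
  by (simp add: trig_series_def mu_series_def trig_mu)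

lemma mu_series_minus: "mu_series (- a) \<kappa> = mu_series a \<kappa>"
proof -
  have "(- a) ^ d * nu_coeff m (Suc d) = a ^ d * nu_coeff m (Suc d)" for d m
    by (cases "even d") (simp_all add: nu_coeff_even)
  then show ?thesis unfolding trig_series_def mu_series_def trig_mu by (intro suminf_cong)
qed

lemma eta_series_0 [simp]: "eta_series 0 \<kappa> z = 0"
  by (simp add: eta_series_def trig_series_def power_0_left if_distrib[of "\<lambda>x. x * _"] cong: if_cong)
lemma w_series_0 [simp]: "w_series 0 \<kappa> z = 0"
  by (simp add: w_series_def trig_series_def power_0_left if_distrib[of "\<lambda>x. x * _"] cong: if_cong)
lemma mu_series_0 [simp]: "mu_series 0 \<kappa> = cww2_complex \<kappa> 1"
proof -
  have "(\<Sum>d. 0 ^ d * nu_coeff (cww2_complex \<kappa>) (Suc d)) = (\<Sum>d\<in>{0}. 0 ^ d * nu_coeff (cww2_complex \<kappa>) (Suc d))"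
    by (rule suminf_finite) auto
  then show ?thesis by (simp add: mu_series_def trig_series_def trig_mu coeff_1[simplified])
qed

locale stokes_local =
  fixes k0 r t B M :: real
  assumes k0: "k0 > 0" and r: "r > 0" "r \<le> k0 / 2" and t: "0 < t" "t \<le> 1" and M: "M \<ge> 0"
    and sep: "\<And>\<kappa> n. \<kappa> \<in> ball (of_real k0) r \<Longrightarrow> n \<noteq> 1 \<Longrightarrow> cww2_complex \<kappa> n \<noteq> cww2_complex \<kappa> 1"
    and bnd: "\<And>\<kappa> n. \<kappa> \<in> ball (of_real k0) r \<Longrightarrow> norm (cww2_complex \<kappa> n) \<le> M"
    and bounded_coeffs: "\<And>\<kappa>. \<kappa> \<in> ball (of_real k0) r \<Longrightarrow> geom_bounded t B (eta_coeff (cww2_complex \<kappa>))"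
        "\<And>\<kappa>. \<kappa> \<in> ball (of_real k0) r \<Longrightarrow> geom_bounded t B (w_coeff (cww2_complex \<kappa>))"
        "\<And>\<kappa>. \<kappa> \<in> ball (of_real k0) r \<Longrightarrow> geom_bounded t B (sigma_coeff (cww2_complex \<kappa>))"
        "\<And>\<kappa>. \<kappa> \<in> ball (of_real k0) r \<Longrightarrow> geom_bounded t B (mu_coeff (cww2_complex \<kappa>))"

lemma stokes_local_exists:
  assumes "k0 > 0"
  obtains r t B M where "stokes_local k0 r t B M"
proof -
  obtain r M \<delta> where r: "r > 0" "r \<le> k0 / 2" "\<delta> > 0" "M \<ge> 1"
    and M: "\<And>\<kappa> n. \<kappa> \<in> ball (of_real k0) r \<Longrightarrow> norm (cww2_complex \<kappa> n) \<le> M"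
    and sep: "\<And>\<kappa> n. \<kappa> \<in> ball (of_real k0) r \<Longrightarrow> n \<noteq> 1 \<Longrightarrow> norm (cww2_complex \<kappa> n - cww2_complex \<kappa> 1) \<ge> \<delta>"
    using cww2_complex_local[OF assms] by metis
  have "M \<ge> 0" using r by simp
  then obtain t B where t: "0 < t" "t \<le> 1" "B \<ge> 0"
    and bd: "\<And>m d. norm (m 1) \<le> M \<Longrightarrow> (\<And>n. n \<noteq> 1 \<Longrightarrow> norm (m n - m 1) \<ge> \<delta>) \<Longrightarrow>
       poly_norm (eta_coeff m d) * t ^ d \<le> B \<and> poly_norm (w_coeff m d) * t ^ d \<le> B \<and>
       poly_norm (sigma_coeff m d) * t ^ d \<le> B \<and> poly_norm (mu_coeff m d) * t ^ d \<le> B"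
    using stokes_bound[OF _ r(3), of M] by metis
  have "stokes_local k0 r t B M"
  proof
    fix \<kappa> :: complex and n :: nat assume \<kappa>: "\<kappa> \<in> ball (of_real k0) r"
    show "geom_bounded t B (eta_coeff (cww2_complex \<kappa>))" "geom_bounded t B (w_coeff (cww2_complex \<kappa>))"
      "geom_bounded t B (sigma_coeff (cww2_complex \<kappa>))" "geom_bounded t B (mu_coeff (cww2_complex \<kappa>))"
      unfolding geom_bounded_def using bd[of "cww2_complex \<kappa>", OF M[OF \<kappa>] sep[OF \<kappa>]]
      by (auto intro: palindromic_degree palindromic_eta palindromic_w palindromic_sigma palindromic_mu_coeff)
    show "norm (cww2_complex \<kappa> n) \<le> M" by (rule M[OF \<kappa>])
    show "n \<noteq> 1 \<Longrightarrow> cww2_complex \<kappa> n \<noteq> cww2_complex \<kappa> 1" using sep[OF \<kappa>, of n] r by auto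
  qed (use assms r t \<open>M \<ge> 0\<close> in auto)
  then show ?thesis by (rule that)
qed

context stokes_local begin

lemma geom_bounded_multiplier:
  assumes "\<kappa> \<in> ball (of_real k0) r"
  shows "geom_bounded t (M * B) (\<lambda>d. multiplier_poly (cww2_complex \<kappa>) d (eta_coeff (cww2_complex \<kappa>) d))"
  unfolding geom_bounded_def
proof (intro allI conjI)
  fix d
  define p where "p = eta_coeff (cww2_complex \<kappa>) d"
  have p: "degree p \<le> d" "poly_norm p * t ^ d \<le> B" using bounded_coeffs(1)[OF assms] by (auto simp: geom_bounded_def p_def)
  show deg: "degree (multiplier_poly (cww2_complex \<kappa>) d (eta_coeff (cww2_complex \<kappa>) d)) \<le> d"
    by (rule degree_le) (simp add: coeff_multiplier_poly)
  have "poly_norm (multiplier_poly (cww2_complex \<kappa>) d p) \<le> (\<Sum>i\<le>d. M * norm (coeff p i))"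
    unfolding poly_norm_altdef[OF deg[folded p_def]]
    by (intro sum_mono) (auto simp: coeff_multiplier_poly norm_mult intro!: mult_right_mono bnd assms)
  also have "\<dots> = M * poly_norm p" by (simp add: poly_norm_altdef[OF p(1)] sum_distrib_left)
  finally have "poly_norm (multiplier_poly (cww2_complex \<kappa>) d p) * t ^ d \<le> M * poly_norm p * t ^ d"
    using t by (intro mult_right_mono) auto
  also have "\<dots> \<le> M * B" using p(2) M by (simp add: mult.assoc mult_left_mono)
  finally show "poly_norm (multiplier_poly (cww2_complex \<kappa>) d (eta_coeff (cww2_complex \<kappa>) d)) * t ^ d \<le> M * B"
    by (simp add: p_def)
qed

lemma series_equations:
  assumes \<kappa>: "\<kappa> \<in> ball (of_real k0) r" and s: "small_amplitude t a z"
  shows "eta_series a \<kappa> z = w_series a \<kappa> z + w_series a \<kappa> z * eta_series a \<kappa> z"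
    and "2 * mult_eta_series a \<kappa> z = mu_series a \<kappa> * (2 * w_series a \<kappa> z - (w_series a \<kappa> z)\<^sup>2)"
proof -
  let ?m = "cww2_complex \<kappa>"
  have "trig_series (\<lambda>d. eta_coeff ?m d - w_coeff ?m d) a z = trig_series (w_coeff ?m) a z * trig_series (eta_coeff ?m) a z"
    unfolding eta_equation by (rule trig_series_mult[OF bounded_coeffs(2)[OF \<kappa>] bounded_coeffs(1)[OF \<kappa>] t(1) s])
  then show "eta_series a \<kappa> z = w_series a \<kappa> z + w_series a \<kappa> z * eta_series a \<kappa> z"
    using trig_series_diff[OF bounded_coeffs(1)[OF \<kappa>] bounded_coeffs(2)[OF \<kappa>] t(1) s]
    by (simp add: eta_series_def w_series_def algebra_simps)
  have "trig_series (\<lambda>d. 2 * w_coeff ?m d - sigma_coeff ?m d) a z = trig_series (w_coeff ?m) a z * trig_series (w_coeff ?m) a z"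
    unfolding sigma_equation by (simp add: trig_series_mult[OF bounded_coeffs(2)[OF \<kappa>] bounded_coeffs(2)[OF \<kappa>] t(1) s])
  moreover have "geom_bounded t (2 * B) (\<lambda>d. 2 * w_coeff ?m d)"
    unfolding geom_bounded_def
  proof (intro allI conjI)
    fix d
    show "degree (2 * w_coeff ?m d) \<le> d" by (rule palindromic_degree[OF palindromic_two[OF palindromic_w]])
    have "poly_norm (2 * w_coeff ?m d) * t ^ d \<le> 2 * poly_norm (w_coeff ?m d) * t ^ d"
      using t by (intro mult_right_mono poly_norm_two) auto
    then show "poly_norm (2 * w_coeff ?m d) * t ^ d \<le> 2 * B"
      using bounded_coeffs(2)[OF \<kappa>, unfolded geom_bounded_def, rule_format, of d] by linarith
  qed
  ultimately have sig: "trig_series (sigma_coeff ?m) a z = 2 * w_series a \<kappa> z - (w_series a \<kappa> z)\<^sup>2"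
    using trig_series_diff[OF _ bounded_coeffs(3)[OF \<kappa>] t(1) s, of "2 * B" "\<lambda>d. 2 * w_coeff ?m d"] trig_series_two[OF bounded_coeffs(2)[OF \<kappa>] t(1) s]
    by (simp add: w_series_def power2_eq_square algebra_simps)
  have wave: "2 * multiplier_poly ?m d (eta_coeff ?m d) = (\<Sum>e\<le>d. mu_coeff ?m e * sigma_coeff ?m (d - e))" for d
    by (rule wave_equation) (rule sep[OF \<kappa>])
  have "trig_series (\<lambda>d. 2 * multiplier_poly ?m d (eta_coeff ?m d)) a z = trig_series (mu_coeff ?m) a z * trig_series (sigma_coeff ?m) a z"
    unfolding wave by (rule trig_series_mult[OF bounded_coeffs(4)[OF \<kappa>] bounded_coeffs(3)[OF \<kappa>] t(1) s])
  then show "2 * mult_eta_series a \<kappa> z = mu_series a \<kappa> * (2 * w_series a \<kappa> z - (w_series a \<kappa> z)\<^sup>2)"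
    unfolding series_mu sig trig_series_two[OF geom_bounded_multiplier[OF \<kappa>] t(1) s] mult_eta_series_def .
qed

lemma norm_eta_w_series_le:
  assumes \<kappa>: "\<kappa> \<in> ball (of_real k0) r" and s: "small_amplitude t a z"
  shows "norm (eta_series a \<kappa> z) \<le> 2 * B" "norm (w_series a \<kappa> z) \<le> 2 * B"
  unfolding eta_series_def w_series_def by (rule norm_trig_series_le[OF _ t(1) s]; rule bounded_coeffs[OF \<kappa>])+

lemma small_amplitude_of_real: "norm a \<le> t / 2 \<Longrightarrow> small_amplitude t a (of_real x)"
  by (simp add: small_amplitude_def)

lemma holomorphic_coeffs:
  shows "(\<lambda>\<kappa>. coeff (eta_coeff (cww2_complex \<kappa>) d) i) holomorphic_on ball (of_real k0) r"
    and "(\<lambda>\<kappa>. coeff (w_coeff (cww2_complex \<kappa>) d) i) holomorphic_on ball (of_real k0) r"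
    and "(\<lambda>\<kappa>. coeff (mu_coeff (cww2_complex \<kappa>) d) i) holomorphic_on ball (of_real k0) r"
proof -
  \<comment> \<open>The abstract recursion lemma is applied to the ring of functions holomorphic on
    the disc.\<close>
  interpret function_ring "ball (of_real k0) r" "{f. f holomorphic_on ball (of_real k0) r}"
    by unfold_locales (auto intro: holomorphic_intros)
  have *: "coeffs_in (\<lambda>x. eta_coeff (cww2_complex x) d) \<and> coeffs_in (\<lambda>x. w_coeff (cww2_complex x) d) \<and>
    coeffs_in (\<lambda>x. sigma_coeff (cww2_complex x) d) \<and> (\<lambda>x. nu_coeff (cww2_complex x) d) \<in> {f. f holomorphic_on ball (of_real k0) r}" for d
    by (rule coeffs_in_stokes) (use cww2_complex_holomorphic[OF k0 r(2)] sep in auto)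
  show "(\<lambda>\<kappa>. coeff (eta_coeff (cww2_complex \<kappa>) d) i) holomorphic_on ball (of_real k0) r"
    "(\<lambda>\<kappa>. coeff (w_coeff (cww2_complex \<kappa>) d) i) holomorphic_on ball (of_real k0) r"
    using *[of d] by (auto simp: coeffs_in_def)
  show "(\<lambda>\<kappa>. coeff (mu_coeff (cww2_complex \<kappa>) d) i) holomorphic_on ball (of_real k0) r"
    using *[of "Suc d"] by (cases "i = d div 2") (auto simp: mu_coeff_def speed_poly_def)
qed

lemma series_holomorphic:
  assumes "norm a \<le> t / 2"
  shows "(\<lambda>\<kappa>. eta_series a \<kappa> (of_real x)) holomorphic_on ball (of_real k0) r"
    and "(\<lambda>\<kappa>. w_series a \<kappa> (of_real x)) holomorphic_on ball (of_real k0) r"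
    and "(\<lambda>\<kappa>. mu_series a \<kappa>) holomorphic_on ball (of_real k0) r"
proof -
  show "(\<lambda>\<kappa>. eta_series a \<kappa> (of_real x)) holomorphic_on ball (of_real k0) r"
    unfolding eta_series_def by (rule trig_series_holomorphic_parameter[OF bounded_coeffs(1) t(1) open_ball small_amplitude_of_real[OF assms] holomorphic_coeffs(1)])
  show "(\<lambda>\<kappa>. w_series a \<kappa> (of_real x)) holomorphic_on ball (of_real k0) r"
    unfolding w_series_def by (rule trig_series_holomorphic_parameter[OF bounded_coeffs(2) t(1) open_ball small_amplitude_of_real[OF assms] holomorphic_coeffs(2)])
  show "(\<lambda>\<kappa>. mu_series a \<kappa>) holomorphic_on ball (of_real k0) r"
    unfolding mu_series_def
    using trig_series_holomorphic_parameter[OF bounded_coeffs(4) t(1) open_ball small_amplitude_of_real[OF assms, of 0] holomorphic_coeffs(3)] by simp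
qed

lemma series_holomorphic_a:
  assumes \<kappa>: "\<kappa> \<in> ball (of_real k0) r"
  shows "(\<lambda>a. eta_series a \<kappa> (of_real x)) holomorphic_on ball 0 (t / 2)"
    and "(\<lambda>a. w_series a \<kappa> (of_real x)) holomorphic_on ball 0 (t / 2)"
    and "(\<lambda>a. mu_series a \<kappa>) holomorphic_on ball 0 (t / 2)"
proof -
  have s: "small_amplitude t a (of_real x)" if "a \<in> ball 0 (t / 2)" for a x using that by (intro small_amplitude_of_real) simp
  show "(\<lambda>a. eta_series a \<kappa> (of_real x)) holomorphic_on ball 0 (t / 2)"
    unfolding eta_series_def by (rule trig_series_holomorphic_amplitude[OF bounded_coeffs(1)[OF \<kappa>] t(1) open_ball s])
  show "(\<lambda>a. w_series a \<kappa> (of_real x)) holomorphic_on ball 0 (t / 2)"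
    unfolding w_series_def by (rule trig_series_holomorphic_amplitude[OF bounded_coeffs(2)[OF \<kappa>] t(1) open_ball s])
  show "(\<lambda>a. mu_series a \<kappa>) holomorphic_on ball 0 (t / 2)"
    unfolding mu_series_def
  proof (rule trig_series_holomorphic_amplitude[OF bounded_coeffs(4)[OF \<kappa>] t(1) open_ball])
    show "small_amplitude t a 0" if "a \<in> ball 0 (t / 2)" for a using s[OF that, of 0] by simp
  qed
qed

text \<open>In this strip exp |Im z| is at most 2, so |a| < t/4 gives
  \<open>small_amplitude\<close>. A strip around the real axis is what smoothness in z
  needs.\<close>

lemma series_holomorphic_z:
  assumes \<kappa>: "\<kappa> \<in> ball (of_real k0) r" and a: "norm a < t / 4"
  shows "(\<lambda>z. eta_series a \<kappa> z) holomorphic_on {z. \<bar>Im z\<bar> < ln 2}"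
    and "(\<lambda>z. w_series a \<kappa> z) holomorphic_on {z. \<bar>Im z\<bar> < ln 2}"
proof -
  have op: "open {z. \<bar>Im z\<bar> < ln 2}" by (intro open_Collect_less continuous_intros)
  have s: "small_amplitude t a z" if "z \<in> {z. \<bar>Im z\<bar> < ln 2}" for z
  proof -
    have "exp \<bar>Im z\<bar> \<le> exp (ln 2)" using that by (subst exp_le_cancel_iff) simp
    then have "norm a * exp \<bar>Im z\<bar> \<le> t / 4 * 2" using a t by (intro mult_mono) auto
    then show ?thesis by (simp add: small_amplitude_def)
  qed
  show "(\<lambda>z. eta_series a \<kappa> z) holomorphic_on {z. \<bar>Im z\<bar> < ln 2}"
    unfolding eta_series_def by (rule trig_series_holomorphic_phase[OF bounded_coeffs(1)[OF \<kappa>] t(1) op s])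
  show "(\<lambda>z. w_series a \<kappa> z) holomorphic_on {z. \<bar>Im z\<bar> < ln 2}"
    unfolding w_series_def by (rule trig_series_holomorphic_phase[OF bounded_coeffs(2)[OF \<kappa>] t(1) op s])
qed

end

section \<open>Real parameters: reality, the multiplier, low orders\<close>

lemma cww_minus: "cww (- x) = cww x"
  by (simp add: cww_def)

context stokes_local begin

lemma ball_real_pos: "of_real k \<in> ball (complex_of_real k0) r \<Longrightarrow> k > 0"
proof -
  assume "of_real k \<in> ball (complex_of_real k0) r"
  then have "\<bar>k0 - k\<bar> < r" by (simp add: dist_norm flip: of_real_diff)
  then show "k > 0" using k0 r by linarith
qed

lemma real_coeffs:
  assumes "of_real k \<in> ball (complex_of_real k0) r"
  shows "coeff (eta_coeff (cww2_complex (of_real k)) d) i \<in> \<real>" "coeff (w_coeff (cww2_complex (of_real k)) d) i \<in> \<real>"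
    "coeff (mu_coeff (cww2_complex (of_real k)) d) i \<in> \<real>"
proof -
  define S where "S = ball (complex_of_real k0) r \<inter> range of_real"
  \<comment> \<open>The same recursion lemma, now for the ring of functions with real values at the
    real points of the disc.\<close>
  interpret function_ring S "{f. \<forall>x\<in>S. f x \<in> \<real>}"
    by unfold_locales (auto intro: Reals_add Reals_mult Reals_divide)
  have "cww2_complex x n \<in> \<real>" if "x \<in> S" for x n
    using that ball_real_pos cww2_complex_of_real by (auto simp: S_def)
  then have *: "coeffs_in (\<lambda>x. eta_coeff (cww2_complex x) d) \<and> coeffs_in (\<lambda>x. w_coeff (cww2_complex x) d) \<and>
    coeffs_in (\<lambda>x. sigma_coeff (cww2_complex x) d) \<and> (\<lambda>x. nu_coeff (cww2_complex x) d) \<in> {f. \<forall>x\<in>S. f x \<in> \<real>}" for d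
    by (intro coeffs_in_stokes) (use sep in \<open>auto simp: S_def\<close>)
  have k: "of_real k \<in> S" using assms by (simp add: S_def)
  show "coeff (eta_coeff (cww2_complex (of_real k)) d) i \<in> \<real>" "coeff (w_coeff (cww2_complex (of_real k)) d) i \<in> \<real>"
    using *[of d] k by (auto simp: coeffs_in_def)
  show "coeff (mu_coeff (cww2_complex (of_real k)) d) i \<in> \<real>"
    using *[of "Suc d"] k by (auto simp: mu_coeff_def speed_poly_def)
qed

lemma real_series:
  assumes k: "of_real k \<in> ball (complex_of_real k0) r" and a: "\<bar>\<alpha>\<bar> \<le> t / 2"
  shows "eta_series (of_real \<alpha>) (of_real k) (of_real x) \<in> \<real>"
    and "w_series (of_real \<alpha>) (of_real k) (of_real x) \<in> \<real>"
    and "mu_series (of_real \<alpha>) (of_real k) \<in> \<real>"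
proof -
  have s: "small_amplitude t (of_real \<alpha>) (of_real x)" for x using a by (intro small_amplitude_of_real) simp
  show "eta_series (of_real \<alpha>) (of_real k) (of_real x) \<in> \<real>"
    unfolding eta_series_def by (rule trig_series_real[OF palindromic_eta real_coeffs(1)[OF k] _ bounded_coeffs(1)[OF k] t(1) s]) simp
  show "w_series (of_real \<alpha>) (of_real k) (of_real x) \<in> \<real>"
    unfolding w_series_def by (rule trig_series_real[OF palindromic_w real_coeffs(2)[OF k] _ bounded_coeffs(2)[OF k] t(1) s]) simp
  show "mu_series (of_real \<alpha>) (of_real k) \<in> \<real>"
    unfolding mu_series_def using trig_series_real[OF palindromic_mu_coeff real_coeffs(3)[OF k] _ bounded_coeffs(4)[OF k] t(1) s[of 0]] by simp
qed

text \<open>\<open>H\<close> and \<open>Q\<close> will be s^2 - 1 and s^2, as \<eta> is affine in e.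
  The constant passes through unchanged because the symbol is 1 at frequency 0.\<close>

lemma cww2_mult_eta:
  assumes k: "of_real k \<in> ball (complex_of_real k0) r" and a: "\<bar>\<alpha>\<bar> \<le> t / 2"
  shows "cww2_mult k (\<lambda>z. Re (of_real H + of_real Q * eta_series (of_real \<alpha>) (of_real k) (of_real z))) x =
    Re (of_real H + of_real Q * mult_eta_series (of_real \<alpha>) (of_real k) (of_real x))"
proof -
  define m where "m = cww2_complex (of_real k)"
  define E where "E = eta_coeff m"
  define g where "g = (\<lambda>n. (cww (n * k))\<^sup>2)"
  define p where "p d = smult (of_real Q * of_real \<alpha> ^ d) (E d) + (if d = 0 then [:of_real H:] else 0)" for d
  have kp: "k > 0" by (rule ball_real_pos[OF k])
  have s: "small_amplitude t (of_real \<alpha>) (of_real x)" for x using a by (intro small_amplitude_of_real) simp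
  have T: "degree (E d) \<le> d" "poly_norm (E d) * t ^ d \<le> B" for d
    using bounded_coeffs(1)[OF k] by (auto simp: geom_bounded_def E_def m_def)
  have gm: "complex_of_real (g (of_nat n)) = m n" for n
    using cww2_complex_of_real[OF kp, of n] by (simp add: g_def m_def)
  have ge: "g (of_int n) = g (of_nat (nat \<bar>n\<bar>))" for n
  proof (cases "n \<ge> 0")
    case False
    then have "real_of_int n * k = - (real (nat \<bar>n\<bar>) * k)" by simp
    then show ?thesis unfolding g_def by (simp only: cww_minus)
  qed simp
  have gB: "\<bar>g (of_int n)\<bar> \<le> M" for n
    using bnd[OF k, of "nat \<bar>n\<bar>"] unfolding ge gm[unfolded m_def, symmetric] by simp
  have tp: "trig d (p d) z = of_real Q * (of_real \<alpha> ^ d * trig d (E d) z) + (if d = 0 then of_real H else 0)" for d z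
    unfolding p_def trig_add by (simp add: trig_def sum_distrib_left mult_ac)
  have bounded_coeffs': "trig d (multiplier_poly m d (p d)) z =
      of_real Q * (of_real \<alpha> ^ d * trig d (multiplier_poly m d (E d)) z) + (if d = 0 then of_real H else 0)" for d z
  proof -
    have "m 0 = 1" by (simp add: m_def cww2_complex_def)
    then show ?thesis
      by (auto simp: trig_def coeff_multiplier_poly p_def mode_def sum_distrib_left algebra_simps)
  qed
  have sgl: "(\<lambda>d. if d = 0 then complex_of_real H else 0) sums of_real H"
    using sums_single[of 0 "\<lambda>_. complex_of_real H"] by simp
  have sm1: "(\<lambda>d. trig d (p d) (of_real z)) sums (of_real Q * eta_series (of_real \<alpha>) (of_real k) (of_real z) + of_real H)" for z
    unfolding tp eta_series_def trig_series_def m_def[symmetric] E_def[symmetric]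
    using summable_norm_cancel[OF summable_trig_series[OF bounded_coeffs(1)[OF k] t(1) s]]
    by (intro sums_add sums_mult summable_sums sgl) (simp add: E_def m_def)
  have sm2: "(\<lambda>d. trig d (multiplier_poly m d (p d)) (of_real z)) sums (of_real Q * mult_eta_series (of_real \<alpha>) (of_real k) (of_real z) + of_real H)" for z
    unfolding bounded_coeffs' mult_eta_series_def trig_series_def m_def[symmetric] E_def[symmetric]
    using summable_norm_cancel[OF summable_trig_series[OF geom_bounded_multiplier[OF k] t(1) s]]
    by (intro sums_add sums_mult summable_sums sgl) (simp add: E_def m_def)
  have "fourier_mult g (\<lambda>z. Re (of_real H + of_real Q * eta_series (of_real \<alpha>) (of_real k) (of_real z))) x =
    Re (\<Sum>d. trig d (multiplier_poly (\<lambda>n. of_real (g (of_nat n))) d (p d)) (of_real x))"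
  proof (rule fourier_mult_trig_series[OF _ _ _ gB ge])
    show "degree (p d) \<le> d" for d
    proof (cases "d = 0")
      case True
      then show ?thesis by (simp add: p_def E_def)
    next
      case False
      then show ?thesis using T(1)[of d] by (simp add: p_def)
    qed
    show "poly_norm (p d) \<le> (\<bar>Q\<bar> * B + \<bar>H\<bar>) * (1/2) ^ d" for d
    proof -
      have "poly_norm (p d) \<le> \<bar>Q\<bar> * (\<bar>\<alpha>\<bar> ^ d * poly_norm (E d)) + (if d = 0 then \<bar>H\<bar> else 0)"
        unfolding p_def by (rule order_trans[OF poly_norm_add]) (auto simp: poly_norm_smult norm_mult norm_power)
      also have "\<dots> \<le> \<bar>Q\<bar> * (B * (1/2) ^ d) + \<bar>H\<bar> * (1/2) ^ d"
      proof (intro add_mono mult_left_mono)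
        have "\<bar>\<alpha>\<bar> ^ d * poly_norm (E d) \<le> (t / 2) ^ d * poly_norm (E d)"
          using a by (intro mult_right_mono power_mono) auto
        also have "\<dots> = (poly_norm (E d) * t ^ d) * (1/2) ^ d" by (simp add: power_divide)
        also have "\<dots> \<le> B * (1/2) ^ d" using T(2) by (intro mult_right_mono) auto
        finally show "\<bar>\<alpha>\<bar> ^ d * poly_norm (E d) \<le> B * (1/2) ^ d" .
      qed auto
      finally show ?thesis by (simp add: algebra_simps)
    qed
    show "(\<lambda>d. trig d (p d) (of_real z)) sums complex_of_real (Re (of_real H + of_real Q * eta_series (of_real \<alpha>) (of_real k) (of_real z)))" for z
    proof -
      have "of_real H + of_real Q * eta_series (of_real \<alpha>) (of_real k) (of_real z) \<in> \<real>"
        using real_series(1)[OF k a] by (intro Reals_add Reals_mult) auto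
      then have eq: "complex_of_real (Re (of_real H + of_real Q * eta_series (of_real \<alpha>) (of_real k) (of_real z))) =
          of_real H + of_real Q * eta_series (of_real \<alpha>) (of_real k) (of_real z)"
        by (rule of_real_Re)
      show ?thesis unfolding eq using sm1[of z] by (simp add: add.commute)
    qed
  qed
  also have "(\<lambda>n. complex_of_real (g (of_nat n))) = m" using gm by auto
  also have "(\<Sum>d. trig d (multiplier_poly m d (p d)) (of_real x)) = of_real Q * mult_eta_series (of_real \<alpha>) (of_real k) (of_real x) + of_real H"
    using sm2[of x] by (rule sums_unique[symmetric])
  finally show ?thesis by (simp add: cww2_mult_def g_def add.commute)
qed

text \<open>Truncation after order 2, with the coefficients of \<open>eta_coeff_2\<close>,
  \<open>w_coeff_2\<close> and \<open>nu_coeff_3\<close> rewritten through h0 and h2. The linear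
  term in the third expansion is absent by \<open>nu_coeff_even\<close>.\<close>

lemma series_lower_order:
  assumes k: "of_real k \<in> ball (complex_of_real k0) r" and a: "norm a \<le> t / 2"
  defines "h0 \<equiv> 3 / 4 * (cww k)\<^sup>2 / ((cww k)\<^sup>2 - 1)"
    and "h2 \<equiv> 3 / 4 * (cww k)\<^sup>2 / ((cww k)\<^sup>2 - (cww (2 * k))\<^sup>2)"
  shows "norm (eta_series a (of_real k) (of_real x) - of_real (cos x) * a - a\<^sup>2 * of_real (h0 + h2 * cos (2 * x))) \<le> 2 * B / t ^ 3 * norm a ^ 3"
    and "norm (w_series a (of_real k) (of_real x) - of_real (cos x) * a - a\<^sup>2 * of_real (h0 - 1/2 + (h2 - 1/2) * cos (2 * x))) \<le> 2 * B / t ^ 3 * norm a ^ 3"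
    and "norm (mu_series a (of_real k) - of_real ((cww k)\<^sup>2) - a\<^sup>2 * of_real (3 / 2 * (cww k)\<^sup>2 * (2 * h0 + h2 - 1))) \<le> 2 * B / t ^ 3 * norm a ^ 3"
proof -
  define m where "m = cww2_complex (of_real k)"
  have kp: "k > 0" by (rule ball_real_pos[OF k])
  have m: "m n = of_real ((cww (real n * k))\<^sup>2)" for n
    unfolding m_def by (rule cww2_complex_of_real[OF kp])
  have m0: "m 0 = 1" by (simp add: m_def cww2_complex_def)
  define X where "X = - (3/8) * m 1 / (m 2 - m 1)"
  define Y where "Y = - (3/4) * m 1 / (m 0 - m 1)"
  have flip: "- u / (v - w) = u / (w - v)" for u v w :: complex
    by (metis minus_diff_eq minus_divide_divide)
  have Y: "Y = of_real h0"
  proof -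
    have "Y = (3/4) * m 1 / (m 1 - m 0)" unfolding Y_def using flip[of "(3/4) * m 1" "m 0" "m 1"] by simp
    also have "m 1 = of_real ((cww k)\<^sup>2)" using m[of 1] by simp
    finally show ?thesis by (simp add: h0_def m0)
  qed
  have X: "2 * X = of_real h2"
  proof -
    have "2 * X = (3/4) * m 1 / (m 1 - m 2)"
    proof -
      have "2 * (- (3/8) * m 1) = - ((3/4) * m 1)" by simp
      then show ?thesis unfolding X_def times_divide_eq_right[of 2] by (simp only: flip)
    qed
    then show ?thesis by (simp add: h2_def m)
  qed
  have e2: "eta_coeff m 2 = [:X, Y, X:]" by (simp add: eta_coeff_2 X_def Y_def Let_def)
  have cos: "cos (2 * complex_of_real x) = of_real (cos (2 * x))" "cos (complex_of_real x) = of_real (cos x)"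
    by (simp_all add: cos_of_real[symmetric])
  have te: "trig 2 (eta_coeff m 2) (of_real x) = of_real (h0 + h2 * cos (2 * x))"
    unfolding e2 trig_2 X Y cos by simp
  have tw: "trig 2 (w_coeff m 2) (of_real x) = of_real (h0 - 1/2 + (h2 - 1/2) * cos (2 * x))"
    unfolding w_coeff_2 trig_diff te trig_2 cos by (simp add: algebra_simps)
  have sum3: "(\<Sum>d<3. f d) = f 0 + f 1 + f 2" for f :: "nat \<Rightarrow> complex"
    by (simp add: numeral_3_eq_3 numeral_2_eq_2)
  show "norm (eta_series a (of_real k) (of_real x) - of_real (cos x) * a - a\<^sup>2 * of_real (h0 + h2 * cos (2 * x))) \<le> 2 * B / t ^ 3 * norm a ^ 3"
    using trig_series_remainder[OF bounded_coeffs(1)[OF k] t(1) a, of x 3]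
    unfolding eta_series_def m_def[symmetric] sum3 te coeff_1 trig_1 cos by (simp add: algebra_simps)
  show "norm (w_series a (of_real k) (of_real x) - of_real (cos x) * a - a\<^sup>2 * of_real (h0 - 1/2 + (h2 - 1/2) * cos (2 * x))) \<le> 2 * B / t ^ 3 * norm a ^ 3"
    using trig_series_remainder[OF bounded_coeffs(2)[OF k] t(1) a, of x 3]
    unfolding w_series_def m_def[symmetric] sum3 tw coeff_1 trig_1 cos by (simp add: algebra_simps)
  have nu3: "nu_coeff m (Suc 2) = of_real (3 / 2 * (cww k)\<^sup>2 * (2 * h0 + h2 - 1))"
  proof -
    have "nu_coeff m 3 = (3/2) * m 1 * (2 * Y + 2 * X - 1)" by (simp add: nu_coeff_3 e2)
    then show ?thesis unfolding X Y by (simp add: m)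
  qed
  have nu2: "nu_coeff m (Suc 1) = 0" by (rule nu_coeff_even) simp
  have nu1: "nu_coeff m (Suc 0) = of_real ((cww k)\<^sup>2)" using coeff_1(3)[of m] m[of 1] by simp
  have "norm (mu_series a (of_real k) - of_real ((cww k)\<^sup>2) - a\<^sup>2 * nu_coeff m (Suc 2)) \<le> 2 * B / t ^ 3 * norm a ^ 3"
    using trig_series_remainder[OF bounded_coeffs(4)[OF k] t(1) a, of 0 3]
    unfolding mu_series_def m_def[symmetric] sum3 trig_mu nu1 nu2 by (simp add: algebra_simps)
  then show "norm (mu_series a (of_real k) - of_real ((cww k)\<^sup>2) - a\<^sup>2 * of_real (3 / 2 * (cww k)\<^sup>2 * (2 * h0 + h2 - 1))) \<le> 2 * B / t ^ 3 * norm a ^ 3"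
    unfolding nu3 .
qed

end

section \<open>Asymptotics and the family of waves\<close>

text \<open>From q^2 to q through (q - q0) (q + q0) = q^2 - q0^2, where Re q >= 0 keeps |q + q0| >=
  q0. Replacing 1/(q + q0) by 1/(2 q0) costs a further factor q - q0, hence only an error of order
  a^4.\<close>

lemma sqrt_expansion:
  fixes q a \<nu> :: complex and q0 K \<alpha> :: real
  assumes q0: "0 < q0" and Re: "Re q \<ge> 0" and \<alpha>: "\<alpha> = norm a" "\<alpha> \<le> 1"
    and R: "norm (q\<^sup>2 - of_real (q0\<^sup>2) - a\<^sup>2 * \<nu>) \<le> K * \<alpha> ^ 3"
  defines "N \<equiv> (norm \<nu> + K) / q0"
  shows "norm (q - of_real q0) \<le> N * \<alpha>\<^sup>2"
    and "norm (q - of_real q0 - a\<^sup>2 * (\<nu> / (2 * of_real q0))) \<le> (2 * q0 * K + N * norm \<nu>) / (2 * q0\<^sup>2) * \<alpha> ^ 3"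
proof -
  define x where "x = complex_of_real q0"
  define r where "r = q\<^sup>2 - x\<^sup>2 - a\<^sup>2 * \<nu>"
  have r: "norm r \<le> K * \<alpha> ^ 3" using R by (simp add: r_def x_def)
  have \<alpha>0: "\<alpha> \<ge> 0" using \<alpha> by simp
  have a3: "\<alpha> ^ 3 \<le> \<alpha>\<^sup>2" using \<alpha>0 \<alpha>(2) by (intro power_decreasing) auto
  have a4: "\<alpha>\<^sup>2 * \<alpha>\<^sup>2 \<le> \<alpha> ^ 3"
    using \<alpha>0 \<alpha>(2) power_decreasing[of 3 4 \<alpha>] by (simp flip: power_add)
  have K: "K * \<alpha> ^ 3 \<ge> 0" using r norm_ge_zero order_trans by blast
  have "Re (q + x) \<ge> q0" using Re by (simp add: x_def)
  then have nq: "norm (q + x) \<ge> q0" using complex_Re_le_cmod[of "q + x"] by linarith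
  then have q0x: "q + x \<noteq> 0" using q0 by auto
  have x0: "x \<noteq> 0" using q0 by (simp add: x_def)
  have nx: "norm x = q0" using q0 by (simp add: x_def)
  have fac: "(q - x) * (q + x) = a\<^sup>2 * \<nu> + r"
    by (simp add: r_def algebra_simps power2_eq_square)
  have na: "norm (a\<^sup>2 * \<nu>) = \<alpha>\<^sup>2 * norm \<nu>" by (simp add: norm_mult norm_power \<alpha>)
  have K3: "K * \<alpha> ^ 3 \<le> K * \<alpha>\<^sup>2"
  proof (cases "\<alpha> = 0")
    case False
    then have "\<alpha> ^ 3 > 0" using \<alpha>0 by simp
    then have "K \<ge> 0" using K by (simp add: zero_le_mult_iff)
    then show ?thesis using a3 by (intro mult_left_mono)
  qed simp
  have "norm (q - x) * q0 \<le> norm (q - x) * norm (q + x)" using nq by (intro mult_left_mono) auto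
  also have "\<dots> = norm (a\<^sup>2 * \<nu> + r)" by (simp add: fac[symmetric] norm_mult)
  also have "\<dots> \<le> \<alpha>\<^sup>2 * norm \<nu> + K * \<alpha>\<^sup>2"
    using norm_triangle_ineq[of "a\<^sup>2 * \<nu>" r] r na K3 by linarith
  finally have "norm (q - x) \<le> (\<alpha>\<^sup>2 * norm \<nu> + K * \<alpha>\<^sup>2) / q0"
    using q0 by (simp add: pos_le_divide_eq)
  also have "\<dots> = N * \<alpha>\<^sup>2" by (simp add: N_def algebra_simps add_divide_distrib)
  finally have 1: "norm (q - x) \<le> N * \<alpha>\<^sup>2" .
  then show "norm (q - of_real q0) \<le> N * \<alpha>\<^sup>2" by (simp add: x_def)
  have eq: "(q - x - a\<^sup>2 * (\<nu> / (2 * x))) * (2 * x * (q + x)) = 2 * x * r - (q - x) * (a\<^sup>2 * \<nu>)"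
  proof -
    have "(q - x - a\<^sup>2 * (\<nu> / (2 * x))) * (2 * x * (q + x)) = 2 * x * ((q - x) * (q + x)) - a\<^sup>2 * \<nu> * (q + x)"
      using x0 by (simp add: field_simps)
    then show ?thesis unfolding fac by (simp add: algebra_simps)
  qed
  have "norm (q - x - a\<^sup>2 * (\<nu> / (2 * x))) * (2 * q0 * q0) \<le> norm (q - x - a\<^sup>2 * (\<nu> / (2 * x))) * norm (2 * x * (q + x))"
    unfolding norm_mult nx using nq q0 by (intro mult_left_mono mult_mono) auto
  also have "\<dots> = norm (2 * x * r - (q - x) * (a\<^sup>2 * \<nu>))" by (simp add: eq[symmetric] norm_mult)
  also have "\<dots> \<le> norm (2 * x * r) + norm ((q - x) * (a\<^sup>2 * \<nu>))" by (rule norm_triangle_ineq4)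
  also have "\<dots> \<le> 2 * q0 * (K * \<alpha> ^ 3) + N * norm \<nu> * \<alpha> ^ 3"
  proof (rule add_mono)
    show "norm (2 * x * r) \<le> 2 * q0 * (K * \<alpha> ^ 3)" using r q0 by (simp add: norm_mult nx)
    have N0: "0 \<le> N * \<alpha>\<^sup>2" using 1 norm_ge_zero order_trans by blast
    have "norm ((q - x) * (a\<^sup>2 * \<nu>)) \<le> N * \<alpha>\<^sup>2 * (\<alpha>\<^sup>2 * norm \<nu>)"
      unfolding norm_mult[of "q - x"] na using 1 by (intro mult_right_mono) auto
    also have "\<dots> = N * norm \<nu> * (\<alpha>\<^sup>2 * \<alpha>\<^sup>2)" by simp
    also have "\<dots> \<le> N * norm \<nu> * \<alpha> ^ 3"
    proof (cases "\<alpha> = 0")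
      case False
      then have "N \<ge> 0" using N0 by (simp add: zero_le_mult_iff)
      then show ?thesis using a4 by (intro mult_left_mono) auto
    qed simp
    finally show "norm ((q - x) * (a\<^sup>2 * \<nu>)) \<le> N * norm \<nu> * \<alpha> ^ 3" .
  qed
  finally have "norm (q - x - a\<^sup>2 * (\<nu> / (2 * x))) \<le> (2 * q0 * (K * \<alpha> ^ 3) + N * norm \<nu> * \<alpha> ^ 3) / (2 * q0 * q0)"
    using q0 by (simp add: pos_le_divide_eq)
  also have "\<dots> = (2 * q0 * K + N * norm \<nu>) / (2 * q0\<^sup>2) * \<alpha> ^ 3" by (simp add: algebra_simps power2_eq_square add_divide_distrib)
  finally show "norm (q - of_real q0 - a\<^sup>2 * (\<nu> / (2 * of_real q0))) \<le> (2 * q0 * K + N * norm \<nu>) / (2 * q0\<^sup>2) * \<alpha> ^ 3"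
    by (simp add: x_def)
qed

text \<open>The error \<alpha> (\<alpha> + \<beta>)^2 is made of \<alpha>^3, \<alpha>^2 \<beta> and
  \<alpha> \<beta>^2, and each remainder has to fit one of them. No pure power of \<beta> is
  admissible: therefore the comparison is with the exact values c0 and s0 at a = 0 instead of their
  expansions, and the hypotheses on c and s carry the product \<alpha>^2 \<beta>.\<close>

lemma combine_expansions:
  fixes a q q0 c c0 s s0 e w x h w2 L \<gamma> :: complex and \<alpha> \<beta> K :: real
  assumes \<alpha>: "\<alpha> = norm a" "\<alpha> \<le> 1" and \<beta>: "0 \<le> \<beta>" "\<beta> \<le> 1" and K: "K \<ge> 1"
    and q: "norm (q - q0) \<le> K * \<alpha>\<^sup>2" "norm (q - q0 - a\<^sup>2 * \<gamma>) \<le> K * \<alpha> ^ 3" "norm q \<le> K" "norm q0 \<le> K"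
    and c: "norm ((c - q) - (c0 - q0)) \<le> K * (\<alpha>\<^sup>2 * \<beta>)"
    and s: "norm (s - s0) \<le> K * (\<alpha>\<^sup>2 * \<beta>)" "norm s \<le> K" "norm s0 \<le> K" "norm (s - 1) \<le> K * \<beta>" "norm (s0 - 1) \<le> K * \<beta>"
      "norm (s0 - 1 - L / 2) \<le> K * \<beta>\<^sup>2"
    and e: "norm (e - a * x) \<le> K * \<alpha>\<^sup>2" "norm (e - a * x - a\<^sup>2 * h) \<le> K * \<alpha> ^ 3"
    and w: "norm (w - a * x) \<le> K * \<alpha>\<^sup>2" "norm (w - a * x - a\<^sup>2 * w2) \<le> K * \<alpha> ^ 3"
    and x: "norm x \<le> 1"
  defines "E \<equiv> \<alpha> * (\<alpha> + \<beta>)\<^sup>2"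
  shows "norm (c - (c0 + a\<^sup>2 * \<gamma>)) \<le> 20 * K ^ 3 * E"
    and "norm (s\<^sup>2 - 1 + s\<^sup>2 * e - (s0\<^sup>2 - 1 + a * x + a * L * x + a\<^sup>2 * h)) \<le> 20 * K ^ 3 * E"
    and "norm (c - s * q + s * q * w - (c0 - s0 * q0 + a * q0 * x + a * q0 * L * x / 2 + a\<^sup>2 * q0 * w2)) \<le> 20 * K ^ 3 * E"
proof -
  have \<alpha>0: "\<alpha> \<ge> 0" using \<alpha> by simp
  have E: "E = \<alpha> ^ 3 + 2 * (\<alpha>\<^sup>2 * \<beta>) + \<alpha> * \<beta>\<^sup>2"
    by (simp add: E_def power2_eq_square power3_eq_cube algebra_simps)
  have nn: "0 \<le> \<alpha> ^ 3" "0 \<le> \<alpha>\<^sup>2 * \<beta>" "0 \<le> \<alpha> * \<beta>\<^sup>2" using \<alpha>0 \<beta> by auto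
  have e1: "\<alpha> ^ 3 \<le> E" "\<alpha>\<^sup>2 * \<beta> \<le> E" "\<alpha> * \<beta>\<^sup>2 \<le> E" "0 \<le> E" using nn unfolding E by linarith+
  have e2: "\<alpha> ^ 3 * \<beta> \<le> E" "\<alpha>\<^sup>2 * \<alpha>\<^sup>2 \<le> E"
  proof -
    have "\<alpha> ^ 3 * \<beta> \<le> \<alpha> ^ 3 * 1" using \<beta> nn by (intro mult_left_mono) auto
    then show "\<alpha> ^ 3 * \<beta> \<le> E" using e1 by linarith
    have "\<alpha> ^ 3 * \<alpha> \<le> \<alpha> ^ 3 * 1" using \<alpha> nn by (intro mult_left_mono) auto
    then show "\<alpha>\<^sup>2 * \<alpha>\<^sup>2 \<le> E" using e1 by (simp add: power2_eq_square power3_eq_cube mult_ac)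
  qed
  have k2: "K \<le> K ^ 2" "K ^ 2 \<le> K ^ 3" "1 \<le> K ^ 3" using K by (auto intro: self_le_power power_increasing one_le_power)
  have k3: "K \<le> K ^ 3" using k2 by linarith
  have KE: "A * v \<le> K ^ 3 * E" if "0 \<le> A" "A \<le> K ^ 3" "v \<le> E" for A v
    using that e1 by (intro order_trans[OF mult_left_mono[of v E A] mult_right_mono]) auto
  have K30: "0 \<le> K ^ 3" using k2 by linarith
  have G: "0 \<le> K ^ 3 * E" using mult_nonneg_nonneg[OF K30 e1(4)] .
  have tw: "20 * K ^ 3 * E = 20 * (K ^ 3 * E)" by simp
  have na: "norm (a\<^sup>2) = \<alpha>\<^sup>2" by (simp add: norm_power \<alpha>)
  have nax: "norm (a * x) \<le> \<alpha>" using x \<alpha>0 by (simp add: norm_mult \<alpha> mult_left_le)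
  have T1: "norm ((c - q) - (c0 - q0)) \<le> K ^ 3 * E"
    using c KE[of K "\<alpha>\<^sup>2 * \<beta>"] k3 K e1 by linarith
  have T2: "norm (q - q0 - a\<^sup>2 * \<gamma>) \<le> K ^ 3 * E"
    using q(2) KE[of K "\<alpha> ^ 3"] k3 K e1 by linarith
  have "norm (c - (c0 + a\<^sup>2 * \<gamma>)) = norm (((c - q) - (c0 - q0)) + (q - q0 - a\<^sup>2 * \<gamma>))" by (simp add: algebra_simps)
  also have "\<dots> \<le> K ^ 3 * E + K ^ 3 * E" by (rule order_trans[OF norm_triangle_ineq add_mono[OF T1 T2]])
  also have "\<dots> \<le> 20 * K ^ 3 * E" using G unfolding tw by linarith
  finally show "norm (c - (c0 + a\<^sup>2 * \<gamma>)) \<le> 20 * K ^ 3 * E" .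
  have ss0: "norm (s\<^sup>2 - s0\<^sup>2) \<le> 2 * K ^ 2 * (\<alpha>\<^sup>2 * \<beta>)"
  proof -
    have "s\<^sup>2 - s0\<^sup>2 = (s - s0) * (s + s0)" by (simp add: algebra_simps power2_eq_square)
    then have "norm (s\<^sup>2 - s0\<^sup>2) = norm (s - s0) * norm (s + s0)" by (simp add: norm_mult)
    also have "\<dots> \<le> (K * (\<alpha>\<^sup>2 * \<beta>)) * (2 * K)"
      using s norm_triangle_ineq[of s s0] nn K by (intro mult_mono) auto
    finally show ?thesis by (simp add: power2_eq_square mult_ac)
  qed
  have s21: "norm (s\<^sup>2 - 1) \<le> 2 * K ^ 2 * \<beta>"
  proof -
    have "s\<^sup>2 - 1 = (s - 1) * (s + 1)" by (simp add: algebra_simps power2_eq_square)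
    then have "norm (s\<^sup>2 - 1) = norm (s - 1) * norm (s + 1)" by (simp add: norm_mult)
    also have "\<dots> \<le> (K * \<beta>) * (2 * K)"
      using s norm_triangle_ineq[of s 1] \<beta> K by (intro mult_mono) auto
    finally show ?thesis by (simp add: power2_eq_square mult_ac)
  qed
  have s0L: "norm (s0\<^sup>2 - 1 - L) \<le> 3 * K ^ 2 * \<beta>\<^sup>2"
  proof -
    have "s0\<^sup>2 - 1 - L = 2 * (s0 - 1 - L / 2) + (s0 - 1)\<^sup>2" by (simp add: algebra_simps power2_eq_square)
    then have "norm (s0\<^sup>2 - 1 - L) \<le> norm (2 * (s0 - 1 - L / 2)) + norm ((s0 - 1)\<^sup>2)" by (metis norm_triangle_ineq)
    also have "\<dots> \<le> 2 * (K * \<beta>\<^sup>2) + (K * \<beta>)\<^sup>2"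
      unfolding norm_mult norm_power using s(6) power_mono[OF s(5), of 2] by (intro add_mono) auto
    also have "\<dots> \<le> 2 * (K ^ 2 * \<beta>\<^sup>2) + K ^ 2 * \<beta>\<^sup>2"
      using k2 by (intro add_mono mult_left_mono mult_right_mono) (auto simp: power_mult_distrib)
    finally show ?thesis by simp
  qed
  \<comment> \<open>The five remainders are: the change of s^2 with \<open>a\<close>, the truncation
    of e, the coupling of s^2 - 1 with the higher orders of e, and the two errors made in replacing
    s^2 by 1 + L in front of a x.\<close>
  have "norm (s\<^sup>2 - 1 + s\<^sup>2 * e - (s0\<^sup>2 - 1 + a * x + a * L * x + a\<^sup>2 * h))
     = norm ((s\<^sup>2 - s0\<^sup>2) + (e - a * x - a\<^sup>2 * h) + (s\<^sup>2 - 1) * (e - a * x) + (s\<^sup>2 - s0\<^sup>2) * (a * x) + (s0\<^sup>2 - 1 - L) * (a * x))"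
    by (simp add: algebra_simps)
  also have "\<dots> \<le> 2 * (K ^ 3 * E) + K ^ 3 * E + 2 * (K ^ 3 * E) + 2 * (K ^ 3 * E) + 3 * (K ^ 3 * E)"
  proof (intro order_trans[OF norm_triangle_ineq] add_mono)
    show P: "norm (s\<^sup>2 - s0\<^sup>2) \<le> 2 * (K ^ 3 * E)"
      using ss0 KE[of "K ^ 2" "\<alpha>\<^sup>2 * \<beta>"] k2 e1 by simp
    show "norm (e - a * x - a\<^sup>2 * h) \<le> K ^ 3 * E"
      using e(2) KE[of K "\<alpha> ^ 3"] k3 K e1 by linarith
    have "norm ((s\<^sup>2 - 1) * (e - a * x)) \<le> (2 * K ^ 2 * \<beta>) * (K * \<alpha>\<^sup>2)"
      unfolding norm_mult using s21 e \<beta> K by (intro mult_mono) auto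
    also have "\<dots> = 2 * (K ^ 3 * (\<alpha>\<^sup>2 * \<beta>))" by (simp add: power2_eq_square power3_eq_cube)
    also have "\<dots> \<le> 2 * (K ^ 3 * E)" using e1 K30 by (intro mult_left_mono) auto
    finally show "norm ((s\<^sup>2 - 1) * (e - a * x)) \<le> 2 * (K ^ 3 * E)" .
    have "norm ((s\<^sup>2 - s0\<^sup>2) * (a * x)) \<le> 2 * (K ^ 3 * E) * 1"
      unfolding norm_mult[of "s\<^sup>2 - s0\<^sup>2"] using P nax \<alpha> G by (intro mult_mono) auto
    then show "norm ((s\<^sup>2 - s0\<^sup>2) * (a * x)) \<le> 2 * (K ^ 3 * E)" by simp
    have "norm ((s0\<^sup>2 - 1 - L) * (a * x)) \<le> (3 * K ^ 2 * \<beta>\<^sup>2) * \<alpha>"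
      unfolding norm_mult[of "s0\<^sup>2 - 1 - L"] using s0L nax K by (intro mult_mono) auto
    also have "\<dots> = 3 * (K ^ 2 * (\<alpha> * \<beta>\<^sup>2))" by simp
    also have "\<dots> \<le> 3 * (K ^ 3 * E)" using KE[of "K ^ 2" "\<alpha> * \<beta>\<^sup>2"] k2 e1 by simp
    finally show "norm ((s0\<^sup>2 - 1 - L) * (a * x)) \<le> 3 * (K ^ 3 * E)" .
  qed
  also have "\<dots> \<le> 20 * K ^ 3 * E" using G unfolding tw by linarith
  finally show "norm (s\<^sup>2 - 1 + s\<^sup>2 * e - (s0\<^sup>2 - 1 + a * x + a * L * x + a\<^sup>2 * h)) \<le> 20 * K ^ 3 * E" .
  have sL: "norm (s - 1 - L / 2) \<le> K * (\<alpha>\<^sup>2 * \<beta>) + K * \<beta>\<^sup>2"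
  proof -
    have "s - 1 - L / 2 = (s - s0) + (s0 - 1 - L / 2)" by simp
    then have "norm (s - 1 - L / 2) \<le> norm (s - s0) + norm (s0 - 1 - L / 2)" by (metis norm_triangle_ineq)
    then show ?thesis using s(1,6) by linarith
  qed
  have sq: "norm (s * q - q0) \<le> K ^ 2 * \<beta> + K ^ 2 * \<alpha>\<^sup>2"
  proof -
    have "s * q - q0 = (s - 1) * q0 + s * (q - q0)" by (simp add: algebra_simps)
    then have "norm (s * q - q0) \<le> norm (s - 1) * norm q0 + norm s * norm (q - q0)"
      by (metis norm_mult norm_triangle_ineq)
    also have "\<dots> \<le> (K * \<beta>) * K + K * (K * \<alpha>\<^sup>2)"
      using s q K \<beta> by (intro add_mono mult_mono) auto
    finally show ?thesis by (simp add: power2_eq_square mult_ac)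
  qed
  \<comment> \<open>The point is to split c - s q = (c - q) - (s - 1) q so that its change with
    \<open>a\<close> always keeps a factor \<beta>: c - q changes by \<alpha>^2 \<beta>, and (s - 1)
    q by (s - s0) q + (s0 - 1) (q - q0).\<close>
  have "norm (c - s * q + s * q * w - (c0 - s0 * q0 + a * q0 * x + a * q0 * L * x / 2 + a\<^sup>2 * q0 * w2))
     = norm (((c - q) - (c0 - q0)) + (- ((s - s0) * q)) + (- ((s0 - 1) * (q - q0))) + q0 * (w - a * x - a\<^sup>2 * w2)
        + (s - 1 - L / 2) * q0 * (a * x) + s * (q - q0) * (a * x) + (s * q - q0) * (w - a * x))"
    by (simp add: algebra_simps)
  also have "\<dots> \<le> K ^ 3 * E + K ^ 3 * E + K ^ 3 * E + K ^ 3 * E + 2 * (K ^ 3 * E) + K ^ 3 * E + 2 * (K ^ 3 * E)"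
  proof (intro order_trans[OF norm_triangle_ineq] add_mono)
    show "norm ((c - q) - (c0 - q0)) \<le> K ^ 3 * E" by (rule T1)
    have "norm ((s - s0) * q) \<le> (K * (\<alpha>\<^sup>2 * \<beta>)) * K"
      unfolding norm_mult using s q nn K by (intro mult_mono) auto
    also have "\<dots> = K ^ 2 * (\<alpha>\<^sup>2 * \<beta>)" by (simp add: power2_eq_square)
    also have "\<dots> \<le> K ^ 3 * E" using KE[of "K ^ 2" "\<alpha>\<^sup>2 * \<beta>"] k2 e1 by simp
    finally show "norm (- ((s - s0) * q)) \<le> K ^ 3 * E" by simp
    have "norm ((s0 - 1) * (q - q0)) \<le> (K * \<beta>) * (K * \<alpha>\<^sup>2)"
      unfolding norm_mult using s q \<beta> K by (intro mult_mono) auto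
    also have "\<dots> = K ^ 2 * (\<alpha>\<^sup>2 * \<beta>)" by (simp add: power2_eq_square)
    also have "\<dots> \<le> K ^ 3 * E" using KE[of "K ^ 2" "\<alpha>\<^sup>2 * \<beta>"] k2 e1 by simp
    finally show "norm (- ((s0 - 1) * (q - q0))) \<le> K ^ 3 * E" by simp
    have "norm (q0 * (w - a * x - a\<^sup>2 * w2)) \<le> K * (K * \<alpha> ^ 3)"
      unfolding norm_mult using q w K by (intro mult_mono) auto
    also have "\<dots> = K ^ 2 * \<alpha> ^ 3" by (simp add: power2_eq_square)
    also have "\<dots> \<le> K ^ 3 * E" using KE[of "K ^ 2" "\<alpha> ^ 3"] k2 e1 by simp
    finally show "norm (q0 * (w - a * x - a\<^sup>2 * w2)) \<le> K ^ 3 * E" .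
    have "norm ((s - 1 - L / 2) * q0 * (a * x)) \<le> ((K * (\<alpha>\<^sup>2 * \<beta>) + K * \<beta>\<^sup>2) * K) * \<alpha>"
      unfolding norm_mult[of _ "a * x"] norm_mult[of _ q0] using sL q nax K nn \<beta> by (intro mult_mono) auto
    also have "\<dots> = K ^ 2 * (\<alpha> ^ 3 * \<beta>) + K ^ 2 * (\<alpha> * \<beta>\<^sup>2)" by (simp add: power2_eq_square power3_eq_cube algebra_simps)
    also have "\<dots> \<le> 2 * (K ^ 3 * E)" using KE[of "K ^ 2" "\<alpha> ^ 3 * \<beta>"] KE[of "K ^ 2" "\<alpha> * \<beta>\<^sup>2"] k2 e1 e2 by simp
    finally show "norm ((s - 1 - L / 2) * q0 * (a * x)) \<le> 2 * (K ^ 3 * E)" .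
    have "norm (s * (q - q0) * (a * x)) \<le> (K * (K * \<alpha>\<^sup>2)) * \<alpha>"
      unfolding norm_mult[of _ "a * x"] norm_mult[of s] using s q nax K by (intro mult_mono) auto
    also have "\<dots> = K ^ 2 * \<alpha> ^ 3" by (simp add: power2_eq_square power3_eq_cube)
    also have "\<dots> \<le> K ^ 3 * E" using KE[of "K ^ 2" "\<alpha> ^ 3"] k2 e1 by simp
    finally show "norm (s * (q - q0) * (a * x)) \<le> K ^ 3 * E" .
    have "norm ((s * q - q0) * (w - a * x)) \<le> (K ^ 2 * \<beta> + K ^ 2 * \<alpha>\<^sup>2) * (K * \<alpha>\<^sup>2)"
      unfolding norm_mult[of "s * q - q0"] using sq w K \<beta> by (intro mult_mono) auto
    also have "\<dots> = K ^ 3 * (\<alpha>\<^sup>2 * \<beta>) + K ^ 3 * (\<alpha>\<^sup>2 * \<alpha>\<^sup>2)" by (simp add: power2_eq_square power3_eq_cube algebra_simps)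
    also have "\<dots> \<le> K ^ 3 * E + K ^ 3 * E" using e1 e2 K30 by (intro add_mono mult_left_mono) auto
    finally show "norm ((s * q - q0) * (w - a * x)) \<le> 2 * (K ^ 3 * E)" by linarith
  qed
  also have "\<dots> \<le> 20 * K ^ 3 * E" using G unfolding tw by linarith
  finally show "norm (c - s * q + s * q * w - (c0 - s0 * q0 + a * q0 * x + a * q0 * L * x / 2 + a\<^sup>2 * q0 * w2)) \<le> 20 * K ^ 3 * E" .
qed

section \<open>The wave as a separately holomorphic family\<close>

lemma separately_holomorphic4I:
  assumes "\<And>y v w. y \<in> ball 0 \<rho> \<Longrightarrow> v \<in> ball 0 \<rho> \<Longrightarrow> w \<in> ball 0 \<rho> \<Longrightarrow> (\<lambda>x. F x y v w) holomorphic_on ball 0 \<rho>"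
    and "\<And>x v w. x \<in> ball 0 \<rho> \<Longrightarrow> v \<in> ball 0 \<rho> \<Longrightarrow> w \<in> ball 0 \<rho> \<Longrightarrow> (\<lambda>y. F x y v w) holomorphic_on ball 0 \<rho>"
    and "\<And>x y w. x \<in> ball 0 \<rho> \<Longrightarrow> y \<in> ball 0 \<rho> \<Longrightarrow> w \<in> ball 0 \<rho> \<Longrightarrow> (\<lambda>v. F x y v w) holomorphic_on ball 0 \<rho>"
    and "\<And>x y v. x \<in> ball 0 \<rho> \<Longrightarrow> y \<in> ball 0 \<rho> \<Longrightarrow> v \<in> ball 0 \<rho> \<Longrightarrow> (\<lambda>w. F x y v w) holomorphic_on ball 0 \<rho>"
  shows "separately_holomorphic4 \<rho> F"
  using assms unfolding separately_holomorphic4_def by blast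

lemma separately_holomorphic4_const: "separately_holomorphic4 \<rho> (\<lambda>x y v w. c)"
  by (simp add: separately_holomorphic4_def)

lemma separately_holomorphic4_add:
  "separately_holomorphic4 \<rho> F \<Longrightarrow> separately_holomorphic4 \<rho> G \<Longrightarrow> separately_holomorphic4 \<rho> (\<lambda>x y v w. F x y v w + G x y v w)"
  unfolding separately_holomorphic4_def by (auto intro!: holomorphic_on_add)

lemma separately_holomorphic4_diff:
  "separately_holomorphic4 \<rho> F \<Longrightarrow> separately_holomorphic4 \<rho> G \<Longrightarrow> separately_holomorphic4 \<rho> (\<lambda>x y v w. F x y v w - G x y v w)"
  unfolding separately_holomorphic4_def by (auto intro!: holomorphic_on_diff)

lemma separately_holomorphic4_mult:
  "separately_holomorphic4 \<rho> F \<Longrightarrow> separately_holomorphic4 \<rho> G \<Longrightarrow> separately_holomorphic4 \<rho> (\<lambda>x y v w. F x y v w * G x y v w)"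
  unfolding separately_holomorphic4_def by (auto intro!: holomorphic_on_mult)

lemma holomorphic_on_ball_shift:
  assumes "f holomorphic_on ball c \<rho>" "norm d + s \<le> \<rho>"
  shows "(\<lambda>x. f (c + (d + x))) holomorphic_on ball 0 s"
proof -
  have "(\<lambda>x. c + (d + x)) ` ball 0 s \<subseteq> ball c \<rho>"
  proof
    fix y assume "y \<in> (\<lambda>x. c + (d + x)) ` ball 0 s"
    then obtain x where "norm x < s" "y = c + (d + x)" by auto
    then have "dist c y = norm (- (d + x))" by (simp add: dist_norm)
    then have "dist c y = norm (d + x)" by (simp only: norm_minus_cancel)
    then show "y \<in> ball c \<rho>" using \<open>norm x < s\<close> assms(2) norm_triangle_ineq[of d x] by simp
  qed
  moreover have "(\<lambda>x. c + (d + x)) holomorphic_on ball 0 s" by (intro holomorphic_intros)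
  ultimately show ?thesis
    using holomorphic_on_compose_gen[of "\<lambda>x. c + (d + x)" "ball 0 s" f "ball c \<rho>"] assms(1) by (simp add: o_def)
qed

lemma separately_holomorphic4_shift:
  assumes F: "separately_holomorphic4 \<rho> F"
    and d: "norm d1 + s \<le> \<rho>" "norm d2 + s \<le> \<rho>" "norm d3 + s \<le> \<rho>" "norm d4 + s \<le> \<rho>"
  shows "separately_holomorphic4 s (\<lambda>x y v w. F (d1 + x) (d2 + y) (d3 + v) (d4 + w))"
proof -
  have m: "d + x \<in> ball 0 \<rho>" if "norm d + s \<le> \<rho>" "x \<in> ball 0 s" for d x :: complex
    using that norm_triangle_ineq[of d x] by simp
  have sh: "(\<lambda>x. f (d + x)) holomorphic_on ball 0 s" if "f holomorphic_on ball 0 \<rho>" "norm d + s \<le> \<rho>" for f d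
    using holomorphic_on_ball_shift[OF that] by simp
  note F' = F[unfolded separately_holomorphic4_def]
  show ?thesis
  proof (rule separately_holomorphic4I)
    fix a b c :: complex assume abc: "a \<in> ball 0 s" "b \<in> ball 0 s" "c \<in> ball (0::complex) s"
    show "(\<lambda>x. F (d1 + x) (d2 + a) (d3 + b) (d4 + c)) holomorphic_on ball 0 s"
      using F' m[OF d(2) abc(1)] m[OF d(3) abc(2)] m[OF d(4) abc(3)] by (intro sh[OF _ d(1)]) blast
    show "(\<lambda>y. F (d1 + a) (d2 + y) (d3 + b) (d4 + c)) holomorphic_on ball 0 s"
      using F' m[OF d(1) abc(1)] m[OF d(3) abc(2)] m[OF d(4) abc(3)] by (intro sh[OF _ d(2)]) blast
    show "(\<lambda>v. F (d1 + a) (d2 + b) (d3 + v) (d4 + c)) holomorphic_on ball 0 s"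
      using F' m[OF d(1) abc(1)] m[OF d(2) abc(2)] m[OF d(4) abc(3)] by (intro sh[OF _ d(3)]) blast
    show "(\<lambda>w. F (d1 + a) (d2 + b) (d3 + c) (d4 + w)) holomorphic_on ball 0 s"
      using F' m[OF d(1) abc(1)] m[OF d(2) abc(2)] m[OF d(3) abc(3)] by (intro sh[OF _ d(4)]) blast
  qed
qed

definition speed0 :: "complex \<Rightarrow> complex \<Rightarrow> complex" where
  "speed0 a \<kappa> = csqrt (mu_series a \<kappa>)"
definition speed_c :: "complex \<Rightarrow> complex \<Rightarrow> complex \<Rightarrow> complex \<Rightarrow> complex" where
  "speed_c a \<kappa> b1 b2 = wave_speed (speed0 a \<kappa>) b1 b2"
definition root_c :: "complex \<Rightarrow> complex \<Rightarrow> complex \<Rightarrow> complex \<Rightarrow> complex" where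
  "root_c a \<kappa> b1 b2 = root_stretch (speed0 a \<kappa>) b1 b2"
definition eta_c :: "complex \<Rightarrow> complex \<Rightarrow> complex \<Rightarrow> complex \<Rightarrow> complex \<Rightarrow> complex" where
  "eta_c a \<kappa> b1 b2 z = (root_c a \<kappa> b1 b2)\<^sup>2 - 1 + (root_c a \<kappa> b1 b2)\<^sup>2 * eta_series a \<kappa> z"
definition u_c :: "complex \<Rightarrow> complex \<Rightarrow> complex \<Rightarrow> complex \<Rightarrow> complex \<Rightarrow> complex" where
  "u_c a \<kappa> b1 b2 z = speed_c a \<kappa> b1 b2 - root_c a \<kappa> b1 b2 * speed0 a \<kappa>
     + root_c a \<kappa> b1 b2 * speed0 a \<kappa> * w_series a \<kappa> z"

text \<open>\<open>near\<close> puts q into the disc of half the size on which \<open>mixed\<close>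
  is available. Of the bounds on \<rho>, t/4 serves holomorphy in a strip of phases and 1/2 ensures
  |b1| + |b2| <= 1.\<close>

locale wave_local = stokes_local k0 r t B M + speed_local "cww k0" \<rho>0 K0 for k0 r t B M \<rho>0 K0 :: real +
  fixes \<rho> :: real
  assumes \<rho>: "0 < \<rho>" "\<rho> \<le> \<rho>0" "\<rho> \<le> r" "\<rho> \<le> t / 4" "\<rho> \<le> 1 / 2"
    and near: "\<And>a \<kappa>. a \<in> ball 0 \<rho> \<Longrightarrow> \<kappa> \<in> ball (of_real k0) \<rho> \<Longrightarrow> Re (mu_series a \<kappa>) > 0"
      "\<And>a \<kappa>. a \<in> ball 0 \<rho> \<Longrightarrow> \<kappa> \<in> ball (of_real k0) \<rho> \<Longrightarrow> speed0 a \<kappa> \<in> ball (of_real (cww k0)) (\<rho>0/2)"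

lemma wave_local_exists:
  assumes "k0 > 0"
  obtains r t B M \<rho>0 K0 \<rho> where "wave_local k0 r t B M \<rho>0 K0 \<rho>"
proof -
  obtain r t B M where "stokes_local k0 r t B M" using stokes_local_exists[OF assms] .
  then interpret stokes_local k0 r t B M .
  define q0 where "q0 = cww k0"
  have q0: "0 < q0" "q0 < 1" using cww_pos[OF assms] cww_less_one[OF assms] by (auto simp: q0_def)
  obtain \<rho>0 K0 where "speed_local q0 \<rho>0 K0" using speed_local_exists[OF q0] .
  then interpret speed_local "cww k0" \<rho>0 K0 by (simp only: q0_def)
  have nz: "complex_of_real (q0\<^sup>2) \<notin> \<real>\<^sub>\<le>\<^sub>0" by (rule Re_pos_not_nonpos) (use q0 in \<open>simp del: of_real_power\<close>)
  have cq: "csqrt (of_real (q0\<^sup>2)) = of_real q0" using q0 by (simp add: csqrt_of_real del: of_real_power)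
  have "((\<lambda>\<mu>. csqrt \<mu>) \<longlongrightarrow> of_real q0) (nhds (of_real (q0\<^sup>2)))"
    using continuous_at_csqrt[OF nz] tendsto_at_iff_tendsto_nhds[of csqrt "of_real (q0\<^sup>2)"]
    unfolding continuous_at cq by simp
  then have "\<forall>\<^sub>F \<mu> in nhds (of_real (q0\<^sup>2)). dist (csqrt \<mu>) (of_real q0) < \<rho>0 / 2"
    by (rule tendstoD) (use \<rho>0 in simp)
  then obtain e0 where e0: "e0 > 0" "\<And>\<mu>. dist \<mu> (of_real (q0\<^sup>2)) < e0 \<Longrightarrow> dist (csqrt \<mu>) (of_real q0) < \<rho>0 / 2"
    unfolding eventually_nhds_metric by blast
  \<comment> \<open>The first bound keeps the root of q^2 close to q0, the second one keeps the real
    part of q^2 positive.\<close>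
  define e where "e = min e0 (q0\<^sup>2 / 2)"
  have e: "e > 0" "e \<le> e0" "e \<le> q0\<^sup>2 / 2" using e0 q0 by (auto simp: e_def)
  have "continuous_on (ball (of_real k0) r) (\<lambda>\<kappa>. cww2_complex \<kappa> 1)"
    by (rule holomorphic_on_imp_continuous_on[OF cww2_complex_holomorphic[OF k0 r(2)]])
  then have "isCont (\<lambda>\<kappa>. cww2_complex \<kappa> 1) (of_real k0)"
    using r by (intro continuous_on_interior) auto
  moreover have "cww2_complex (of_real k0) 1 = of_real (q0\<^sup>2)"
    using cww2_complex_of_real[OF k0, of 1] by (simp add: q0_def)
  ultimately obtain d where d: "d > 0" "\<And>\<kappa>. dist \<kappa> (of_real k0) < d \<Longrightarrow> dist (cww2_complex \<kappa> 1) (of_real (q0\<^sup>2)) < e / 2"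
    using e(1) unfolding continuous_at_eps_delta by (metis half_gt_zero)
  define C where "C = 2 * B / t ^ 1"
  have "B \<ge> 0" using geom_bounded_nonneg[OF bounded_coeffs(1)[of "of_real k0"]] r by simp
  then have C: "C \<ge> 0" using t by (simp add: C_def)
  \<comment> \<open>The radius d lets q^2 move by less than e/2 when \<kappa> varies at a = 0, and
    e/(2 C + 2) lets it move by at most e/2 when \<open>a\<close> varies.\<close>
  define \<rho> where "\<rho> = min (min (min \<rho>0 r) (min (t / 4) (1/2))) (min d (e / (2 * C + 2)))"
  have \<rho>: "0 < \<rho>" "\<rho> \<le> \<rho>0" "\<rho> \<le> r" "\<rho> \<le> t / 4" "\<rho> \<le> 1/2" "\<rho> \<le> d" "\<rho> \<le> e / (2 * C + 2)"
  proof -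
    have "0 < e / (2 * C + 2)" using e C by simp
    then show "0 < \<rho>" using \<rho>0 r t d(1) unfolding \<rho>_def by linarith
  qed (unfold \<rho>_def, linarith+)
  have close: "dist (mu_series a \<kappa>) (of_real (q0\<^sup>2)) < e" if a: "a \<in> ball 0 \<rho>" and \<kappa>: "\<kappa> \<in> ball (of_real k0) \<rho>" for a \<kappa>
  proof -
    have kr: "\<kappa> \<in> ball (of_real k0) r" using \<kappa> \<rho> by auto
    have "norm (trig_series (mu_coeff (cww2_complex \<kappa>)) a (of_real 0) - (\<Sum>d<1. a ^ d * trig d (mu_coeff (cww2_complex \<kappa>) d) (of_real 0))) \<le> 2 * B / t ^ 1 * norm a ^ 1"
      by (rule trig_series_remainder[OF bounded_coeffs(4)[OF kr] t(1)]) (use a \<rho> in auto)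
    then have "norm (mu_series a \<kappa> - cww2_complex \<kappa> 1) \<le> C * norm a"
      using coeff_1(3) by (simp add: mu_series_def C_def trig_mu)
    also have "C * norm a \<le> C * (e / (2 * C + 2))" using a \<rho> C by (intro mult_left_mono) auto
    also have "\<dots> \<le> e / 2" using C e by (simp add: field_simps)
    finally have "dist (mu_series a \<kappa>) (cww2_complex \<kappa> 1) \<le> e / 2" by (simp add: dist_norm)
    moreover have "dist (cww2_complex \<kappa> 1) (of_real (q0\<^sup>2)) < e / 2"
      using d(2)[of \<kappa>] \<kappa> \<rho> by (simp add: dist_commute)
    ultimately show ?thesis using dist_triangle[of "mu_series a \<kappa>" "of_real (q0\<^sup>2)" "cww2_complex \<kappa> 1"] by linarith
  qed
  have n1: "Re (mu_series a \<kappa>) > 0" if a: "a \<in> ball 0 \<rho>" and \<kappa>: "\<kappa> \<in> ball (of_real k0) \<rho>" for a \<kappa>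
  proof -
    have "\<bar>Re (mu_series a \<kappa> - of_real (q0\<^sup>2))\<bar> < e"
      using close[OF that] abs_Re_le_cmod[of "mu_series a \<kappa> - of_real (q0\<^sup>2)"] by (simp add: dist_norm)
    moreover have "Re (mu_series a \<kappa> - of_real (q0\<^sup>2)) = Re (mu_series a \<kappa>) - q0\<^sup>2" by (simp flip: of_real_power)
    moreover have "q0\<^sup>2 > 0" using q0 by simp
    ultimately show ?thesis using e by linarith
  qed
  have n2: "speed0 a \<kappa> \<in> ball (of_real (cww k0)) (\<rho>0/2)" if a: "a \<in> ball 0 \<rho>" and \<kappa>: "\<kappa> \<in> ball (of_real k0) \<rho>" for a \<kappa>
    using e0(2)[of "mu_series a \<kappa>"] close[OF that] e by (simp add: speed0_def q0_def dist_commute)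
  have "wave_local k0 r t B M \<rho>0 K0 \<rho>"
    by unfold_locales (fact \<rho>(1-5) n1 n2)+
  then show ?thesis by (rule that)
qed

context wave_local begin

lemma box_subset: "ball (of_real k0 :: complex) \<rho> \<subseteq> ball (of_real k0) r" "ball (0::complex) \<rho> \<subseteq> ball 0 \<rho>0"
    "ball (0::complex) \<rho> \<subseteq> ball 0 (t / 2)"
  using \<rho> t by auto

lemma speed0_near:
  assumes "a \<in> ball 0 \<rho>" "\<kappa> \<in> ball (of_real k0) \<rho>"
  shows "speed0 a \<kappa> \<in> ball (of_real (cww k0)) \<rho>0"
proof -
  have "\<rho>0 > 0" using \<rho> by linarith
  then have "ball (complex_of_real (cww k0)) (\<rho>0/2) \<subseteq> ball (of_real (cww k0)) \<rho>0" by auto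
  then show ?thesis using near(2)[OF assms] by blast
qed

lemma speed0_holomorphic:
  shows "\<kappa> \<in> ball (of_real k0) \<rho> \<Longrightarrow> (\<lambda>a. speed0 a \<kappa>) holomorphic_on ball 0 \<rho>"
    and "a \<in> ball 0 \<rho> \<Longrightarrow> (\<lambda>\<kappa>. speed0 a \<kappa>) holomorphic_on ball (of_real k0) \<rho>"
proof -
  assume k: "\<kappa> \<in> ball (of_real k0) \<rho>"
  show "(\<lambda>a. speed0 a \<kappa>) holomorphic_on ball 0 \<rho>"
    unfolding speed0_def
  proof (rule holomorphic_on_csqrt')
    show "(\<lambda>a. mu_series a \<kappa>) holomorphic_on ball 0 \<rho>"
      by (rule holomorphic_on_subset[OF series_holomorphic_a(3) box_subset(3)]) (use k box_subset in blast)
    show "mu_series a \<kappa> \<notin> \<real>\<^sub>\<le>\<^sub>0" if "a \<in> ball 0 \<rho>" for a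
      by (rule Re_pos_not_nonpos[OF near(1)[OF that k]])
  qed
next
  assume a: "a \<in> ball 0 \<rho>"
  show "(\<lambda>\<kappa>. speed0 a \<kappa>) holomorphic_on ball (of_real k0) \<rho>"
    unfolding speed0_def
  proof (rule holomorphic_on_csqrt')
    show "(\<lambda>\<kappa>. mu_series a \<kappa>) holomorphic_on ball (of_real k0) \<rho>"
      by (rule holomorphic_on_subset[OF series_holomorphic(3) box_subset(1)]) (use a \<rho> in auto)
    show "mu_series a \<kappa> \<notin> \<real>\<^sub>\<le>\<^sub>0" if "\<kappa> \<in> ball (of_real k0) \<rho>" for \<kappa>
      by (rule Re_pos_not_nonpos[OF near(1)[OF a that]])
  qed
qed

lemma in_box: "y \<in> ball 0 \<rho> \<Longrightarrow> of_real k0 + y \<in> ball (complex_of_real k0) \<rho>"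
  by (simp add: dist_norm)

lemma holomorphic_shift_base: "f holomorphic_on ball (of_real k0) \<rho> \<Longrightarrow> (\<lambda>y. f (of_real k0 + y)) holomorphic_on ball 0 \<rho>"
  using holomorphic_on_ball_shift[of f "of_real k0" \<rho> 0 \<rho>] by simp

lemma separately_holomorphic_speed0: "separately_holomorphic4 \<rho> (\<lambda>x y v w. speed0 x (of_real k0 + y))"
  by (intro separately_holomorphic4I holomorphic_on_const speed0_holomorphic holomorphic_shift_base in_box)

text \<open>\<open>a\<close> and \<kappa> act only through q, so holomorphy in them is that of a
  composition; b1 and b2 enter directly.\<close>

lemma separately_holomorphic_speed:
  assumes F: "F = wave_speed \<or> F = root_stretch"
  shows "separately_holomorphic4 \<rho> (\<lambda>x y v w. F (speed0 x (of_real k0 + y)) v w)"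
proof (rule separately_holomorphic4I)
  fix x y v w :: complex
  assume x: "x \<in> ball 0 \<rho>" and y: "y \<in> ball 0 \<rho>"
  have q: "speed0 x (of_real k0 + y) \<in> ball (of_real (cww k0)) \<rho>0" by (rule speed0_near[OF x in_box[OF y]])
  show "(\<lambda>v. F (speed0 x (of_real k0 + y)) v w) holomorphic_on ball 0 \<rho>" if "w \<in> ball 0 \<rho>" for w
    by (rule holomorphic_on_subset[OF hol(2)[OF F q] box_subset(2)]) (use that box_subset in blast)
  show "(\<lambda>w. F (speed0 x (of_real k0 + y)) v w) holomorphic_on ball 0 \<rho>" if "v \<in> ball 0 \<rho>" for v
    by (rule holomorphic_on_subset[OF hol(3)[OF F q] box_subset(2)]) (use that box_subset in blast)
next
  have comp: "(\<lambda>x. F (f x) v w) holomorphic_on ball 0 \<rho>"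
    if "f holomorphic_on ball 0 \<rho>" "\<And>x. x \<in> ball 0 \<rho> \<Longrightarrow> f x \<in> ball (of_real (cww k0)) \<rho>0"
      "v \<in> ball 0 \<rho>" "w \<in> ball 0 \<rho>" for f v w
  proof -
    have "(\<lambda>q. F q v w) holomorphic_on ball (of_real (cww k0)) \<rho>0"
      by (rule hol(1)[OF F]) (use that(3,4) box_subset in blast)+
    moreover have "f ` ball 0 \<rho> \<subseteq> ball (of_real (cww k0)) \<rho>0" using that(2) by blast
    ultimately show ?thesis using holomorphic_on_compose_gen[OF that(1), of "\<lambda>q. F q v w"] by (simp add: o_def)
  qed
  fix x y v w :: complex
  assume v: "v \<in> ball 0 \<rho>" and w: "w \<in> ball 0 \<rho>"
  show "(\<lambda>x. F (speed0 x (of_real k0 + y)) v w) holomorphic_on ball 0 \<rho>" if "y \<in> ball 0 \<rho>" for y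
    by (rule comp[OF speed0_holomorphic(1)[OF in_box[OF that]] speed0_near[OF _ in_box[OF that]] v w])
  show "(\<lambda>y. F (speed0 x (of_real k0 + y)) v w) holomorphic_on ball 0 \<rho>" if "x \<in> ball 0 \<rho>" for x
    by (rule comp[OF holomorphic_shift_base[OF speed0_holomorphic(2)[OF that]] speed0_near[OF that in_box] v w])
qed

lemma separately_holomorphic_series:
  shows "separately_holomorphic4 \<rho> (\<lambda>x y v w. eta_series x (of_real k0 + y) (of_real z))"
    and "separately_holomorphic4 \<rho> (\<lambda>x y v w. w_series x (of_real k0 + y) (of_real z))"
proof -
  have sa: "norm a \<le> t / 2" if "a \<in> ball 0 \<rho>" for a :: complex using that \<rho> t by simp
  have kr: "of_real k0 + y \<in> ball (complex_of_real k0) r" if "y \<in> ball 0 \<rho>" for y using in_box[OF that] box_subset by blast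
  show "separately_holomorphic4 \<rho> (\<lambda>x y v w. eta_series x (of_real k0 + y) (of_real z))"
    by (intro separately_holomorphic4I holomorphic_on_const holomorphic_shift_base
        holomorphic_on_subset[OF series_holomorphic(1)[OF sa] box_subset(1)]
        holomorphic_on_subset[OF series_holomorphic_a(1)[OF kr] box_subset(3)])
  show "separately_holomorphic4 \<rho> (\<lambda>x y v w. w_series x (of_real k0 + y) (of_real z))"
    by (intro separately_holomorphic4I holomorphic_on_const holomorphic_shift_base
        holomorphic_on_subset[OF series_holomorphic(2)[OF sa] box_subset(1)]
        holomorphic_on_subset[OF series_holomorphic_a(2)[OF kr] box_subset(3)])
qed

lemma separately_holomorphic_wave:
  shows "separately_holomorphic4 \<rho> (\<lambda>x y v w. speed_c x (of_real k0 + y) v w)"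
    and "separately_holomorphic4 \<rho> (\<lambda>x y v w. eta_c x (of_real k0 + y) v w (of_real z))"
    and "separately_holomorphic4 \<rho> (\<lambda>x y v w. u_c x (of_real k0 + y) v w (of_real z))"
  unfolding speed_c_def eta_c_def u_c_def root_c_def power2_eq_square
  by (intro separately_holomorphic4_add separately_holomorphic4_diff separately_holomorphic4_mult
      separately_holomorphic4_const separately_holomorphic_series separately_holomorphic_speed0 separately_holomorphic_speed; simp)+

lemma solution_complex:
  assumes a: "a \<in> ball 0 \<rho>" and \<kappa>: "\<kappa> \<in> ball (of_real k0) \<rho>" and b: "b1 \<in> ball 0 \<rho>" "b2 \<in> ball 0 \<rho>"
  defines "c \<equiv> speed_c a \<kappa> b1 b2" and "s \<equiv> root_c a \<kappa> b1 b2" and "q \<equiv> speed0 a \<kappa>"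
  shows "c = (1 - c\<^sup>2) * b1 + q * s ^ 3" "s\<^sup>2 * (1 + q\<^sup>2 / 2) = 1 + c\<^sup>2 / 2 + (1 - c\<^sup>2) * b2"
    "norm (s - 1) \<le> K0 * (norm b1 + norm b2)" "norm c \<le> K0" "norm s \<le> K0" "norm q \<le> K0" "q\<^sup>2 = mu_series a \<kappa>"
  using main[OF speed0_near[OF a \<kappa>] subsetD[OF box_subset(2) b(1)] subsetD[OF box_subset(2) b(2)]]
  unfolding Let_def c_def s_def q_def speed_c_def root_c_def by (auto simp: speed0_def)

text \<open>A crude bound from |c|, |s|, |q| <= K0 and the bound 2 B for the series; what matters is
  that it is the same for all real phases.\<close>

lemma norm_wave_le:
  assumes a: "a \<in> ball 0 \<rho>" and \<kappa>: "\<kappa> \<in> ball (of_real k0) \<rho>" and b: "b1 \<in> ball 0 \<rho>" "b2 \<in> ball 0 \<rho>"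
  defines "D \<equiv> 1 + K0 + (1 + K0 ^ 2) * (1 + 2 * B)"
  shows "norm (speed_c a \<kappa> b1 b2) \<le> D" "norm (eta_c a \<kappa> b1 b2 (of_real z)) \<le> D" "norm (u_c a \<kappa> b1 b2 (of_real z)) \<le> D"
proof -
  define s where "s = root_c a \<kappa> b1 b2"
  define c where "c = speed_c a \<kappa> b1 b2"
  define q where "q = speed0 a \<kappa>"
  have n: "norm c \<le> K0" "norm s \<le> K0" "norm q \<le> K0"
    using solution_complex[OF a \<kappa> b] by (simp_all add: s_def c_def q_def)
  have kr: "\<kappa> \<in> ball (of_real k0) r" using \<kappa> box_subset by blast
  have sm: "small_amplitude t a (of_real z)" using a \<rho> t by (intro small_amplitude_of_real) simp
  have e: "norm (eta_series a \<kappa> (of_real z)) \<le> 2 * B" "norm (w_series a \<kappa> (of_real z)) \<le> 2 * B"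
    by (rule norm_eta_w_series_le[OF kr sm])+
  have B0: "B \<ge> 0" using e(1) norm_ge_zero[of "eta_series a \<kappa> (of_real z)"] by linarith
  have s2: "norm (s\<^sup>2) \<le> K0 ^ 2" using power_mono[OF n(2), of 2] by (simp add: norm_power)
  have sq: "norm (s * q) \<le> K0 ^ 2" unfolding norm_mult power2_eq_square using n K0 by (intro mult_mono) auto
  have KB: "0 \<le> K0 ^ 2 * B" using B0 by simp
  have D: "D = 2 + K0 + K0 ^ 2 + 2 * B + 2 * (K0 ^ 2 * B)" by (simp add: D_def algebra_simps)
  show "norm (speed_c a \<kappa> b1 b2) \<le> D"
    using n(1) KB B0 zero_le_power2[of K0] unfolding D c_def by linarith
  have "norm (s\<^sup>2 * eta_series a \<kappa> (of_real z)) \<le> K0 ^ 2 * (2 * B)"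
    unfolding norm_mult using s2 e by (intro mult_mono) auto
  moreover have "norm (s\<^sup>2 - 1 + s\<^sup>2 * eta_series a \<kappa> (of_real z)) \<le> norm (s\<^sup>2) + 1 + norm (s\<^sup>2 * eta_series a \<kappa> (of_real z))"
    using norm_triangle_ineq[of "s\<^sup>2 - 1" "s\<^sup>2 * eta_series a \<kappa> (of_real z)"] norm_triangle_ineq4[of "s\<^sup>2" 1] by simp
  ultimately show "norm (eta_c a \<kappa> b1 b2 (of_real z)) \<le> D"
    unfolding eta_c_def s_def[symmetric] D using s2 K0 B0 by linarith
  have "norm (s * q * w_series a \<kappa> (of_real z)) \<le> K0 ^ 2 * (2 * B)"
    unfolding norm_mult[of "s * q"] using sq e by (intro mult_mono) auto
  moreover have "norm (c - s * q + s * q * w_series a \<kappa> (of_real z)) \<le> norm c + norm (s * q) + norm (s * q * w_series a \<kappa> (of_real z))"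
    using norm_triangle_ineq[of "c - s * q" "s * q * w_series a \<kappa> (of_real z)"] norm_triangle_ineq4[of c "s * q"] by linarith
  ultimately show "norm (u_c a \<kappa> b1 b2 (of_real z)) \<le> D"
    unfolding u_c_def s_def[symmetric] c_def[symmetric] q_def[symmetric] D using sq n B0 by linarith
qed

end

section \<open>The real wave solves the system\<close>

definition in_real_box :: "real \<Rightarrow> real \<Rightarrow> real \<times> real \<times> real \<times> real \<Rightarrow> bool" where
  "in_real_box k0 \<rho> = (\<lambda>(a, k, b1, b2). \<bar>a\<bar> < \<rho> \<and> \<bar>k - k0\<bar> < \<rho> \<and> \<bar>b1\<bar> < \<rho> \<and> \<bar>b2\<bar> < \<rho>)"

definition wave_eta :: "real \<times> real \<times> real \<times> real \<Rightarrow> real \<Rightarrow> real" where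
  "wave_eta = (\<lambda>(a, k, b1, b2) z. Re (eta_c (of_real a) (of_real k) (of_real b1) (of_real b2) (of_real z)))"
definition wave_u :: "real \<times> real \<times> real \<times> real \<Rightarrow> real \<Rightarrow> real" where
  "wave_u = (\<lambda>(a, k, b1, b2) z. Re (u_c (of_real a) (of_real k) (of_real b1) (of_real b2) (of_real z)))"
definition wave_c :: "real \<times> real \<times> real \<times> real \<Rightarrow> real" where
  "wave_c = (\<lambda>(a, k, b1, b2). Re (speed_c (of_real a) (of_real k) (of_real b1) (of_real b2)))"

lemma wave_c_minus: "wave_c (- a, k, b1, b2) = wave_c (a, k, b1, b2)"
  by (simp add: wave_c_def speed_c_def speed0_def mu_series_minus)

context wave_local begin

lemma solution_real:
  assumes box: "in_real_box k0 \<rho> (a, k, b1, b2)"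
  defines "p \<equiv> (a, k, b1, b2)"
  shows "\<And>z. - wave_c p * wave_eta p z + wave_u p z + wave_u p z * wave_eta p z = (1 - (wave_c p)\<^sup>2) * b1"
    and "\<And>z. - wave_c p * wave_u p z + cww2_mult k (wave_eta p) z + (wave_u p z)\<^sup>2 / 2 = (1 - (wave_c p)\<^sup>2) * b2"
    and "\<And>z. wave_eta p (z + 2 * pi) = wave_eta p z" "\<And>z. wave_u p (z + 2 * pi) = wave_u p z"
    and "\<And>z. wave_eta p (- z) = wave_eta p z" "\<And>z. wave_u p (- z) = wave_u p z"
    and "smooth_real (wave_eta p)" "smooth_real (wave_u p)"
    and "\<And>z. eta_c (of_real a) (of_real k) (of_real b1) (of_real b2) (of_real z) = of_real (wave_eta p z)"
    and "\<And>z. u_c (of_real a) (of_real k) (of_real b1) (of_real b2) (of_real z) = of_real (wave_u p z)"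
    and "speed_c (of_real a) (of_real k) (of_real b1) (of_real b2) = of_real (wave_c p)"
    and "root_c (of_real a) (of_real k) (of_real b1) (of_real b2) \<in> \<real>"
proof -
  define A where "A = complex_of_real a"
  define \<kappa> where "\<kappa> = complex_of_real k"
  define \<beta>1 where "\<beta>1 = complex_of_real b1"
  define \<beta>2 where "\<beta>2 = complex_of_real b2"
  have A: "A \<in> ball 0 \<rho>" and \<kappa>: "\<kappa> \<in> ball (of_real k0) \<rho>" and b: "\<beta>1 \<in> ball 0 \<rho>" "\<beta>2 \<in> ball 0 \<rho>"
    using box by (auto simp: in_real_box_def A_def \<kappa>_def \<beta>1_def \<beta>2_def dist_norm norm_minus_commute simp flip: of_real_diff)
  have kr: "\<kappa> \<in> ball (of_real k0) r" using \<kappa> box_subset by blast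
  have at: "\<bar>a\<bar> \<le> t / 2" "norm A < t / 4" using box \<rho> t by (auto simp: in_real_box_def A_def)
  have sm: "small_amplitude t A (of_real z)" for z using at by (intro small_amplitude_of_real) (simp add: A_def)
  define q where "q = speed0 A \<kappa>"
  define c where "c = speed_c A \<kappa> \<beta>1 \<beta>2"
  define s where "s = root_c A \<kappa> \<beta>1 \<beta>2"
  note S = solution_complex[OF A \<kappa> b, folded q_def c_def s_def]
  have rs: "eta_series A \<kappa> (of_real z) \<in> \<real>" "w_series A \<kappa> (of_real z) \<in> \<real>" "mu_series A \<kappa> \<in> \<real>" for z
    using real_series[OF kr[unfolded \<kappa>_def] at(1)] by (auto simp: A_def \<kappa>_def)
  have qR: "q \<in> \<real>"
  proof -
    have "mu_series A \<kappa> = of_real (Re (mu_series A \<kappa>))" using rs(3) by (simp add: of_real_Re)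
    moreover have "Re (mu_series A \<kappa>) > 0" by (rule near(1)[OF A \<kappa>])
    ultimately have "q = of_real (sqrt (Re (mu_series A \<kappa>)))"
      unfolding q_def speed0_def by (metis csqrt_of_real less_imp_le)
    then show ?thesis by simp
  qed
  have cs: "c \<in> \<real>" "s \<in> \<real>"
    using real[OF speed0_near[OF A \<kappa>] subsetD[OF box_subset(2) b(1)] subsetD[OF box_subset(2) b(2)]] qR
    by (auto simp: c_def s_def q_def speed_c_def root_c_def \<beta>1_def \<beta>2_def)
  show "root_c (of_real a) (of_real k) (of_real b1) (of_real b2) \<in> \<real>"
    using cs(2) by (simp add: s_def A_def \<kappa>_def \<beta>1_def \<beta>2_def)
  show cc: "speed_c (of_real a) (of_real k) (of_real b1) (of_real b2) = of_real (wave_c p)"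
    using cs(1) by (simp add: wave_c_def p_def c_def A_def \<kappa>_def \<beta>1_def \<beta>2_def of_real_Re)
  have eR: "eta_c A \<kappa> \<beta>1 \<beta>2 (of_real z) \<in> \<real>" and uR: "u_c A \<kappa> \<beta>1 \<beta>2 (of_real z) \<in> \<real>" for z
    unfolding eta_c_def u_c_def s_def[symmetric] c_def[symmetric] q_def[symmetric]
    using cs qR rs by (auto intro!: Reals_add Reals_diff Reals_mult Reals_power)
  show ee: "eta_c (of_real a) (of_real k) (of_real b1) (of_real b2) (of_real z) = of_real (wave_eta p z)" for z
    using eR[of z] by (simp add: wave_eta_def p_def A_def \<kappa>_def \<beta>1_def \<beta>2_def of_real_Re)
  show uu: "u_c (of_real a) (of_real k) (of_real b1) (of_real b2) (of_real z) = of_real (wave_u p z)" for z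
    using uR[of z] by (simp add: wave_u_def p_def A_def \<kappa>_def \<beta>1_def \<beta>2_def of_real_Re)
  have E: "eta_c A \<kappa> \<beta>1 \<beta>2 (of_real z) = of_real (wave_eta p z)" "u_c A \<kappa> \<beta>1 \<beta>2 (of_real z) = of_real (wave_u p z)"
    "c = of_real (wave_c p)" for z
    using ee uu cc by (simp_all add: c_def A_def \<kappa>_def \<beta>1_def \<beta>2_def)
  fix z
  define e where "e = eta_series A \<kappa> (of_real z)"
  define w where "w = w_series A \<kappa> (of_real z)"
  define m where "m = mult_eta_series A \<kappa> (of_real z)"
  have ew: "e = w + w * e" and mw: "2 * m = q\<^sup>2 * (2 * w - w\<^sup>2)"
    using series_equations[OF kr sm[of z]] S(7) by (simp_all add: e_def w_def m_def)
  have eta: "eta_c A \<kappa> \<beta>1 \<beta>2 (of_real z) = s\<^sup>2 - 1 + s\<^sup>2 * e" and u: "u_c A \<kappa> \<beta>1 \<beta>2 (of_real z) = c - s * q + s * q * w"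
    by (simp_all add: eta_c_def u_c_def s_def c_def q_def e_def w_def)
  note E1 = trans[OF eta[symmetric] E(1)] and E2 = trans[OF u[symmetric] E(2)]
  \<comment> \<open>By the equation for e and w, (1 + e) (w - 1) = -1, so z disappears from the
    first equation and the scalar equation for c is left.\<close>
  have "- c * (s\<^sup>2 - 1 + s\<^sup>2 * e) + (c - s * q + s * q * w) + (c - s * q + s * q * w) * (s\<^sup>2 - 1 + s\<^sup>2 * e)
     = c - q * s ^ 3 + q * s ^ 3 * (w + w * e - e)"
    by (simp add: algebra_simps power2_eq_square power3_eq_cube)
  also have "w + w * e - e = 0" using ew by simp
  also have "c - q * s ^ 3 + q * s ^ 3 * 0 = (1 - c\<^sup>2) * \<beta>1"
    unfolding mult_zero_right add_0_right diff_eq_eq by (rule S(1))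
  finally have "complex_of_real (- wave_c p * wave_eta p z + wave_u p z + wave_u p z * wave_eta p z) = of_real ((1 - (wave_c p)\<^sup>2) * b1)"
    unfolding E1 E2 unfolding E(3) by (simp add: \<beta>1_def)
  then show "- wave_c p * wave_eta p z + wave_u p z + wave_u p z * wave_eta p z = (1 - (wave_c p)\<^sup>2) * b1"
    by (simp only: of_real_eq_iff)
  have c1: "cww2_mult k (wave_eta p) z = Re (s\<^sup>2 - 1 + s\<^sup>2 * m)"
  proof -
    have s1: "s\<^sup>2 = of_real (Re (s\<^sup>2))" "s\<^sup>2 - 1 = of_real (Re (s\<^sup>2) - 1)" using cs(2) by (simp_all add: of_real_Re)
    have "wave_eta p = (\<lambda>z. Re (of_real (Re (s\<^sup>2) - 1) + of_real (Re (s\<^sup>2)) * eta_series (of_real a) (of_real k) (of_real z)))"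
      unfolding s1[symmetric] by (simp add: wave_eta_def p_def eta_c_def s_def A_def \<kappa>_def \<beta>1_def \<beta>2_def)
    then have "cww2_mult k (wave_eta p) z = Re (of_real (Re (s\<^sup>2) - 1) + of_real (Re (s\<^sup>2)) * mult_eta_series (of_real a) (of_real k) (of_real z))"
      using cww2_mult_eta[OF kr[unfolded \<kappa>_def] at(1), of "Re (s\<^sup>2) - 1" "Re (s\<^sup>2)" z] by simp
    then show ?thesis unfolding s1[symmetric] by (simp add: m_def A_def \<kappa>_def)
  qed
  have c2: "s\<^sup>2 - 1 + s\<^sup>2 * m \<in> \<real>"
  proof -
    have meq: "m = q\<^sup>2 * (2 * w - w\<^sup>2) / 2" using mw by (simp add: mult.commute[of m])
    have "w \<in> \<real>" using rs(2)[of z] by (simp add: w_def)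
    with qR have "m \<in> \<real>" unfolding meq by (auto intro!: Reals_divide Reals_mult Reals_diff Reals_power)
    then show ?thesis using cs by (auto intro!: Reals_add Reals_diff Reals_mult Reals_power)
  qed
  \<comment> \<open>The multiplier is defined as a real part; since its value is real, the second
    equation can be verified as a complex identity.\<close>
  have cm: "complex_of_real (cww2_mult k (wave_eta p) z) = s\<^sup>2 - 1 + s\<^sup>2 * m"
    unfolding c1 by (rule of_real_Re[OF c2])
  \<comment> \<open>Doubling makes room for the equation for 2 m. The terms depending on z then
    cancel, and the scalar equation for s^2 is left.\<close>
  have "2 * (- c * (c - s * q + s * q * w) + (s\<^sup>2 - 1 + s\<^sup>2 * m) + (c - s * q + s * q * w)\<^sup>2 / 2)
    = s\<^sup>2 * (2 + q\<^sup>2) - 2 - c\<^sup>2 + s\<^sup>2 * (2 * m - q\<^sup>2 * (2 * w - w\<^sup>2))"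
    by (simp add: algebra_simps power2_eq_square add_divide_distrib diff_divide_distrib)
  also have "\<dots> = 2 * (s\<^sup>2 * (1 + q\<^sup>2 / 2)) - 2 - c\<^sup>2" using mw by (simp add: algebra_simps)
  also have "\<dots> = 2 * ((1 - c\<^sup>2) * \<beta>2)" unfolding S(2) by (simp add: algebra_simps)
  finally have "2 * (- c * (c - s * q + s * q * w) + (s\<^sup>2 - 1 + s\<^sup>2 * m) + (c - s * q + s * q * w)\<^sup>2 / 2) = 2 * ((1 - c\<^sup>2) * \<beta>2)" .
  then have "- c * (c - s * q + s * q * w) + (s\<^sup>2 - 1 + s\<^sup>2 * m) + (c - s * q + s * q * w)\<^sup>2 / 2 = (1 - c\<^sup>2) * \<beta>2"
    by (rule mult_left_cancel[OF zero_neq_numeral[symmetric], THEN iffD1])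
  then have "complex_of_real (- wave_c p * wave_u p z + cww2_mult k (wave_eta p) z + (wave_u p z)\<^sup>2 / 2) = of_real ((1 - (wave_c p)\<^sup>2) * b2)"
    unfolding E2 cm[symmetric] unfolding E(3) by (simp add: \<beta>2_def)
  then show "- wave_c p * wave_u p z + cww2_mult k (wave_eta p) z + (wave_u p z)\<^sup>2 / 2 = (1 - (wave_c p)\<^sup>2) * b2"
    by (simp only: of_real_eq_iff)
  show "wave_eta p (z + 2 * pi) = wave_eta p z" "wave_u p (z + 2 * pi) = wave_u p z"
    by (simp_all add: wave_eta_def wave_u_def p_def eta_c_def u_c_def eta_series_def w_series_def trig_series_periodic)
  show "wave_eta p (- z) = wave_eta p z" "wave_u p (- z) = wave_u p z"
    by (simp_all add: wave_eta_def wave_u_def p_def eta_c_def u_c_def eta_series_def w_series_def trig_series_minus palindromic_eta palindromic_w)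
  have op: "open {z. \<bar>Im z\<bar> < ln 2}" by (intro open_Collect_less continuous_intros)
  have "smooth_real (\<lambda>x. Re (eta_c A \<kappa> \<beta>1 \<beta>2 (of_real x)))"
    by (rule smooth_real_of_holomorphic[OF op])
       (auto simp: eta_c_def[abs_def] intro!: holomorphic_on_add holomorphic_on_mult holomorphic_on_const series_holomorphic_z(1)[OF kr at(2)])
  then show "smooth_real (wave_eta p)" by (simp add: wave_eta_def p_def A_def \<kappa>_def \<beta>1_def \<beta>2_def)
  have "smooth_real (\<lambda>x. Re (u_c A \<kappa> \<beta>1 \<beta>2 (of_real x)))"
    by (rule smooth_real_of_holomorphic[OF op])
       (auto simp: u_c_def[abs_def] intro!: holomorphic_on_add holomorphic_on_mult holomorphic_on_const series_holomorphic_z(2)[OF kr at(2)])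
  then show "smooth_real (wave_u p)" by (simp add: wave_u_def p_def A_def \<kappa>_def \<beta>1_def \<beta>2_def)
qed

end

section \<open>Analyticity and asymptotics of the real family\<close>

text \<open>A recentring: a point of a box has a positive distance \<open>s\<close> to its boundary,
  and increments below \<open>s\<close> remain in the box. The box may change from point to point,
  whereas \<open>G\<close> is one and the same function.\<close>

lemma analytic_family_on_boxes:
  assumes box: "\<And>p. p \<in> U \<Longrightarrow> \<exists>k0 \<rho> D. in_real_box k0 \<rho> p \<and>
     (\<forall>z::real. separately_holomorphic4 \<rho> (\<lambda>x y v w. G x (of_real k0 + y) v w z)) \<and>
     (\<forall>z. \<forall>a\<in>ball 0 \<rho>. \<forall>\<kappa>\<in>ball (of_real k0) \<rho>. \<forall>b1\<in>ball 0 \<rho>. \<forall>b2\<in>ball 0 \<rho>. norm (G a \<kappa> b1 b2 z) \<le> D)"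
  shows "analytic_family_on U (\<lambda>(a, k, b1, b2) z. Re (G (of_real a) (of_real k) (of_real b1) (of_real b2) z))"
proof (rule analytic_family_onI)
  fix a k b d assume "(a, k, b, d) \<in> U"
  from box[OF this] obtain k0 \<rho> D where in_b: "in_real_box k0 \<rho> (a, k, b, d)"
    and sh: "\<forall>z::real. separately_holomorphic4 \<rho> (\<lambda>x y v w. G x (of_real k0 + y) v w z)"
    and D: "\<forall>z. \<forall>a\<in>ball 0 \<rho>. \<forall>\<kappa>\<in>ball (of_real k0) \<rho>. \<forall>b1\<in>ball 0 \<rho>. \<forall>b2\<in>ball 0 \<rho>. norm (G a \<kappa> b1 b2 z) \<le> D"
    by (elim exE conjE) (rule that)
  have m: "\<bar>a\<bar> < \<rho>" "\<bar>k - k0\<bar> < \<rho>" "\<bar>b\<bar> < \<rho>" "\<bar>d\<bar> < \<rho>" using in_b by (auto simp: in_real_box_def)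
  define s where "s = min (min (\<rho> - \<bar>a\<bar>) (\<rho> - \<bar>k - k0\<bar>)) (min (\<rho> - \<bar>b\<bar>) (\<rho> - \<bar>d\<bar>))"
  have s: "s > 0" "\<bar>a\<bar> + s \<le> \<rho>" "\<bar>k - k0\<bar> + s \<le> \<rho>" "\<bar>b\<bar> + s \<le> \<rho>" "\<bar>d\<bar> + s \<le> \<rho>"
  proof -
    show "s > 0" using m by (simp add: s_def)
    have "s \<le> \<rho> - \<bar>a\<bar>" "s \<le> \<rho> - \<bar>k - k0\<bar>" "s \<le> \<rho> - \<bar>b\<bar>" "s \<le> \<rho> - \<bar>d\<bar>"
      unfolding s_def by (simp_all add: min_le_iff_disj)
    then show "\<bar>a\<bar> + s \<le> \<rho>" "\<bar>k - k0\<bar> + s \<le> \<rho>" "\<bar>b\<bar> + s \<le> \<rho>" "\<bar>d\<bar> + s \<le> \<rho>" by simp_all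
  qed
  have s': "norm (complex_of_real a) + s \<le> \<rho>" "norm (complex_of_real (k - k0)) + s \<le> \<rho>"
      "norm (complex_of_real b) + s \<le> \<rho>" "norm (complex_of_real d) + s \<le> \<rho>"
    using s by (simp_all only: norm_of_real)
  define F where "F z x y v w = G (of_real a + x) (of_real k0 + (of_real (k - k0) + y)) (of_real b + v) (of_real d + w) z" for z x y v w
  show "\<exists>\<rho>>0. \<exists>B F. (\<forall>z. separately_holomorphic4 \<rho> (F z)) \<and>
       (\<forall>z. \<forall>x\<in>ball 0 \<rho>. \<forall>y\<in>ball 0 \<rho>. \<forall>v\<in>ball 0 \<rho>. \<forall>w\<in>ball 0 \<rho>. norm (F z x y v w) \<le> B) \<and>
       (\<forall>z x y v w. \<bar>x\<bar> < \<rho> \<longrightarrow> \<bar>y\<bar> < \<rho> \<longrightarrow> \<bar>v\<bar> < \<rho> \<longrightarrow> \<bar>w\<bar> < \<rho> \<longrightarrow>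
          (a + x, k + y, b + v, d + w) \<in> U \<longrightarrow>
          (\<lambda>(a, k, b1, b2) z. Re (G (of_real a) (of_real k) (of_real b1) (of_real b2) z)) (a + x, k + y, b + v, d + w) z =
            Re (F z (of_real x) (of_real y) (of_real v) (of_real w)))"
  proof (rule exI[of _ s], rule conjI[OF s(1)], rule exI[of _ D], rule exI[of _ F], intro conjI allI ballI impI)
    show "separately_holomorphic4 s (F z)" for z
      unfolding F_def by (rule separately_holomorphic4_shift[where F = "\<lambda>x y v w. G x (of_real k0 + y) v w z"])
        (use sh s' in auto)
    fix z :: real and x y v w :: complex assume "x \<in> ball 0 s" "y \<in> ball 0 s" "v \<in> ball 0 s" "w \<in> ball (0::complex) s"
    then have n: "norm x < s" "norm y < s" "norm v < s" "norm w < s" by auto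
    have sh0: "c + x \<in> ball 0 \<rho>" if "norm c + s \<le> \<rho>" "norm x < s" for c x :: complex
      using that norm_triangle_ineq[of c x] by simp
    have sh1: "of_real k0 + (c + x) \<in> ball (of_real k0) \<rho>" if "norm c + s \<le> \<rho>" "norm x < s" for c x :: complex
    proof -
      have "dist (of_real k0) (of_real k0 + (c + x)) = norm (- (c + x))" by (simp add: dist_norm)
      also have "\<dots> < \<rho>" unfolding norm_minus_cancel using sh0[OF that] by simp
      finally show ?thesis by simp
    qed
    show "norm (F z x y v w) \<le> D"
      unfolding F_def using D sh0[OF s'(1) n(1)] sh1[OF s'(2) n(2)] sh0[OF s'(3) n(3)] sh0[OF s'(4) n(4)] by blast
  qed (simp add: F_def)
qed

context wave_local begin

lemma speed0_zero: "speed0 0 (of_real k0) = of_real (cww k0)"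
proof -
  have "mu_series 0 (of_real k0) = of_real ((cww k0)\<^sup>2)" using cww2_complex_of_real[OF k0, of 1] by simp
  then show ?thesis using cww_pos[OF k0] by (simp add: speed0_def csqrt_of_real del: of_real_power)
qed

text \<open>At a = 0 the wave is constant in z and is determined by c and s at q =
  \<open>cww k0\<close>; its values are taken for \<eta>0, u0 and c0.\<close>

lemma base_point:
  defines "x \<equiv> complex_of_real (cww k0)"
  shows "eta_c 0 (of_real k0) b1 b2 z = (root_stretch x b1 b2)\<^sup>2 - 1"
    and "u_c 0 (of_real k0) b1 b2 z = wave_speed x b1 b2 - root_stretch x b1 b2 * x"
    and "speed_c 0 (of_real k0) b1 b2 = wave_speed x b1 b2"
  by (simp_all add: eta_c_def u_c_def speed_c_def root_c_def speed0_zero x_def)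

text \<open>The linear part of \<eta>0 = s^2 - 1 is twice that of s - 1. For u0 = c - s q, the
  linear part is that of c - q minus q times that of s - 1, and the terms in q^2 b1 cancel.\<close>

lemma first_order_real:
  assumes b: "\<bar>b1\<bar> < \<rho>" "\<bar>b2\<bar> < \<rho>"
  defines "K \<equiv> 2 * K0 + K0 ^ 2"
  shows "\<bar>wave_eta (0, k0, b1, b2) 0 - (b1 * cww k0 + b2)\<bar> \<le> K * (\<bar>b1\<bar> + \<bar>b2\<bar>)\<^sup>2"
    and "\<bar>wave_u (0, k0, b1, b2) 0 - (b1 + b2 * cww k0)\<bar> \<le> K * (\<bar>b1\<bar> + \<bar>b2\<bar>)\<^sup>2"
    and "\<bar>wave_c (0, k0, b1, b2) - (cww k0 + b1 * ((cww k0)\<^sup>2 / 2 + 1) + 3 / 2 * b2 * cww k0)\<bar> \<le> K * (\<bar>b1\<bar> + \<bar>b2\<bar>)\<^sup>2"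
proof -
  define x where "x = complex_of_real (cww k0)"
  define \<beta>1 where "\<beta>1 = complex_of_real b1"
  define \<beta>2 where "\<beta>2 = complex_of_real b2"
  define s where "s = root_stretch x \<beta>1 \<beta>2"
  define c where "c = wave_speed x \<beta>1 \<beta>2"
  define \<beta> where "\<beta> = \<bar>b1\<bar> + \<bar>b2\<bar>"
  have B: "\<beta>1 \<in> ball 0 \<rho>" "\<beta>2 \<in> ball 0 \<rho>" using b by (auto simp: \<beta>1_def \<beta>2_def)
  have n\<beta>: "norm \<beta>1 + norm \<beta>2 = \<beta>" by (simp add: \<beta>1_def \<beta>2_def \<beta>_def)
  have z: "0 \<in> ball (0::complex) \<rho>" "of_real k0 \<in> ball (complex_of_real k0) \<rho>" using \<rho> by auto
  have sm1: "norm (s - 1) \<le> K0 * \<beta>"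
    using solution_complex(3)[OF z B] n\<beta> by (simp add: root_c_def speed0_zero x_def s_def)
  have fo: "norm (s - 1 - (x * \<beta>1 + \<beta>2) / 2) \<le> K0 * \<beta>\<^sup>2"
     "norm (c - (x + \<beta>1 * (x\<^sup>2 / 2 + 1) + 3 / 2 * \<beta>2 * x)) \<le> K0 * \<beta>\<^sup>2"
    using first_order[OF subsetD[OF box_subset(2) B(1)] subsetD[OF box_subset(2) B(2)]] n\<beta> by (auto simp: s_def c_def x_def)
  have nx: "norm x \<le> 1" using cww_pos[OF k0] cww_less_one[OF k0] by (simp add: x_def)
  have K: "K0 * \<beta>\<^sup>2 \<le> K * \<beta>\<^sup>2" "2 * K0 * \<beta>\<^sup>2 \<le> K * \<beta>\<^sup>2"
    using K0 by (auto simp: K_def intro!: mult_right_mono)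
  have re: "\<bar>Re v - y\<bar> \<le> norm (v - of_real y)" for v y
    using abs_Re_le_cmod[of "v - of_real y"] by simp
  have "norm (s\<^sup>2 - 1 - (x * \<beta>1 + \<beta>2)) \<le> K * \<beta>\<^sup>2"
  proof -
    have "s\<^sup>2 - 1 - (x * \<beta>1 + \<beta>2) = 2 * (s - 1 - (x * \<beta>1 + \<beta>2) / 2) + (s - 1)\<^sup>2" by (simp add: field_simps power2_eq_square)
    then have "norm (s\<^sup>2 - 1 - (x * \<beta>1 + \<beta>2)) \<le> norm (2 * (s - 1 - (x * \<beta>1 + \<beta>2) / 2)) + norm ((s - 1)\<^sup>2)"
      by (metis norm_triangle_ineq)
    also have "\<dots> \<le> 2 * (K0 * \<beta>\<^sup>2) + (K0 * \<beta>)\<^sup>2"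
      unfolding norm_mult norm_power using fo(1) power_mono[OF sm1, of 2] by (intro add_mono) auto
    finally show ?thesis by (simp add: K_def algebra_simps power_mult_distrib)
  qed
  then show "\<bar>wave_eta (0, k0, b1, b2) 0 - (b1 * cww k0 + b2)\<bar> \<le> K * (\<bar>b1\<bar> + \<bar>b2\<bar>)\<^sup>2"
    using re[of "s\<^sup>2 - 1" "b1 * cww k0 + b2"]
    by (simp add: wave_eta_def base_point \<beta>_def \<beta>1_def[symmetric] \<beta>2_def[symmetric] x_def[symmetric] s_def[symmetric] mult.commute)
  have "norm (c - (x + \<beta>1 * (x\<^sup>2 / 2 + 1) + 3 / 2 * \<beta>2 * x)) \<le> K * \<beta>\<^sup>2" using fo(2) K by linarith
  then show "\<bar>wave_c (0, k0, b1, b2) - (cww k0 + b1 * ((cww k0)\<^sup>2 / 2 + 1) + 3 / 2 * b2 * cww k0)\<bar> \<le> K * (\<bar>b1\<bar> + \<bar>b2\<bar>)\<^sup>2"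
    using re[of c "cww k0 + b1 * ((cww k0)\<^sup>2 / 2 + 1) + 3 / 2 * b2 * cww k0"]
    by (simp add: wave_c_def base_point \<beta>_def \<beta>1_def[symmetric] \<beta>2_def[symmetric] x_def[symmetric] c_def[symmetric])
  have "norm (c - s * x - (\<beta>1 + \<beta>2 * x)) \<le> K * \<beta>\<^sup>2"
  proof -
    have "c - s * x - (\<beta>1 + \<beta>2 * x) = (c - (x + \<beta>1 * (x\<^sup>2 / 2 + 1) + 3 / 2 * \<beta>2 * x)) - (s - 1 - (x * \<beta>1 + \<beta>2) / 2) * x"
      by (simp add: field_simps power2_eq_square)
    then have "norm (c - s * x - (\<beta>1 + \<beta>2 * x)) \<le> norm (c - (x + \<beta>1 * (x\<^sup>2 / 2 + 1) + 3 / 2 * \<beta>2 * x)) + norm (s - 1 - (x * \<beta>1 + \<beta>2) / 2) * norm x"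
      by (metis norm_mult norm_triangle_ineq4)
    also have "norm (s - 1 - (x * \<beta>1 + \<beta>2) / 2) * norm x \<le> (K0 * \<beta>\<^sup>2) * 1"
      using fo(1) nx K0 by (intro mult_mono) auto
    finally show ?thesis using fo(2) K by linarith
  qed
  then show "\<bar>wave_u (0, k0, b1, b2) 0 - (b1 + b2 * cww k0)\<bar> \<le> K * (\<bar>b1\<bar> + \<bar>b2\<bar>)\<^sup>2"
    using re[of "c - s * x" "b1 + b2 * cww k0"]
    by (simp add: wave_u_def base_point \<beta>_def \<beta>1_def[symmetric] \<beta>2_def[symmetric] x_def[symmetric] s_def[symmetric] c_def[symmetric])
qed

lemma second_order_real:
  defines "h0 \<equiv> 3 / 4 * (cww k0)\<^sup>2 / ((cww k0)\<^sup>2 - 1)"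
    and "h2 \<equiv> 3 / 4 * (cww k0)\<^sup>2 / ((cww k0)\<^sup>2 - (cww (2 * k0))\<^sup>2)"
  obtains K where "K \<ge> 0"
    "\<And>a b1 b2 z. \<bar>a\<bar> < \<rho> \<Longrightarrow> \<bar>b1\<bar> < \<rho> \<Longrightarrow> \<bar>b2\<bar> < \<rho> \<Longrightarrow>
      \<bar>wave_c (a, k0, b1, b2) - (wave_c (0, k0, b1, b2) + 3 / 4 * a\<^sup>2 * cww k0 * (2 * h0 + h2 - 1))\<bar>
         \<le> K * \<bar>a\<bar> * (\<bar>a\<bar> + \<bar>b1\<bar> + \<bar>b2\<bar>)\<^sup>2 \<and>
      \<bar>wave_eta (a, k0, b1, b2) z - (wave_eta (0, k0, b1, b2) 0 + a * cos z + a * (b1 * cww k0 + b2) * cos z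
          + a\<^sup>2 * (h0 + h2 * cos (2 * z)))\<bar> \<le> K * \<bar>a\<bar> * (\<bar>a\<bar> + \<bar>b1\<bar> + \<bar>b2\<bar>)\<^sup>2 \<and>
      \<bar>wave_u (a, k0, b1, b2) z - (wave_u (0, k0, b1, b2) 0 + a * cww k0 * cos z
          + 1 / 2 * a * cww k0 * (b1 * cww k0 + b2) * cos z
          + a\<^sup>2 * cww k0 * (h0 - 1 / 2 + (h2 - 1 / 2) * cos (2 * z)))\<bar> \<le> K * \<bar>a\<bar> * (\<bar>a\<bar> + \<bar>b1\<bar> + \<bar>b2\<bar>)\<^sup>2"
proof -
  define cw where "cw = cww k0"
  have cw: "0 < cw" "cw < 1" using cww_pos[OF k0] cww_less_one[OF k0] by (auto simp: cw_def)
  define x where "x = complex_of_real cw"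
  define \<nu> where "\<nu> = complex_of_real (3 / 2 * cw\<^sup>2 * (2 * h0 + h2 - 1))"
  define C where "C = 2 * B / t ^ 3"
  have "B \<ge> 0" using geom_bounded_nonneg[OF bounded_coeffs(1)[of "of_real k0"]] r by simp
  then have C: "C \<ge> 0" using t by (simp add: C_def)
  define N where "N = (norm \<nu> + C) / cw"
  define N' where "N' = (2 * cw * C + N * norm \<nu>) / (2 * cw\<^sup>2)"
  have N: "N \<ge> 0" "N' \<ge> 0" using C cw by (auto simp: N_def N'_def)
  define H where "H = \<bar>h0\<bar> + \<bar>h2\<bar> + 1"
  \<comment> \<open>One constant that dominates all bounds entering
    \<open>combine_expansions\<close>.\<close>
  define K where "K = 1 + K0 + K0 * N + N + N' + C + H"
  have KN: "0 \<le> K0 * N" "0 \<le> H" using K0 N by (auto simp: H_def)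
  have K: "1 \<le> K" "K0 \<le> K" "K0 * N \<le> K" "N \<le> K" "N' \<le> K" "C \<le> K" "C + H \<le> K" "0 \<le> K"
    using K0 N C KN unfolding K_def by linarith+
  show ?thesis
  proof (rule that[of "20 * K ^ 3"])
    show "20 * K ^ 3 \<ge> 0" using K by simp
    fix a b1 b2 z :: real
    assume a: "\<bar>a\<bar> < \<rho>" and b: "\<bar>b1\<bar> < \<rho>" "\<bar>b2\<bar> < \<rho>"
    define A where "A = complex_of_real a"
    define \<alpha> where "\<alpha> = norm A"
    define \<beta>1 where "\<beta>1 = complex_of_real b1"
    define \<beta>2 where "\<beta>2 = complex_of_real b2"
    define \<beta> where "\<beta> = \<bar>b1\<bar> + \<bar>b2\<bar>"
    define q where "q = speed0 A (of_real k0)"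
    define c where "c = wave_speed q \<beta>1 \<beta>2"
    define s where "s = root_stretch q \<beta>1 \<beta>2"
    define c0 where "c0 = wave_speed x \<beta>1 \<beta>2"
    define s0 where "s0 = root_stretch x \<beta>1 \<beta>2"
    define e where "e = eta_series A (of_real k0) (of_real z)"
    define w where "w = w_series A (of_real k0) (of_real z)"
    \<comment> \<open>The linear part of s^2 - 1 in b1 and b2, the source of the terms a (b1 cww +
      b2) cos z.\<close>
    define L where "L = x * \<beta>1 + \<beta>2"
    define X where "X = complex_of_real (cos z)"
    define h where "h = complex_of_real (h0 + h2 * cos (2 * z))"
    define w2 where "w2 = complex_of_real (h0 - 1/2 + (h2 - 1/2) * cos (2 * z))"
    have kk: "of_real k0 \<in> ball (complex_of_real k0) \<rho>" "of_real k0 \<in> ball (complex_of_real k0) r" using \<rho> r by auto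
    have Ab: "A \<in> ball 0 \<rho>" "0 \<in> ball (0::complex) \<rho>" using a \<rho> by (auto simp: A_def)
    have B: "\<beta>1 \<in> ball 0 \<rho>" "\<beta>2 \<in> ball 0 \<rho>" using b by (auto simp: \<beta>1_def \<beta>2_def)
    have B0: "\<beta>1 \<in> ball 0 \<rho>0" "\<beta>2 \<in> ball 0 \<rho>0" using B box_subset by blast+
    have n\<beta>: "norm \<beta>1 + norm \<beta>2 = \<beta>" by (simp add: \<beta>1_def \<beta>2_def \<beta>_def)
    have \<alpha>: "\<alpha> \<le> 1" "\<alpha> = \<bar>a\<bar>" "0 \<le> \<alpha>" using a \<rho> by (auto simp: \<alpha>_def A_def)
    have \<beta>: "0 \<le> \<beta>" "\<beta> \<le> 1" using b \<rho> by (auto simp: \<beta>_def)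
    have at: "norm A \<le> t / 2" using a \<rho> t by (simp add: A_def)
    note lo = series_lower_order[OF kk(2) at, folded cw_def, folded h0_def h2_def C_def]
    have lo1: "norm (e - A * X - A\<^sup>2 * h) \<le> C * \<alpha> ^ 3" "norm (w - A * X - A\<^sup>2 * w2) \<le> C * \<alpha> ^ 3"
      using lo(1,2)[of z] unfolding h0_def h2_def by (simp_all add: e_def w_def X_def h_def w2_def \<alpha>_def C_def cw_def h0_def h2_def mult.commute)
    have lo3: "norm (mu_series A (of_real k0) - of_real (cw\<^sup>2) - A\<^sup>2 * \<nu>) \<le> C * \<alpha> ^ 3"
      using lo(3) unfolding \<nu>_def \<alpha>_def by (simp add: C_def cw_def h0_def h2_def)
    have q2: "q\<^sup>2 = mu_series A (of_real k0)" by (simp add: q_def speed0_def)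
    have Rq: "Re q \<ge> 0" unfolding q_def speed0_def by (rule Re_csqrt)
    note sq = sqrt_expansion[OF cw(1) Rq \<alpha>_def \<alpha>(1) lo3[folded q2], folded N_def, folded N'_def x_def]
    have h: "norm h \<le> H" "norm w2 \<le> H"
    proof -
      have c1: "\<bar>h2 * cos (2 * z)\<bar> \<le> \<bar>h2\<bar>" "\<bar>cos (2 * z)\<bar> \<le> 1" by (simp_all add: abs_mult mult_left_le)
      show "norm h \<le> H" unfolding h_def norm_of_real H_def using c1 by linarith
      have "(h2 - 1/2) * cos (2 * z) = h2 * cos (2 * z) - cos (2 * z) / 2" by (simp add: algebra_simps)
      then show "norm w2 \<le> H" unfolding w2_def norm_of_real H_def using c1 by linarith
    qed
    have a32: "\<alpha> ^ 3 \<le> \<alpha>\<^sup>2" using \<alpha> by (intro power_decreasing) auto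
    have first: "norm (v - A * X) \<le> K * \<alpha>\<^sup>2" if "norm (v - A * X - A\<^sup>2 * g) \<le> C * \<alpha> ^ 3" "norm g \<le> H" for v g
    proof -
      have "norm (v - A * X) \<le> norm (v - A * X - A\<^sup>2 * g) + norm (A\<^sup>2 * g)"
        using norm_triangle_ineq[of "v - A * X - A\<^sup>2 * g" "A\<^sup>2 * g"] by simp
      also have "norm (A\<^sup>2 * g) \<le> \<alpha>\<^sup>2 * H" unfolding norm_mult norm_power \<alpha>_def[symmetric] using that by (intro mult_left_mono) auto
      also have "norm (v - A * X - A\<^sup>2 * g) \<le> C * \<alpha>\<^sup>2" using that(1) mult_left_mono[OF a32 C] by linarith
      finally have "norm (v - A * X) \<le> (C + H) * \<alpha>\<^sup>2" by (simp add: algebra_simps)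
      also have "\<dots> \<le> K * \<alpha>\<^sup>2" using K by (intro mult_right_mono) auto
      finally show ?thesis .
    qed
    have mixed': "norm ((c - q) - (c0 - x)) \<le> K0 * \<beta> * norm (q - x)" "norm (s - s0) \<le> K0 * \<beta> * norm (q - x)"
      using mixed[OF near(2)[OF Ab(1) kk(1)] B0] unfolding n\<beta> by (simp_all add: c_def c0_def s_def s0_def q_def x_def cw_def)
    \<comment> \<open>q differs from its value at a = 0 by a term of order a^2, so
      \<open>mixed\<close> yields the required product \<alpha>^2 \<beta>.\<close>
    have mx: "K0 * \<beta> * norm (q - x) \<le> K * (\<alpha>\<^sup>2 * \<beta>)"
    proof -
      have "K0 * \<beta> * norm (q - x) \<le> K0 * \<beta> * (N * \<alpha>\<^sup>2)" using sq(1) K0 \<beta> by (intro mult_left_mono) auto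
      also have "\<dots> = (K0 * N) * (\<alpha>\<^sup>2 * \<beta>)" by simp
      also have "\<dots> \<le> K * (\<alpha>\<^sup>2 * \<beta>)" using K \<beta> by (intro mult_right_mono) auto
      finally show ?thesis .
    qed
    have sol: "norm (s - 1) \<le> K0 * \<beta>" "norm s \<le> K0" "norm q \<le> K0"
      using solution_complex(3,5,6)[OF Ab(1) kk(1) B] unfolding n\<beta> by (simp_all add: s_def q_def root_c_def)
    have sol0: "norm (s0 - 1) \<le> K0 * \<beta>" "norm s0 \<le> K0" "norm x \<le> K0"
      using solution_complex(3,5,6)[OF Ab(2) kk(1) B] unfolding n\<beta> by (simp_all add: s0_def root_c_def speed0_zero x_def cw_def)
    have fo: "norm (s0 - 1 - L / 2) \<le> K0 * \<beta>\<^sup>2"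
      using first_order[OF B0] unfolding n\<beta> by (auto simp: s0_def L_def x_def cw_def)
    have Kb: "K0 * \<beta> \<le> K * \<beta>" "K0 * \<beta>\<^sup>2 \<le> K * \<beta>\<^sup>2" using K \<beta> by (auto intro!: mult_right_mono)
    have Ka: "N * \<alpha>\<^sup>2 \<le> K * \<alpha>\<^sup>2" "N' * \<alpha> ^ 3 \<le> K * \<alpha> ^ 3" "C * \<alpha> ^ 3 \<le> K * \<alpha> ^ 3"
      using K \<alpha> by (auto intro!: mult_right_mono)
    have nX: "norm X \<le> 1" by (simp add: X_def)
    note R = combine_expansions[of \<alpha> A \<beta> K q x "\<nu> / (2 * x)" c c0 s s0 L e X h w w2,
        OF \<alpha>_def \<alpha>(1) \<beta> K(1) order_trans[OF sq(1) Ka(1)] order_trans[OF sq(2) Ka(2)]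
        order_trans[OF sol(3) K(2)] order_trans[OF sol0(3) K(2)]
        order_trans[OF mixed'(1) mx] order_trans[OF mixed'(2) mx] order_trans[OF sol(2) K(2)] order_trans[OF sol0(2) K(2)]
        order_trans[OF sol(1) Kb(1)] order_trans[OF sol0(1) Kb(1)] order_trans[OF fo Kb(2)]
        first[OF lo1(1) h(1)] order_trans[OF lo1(1) Ka(3)] first[OF lo1(2) h(2)] order_trans[OF lo1(2) Ka(3)] nX]
    have E: "20 * K ^ 3 * (\<alpha> * (\<alpha> + \<beta>)\<^sup>2) = 20 * K ^ 3 * \<bar>a\<bar> * (\<bar>a\<bar> + \<bar>b1\<bar> + \<bar>b2\<bar>)\<^sup>2"
      by (simp add: \<alpha>(2) \<beta>_def add.assoc)
    have inb: "in_real_box k0 \<rho> (a, k0, b1, b2)" "in_real_box k0 \<rho> (0, k0, b1, b2)"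
      using a b \<rho> by (auto simp: in_real_box_def)
    note fr = solution_real(9-11)[OF inb(1)] and fr0 = solution_real(9-11)[OF inb(2)]
    have fc: "c = of_real (wave_c (a, k0, b1, b2))"
      using fr(3) by (simp add: speed_c_def c_def q_def A_def \<beta>1_def \<beta>2_def)
    have fe: "s\<^sup>2 - 1 + s\<^sup>2 * e = of_real (wave_eta (a, k0, b1, b2) z)"
      using fr(1)[of z] by (simp add: eta_c_def root_c_def s_def e_def q_def A_def \<beta>1_def \<beta>2_def)
    have fu: "c - s * q + s * q * w = of_real (wave_u (a, k0, b1, b2) z)"
      using fr(2)[of z] by (simp add: u_c_def speed_c_def root_c_def c_def s_def w_def q_def A_def \<beta>1_def \<beta>2_def)
    have fc0: "c0 = of_real (wave_c (0, k0, b1, b2))"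
      using fr0(3) by (simp add: base_point c0_def x_def cw_def \<beta>1_def \<beta>2_def)
    have fe0: "s0\<^sup>2 - 1 = of_real (wave_eta (0, k0, b1, b2) 0)"
      using fr0(1)[of 0] by (simp add: base_point s0_def x_def cw_def \<beta>1_def \<beta>2_def)
    have fu0: "c0 - s0 * x = of_real (wave_u (0, k0, b1, b2) 0)"
      using fr0(2)[of 0] by (simp add: base_point c0_def s0_def x_def cw_def \<beta>1_def \<beta>2_def)
    \<comment> \<open>Dividing the coefficient of a^2 in q^2 by 2 q0 turns 3/2 into 3/4 and removes
      one factor \<open>cww k0\<close>.\<close>
    have gam: "A\<^sup>2 * (\<nu> / (2 * x)) = of_real (3 / 4 * a\<^sup>2 * cw * (2 * h0 + h2 - 1))"
    proof -
      have "\<nu> / (2 * x) = of_real (3 / 2 * cw\<^sup>2 * (2 * h0 + h2 - 1) / (2 * cw))" by (simp add: \<nu>_def x_def)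
      also have "3 / 2 * cw\<^sup>2 * (2 * h0 + h2 - 1) / (2 * cw) = 3 / 4 * cw * (2 * h0 + h2 - 1)"
        using cw by (simp add: power2_eq_square)
      finally have g: "\<nu> / (2 * x) = of_real (3 / 4 * cw * (2 * h0 + h2 - 1))" .
      have "A\<^sup>2 * (\<nu> / (2 * x)) = of_real (a\<^sup>2 * (3 / 4 * cw * (2 * h0 + h2 - 1)))"
        unfolding g A_def by (simp only: of_real_power of_real_mult)
      also have "a\<^sup>2 * (3 / 4 * cw * (2 * h0 + h2 - 1)) = 3 / 4 * a\<^sup>2 * cw * (2 * h0 + h2 - 1)" by simp
      finally show ?thesis .
    qed
    have "norm (complex_of_real (wave_c (a, k0, b1, b2)) - (of_real (wave_c (0, k0, b1, b2)) + of_real (3 / 4 * a\<^sup>2 * cw * (2 * h0 + h2 - 1))))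
        \<le> 20 * K ^ 3 * \<bar>a\<bar> * (\<bar>a\<bar> + \<bar>b1\<bar> + \<bar>b2\<bar>)\<^sup>2"
      using R(1) unfolding E gam fc fc0 .
    then have r1: "\<bar>wave_c (a, k0, b1, b2) - (wave_c (0, k0, b1, b2) + 3 / 4 * a\<^sup>2 * cw * (2 * h0 + h2 - 1))\<bar>
         \<le> 20 * K ^ 3 * \<bar>a\<bar> * (\<bar>a\<bar> + \<bar>b1\<bar> + \<bar>b2\<bar>)\<^sup>2"
      by (simp only: of_real_add[symmetric] of_real_diff[symmetric] norm_of_real)
    have eqn: "complex_of_real (wave_eta (0, k0, b1, b2) 0) + A * X + A * L * X + A\<^sup>2 * h =
       of_real (wave_eta (0, k0, b1, b2) 0 + a * cos z + a * (b1 * cw + b2) * cos z + a\<^sup>2 * (h0 + h2 * cos (2 * z)))"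
      by (simp add: A_def X_def L_def h_def x_def \<beta>1_def \<beta>2_def mult_ac)
    have "norm (complex_of_real (wave_eta (a, k0, b1, b2) z) - of_real (wave_eta (0, k0, b1, b2) 0 + a * cos z + a * (b1 * cw + b2) * cos z + a\<^sup>2 * (h0 + h2 * cos (2 * z))))
        \<le> 20 * K ^ 3 * \<bar>a\<bar> * (\<bar>a\<bar> + \<bar>b1\<bar> + \<bar>b2\<bar>)\<^sup>2"
      using R(2) unfolding E fe fe0 eqn .
    then have r2: "\<bar>wave_eta (a, k0, b1, b2) z - (wave_eta (0, k0, b1, b2) 0 + a * cos z + a * (b1 * cw + b2) * cos z + a\<^sup>2 * (h0 + h2 * cos (2 * z)))\<bar>
         \<le> 20 * K ^ 3 * \<bar>a\<bar> * (\<bar>a\<bar> + \<bar>b1\<bar> + \<bar>b2\<bar>)\<^sup>2"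
      by (simp only: of_real_diff[symmetric] norm_of_real)
    have equ: "complex_of_real (wave_u (0, k0, b1, b2) 0) + A * x * X + A * x * L * X / 2 + A\<^sup>2 * x * w2 =
       of_real (wave_u (0, k0, b1, b2) 0 + a * cw * cos z + 1 / 2 * a * cw * (b1 * cw + b2) * cos z
          + a\<^sup>2 * cw * (h0 - 1 / 2 + (h2 - 1 / 2) * cos (2 * z)))"
      by (simp add: A_def X_def L_def w2_def x_def \<beta>1_def \<beta>2_def mult_ac)
    have "norm (complex_of_real (wave_u (a, k0, b1, b2) z) - of_real (wave_u (0, k0, b1, b2) 0 + a * cw * cos z + 1 / 2 * a * cw * (b1 * cw + b2) * cos z
          + a\<^sup>2 * cw * (h0 - 1 / 2 + (h2 - 1 / 2) * cos (2 * z)))) \<le> 20 * K ^ 3 * \<bar>a\<bar> * (\<bar>a\<bar> + \<bar>b1\<bar> + \<bar>b2\<bar>)\<^sup>2"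
      using R(3) unfolding E fu fu0 equ .
    then have r3: "\<bar>wave_u (a, k0, b1, b2) z - (wave_u (0, k0, b1, b2) 0 + a * cw * cos z + 1 / 2 * a * cw * (b1 * cw + b2) * cos z
          + a\<^sup>2 * cw * (h0 - 1 / 2 + (h2 - 1 / 2) * cos (2 * z)))\<bar> \<le> 20 * K ^ 3 * \<bar>a\<bar> * (\<bar>a\<bar> + \<bar>b1\<bar> + \<bar>b2\<bar>)\<^sup>2"
      by (simp only: of_real_diff[symmetric] norm_of_real)
    show "\<bar>wave_c (a, k0, b1, b2) - (wave_c (0, k0, b1, b2) + 3 / 4 * a\<^sup>2 * cww k0 * (2 * h0 + h2 - 1))\<bar>
         \<le> 20 * K ^ 3 * \<bar>a\<bar> * (\<bar>a\<bar> + \<bar>b1\<bar> + \<bar>b2\<bar>)\<^sup>2 \<and>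
      \<bar>wave_eta (a, k0, b1, b2) z - (wave_eta (0, k0, b1, b2) 0 + a * cos z + a * (b1 * cww k0 + b2) * cos z
          + a\<^sup>2 * (h0 + h2 * cos (2 * z)))\<bar> \<le> 20 * K ^ 3 * \<bar>a\<bar> * (\<bar>a\<bar> + \<bar>b1\<bar> + \<bar>b2\<bar>)\<^sup>2 \<and>
      \<bar>wave_u (a, k0, b1, b2) z - (wave_u (0, k0, b1, b2) 0 + a * cww k0 * cos z
          + 1 / 2 * a * cww k0 * (b1 * cww k0 + b2) * cos z
          + a\<^sup>2 * cww k0 * (h0 - 1 / 2 + (h2 - 1 / 2) * cos (2 * z)))\<bar> \<le> 20 * K ^ 3 * \<bar>a\<bar> * (\<bar>a\<bar> + \<bar>b1\<bar> + \<bar>b2\<bar>)\<^sup>2"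
      using r1 r2 r3 unfolding cw_def by blast
  qed
qed

end

section \<open>Union of the local boxes over all wave numbers\<close>

definition good_radius :: "real \<Rightarrow> real \<Rightarrow> bool" where
  "good_radius k0 \<rho> \<longleftrightarrow> (\<exists>r t B M \<rho>0 K0. wave_local k0 r t B M \<rho>0 K0 \<rho>)"

text \<open>The radius may depend on k0 in an arbitrary way: the union of open boxes is open in any
  case. The boxes are symmetric in \<open>a\<close>, so the union is invariant under a ->
  -a.\<close>

definition box_union :: "(real \<Rightarrow> real) \<Rightarrow> (real \<times> real \<times> real \<times> real) set" where
  "box_union R = {p. \<exists>k0>0. in_real_box k0 (R k0) p}"

lemma open_box_union: "open (box_union R)"
proof -
  have "{p. in_real_box k0 \<rho> p} = {-\<rho><..<\<rho>} \<times> {k0-\<rho><..<k0+\<rho>} \<times> {-\<rho><..<\<rho>} \<times> {-\<rho><..<\<rho>}" for k0 \<rho>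
    by (auto simp: in_real_box_def abs_less_iff)
  then have "open {p. in_real_box k0 \<rho> p}" for k0 \<rho> by (simp add: open_Times)
  moreover have "box_union R = (\<Union>k0\<in>{0<..}. {p. in_real_box k0 (R k0) p})" by (auto simp: box_union_def)
  ultimately show ?thesis by (simp add: open_UN)
qed

lemma good_radius_analytic:
  assumes R: "\<And>k0. k0 > 0 \<Longrightarrow> good_radius k0 (R k0)"
  shows "analytic_family_on (box_union R) wave_eta" "analytic_family_on (box_union R) wave_u"
    "analytic_family_on (box_union R) (\<lambda>p z. wave_c p)"
proof -
  have bd: "\<exists>k0 \<rho> D. in_real_box k0 \<rho> p \<and>
     (\<forall>z::real. separately_holomorphic4 \<rho> (\<lambda>x y v w. G x (of_real k0 + y) v w z)) \<and>
     (\<forall>z. \<forall>a\<in>ball 0 \<rho>. \<forall>\<kappa>\<in>ball (of_real k0) \<rho>. \<forall>b1\<in>ball 0 \<rho>. \<forall>b2\<in>ball 0 \<rho>. norm (G a \<kappa> b1 b2 z) \<le> D)"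
    if p: "p \<in> box_union R" and G: "G \<in> {\<lambda>a \<kappa> b1 b2 z. eta_c a \<kappa> b1 b2 (of_real z), \<lambda>a \<kappa> b1 b2 z. u_c a \<kappa> b1 b2 (of_real z),
      \<lambda>a \<kappa> b1 b2 z. speed_c a \<kappa> b1 b2}" for p and G :: "complex \<Rightarrow> complex \<Rightarrow> complex \<Rightarrow> complex \<Rightarrow> real \<Rightarrow> complex"
  proof -
    from p obtain k0 where k: "k0 > 0" "in_real_box k0 (R k0) p" by (auto simp: box_union_def)
    from R[OF k(1)] obtain r t B M \<rho>0 K0 where "wave_local k0 r t B M \<rho>0 K0 (R k0)" by (auto simp: good_radius_def)
    then interpret wave_local k0 r t B M \<rho>0 K0 "R k0" .
    show ?thesis
      by (rule exI[of _ k0], rule exI[of _ "R k0"], rule exI[of _ "1 + K0 + (1 + K0 ^ 2) * (1 + 2 * B)"])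
        (use k(2) G separately_holomorphic_wave norm_wave_le in auto)
  qed
  show "analytic_family_on (box_union R) wave_eta"
    using analytic_family_on_boxes[of "box_union R" "\<lambda>a \<kappa> b1 b2 z. eta_c a \<kappa> b1 b2 (of_real z)", OF bd]
    unfolding wave_eta_def by simp
  show "analytic_family_on (box_union R) wave_u"
    using analytic_family_on_boxes[of "box_union R" "\<lambda>a \<kappa> b1 b2 z. u_c a \<kappa> b1 b2 (of_real z)", OF bd]
    unfolding wave_u_def by simp
  have "(\<lambda>p z. wave_c p) = (\<lambda>(a, k, b1, b2) (z::real). Re (speed_c (of_real a) (of_real k) (of_real b1) (of_real b2)))"
    by (auto simp: wave_c_def fun_eq_iff)
  then show "analytic_family_on (box_union R) (\<lambda>p z. wave_c p)"
    using analytic_family_on_boxes[of "box_union R" "\<lambda>a \<kappa> b1 b2 z. speed_c a \<kappa> b1 b2", OF bd] by simp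
qed

lemma good_radius_solution:
  assumes g: "good_radius k0 \<rho>" and box: "in_real_box k0 \<rho> (a, k, b1, b2)"
  defines "p \<equiv> (a, k, b1, b2)"
  shows "k > 0"
    and "\<And>z. - wave_c p * wave_eta p z + wave_u p z + wave_u p z * wave_eta p z = (1 - (wave_c p)\<^sup>2) * b1"
    and "\<And>z. - wave_c p * wave_u p z + cww2_mult k (wave_eta p) z + (wave_u p z)\<^sup>2 / 2 = (1 - (wave_c p)\<^sup>2) * b2"
    and "\<And>z. wave_eta p (z + 2 * pi) = wave_eta p z" "\<And>z. wave_u p (z + 2 * pi) = wave_u p z"
    and "\<And>z. wave_eta p (- z) = wave_eta p z" "\<And>z. wave_u p (- z) = wave_u p z"
    and "smooth_real (wave_eta p)" "smooth_real (wave_u p)"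
proof -
  from g obtain r t B M \<rho>0 K0 where "wave_local k0 r t B M \<rho>0 K0 \<rho>" by (auto simp: good_radius_def)
  then interpret wave_local k0 r t B M \<rho>0 K0 \<rho> .
  show "k > 0" using box \<rho>(3) r k0 by (auto simp: in_real_box_def)
  note S = solution_real[OF box, folded p_def]
  show "\<And>z. - wave_c p * wave_eta p z + wave_u p z + wave_u p z * wave_eta p z = (1 - (wave_c p)\<^sup>2) * b1"
    and "\<And>z. - wave_c p * wave_u p z + cww2_mult k (wave_eta p) z + (wave_u p z)\<^sup>2 / 2 = (1 - (wave_c p)\<^sup>2) * b2"
    and "\<And>z. wave_eta p (z + 2 * pi) = wave_eta p z" "\<And>z. wave_u p (z + 2 * pi) = wave_u p z"
    and "\<And>z. wave_eta p (- z) = wave_eta p z" "\<And>z. wave_u p (- z) = wave_u p z"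
    and "smooth_real (wave_eta p)" "smooth_real (wave_u p)"
    by (rule S)+
qed

text \<open>The box centred at the given wave number is used, so that the expansion takes place
  about q0 = \<open>cww \<kappa>\<close> itself; the constants may therefore depend on
  \<kappa>.\<close>

lemma good_radius_expansion:
  assumes g: "good_radius \<kappa> \<delta>" and box: "\<And>p. in_real_box \<kappa> \<delta> p \<Longrightarrow> p \<in> U"
  shows "\<exists>K \<delta>. \<delta> > 0 \<and>
        (\<forall>b1 b2. \<bar>b1\<bar> < \<delta> \<longrightarrow> \<bar>b2\<bar> < \<delta> \<longrightarrow>
           \<bar>wave_eta (0, \<kappa>, b1, b2) 0 - (b1 * cww \<kappa> + b2)\<bar> \<le> K * (\<bar>b1\<bar> + \<bar>b2\<bar>)\<^sup>2 \<and>
           \<bar>wave_u (0, \<kappa>, b1, b2) 0 - (b1 + b2 * cww \<kappa>)\<bar> \<le> K * (\<bar>b1\<bar> + \<bar>b2\<bar>)\<^sup>2 \<and>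
           \<bar>wave_c (0, \<kappa>, b1, b2) - (cww \<kappa> + b1 * ((cww \<kappa>)\<^sup>2 / 2 + 1) + 3 / 2 * b2 * cww \<kappa>)\<bar>
              \<le> K * (\<bar>b1\<bar> + \<bar>b2\<bar>)\<^sup>2) \<and>
        (\<forall>a b1 b2. \<bar>a\<bar> < \<delta> \<longrightarrow> \<bar>b1\<bar> < \<delta> \<longrightarrow> \<bar>b2\<bar> < \<delta> \<longrightarrow>
           (let cw = cww \<kappa>;
                h0 = 3 / 4 * cw\<^sup>2 / (cw\<^sup>2 - 1);
                h2 = 3 / 4 * cw\<^sup>2 / (cw\<^sup>2 - (cww (2 * \<kappa>))\<^sup>2);
                E = K * \<bar>a\<bar> * (\<bar>a\<bar> + \<bar>b1\<bar> + \<bar>b2\<bar>)\<^sup>2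
            in (a, \<kappa>, b1, b2) \<in> U \<and>
               (\<forall>z. \<bar>wave_eta (a, \<kappa>, b1, b2) z
                   - (wave_eta (0, \<kappa>, b1, b2) 0 + a * cos z + a * (b1 * cw + b2) * cos z
                      + a\<^sup>2 * (h0 + h2 * cos (2 * z)))\<bar> \<le> E) \<and>
               (\<forall>z. \<bar>wave_u (a, \<kappa>, b1, b2) z
                   - (wave_u (0, \<kappa>, b1, b2) 0 + a * cw * cos z + 1 / 2 * a * cw * (b1 * cw + b2) * cos z
                      + a\<^sup>2 * cw * (h0 - 1 / 2 + (h2 - 1 / 2) * cos (2 * z)))\<bar> \<le> E) \<and>
               \<bar>wave_c (a, \<kappa>, b1, b2)
                   - (wave_c (0, \<kappa>, b1, b2) + 3 / 4 * a\<^sup>2 * cw * (2 * h0 + h2 - 1))\<bar> \<le> E))"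
proof -
  define cw where "cw = cww \<kappa>"
  define h0 where "h0 = 3 / 4 * cw\<^sup>2 / (cw\<^sup>2 - 1)"
  define h2 where "h2 = 3 / 4 * cw\<^sup>2 / (cw\<^sup>2 - (cww (2 * \<kappa>))\<^sup>2)"
  from g obtain r t B M \<rho>0 K0 where "wave_local \<kappa> r t B M \<rho>0 K0 \<delta>" by (auto simp: good_radius_def)
  then interpret wave_local \<kappa> r t B M \<rho>0 K0 \<delta> .
  from second_order_real obtain K where K0: "K \<ge> 0" and K: "\<And>a b1 b2 z. \<bar>a\<bar> < \<delta> \<Longrightarrow> \<bar>b1\<bar> < \<delta> \<Longrightarrow> \<bar>b2\<bar> < \<delta> \<Longrightarrow>
      \<bar>wave_c (a, \<kappa>, b1, b2) - (wave_c (0, \<kappa>, b1, b2) + 3 / 4 * a\<^sup>2 * cw * (2 * h0 + h2 - 1))\<bar>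
         \<le> K * \<bar>a\<bar> * (\<bar>a\<bar> + \<bar>b1\<bar> + \<bar>b2\<bar>)\<^sup>2 \<and>
      \<bar>wave_eta (a, \<kappa>, b1, b2) z - (wave_eta (0, \<kappa>, b1, b2) 0 + a * cos z + a * (b1 * cw + b2) * cos z
          + a\<^sup>2 * (h0 + h2 * cos (2 * z)))\<bar> \<le> K * \<bar>a\<bar> * (\<bar>a\<bar> + \<bar>b1\<bar> + \<bar>b2\<bar>)\<^sup>2 \<and>
      \<bar>wave_u (a, \<kappa>, b1, b2) z - (wave_u (0, \<kappa>, b1, b2) 0 + a * cw * cos z
          + 1 / 2 * a * cw * (b1 * cw + b2) * cos z
          + a\<^sup>2 * cw * (h0 - 1 / 2 + (h2 - 1 / 2) * cos (2 * z)))\<bar> \<le> K * \<bar>a\<bar> * (\<bar>a\<bar> + \<bar>b1\<bar> + \<bar>b2\<bar>)\<^sup>2"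
    unfolding h0_def h2_def cw_def by metis
  define K' where "K' = max K (2 * K0 + K0 ^ 2)"
  have m1: "x \<le> K' * (\<bar>b1\<bar> + \<bar>b2\<bar>)\<^sup>2" if "x \<le> (2 * K0 + K0 ^ 2) * (\<bar>b1\<bar> + \<bar>b2\<bar>)\<^sup>2" for x b1 b2
    using that by (rule order_trans) (auto simp: K'_def intro: mult_right_mono)
  have m2: "x \<le> K' * \<bar>a\<bar> * (\<bar>a\<bar> + \<bar>b1\<bar> + \<bar>b2\<bar>)\<^sup>2" if "x \<le> K * \<bar>a\<bar> * (\<bar>a\<bar> + \<bar>b1\<bar> + \<bar>b2\<bar>)\<^sup>2" for x a b1 b2
    using that by (rule order_trans) (auto simp: K'_def intro!: mult_right_mono)
  have KE: "\<bar>wave_c (a, \<kappa>, b1, b2) - (wave_c (0, \<kappa>, b1, b2) + 3 / 4 * a\<^sup>2 * cw * (2 * h0 + h2 - 1))\<bar>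
         \<le> K * \<bar>a\<bar> * (\<bar>a\<bar> + \<bar>b1\<bar> + \<bar>b2\<bar>)\<^sup>2"
      "\<bar>wave_eta (a, \<kappa>, b1, b2) z - (wave_eta (0, \<kappa>, b1, b2) 0 + a * cos z + a * (b1 * cw + b2) * cos z
          + a\<^sup>2 * (h0 + h2 * cos (2 * z)))\<bar> \<le> K * \<bar>a\<bar> * (\<bar>a\<bar> + \<bar>b1\<bar> + \<bar>b2\<bar>)\<^sup>2"
      "\<bar>wave_u (a, \<kappa>, b1, b2) z - (wave_u (0, \<kappa>, b1, b2) 0 + a * cw * cos z
          + 1 / 2 * a * cw * (b1 * cw + b2) * cos z
          + a\<^sup>2 * cw * (h0 - 1 / 2 + (h2 - 1 / 2) * cos (2 * z)))\<bar> \<le> K * \<bar>a\<bar> * (\<bar>a\<bar> + \<bar>b1\<bar> + \<bar>b2\<bar>)\<^sup>2"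
    if "\<bar>a\<bar> < \<delta>" "\<bar>b1\<bar> < \<delta>" "\<bar>b2\<bar> < \<delta>" for a b1 b2 z using K[OF that] by blast+
  have bx: "(a, \<kappa>, b1, b2) \<in> U" if "\<bar>a\<bar> < \<delta>" "\<bar>b1\<bar> < \<delta>" "\<bar>b2\<bar> < \<delta>" for a b1 b2
    using that \<rho>(1) by (intro box) (simp add: in_real_box_def)
  show ?thesis
    unfolding Let_def
    by (intro exI[of _ K'] exI[of _ \<delta>] conjI allI impI m1 m2 \<rho>(1) first_order_real bx
        KE[unfolded h0_def h2_def cw_def]; assumption)
qed

theorem theorem2p1:
  "\<exists>(U :: (real \<times> real \<times> real \<times> real) set)
      (\<eta> :: real \<times> real \<times> real \<times> real \<Rightarrow> real \<Rightarrow> real)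
      (u :: real \<times> real \<times> real \<times> real \<Rightarrow> real \<Rightarrow> real)
      (c :: real \<times> real \<times> real \<times> real \<Rightarrow> real)
      (\<eta>0 :: real \<Rightarrow> real \<Rightarrow> real \<Rightarrow> real) (u0 :: real \<Rightarrow> real \<Rightarrow> real \<Rightarrow> real)
      (c0 :: real \<Rightarrow> real \<Rightarrow> real \<Rightarrow> real).
     open U \<and> U \<subseteq> {(a, \<kappa>, b1, b2). \<kappa> > 0} \<and>
     (\<forall>a \<kappa> b1 b2. (a, \<kappa>, b1, b2) \<in> U \<longrightarrow>
        (\<forall>z. - c (a, \<kappa>, b1, b2) * \<eta> (a, \<kappa>, b1, b2) z + u (a, \<kappa>, b1, b2) z
              + u (a, \<kappa>, b1, b2) z * \<eta> (a, \<kappa>, b1, b2) z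
             = (1 - (c (a, \<kappa>, b1, b2))\<^sup>2) * b1) \<and>
        (\<forall>z. - c (a, \<kappa>, b1, b2) * u (a, \<kappa>, b1, b2) z + cww2_mult \<kappa> (\<eta> (a, \<kappa>, b1, b2)) z
              + (u (a, \<kappa>, b1, b2) z)\<^sup>2 / 2
             = (1 - (c (a, \<kappa>, b1, b2))\<^sup>2) * b2) \<and>
        (\<forall>z. \<eta> (a, \<kappa>, b1, b2) (z + 2 * pi) = \<eta> (a, \<kappa>, b1, b2) z) \<and>
        (\<forall>z. u (a, \<kappa>, b1, b2) (z + 2 * pi) = u (a, \<kappa>, b1, b2) z) \<and>
        (\<forall>z. \<eta> (a, \<kappa>, b1, b2) (- z) = \<eta> (a, \<kappa>, b1, b2) z) \<and>
        (\<forall>z. u (a, \<kappa>, b1, b2) (- z) = u (a, \<kappa>, b1, b2) z) \<and>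
        smooth_real (\<eta> (a, \<kappa>, b1, b2)) \<and> smooth_real (u (a, \<kappa>, b1, b2)) \<and>
        (- a, \<kappa>, b1, b2) \<in> U \<and> c (- a, \<kappa>, b1, b2) = c (a, \<kappa>, b1, b2)) \<and>
     analytic_family_on U \<eta> \<and> analytic_family_on U u \<and>
     analytic_family_on U (\<lambda>p z. c p) \<and>
     (\<forall>\<kappa>>0. \<exists>K \<delta>. \<delta> > 0 \<and>
        (\<forall>b1 b2. \<bar>b1\<bar> < \<delta> \<longrightarrow> \<bar>b2\<bar> < \<delta> \<longrightarrow>
           \<bar>\<eta>0 \<kappa> b1 b2 - (b1 * cww \<kappa> + b2)\<bar> \<le> K * (\<bar>b1\<bar> + \<bar>b2\<bar>)\<^sup>2 \<and>
           \<bar>u0 \<kappa> b1 b2 - (b1 + b2 * cww \<kappa>)\<bar> \<le> K * (\<bar>b1\<bar> + \<bar>b2\<bar>)\<^sup>2 \<and>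
           \<bar>c0 \<kappa> b1 b2 - (cww \<kappa> + b1 * ((cww \<kappa>)\<^sup>2 / 2 + 1) + 3 / 2 * b2 * cww \<kappa>)\<bar>
              \<le> K * (\<bar>b1\<bar> + \<bar>b2\<bar>)\<^sup>2) \<and>
        (\<forall>a b1 b2. \<bar>a\<bar> < \<delta> \<longrightarrow> \<bar>b1\<bar> < \<delta> \<longrightarrow> \<bar>b2\<bar> < \<delta> \<longrightarrow>
           (let cw = cww \<kappa>;
                h0 = 3 / 4 * cw\<^sup>2 / (cw\<^sup>2 - 1);
                h2 = 3 / 4 * cw\<^sup>2 / (cw\<^sup>2 - (cww (2 * \<kappa>))\<^sup>2);
                E = K * \<bar>a\<bar> * (\<bar>a\<bar> + \<bar>b1\<bar> + \<bar>b2\<bar>)\<^sup>2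
            in (a, \<kappa>, b1, b2) \<in> U \<and>
               (\<forall>z. \<bar>\<eta> (a, \<kappa>, b1, b2) z
                   - (\<eta>0 \<kappa> b1 b2 + a * cos z + a * (b1 * cw + b2) * cos z
                      + a\<^sup>2 * (h0 + h2 * cos (2 * z)))\<bar> \<le> E) \<and>
               (\<forall>z. \<bar>u (a, \<kappa>, b1, b2) z
                   - (u0 \<kappa> b1 b2 + a * cw * cos z + 1 / 2 * a * cw * (b1 * cw + b2) * cos z
                      + a\<^sup>2 * cw * (h0 - 1 / 2 + (h2 - 1 / 2) * cos (2 * z)))\<bar> \<le> E) \<and>
               \<bar>c (a, \<kappa>, b1, b2)
                   - (c0 \<kappa> b1 b2 + 3 / 4 * a\<^sup>2 * cw * (2 * h0 + h2 - 1))\<bar> \<le> E)))"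
proof -
  have "\<forall>k0. \<exists>\<rho>. k0 > 0 \<longrightarrow> good_radius k0 \<rho>"
    using wave_local_exists unfolding good_radius_def by metis
  then obtain R where R: "\<And>k0. k0 > 0 \<Longrightarrow> good_radius k0 (R k0)" by metis
  have inU: "\<exists>k0. good_radius k0 (R k0) \<and> in_real_box k0 (R k0) p" if "p \<in> box_union R" for p
    using that R by (auto simp: box_union_def)
  have sol: "(\<forall>z. - wave_c (a, \<kappa>, b1, b2) * wave_eta (a, \<kappa>, b1, b2) z + wave_u (a, \<kappa>, b1, b2) z
              + wave_u (a, \<kappa>, b1, b2) z * wave_eta (a, \<kappa>, b1, b2) z
             = (1 - (wave_c (a, \<kappa>, b1, b2))\<^sup>2) * b1) \<and>
        (\<forall>z. - wave_c (a, \<kappa>, b1, b2) * wave_u (a, \<kappa>, b1, b2) z + cww2_mult \<kappa> (wave_eta (a, \<kappa>, b1, b2)) z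
              + (wave_u (a, \<kappa>, b1, b2) z)\<^sup>2 / 2
             = (1 - (wave_c (a, \<kappa>, b1, b2))\<^sup>2) * b2) \<and>
        (\<forall>z. wave_eta (a, \<kappa>, b1, b2) (z + 2 * pi) = wave_eta (a, \<kappa>, b1, b2) z) \<and>
        (\<forall>z. wave_u (a, \<kappa>, b1, b2) (z + 2 * pi) = wave_u (a, \<kappa>, b1, b2) z) \<and>
        (\<forall>z. wave_eta (a, \<kappa>, b1, b2) (- z) = wave_eta (a, \<kappa>, b1, b2) z) \<and>
        (\<forall>z. wave_u (a, \<kappa>, b1, b2) (- z) = wave_u (a, \<kappa>, b1, b2) z) \<and>
        smooth_real (wave_eta (a, \<kappa>, b1, b2)) \<and> smooth_real (wave_u (a, \<kappa>, b1, b2)) \<and>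
        (- a, \<kappa>, b1, b2) \<in> box_union R \<and> wave_c (- a, \<kappa>, b1, b2) = wave_c (a, \<kappa>, b1, b2)"
    if p: "(a, \<kappa>, b1, b2) \<in> box_union R" for a \<kappa> b1 b2
  proof -
    from inU[OF p] obtain k0 where k0: "good_radius k0 (R k0)" "in_real_box k0 (R k0) (a, \<kappa>, b1, b2)" by blast
    have "(- a, \<kappa>, b1, b2) \<in> box_union R" using p by (auto simp: box_union_def in_real_box_def)
    then show ?thesis by (intro conjI allI good_radius_solution(2-9)[OF k0] wave_c_minus)
  qed
  have boxU: "in_real_box \<kappa> (R \<kappa>) p \<Longrightarrow> \<kappa> > 0 \<Longrightarrow> p \<in> box_union R" for \<kappa> p by (auto simp: box_union_def)
  show ?thesis
  \<comment> \<open>At a = 0 the wave does not depend on z, so its values at z = 0 give the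
    constants \<eta>0 and u0.\<close>
  proof (rule exI[of _ "box_union R"], rule exI[of _ wave_eta], rule exI[of _ wave_u], rule exI[of _ wave_c],
      rule exI[of _ "\<lambda>\<kappa> b1 b2. wave_eta (0, \<kappa>, b1, b2) 0"], rule exI[of _ "\<lambda>\<kappa> b1 b2. wave_u (0, \<kappa>, b1, b2) 0"],
      rule exI[of _ "\<lambda>\<kappa> b1 b2. wave_c (0, \<kappa>, b1, b2)"], intro conjI)
    show "open (box_union R)" by (rule open_box_union)
    show "box_union R \<subseteq> {(a, \<kappa>, b1, b2). \<kappa> > 0}"
      using inU good_radius_solution(1) by fastforce
    show "analytic_family_on (box_union R) wave_eta" "analytic_family_on (box_union R) wave_u"
      "analytic_family_on (box_union R) (\<lambda>p z. wave_c p)"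
      by (rule good_radius_analytic[OF R]; assumption)+
  qed (intro allI impI, rule sol, assumption, intro allI impI, rule good_radius_expansion[OF R boxU])
qed

end
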